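(* Let $z,z'$ be admissible parameters, $t=zz'$, and let $\tilde\rho_n^{(zz')}$ be the $n$-th correlation function of the lifted process $\widetilde{\mathcal P}_{zz'}$. Then for all $x_1,\dots,x_n>0$, $$\tilde\rho_n^{(zz')}(x_1,\dots,x_n)=\det\big[K(x_i,x_j)\big]_{i,j=1}^n,$$ where $$K(x,y)=\frac{1}{\Gamma(z)\Gamma(z')}\,\frac{\varphi_1(x)\varphi_2(y)-\varphi_1(y)\varphi_2(x)}{x-y},\qquad \varphi_1(x)=x^{-1/2}W_{\frac{z+z'+1}{2},\frac{z-z'}{2}}(x),\quad \varphi_2(x)=x^{-1/2}W_{\frac{z+z'-1}{2},\frac{z-z'}{2}}(x),$$ $W_{\kappa,\mu}$ being the Whittaker function (with $W_{\kappa,\mu}=W_{\kappa,-\mu}$), and $K(x,x)$ is understood as the limit as $y\to x$.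
   Context: Let $\Omega$ be the Thoma simplex: the set of pairs of sequences $(\alpha|\beta)$ with $\alpha_1\ge\alpha_2\ge\dots\ge0$, $\beta_1\ge\beta_2\ge\dots\ge0$, $\sum_i(\alpha_i+\beta_i)\le1$ (coordinatewise topology), and $\Omega_0$ the subset where $\sum_i(\alpha_i+\beta_i)=1$. Parameters $z,z'\in\mathbb C$ are admissible if either $z'=\bar z$, $z\notin\mathbb Z$, or $z,z'\in\mathbb R$ with $m<z,z'<m+1$ for some $m\in\mathbb Z$; put $t=zz'>0$ and $(a)_k=\Gamma(a+k)/\Gamma(a)$. For $n\ge1$ let $P^{(n)}_{zz'}$ be the probability measure on $\Omega_0$ supported on points with $\alpha_i=(p_i+1/2)/n$, $\beta_i=(q_i+1/2)/n$ for $i\le d$ and $\alpha_i=\beta_i=0$ for $i>d$, where $d\ge1$ and $p_1>\dots>p_d\ge0$, $q_1>\dots>q_d\ge0$ are integers with $\sum_i(p_i+q_i+1)=n$, the mass of such a point being $\frac{n!\,t^d}{(t)_n}\prod_{i=1}^d\frac{(z+1)_{p_i}(z'+1)_{p_i}(-z+1)_{q_i}(-z'+1)_{q_i}}{(p_i!)^2(q_i!)^2}\Big(\det\big[\tfrac1{p_i+q_j+1}\big]_{i,j=1}^d\Big)^2$. It is known that $P^{(n)}_{zz'}$ converges weakly to a probability measure $P_{zz'}$ on $\Omega$, and that $P_{zz'}$ is concentrated on $\Omega_0$. The lifted process $\widetilde{\mathcal P}_{zz'}$: on $\Omega_0\times(0,\infty)$ take the probability measure $P_{zz'}\otimes\frac{s^{t-1}e^{-s}}{\Gamma(t)}ds$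 and associate to $((\alpha|\beta),s)$ the point configuration in $\mathbb R\setminus\{0\}$ consisting of the points $s\alpha_i$ (for $\alpha_i\ne0$) and $-s\beta_i$ (for $\beta_i\ne0$), indexed by $i$. Its $n$-th correlation measure assigns to a Borel set $A\subset(\mathbb R\setminus\{0\})^n$ the expected number of ordered $n$-tuples of pairwise distinct (indexed) points of the configuration lying in $A$; the lifted correlation function $\tilde\rho^{(zz')}_n$ is its density with respect to Lebesgue measure. *)

theory Defs
  imports "HOL-Analysis.Analysis" "HOL-Probability.Probability"
begin

type_synonym thoma = "(nat \<Rightarrow> real) \<times> (nat \<Rightarrow> real)"

definition admissible :: "complex \<Rightarrow> complex \<Rightarrow> bool" where
  "admissible z z' \<longleftrightarrow>
     (z' = cnj z \<and> z \<notin> \<int>) \<or>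
     (z \<in> \<real> \<and> z' \<in> \<real> \<and>
        (\<exists>m::int. of_int m < Re z \<and> Re z < of_int m + 1 \<and> of_int m < Re z' \<and> Re z' < of_int m + 1))"

text \<open>Thoma simplex and its face where the coordinates sum to one
  (the topology of the type is the coordinatewise/product topology).\<close>
definition Thoma :: "thoma set" where
  "Thoma = {(a, b). decseq a \<and> decseq b \<and> (\<forall>i. 0 \<le> a i \<and> 0 \<le> b i) \<and>
              summable (\<lambda>i. a i + b i) \<and> (\<Sum>i. a i + b i) \<le> 1}"

definition Thoma0 :: "thoma set" where
  "Thoma0 = {(a, b). decseq a \<and> decseq b \<and> (\<forall>i. 0 \<le> a i \<and> 0 \<le> b i) \<and>
              summable (\<lambda>i. a i + b i) \<and> (\<Sum>i. a i + b i) = 1}"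

definition detN :: "nat \<Rightarrow> (nat \<Rightarrow> nat \<Rightarrow> 'a::comm_ring_1) \<Rightarrow> 'a" where
  "detN d M = (\<Sum>p | p permutes {..<d}. of_int (sign p) * (\<Prod>i<d. M i (p i)))"

definition configs :: "nat \<Rightarrow> (nat list \<times> nat list) set" where
  "configs n = {(ps, qs). length ps = length qs \<and> 1 \<le> length ps \<and>
       sorted_wrt (>) ps \<and> sorted_wrt (>) qs \<and>
       sum_list ps + sum_list qs + length ps = n}"

definition config_point :: "nat \<Rightarrow> nat list \<times> nat list \<Rightarrow> thoma" where
  "config_point n c = (\<lambda>i. if i < length (fst c) then (real (fst c ! i) + 1/2) / real n else 0,
                       \<lambda>i. if i < length (snd c) then (real (snd c ! i) + 1/2) / real n else 0)"

definition zz_t :: "complex \<Rightarrow> complex \<Rightarrow> real" where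
  "zz_t z z' = Re (z * z')"

definition config_mass :: "complex \<Rightarrow> complex \<Rightarrow> nat \<Rightarrow> nat list \<times> nat list \<Rightarrow> real" where
  "config_mass z z' n c =
     (let ps = fst c; qs = snd c; d = length ps; t = zz_t z z' in
      Re (of_real (fact n * t ^ d / pochhammer t n) *
          (\<Prod>i<d. pochhammer (z + 1) (ps ! i) * pochhammer (z' + 1) (ps ! i) *
                   pochhammer (- z + 1) (qs ! i) * pochhammer (- z' + 1) (qs ! i) /
                   of_real ((fact (ps ! i))\<^sup>2 * (fact (qs ! i))\<^sup>2)) *
          of_real ((detN d (\<lambda>i j. 1 / real (ps ! i + qs ! j + 1)))\<^sup>2)))"

definition Pn_weak_limit :: "complex \<Rightarrow> complex \<Rightarrow> thoma measure \<Rightarrow> bool" where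
  "Pn_weak_limit z z' P \<longleftrightarrow>
     prob_space P \<and> sets P = sets borel \<and> emeasure P Thoma = 1 \<and>
     (\<forall>f :: thoma \<Rightarrow> real. continuous_on Thoma f \<longrightarrow> bounded (f ` Thoma) \<longrightarrow>
        (\<lambda>n. \<Sum>c\<in>configs n. config_mass z z' n c * f (config_point n c))
          \<longlonglongrightarrow> (\<integral>\<omega>. indicator Thoma \<omega> * f \<omega> \<partial>P))"

definition is_whittakerW :: "complex \<Rightarrow> complex \<Rightarrow> (real \<Rightarrow> complex) \<Rightarrow> bool" where
  "is_whittakerW \<kappa> \<mu> w \<longleftrightarrow>
     (\<forall>x\<le>0. w x = 0) \<and>
     (\<exists>w'. \<forall>x>0. (w has_vector_derivative w' x) (at x) \<and>
        (w' has_vector_derivative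
            ((1/4 - \<kappa> / of_real x + (\<mu>\<^sup>2 - 1/4) / of_real (x\<^sup>2)) * w x)) (at x)) \<and>
     ((\<lambda>x. w x / (of_real (exp (- x / 2)) * of_real x powr \<kappa>)) \<longlongrightarrow> 1) at_top"

definition whittakerW :: "complex \<Rightarrow> complex \<Rightarrow> real \<Rightarrow> complex" where
  "whittakerW \<kappa> \<mu> = (THE w. is_whittakerW \<kappa> \<mu> w)"

definition phi1 :: "complex \<Rightarrow> complex \<Rightarrow> real \<Rightarrow> complex" where
  "phi1 z z' x = of_real (x powr (-1/2)) * whittakerW ((z + z' + 1) / 2) ((z - z') / 2) x"

definition phi2 :: "complex \<Rightarrow> complex \<Rightarrow> real \<Rightarrow> complex" where
  "phi2 z z' x = of_real (x powr (-1/2)) * whittakerW ((z + z' - 1) / 2) ((z - z') / 2) x"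

definition K_offdiag :: "complex \<Rightarrow> complex \<Rightarrow> real \<Rightarrow> real \<Rightarrow> complex" where
  "K_offdiag z z' x y = 1 / (Gamma z * Gamma z') *
      ((phi1 z z' x * phi2 z z' y - phi1 z z' y * phi2 z z' x) / of_real (x - y))"

definition Kwh :: "complex \<Rightarrow> complex \<Rightarrow> real \<Rightarrow> real \<Rightarrow> complex" where
  "Kwh z z' x y = (if x = y then Lim (at x) (\<lambda>y'. K_offdiag z z' x y') else K_offdiag z z' x y)"

definition conf_idx :: "thoma \<Rightarrow> (nat + nat) set" where
  "conf_idx \<omega> = {Inl i | i. fst \<omega> i \<noteq> 0} \<union> {Inr i | i. snd \<omega> i \<noteq> 0}"

definition conf_pos :: "thoma \<Rightarrow> real \<Rightarrow> nat + nat \<Rightarrow> real" where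
  "conf_pos \<omega> s j = (case j of Inl i \<Rightarrow> s * fst \<omega> i | Inr i \<Rightarrow> - (s * snd \<omega> i))"

definition gamma_meas :: "real \<Rightarrow> real measure" where
  "gamma_meas t = density lborel (\<lambda>s. ennreal (indicator {0<..} s * s powr (t - 1) * exp (- s) / Gamma t))"

definition lifted_corr_measure ::
  "complex \<Rightarrow> complex \<Rightarrow> thoma measure \<Rightarrow> nat \<Rightarrow> (nat \<Rightarrow> real) set \<Rightarrow> ennreal" where
  "lifted_corr_measure z z' P n A =
     (\<integral>\<^sup>+ \<omega>s. indicator (Thoma0 \<times> {0<..}) \<omega>s *
        emeasure (count_space UNIV)
          {J :: (nat + nat) list. length J = n \<and> distinct J \<and> set J \<subseteq> conf_idx (fst \<omega>s) \<and>
              restrict (\<lambda>k. conf_pos (fst \<omega>s) (snd \<omega>s) (J ! k)) {..<n} \<in> A}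
      \<partial>(P \<Otimes>\<^sub>M gamma_meas (zz_t z z')))"

end

theory Submission
  imports Defs "HOL-Complex_Analysis.Complex_Analysis" "HOL-Real_Asymp.Real_Asymp"
begin

text \<open>Mix the measures $P^{(n)}$ over $n$ with a negative binomial law of parameter $\xi = 1 - 1/m$.
The mixture is a determinantal point process on pairs of integer sets, with weights
$\prod F(p_i) \prod G(q_i) \det(1/(p_i+q_j+1))^2$, so its correlations are minors of $1 - (1 + AA^T)^{-1}$
for the Cauchy-type matrix $A$. The commutator of this resolvent with multiplication by $p$ has rank two,
and the two vectors involved are solved by Gauss hypergeometric functions. As $m \to \infty$ the rescaled
mixing law tends to the gamma law, the hypergeometric functions tend to Whittaker functions, and
the discrete kernel tends to the Whittaker kernel; comparing both limits on test functions gives the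
correlation measures of the lifted process. That $P$ lives on the face of total mass one follows from the
bound $K(p, p) \le C / (p + 1)$ for the discrete kernel, uniform in $m$.\<close>

section \<open>Minors and resolvents of Gram matrices\<close>

abbreviation delta :: "'i \<Rightarrow> 'i \<Rightarrow> 'a::zero_neq_one" where
  "delta i j \<equiv> (if i = j then 1 else 0)"

definition det_on :: "'i set \<Rightarrow> ('i \<Rightarrow> 'i \<Rightarrow> 'a::comm_ring_1) \<Rightarrow> 'a" where
  "det_on S M = (\<Sum>p | p permutes S. of_int (sign p) * (\<Prod>i\<in>S. M i (p i)))"

lemma detN_eq_det_on: "detN d M = det_on {..<d} M"
  by (simp add: detN_def det_on_def)

lemma det_on_cong:
  assumes "\<And>i j. i \<in> S \<Longrightarrow> j \<in> S \<Longrightarrow> M i j = M' i j"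
  shows "det_on S M = det_on S M'"
  unfolding det_on_def
  by (intro sum.cong refl arg_cong2[where f="(*)"] prod.cong assms) (auto simp: permutes_in_image)

lemma det_on_reindex:
  assumes inj: "inj_on f S" and fin: "finite S"
  shows "det_on (f ` S) M = det_on S (\<lambda>i j. M (f i) (f j))"
proof -
  have "bij_betw (\<lambda>p x. if x \<in> f ` S then f (p (inv_into S f x)) else x) {p. p permutes S} {p. p permutes f ` S}"
    using inj by (intro bij_betw_permutations) (simp add: bij_betw_def)
  hence bij: "bij_betw (map_permutation S f) {p. p permutes S} {p. p permutes f ` S}"
    by (rule iffD1[OF bij_betw_cong, rotated]) (auto simp: map_permutation_def restrict_id_def fun_eq_iff)
  have "map_permutation S f p (f i) = f (p i)" if "i \<in> S" for p i
    using inj that by (simp add: map_permutation_def restrict_id_def)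
  hence "of_int (sign (map_permutation S f p)) * (\<Prod>i\<in>f ` S. M i (map_permutation S f p i))
      = of_int (sign p) * (\<Prod>i\<in>S. M (f i) (f (p i)))" if "p permutes S" for p
    using that by (simp add: sign_map_permutation[OF inj that fin] prod.reindex[OF inj])
  thus ?thesis
    unfolding det_on_def by (subst sum.reindex_bij_betw[OF bij, symmetric]) (auto intro!: sum.cong)
qed

lemma det_on_transpose:
  assumes "finite S"
  shows "det_on S (\<lambda>i j. M j i) = det_on S M"
proof -
  have "of_int (sign (inv p)) * (\<Prod>i\<in>S. M (inv p i) i) = of_int (sign p) * (\<Prod>i\<in>S. M i (p i))"
    if p: "p permutes S" for p
  proof -
    have "(\<Prod>i\<in>S. M (inv p i) i) = (\<Prod>i\<in>S. M (inv p (p i)) (p i))"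
      by (rule prod.permute[OF p, unfolded o_def])
    moreover have "permutation p" using p assms permutation_permutes by blast
    ultimately show ?thesis using p by (simp add: permutes_inverses sign_inverse)
  qed
  thus ?thesis
    unfolding det_on_def by (subst sum_permutations_inverse) (auto intro!: sum.cong)
qed

lemma det_on_permute_cols:
  fixes M :: "'i \<Rightarrow> 'i \<Rightarrow> 'a::comm_ring_1"
  assumes "finite S" "q permutes S"
  shows "det_on S (\<lambda>i j. M i (q j)) = of_int (sign q) * det_on S M"
proof -
  have "of_int (sign q) * det_on S M
      = (\<Sum>p | p permutes S. of_int (sign q) * (of_int (sign (q \<circ> p)) * (\<Prod>i\<in>S. M i ((q \<circ> p) i))))"
    unfolding det_on_def sum_distrib_left by (rule setum_permutations_compose_left[OF assms(2)])
  also have "\<dots> = det_on S (\<lambda>i j. M i (q j))"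
    unfolding det_on_def
  proof (intro sum.cong refl)
    fix p assume "p \<in> {p. p permutes S}"
    hence "sign (q \<circ> p) = sign q * sign p"
      using assms permutation_permutes by (intro sign_compose) blast+
    hence "of_int (sign q) * of_int (sign (q \<circ> p)) = (of_int (sign p) :: 'a)"
      by (simp add: sign_left_idempotent flip: of_int_mult)
    thus "of_int (sign q) * (of_int (sign (q \<circ> p)) * (\<Prod>i\<in>S. M i ((q \<circ> p) i)))
        = of_int (sign p) * (\<Prod>i\<in>S. M i (q (p i)))"
      by (simp add: mult.assoc[symmetric])
  qed
  finally show ?thesis by simp
qed

lemma det_on_noninj_cols:
  fixes M :: "'i \<Rightarrow> 'j \<Rightarrow> 'a::field_char_0"
  assumes "finite S" "\<not> inj_on f S"
  shows "det_on S (\<lambda>i j. M i (f j)) = 0"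
proof -
  obtain a b where ab: "a \<in> S" "b \<in> S" "a \<noteq> b" "f a = f b"
    using assms(2) by (auto simp: inj_on_def)
  let ?q = "Transposition.transpose a b"
  have "det_on S (\<lambda>i j. M i (f j)) = det_on S (\<lambda>i j. M i (f (?q j)))"
    by (rule det_on_cong) (use ab in \<open>auto simp: Transposition.transpose_def\<close>)
  also have "\<dots> = of_int (sign ?q) * det_on S (\<lambda>i j. M i (f j))"
    by (rule det_on_permute_cols[OF assms(1)]) (use ab in \<open>simp add: permutes_swap_id\<close>)
  finally show ?thesis using ab by (simp add: sign_swap_id)
qed

lemma det_on_sum_PiE:
  fixes A B :: "'i \<Rightarrow> 'j \<Rightarrow> 'a::field_char_0"
  assumes "finite S" "finite T"
  shows "det_on S (\<lambda>i j. \<Sum>q\<in>T. A i q * B j q)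
      = (\<Sum>k | k \<in> S \<rightarrow>\<^sub>E T \<and> inj_on k S. (\<Prod>i\<in>S. A i (k i)) * det_on S (\<lambda>i j. B i (k j)))"
proof -
  have "det_on S (\<lambda>i j. \<Sum>q\<in>T. A i q * B j q)
      = (\<Sum>k\<in>S \<rightarrow>\<^sub>E T. \<Sum>p | p permutes S. of_int (sign p) * (\<Prod>i\<in>S. A i (k i) * B (p i) (k i)))"
    unfolding det_on_def sum_distrib_left by (subst sum.swap) (simp add: prod_sum_PiE assms sum_distrib_left)
  also have "\<dots> = (\<Sum>k\<in>S \<rightarrow>\<^sub>E T. (\<Prod>i\<in>S. A i (k i)) * det_on S (\<lambda>i j. B j (k i)))"
    unfolding det_on_def by (simp add: prod.distrib sum_distrib_left mult_ac)
  also have "\<dots> = (\<Sum>k\<in>S \<rightarrow>\<^sub>E T. (\<Prod>i\<in>S. A i (k i)) * det_on S (\<lambda>i j. B i (k j)))"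
    by (intro sum.cong refl arg_cong2[where f="(*)"] det_on_transpose[OF assms(1)])
  also have "\<dots> = (\<Sum>k | k \<in> S \<rightarrow>\<^sub>E T \<and> inj_on k S. (\<Prod>i\<in>S. A i (k i)) * det_on S (\<lambda>i j. B i (k j)))"
    by (rule sum.mono_neutral_right) (use assms det_on_noninj_cols in \<open>auto intro!: finite_PiE\<close>)
  finally show ?thesis .
qed

lemma bij_betw_permutations_injective_PiE:
  assumes fin: "finite S" and f: "bij_betw f S T"
  shows "bij_betw (\<lambda>p. restrict (f \<circ> p) S) {p. p permutes S} {k \<in> S \<rightarrow>\<^sub>E T. inj_on k S}"
proof (rule bij_betwI)
  let ?g = "\<lambda>k x. if x \<in> S then inv_into S f (k x) else x"
  have bij: "bij_betw k S T" if "k \<in> S \<rightarrow>\<^sub>E T" "inj_on k S" for k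
    using that card_subset_eq[of T "k ` S"] bij_betw_finite[OF f] bij_betw_same_card[OF f] fin
    by (auto simp: bij_betw_def card_image)
  show "(\<lambda>p. restrict (f \<circ> p) S) \<in> {p. p permutes S} \<rightarrow> {k \<in> S \<rightarrow>\<^sub>E T. inj_on k S}"
  proof (intro Pi_I)
    fix p assume "p \<in> {p. p permutes S}"
    hence "bij_betw (f \<circ> p) S T" using f by (auto intro: bij_betw_trans permutes_imp_bij)
    thus "restrict (f \<circ> p) S \<in> {k \<in> S \<rightarrow>\<^sub>E T. inj_on k S}" by (auto simp: bij_betw_def inj_on_def)
  qed
  show "?g \<in> {k \<in> S \<rightarrow>\<^sub>E T. inj_on k S} \<rightarrow> {p. p permutes S}"
  proof (intro Pi_I CollectI)
    fix k assume "k \<in> {k \<in> S \<rightarrow>\<^sub>E T. inj_on k S}"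
    hence "bij_betw (inv_into S f \<circ> k) S S"
      using bij_betw_trans[OF bij bij_betw_inv_into[OF f]] by blast
    hence "bij_betw (?g k) S S"
      by (rule iffD1[OF bij_betw_cong, rotated]) simp
    thus "?g k permutes S" by (rule bij_imp_permutes) simp
  qed
  show "?g (restrict (f \<circ> p) S) = p" if "p \<in> {p. p permutes S}" for p
    using that f by (auto simp: fun_eq_iff bij_betw_def permutes_in_image permutes_not_in)
  show "restrict (f \<circ> ?g k) S = k" if "k \<in> {k \<in> S \<rightarrow>\<^sub>E T. inj_on k S}" for k
    using that f by (auto simp: fun_eq_iff PiE_def extensional_def intro!: bij_betw_inv_into_right[OF f])
qed

lemma sum_injective_PiE_det_on:
  fixes A :: "'i \<Rightarrow> 'j \<Rightarrow> 'a::field_char_0"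
  assumes "finite S" "bij_betw f S T"
  shows "(\<Sum>k | k \<in> S \<rightarrow>\<^sub>E T \<and> inj_on k S. (\<Prod>i\<in>S. A i (k i)) * det_on S (\<lambda>i j. B i (k j)))
      = det_on S (\<lambda>i j. A i (f j)) * det_on S (\<lambda>i j. B i (f j))"
proof -
  have "(\<Sum>k | k \<in> S \<rightarrow>\<^sub>E T \<and> inj_on k S. (\<Prod>i\<in>S. A i (k i)) * det_on S (\<lambda>i j. B i (k j)))
      = (\<Sum>p | p permutes S. (\<Prod>i\<in>S. A i (f (p i))) * det_on S (\<lambda>i j. B i (f (p j))))"
    unfolding sum.reindex_bij_betw[OF bij_betw_permutations_injective_PiE[OF assms], symmetric]
    by (intro sum.cong refl arg_cong2[where f="(*)"] prod.cong det_on_cong) auto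
  also have "\<dots> = (\<Sum>p | p permutes S. (\<Prod>i\<in>S. A i (f (p i))) * (of_int (sign p) * det_on S (\<lambda>i j. B i (f j))))"
    using det_on_permute_cols[OF assms(1), where M="\<lambda>i j. B i (f j)"] by (intro sum.cong) auto
  also have "\<dots> = det_on S (\<lambda>i j. A i (f j)) * det_on S (\<lambda>i j. B i (f j))"
    unfolding det_on_def[of S "\<lambda>i j. A i (f j)"] sum_distrib_right by (simp add: mult_ac)
  finally show ?thesis .
qed

lemma det_on_mult:
  fixes A B :: "'i \<Rightarrow> 'i \<Rightarrow> 'a::field_char_0"
  assumes "finite S"
  shows "det_on S (\<lambda>i j. \<Sum>k\<in>S. A i k * B k j) = det_on S A * det_on S B"
  using det_on_sum_PiE[OF assms assms, of A "\<lambda>i j. B j i"] det_on_transpose[OF assms, of B]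
    sum_injective_PiE_det_on[OF assms, of id S A "\<lambda>i j. B j i"] by simp

definition decreasing_lists :: "nat \<Rightarrow> nat set \<Rightarrow> nat list set" where
  "decreasing_lists d T = {xs. length xs = d \<and> sorted_wrt (>) xs \<and> set xs \<subseteq> T}"

lemma decreasing_list_unique:
  fixes xs ys :: "nat list"
  assumes "sorted_wrt (>) xs" "sorted_wrt (>) ys" "set xs = set ys"
  shows "xs = ys"
proof -
  have "sorted_wrt (<) (rev xs)" "sorted_wrt (<) (rev ys)"
    using assms by (auto simp: sorted_wrt_rev)
  hence "rev xs = rev ys" using assms(3) by (metis set_rev strict_sorted_equal)
  thus ?thesis by simp
qed

lemma distinct_decreasing_list: "sorted_wrt (>) (xs :: nat list) \<Longrightarrow> distinct xs"
  by (induction xs) auto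

lemma finite_decreasing_lists: "finite T \<Longrightarrow> finite (decreasing_lists d T)"
  unfolding decreasing_lists_def using finite_lists_length_eq[of T d] by (rule rev_finite_subset) auto

lemma decreasing_list_of_set:
  assumes "finite (S :: nat set)"
  defines "xs \<equiv> rev (sorted_list_of_set S)"
  shows "sorted_wrt (>) xs" "set xs = S" "length xs = card S"
  using assms by (auto simp: sorted_wrt_rev)

lemma cauchy_binet:
  fixes A B :: "nat \<Rightarrow> nat \<Rightarrow> 'a::field_char_0"
  assumes fin: "finite T"
  shows "detN d (\<lambda>i j. \<Sum>q\<in>T. A i q * B j q)
      = (\<Sum>qs\<in>decreasing_lists d T. detN d (\<lambda>i j. A i (qs ! j)) * detN d (\<lambda>i j. B i (qs ! j)))"
proof -
  let ?I = "{..<d}"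
  let ?inj = "\<lambda>T. {k \<in> ?I \<rightarrow>\<^sub>E T. inj_on k ?I}"
  have image: "k ` ?I = set qs" if "qs \<in> decreasing_lists d T" "k \<in> ?inj (set qs)" for qs k
    using that distinct_card[OF distinct_decreasing_list, of qs]
    by (intro card_subset_eq) (auto simp: decreasing_lists_def card_image)
  have "?inj T = (\<Union>qs\<in>decreasing_lists d T. ?inj (set qs))"
  proof (intro equalityI subsetI)
    fix k assume k: "k \<in> ?inj T"
    define qs where "qs = rev (sorted_list_of_set (k ` ?I))"
    have "qs \<in> decreasing_lists d T" "set qs = k ` ?I"
      using k decreasing_list_of_set[of "k ` ?I"] by (auto simp: qs_def decreasing_lists_def card_image)
    with k show "k \<in> (\<Union>qs\<in>decreasing_lists d T. ?inj (set qs))" by (auto simp: PiE_iff)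
  qed (auto simp: decreasing_lists_def PiE_iff)
  hence "detN d (\<lambda>i j. \<Sum>q\<in>T. A i q * B j q)
      = (\<Sum>k\<in>(\<Union>qs\<in>decreasing_lists d T. ?inj (set qs)). (\<Prod>i\<in>?I. A i (k i)) * det_on ?I (\<lambda>i j. B i (k j)))"
    unfolding detN_eq_det_on det_on_sum_PiE[OF finite_lessThan fin] by simp
  also have "\<dots> = (\<Sum>qs\<in>decreasing_lists d T. \<Sum>k\<in>?inj (set qs). (\<Prod>i\<in>?I. A i (k i)) * det_on ?I (\<lambda>i j. B i (k j)))"
  proof (rule sum.UNION_disjoint)
    have "qs = qs'" if "qs \<in> decreasing_lists d T" "qs' \<in> decreasing_lists d T"
      "k \<in> ?inj (set qs)" "k \<in> ?inj (set qs')" for qs qs' k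
      using image[OF that(1,3)] image[OF that(2,4)] that(1,2)
      by (intro decreasing_list_unique) (auto simp: decreasing_lists_def)
    thus "\<forall>qs\<in>decreasing_lists d T. \<forall>qs'\<in>decreasing_lists d T. qs \<noteq> qs' \<longrightarrow> ?inj (set qs) \<inter> ?inj (set qs') = {}"
      by blast
    show "\<forall>qs\<in>decreasing_lists d T. finite (?inj (set qs))"
      by (intro ballI finite_subset[OF _ finite_PiE[of ?I "\<lambda>_. set _"]]) auto
  qed (rule finite_decreasing_lists[OF fin])
  also have "\<dots> = (\<Sum>qs\<in>decreasing_lists d T. detN d (\<lambda>i j. A i (qs ! j)) * detN d (\<lambda>i j. B i (qs ! j)))"
    unfolding detN_eq_det_on
    by (intro sum.cong refl sum_injective_PiE_det_on bij_betw_nth)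
      (auto simp: decreasing_lists_def intro: distinct_decreasing_list)
  finally show ?thesis .
qed

lemma det_on_fixing:
  assumes "finite U" "S \<subseteq> U"
    and zero: "\<And>p. p permutes U \<Longrightarrow> \<not> p permutes S \<Longrightarrow> (\<Prod>i\<in>U. C i (p i)) = 0"
    and one: "\<And>i. i \<in> U - S \<Longrightarrow> C i i = 1"
  shows "det_on U C = det_on S C"
proof -
  have "det_on U C = (\<Sum>p | p permutes S. of_int (sign p) * (\<Prod>i\<in>U. C i (p i)))"
    unfolding det_on_def
    by (rule sum.mono_neutral_right) (use assms permutes_subset in \<open>auto simp: finite_permutations\<close>)
  also have "\<dots> = det_on S C"
    unfolding det_on_def
  proof (intro sum.cong refl arg_cong2[where f="(*)"])
    fix p assume "p \<in> {p. p permutes S}"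
    hence "p i = i" if "i \<notin> S" for i using that by (auto simp: permutes_def)
    thus "(\<Prod>i\<in>U. C i (p i)) = (\<Prod>i\<in>S. C i (p i))"
      using assms(1,2) one by (intro prod.mono_neutral_right) auto
  qed
  finally show ?thesis .
qed

lemma not_permutes_subset_moves:
  assumes "p permutes U" "\<not> p permutes S"
  obtains i where "i \<in> U - S" "p i \<noteq> i"
  using assms permutes_superset[OF assms(1), of S] by blast

lemma det_on_mixed_rows:
  fixes L :: "'i \<Rightarrow> 'i \<Rightarrow> 'a::comm_ring_1"
  assumes fin: "finite U" and S: "S \<subseteq> U"
  shows "det_on U (\<lambda>i j. if i \<in> S then L i j else if i = j \<and> i \<notin> X then 1 else 0)
      = (if X \<inter> U \<subseteq> S then det_on S L else 0)" (is "det_on U ?C = _")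
proof (cases "X \<inter> U \<subseteq> S")
  case True
  have "det_on U ?C = det_on S ?C"
  proof (rule det_on_fixing[OF fin S])
    fix p assume "p permutes U" "\<not> p permutes S"
    then obtain i where "i \<in> U - S" "p i \<noteq> i" by (rule not_permutes_subset_moves)
    thus "(\<Prod>i\<in>U. ?C i (p i)) = 0" by (intro prod_zero[OF fin] bexI[of _ i]) auto
  qed (use True in auto)
  also have "\<dots> = det_on S L" by (rule det_on_cong) auto
  finally show ?thesis using True by simp
next
  case False
  then obtain i where "i \<in> X" "i \<in> U" "i \<notin> S" by auto
  hence "(\<Prod>i\<in>U. ?C i (p i)) = 0" for p
    by (intro prod_zero[OF fin] bexI[of _ i]) auto
  thus ?thesis using False by (simp add: det_on_def)
qed

lemma sum_principal_minors:
  fixes L :: "'i \<Rightarrow> 'i \<Rightarrow> 'a::comm_ring_1"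
  assumes fin: "finite U" and XU: "X \<subseteq> U"
  shows "(\<Sum>S | X \<subseteq> S \<and> S \<subseteq> U. det_on S L) = det_on U (\<lambda>i j. (if i = j \<and> i \<notin> X then 1 else 0) + L i j)"
proof -
  let ?D = "\<lambda>i j. if i = j \<and> i \<notin> X then 1 else (0::'a)"
  have "det_on U (\<lambda>i j. ?D i j + L i j)
      = (\<Sum>S\<in>Pow U. \<Sum>p | p permutes U. of_int (sign p) * ((\<Prod>i\<in>S. L i (p i)) * (\<Prod>i\<in>U - S. ?D i (p i))))"
    unfolding det_on_def by (subst add.commute, subst sum.swap) (simp add: prod_add[OF fin] sum_distrib_left)
  also have "\<dots> = (\<Sum>S\<in>Pow U. if X \<inter> U \<subseteq> S then det_on S L else 0)"
  proof (intro sum.cong refl)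
    fix S assume "S \<in> Pow U"
    hence S: "S \<subseteq> U" by auto
    have "(\<Prod>i\<in>S. L i (p i)) * (\<Prod>i\<in>U - S. ?D i (p i)) = (\<Prod>i\<in>U. if i \<in> S then L i (p i) else ?D i (p i))" for p
      by (subst prod.subset_diff[OF S fin]) (simp add: mult.commute)
    thus "(\<Sum>p | p permutes U. of_int (sign p) * ((\<Prod>i\<in>S. L i (p i)) * (\<Prod>i\<in>U - S. ?D i (p i))))
        = (if X \<inter> U \<subseteq> S then det_on S L else 0)"
      unfolding det_on_mixed_rows[OF fin S, symmetric] by (simp add: det_on_def)
  qed
  also have "\<dots> = (\<Sum>S | X \<subseteq> S \<and> S \<subseteq> U. det_on S L)"
    unfolding Int_absorb2[OF XU] using fin by (simp add: sum.If_cases Int_def conj_commute)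
  finally show ?thesis ..
qed

definition gram :: "'q set \<Rightarrow> ('i \<Rightarrow> 'q \<Rightarrow> real) \<Rightarrow> 'i \<Rightarrow> 'i \<Rightarrow> real" where
  "gram Q A i k = (\<Sum>q\<in>Q. A i q * A k q)"

definition is_resolvent :: "'i set \<Rightarrow> ('i \<Rightarrow> 'i \<Rightarrow> real) \<Rightarrow> ('i \<Rightarrow> 'i \<Rightarrow> real) \<Rightarrow> bool" where
  "is_resolvent U L M \<longleftrightarrow> (\<forall>i\<in>U. \<forall>j\<in>U. M i j = M j i) \<and>
     (\<forall>i\<in>U. \<forall>j\<in>U. M i j + (\<Sum>k\<in>U. L i k * M k j) = delta i j)"

lemma is_resolvent_sym: "is_resolvent U L M \<Longrightarrow> i \<in> U \<Longrightarrow> j \<in> U \<Longrightarrow> M i j = M j i"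
  unfolding is_resolvent_def by blast

lemma is_resolvent_eq:
  "is_resolvent U L M \<Longrightarrow> i \<in> U \<Longrightarrow> j \<in> U \<Longrightarrow> M i j + (\<Sum>k\<in>U. L i k * M k j) = delta i j"
  unfolding is_resolvent_def by blast

lemma sum_delta_mult:
  fixes f :: "'i \<Rightarrow> 'a::semiring_1"
  assumes "finite U" "i \<in> U"
  shows "(\<Sum>k\<in>U. delta i k * f k) = f i" "(\<Sum>k\<in>U. delta k i * f k) = f i" "(\<Sum>k\<in>U. f k * delta k i) = f i"
  using assms by (simp_all add: if_distrib[where f="\<lambda>x. x * _"] if_distrib[where f="\<lambda>x. _ * x"] cong: if_cong)

lemma gram_sym: "gram Q A i k = gram Q A k i"
  by (simp add: gram_def mult.commute)

lemma gram_inner: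
  "(\<Sum>i\<in>U. v i * (\<Sum>k\<in>U. gram Q A i k * w k)) = (\<Sum>q\<in>Q. (\<Sum>i\<in>U. A i q * v i) * (\<Sum>k\<in>U. A k q * w k))"
proof -
  have "(\<Sum>q\<in>Q. (\<Sum>i\<in>U. A i q * v i) * (\<Sum>k\<in>U. A k q * w k))
      = (\<Sum>i\<in>U. \<Sum>k\<in>U. \<Sum>q\<in>Q. (A i q * v i) * (A k q * w k))"
    unfolding sum_product by (subst sum.swap, intro sum.cong refl, subst sum.swap) simp
  thus ?thesis by (simp add: gram_def sum_distrib_left sum_distrib_right mult_ac)
qed

lemma gram_inner_nonneg: "0 \<le> (\<Sum>i\<in>U. v i * (\<Sum>k\<in>U. gram Q A i k * v k))"
  unfolding gram_inner by (auto intro!: sum_nonneg)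

lemma is_resolvent_apply:
  assumes "is_resolvent U L M" "finite U" "i \<in> U"
  shows "(\<Sum>j\<in>U. M i j * v j) + (\<Sum>k\<in>U. L i k * (\<Sum>j\<in>U. M k j * v j)) = v i"
proof -
  have "(\<Sum>k\<in>U. L i k * (\<Sum>j\<in>U. M k j * v j)) = (\<Sum>j\<in>U. (\<Sum>k\<in>U. L i k * M k j) * v j)"
    unfolding sum_distrib_left sum_distrib_right by (subst sum.swap) (simp add: mult.assoc)
  hence "(\<Sum>j\<in>U. M i j * v j) + (\<Sum>k\<in>U. L i k * (\<Sum>j\<in>U. M k j * v j))
      = (\<Sum>j\<in>U. (M i j + (\<Sum>k\<in>U. L i k * M k j)) * v j)"
    by (simp add: distrib_right sum.distrib)
  also have "\<dots> = (\<Sum>j\<in>U. delta i j * v j)"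
    by (intro sum.cong refl arg_cong2[where f="(*)"] is_resolvent_eq[OF assms(1,3)])
  finally show ?thesis by (simp only: sum_delta_mult[OF assms(2,3)])
qed

lemma is_resolvent_gram_right:
  assumes "is_resolvent U (gram Q A) M" "i \<in> U" "j \<in> U"
  shows "M i j + (\<Sum>k\<in>U. M i k * gram Q A k j) = delta i j"
proof -
  have "(\<Sum>k\<in>U. gram Q A j k * M k i) = (\<Sum>k\<in>U. M i k * gram Q A k j)"
    using is_resolvent_sym[OF assms(1) _ assms(2)]
    by (intro sum.cong refl) (simp add: gram_sym[of Q A j] mult.commute)
  thus ?thesis
    using is_resolvent_eq[OF assms(1,3,2)] is_resolvent_sym[OF assms(1,2,3)] by (simp add: eq_commute)
qed

lemma is_resolvent_rank_one_update:
  fixes a :: "'i \<Rightarrow> real"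
  assumes M: "is_resolvent U L M" and fin: "finite U"
  defines "b \<equiv> \<lambda>i. \<Sum>j\<in>U. M i j * a j"
  defines "D \<equiv> 1 + (\<Sum>i\<in>U. a i * b i)"
  assumes D: "D \<noteq> 0"
  shows "is_resolvent U (\<lambda>i k. L i k + a i * a k) (\<lambda>i j. M i j - b i * b j / D)"
  unfolding is_resolvent_def
proof (intro conjI ballI)
  fix i j assume ij: "i \<in> U" "j \<in> U"
  note sym = is_resolvent_sym[OF M]
  show "M i j - b i * b j / D = M j i - b j * b i / D" using sym[OF ij] by simp
  have aM: "(\<Sum>k\<in>U. a k * M k j) = b j"
    unfolding b_def using sym[OF _ ij(2)] by (intro sum.cong refl) (auto simp: mult.commute)
  have LM: "(\<Sum>k\<in>U. L i k * M k j) = delta i j - M i j"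
    using is_resolvent_eq[OF M ij] by linarith
  have Lb: "(\<Sum>k\<in>U. L i k * b k) = a i - b i"
    using is_resolvent_apply[OF M fin ij(1), of a] by (simp add: b_def)
  have "(\<Sum>k\<in>U. (L i k + a i * a k) * (M k j - b k * b j / D))
      = (\<Sum>k\<in>U. L i k * M k j) - (\<Sum>k\<in>U. L i k * b k) * b j / D
      + a i * ((\<Sum>k\<in>U. a k * M k j) - (\<Sum>k\<in>U. a k * b k) * b j / D)"
    unfolding sum_distrib_left sum_distrib_right sum_divide_distrib sum_subtractf[symmetric] sum.distrib[symmetric]
    by (intro sum.cong refl) (simp add: algebra_simps)
  also have "(\<Sum>k\<in>U. a k * b k) = D - 1" by (simp add: D_def)
  finally show "M i j - b i * b j / D + (\<Sum>k\<in>U. (L i k + a i * a k) * (M k j - b k * b j / D)) = delta i j"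
    unfolding aM LM Lb using D by (simp add: field_simps)
qed

lemma gram_resolvent_exists:
  assumes "finite U" "finite Q"
  shows "\<exists>M. is_resolvent U (gram Q A) M"
  using assms(2)
proof (induction Q rule: finite_induct)
  case empty
  have "is_resolvent U (gram {} A) delta" by (auto simp: is_resolvent_def gram_def)
  thus ?case by blast
next
  case (insert q Q)
  then obtain M where M: "is_resolvent U (gram Q A) M" by blast
  define b where "b i = (\<Sum>j\<in>U. M i j * A j q)" for i
  have "(\<Sum>i\<in>U. A i q * b i) = (\<Sum>i\<in>U. (b i + (\<Sum>k\<in>U. gram Q A i k * b k)) * b i)"
    by (intro sum.cong refl arg_cong2[where f="(*)"])
      (simp add: b_def is_resolvent_apply[OF M assms(1), of _ "\<lambda>j. A j q"])
  also have "\<dots> = (\<Sum>i\<in>U. (b i)\<^sup>2) + (\<Sum>i\<in>U. b i * (\<Sum>k\<in>U. gram Q A i k * b k))"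
    by (simp add: sum.distrib distrib_right power2_eq_square) (simp add: mult.commute)
  finally have "1 + (\<Sum>i\<in>U. A i q * b i) \<noteq> 0"
    using gram_inner_nonneg[of b Q A U] sum_nonneg[of U "\<lambda>i. (b i)\<^sup>2"] by auto
  hence "is_resolvent U (\<lambda>i k. gram Q A i k + A i q * A k q)
      (\<lambda>i j. M i j - b i * b j / (1 + (\<Sum>i\<in>U. A i q * b i)))"
    unfolding b_def by (intro is_resolvent_rank_one_update M assms(1))
  moreover have "gram (insert q Q) A = (\<lambda>i k. gram Q A i k + A i q * A k q)"
    using insert by (simp add: gram_def fun_eq_iff)
  ultimately show ?case by auto
qed

lemma sum_squares_le_one_plus_gram_real:
  "(\<Sum>i\<in>U. (w i)\<^sup>2) \<le> (\<Sum>i\<in>U. (w i + (\<Sum>k\<in>U. gram Q A i k * w k))\<^sup>2)"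
proof -
  let ?L = "\<lambda>i. \<Sum>k\<in>U. gram Q A i k * w k"
  have "(\<Sum>i\<in>U. (w i + ?L i)\<^sup>2) = (\<Sum>i\<in>U. (w i)\<^sup>2) + 2 * (\<Sum>i\<in>U. w i * ?L i) + (\<Sum>i\<in>U. (?L i)\<^sup>2)"
    by (simp add: power2_sum sum.distrib sum_distrib_left mult_ac)
  thus ?thesis using gram_inner_nonneg[of w Q A U] by (simp add: sum_nonneg)
qed

lemma sum_squares_le_one_plus_gram:
  fixes w :: "'i \<Rightarrow> complex"
  shows "(\<Sum>i\<in>U. (norm (w i))\<^sup>2) \<le> (\<Sum>i\<in>U. (norm (w i + (\<Sum>k\<in>U. of_real (gram Q A i k) * w k)))\<^sup>2)"
  using sum_squares_le_one_plus_gram_real[of "\<lambda>i. Re (w i)" U Q A]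
    sum_squares_le_one_plus_gram_real[of "\<lambda>i. Im (w i)" U Q A]
  by (simp add: cmod_power2 sum.distrib)

lemma gram_resolvent_inner:
  assumes M: "is_resolvent U (gram Q A) M" and fin: "finite U" and p: "p \<in> U"
  shows "(\<Sum>i\<in>U. f i * M i p) + (\<Sum>q\<in>Q. (\<Sum>i\<in>U. A i q * f i) * (\<Sum>i\<in>U. A i q * M i p)) = f p"
proof -
  have "(\<Sum>i\<in>U. f i * M i p) + (\<Sum>q\<in>Q. (\<Sum>i\<in>U. A i q * f i) * (\<Sum>i\<in>U. A i q * M i p))
      = (\<Sum>i\<in>U. f i * (M i p + (\<Sum>k\<in>U. gram Q A i k * M k p)))"
    unfolding gram_inner[symmetric] by (simp add: distrib_left sum.distrib)
  also have "\<dots> = (\<Sum>i\<in>U. f i * delta i p)"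
    by (intro sum.cong refl arg_cong2[where f="(*)"] is_resolvent_eq[OF M _ p])
  finally show ?thesis by (simp only: sum_delta_mult[OF fin p])
qed

lemma resolvent_complement_diag_le:
  assumes M: "is_resolvent U (gram Q A) M" and fin: "finite U" and p: "p \<in> U"
  shows "1 - M p p \<le> (\<Sum>i\<in>U. (u i)\<^sup>2) + (\<Sum>q\<in>Q. (A p q - (\<Sum>i\<in>U. A i q * u i))\<^sup>2)"
proof -
  define f where "f i = delta i p - u i" for i
  define Af where "Af q = (\<Sum>i\<in>U. A i q * f i)" for q
  define AM where "AM q = (\<Sum>i\<in>U. A i q * M i p)" for q
  have "0 \<le> (\<Sum>i\<in>U. (f i - M i p)\<^sup>2) + (\<Sum>q\<in>Q. (Af q - AM q)\<^sup>2)"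
    by (intro add_nonneg_nonneg sum_nonneg) auto
  also have "\<dots> = (\<Sum>i\<in>U. (f i)\<^sup>2) + (\<Sum>q\<in>Q. (Af q)\<^sup>2) - 2 * ((\<Sum>i\<in>U. f i * M i p) + (\<Sum>q\<in>Q. Af q * AM q))
      + ((\<Sum>i\<in>U. M i p * M i p) + (\<Sum>q\<in>Q. AM q * AM q))"
    by (simp add: power2_eq_square algebra_simps sum.distrib sum_subtractf sum_distrib_left)
  also have "\<dots> = (\<Sum>i\<in>U. (f i)\<^sup>2) + (\<Sum>q\<in>Q. (Af q)\<^sup>2) - 2 * f p + M p p"
    unfolding Af_def AM_def gram_resolvent_inner[OF M fin p] ..
  finally have "2 * f p - M p p \<le> (\<Sum>i\<in>U. (f i)\<^sup>2) + (\<Sum>q\<in>Q. (Af q)\<^sup>2)" by linarith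
  moreover have "Af q = A p q - (\<Sum>i\<in>U. A i q * u i)" for q
    unfolding Af_def f_def using sum_delta_mult(3)[OF fin p, of "\<lambda>i. A i q"]
    by (simp add: right_diff_distrib sum_subtractf)
  moreover have "(\<Sum>i\<in>U. (f i)\<^sup>2) = (\<Sum>i\<in>U. delta i p * (1 - 2 * u i)) + (\<Sum>i\<in>U. (u i)\<^sup>2)"
    unfolding sum.distrib[symmetric] by (intro sum.cong refl) (simp add: f_def power2_diff)
  ultimately show ?thesis by (simp add: sum_delta_mult[OF fin p] f_def del: mult_delta_left mult_delta_right)
qed

lemma resolvent_row_norm_le:
  assumes M: "is_resolvent U (gram Q A) M" and fin: "finite U" and p: "p \<in> U"
  shows "(\<Sum>j\<in>U. (M p j)\<^sup>2) \<le> 1"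
proof -
  have "(\<Sum>j\<in>U. (M p j)\<^sup>2) = (\<Sum>j\<in>U. (M j p)\<^sup>2)"
    using is_resolvent_sym[OF M p] by (intro sum.cong refl) simp
  also have "\<dots> \<le> (\<Sum>i\<in>U. (delta i p)\<^sup>2)"
    using sum_squares_le_one_plus_gram_real[of "\<lambda>i. M i p" U Q A] is_resolvent_eq[OF M _ p]
    by (simp cong: sum.cong)
  also have "\<dots> = 1" using fin p by (simp add: if_distrib[where f="\<lambda>x. x\<^sup>2"] cong: if_cong)
  finally show ?thesis .
qed

lemma det_on_delta_outside:
  assumes fin: "finite U" and X: "X \<subseteq> U"
  shows "det_on U (\<lambda>i j. if j \<in> X then C i j else delta i j) = det_on X C" (is "det_on U ?B = _")
proof -
  have "det_on U ?B = det_on X ?B"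
  proof (rule det_on_fixing[OF fin X])
    fix p assume p: "p permutes U" "\<not> p permutes X"
    then obtain i where i: "i \<in> U - X" "p i \<noteq> i" by (rule not_permutes_subset_moves)
    have "p (inv p i) = i" using p(1) by (simp add: permutes_inverses)
    moreover from this have "inv p i \<in> U" using i p(1) by (metis DiffD1 permutes_in_image)
    ultimately show "(\<Prod>i\<in>U. ?B i (p i)) = 0"
      using i by (intro prod_zero[OF fin] bexI[of _ "inv p i"]) auto
  qed auto
  also have "\<dots> = det_on X C" by (rule det_on_cong) auto
  finally show ?thesis .
qed

text \<open>With $T = 1 + A A^{T}$ and $M = T^{-1}$, the matrix summed over by \<open>sum_principal_minors\<close> is
  $T$ times the matrix that has the columns of $1 - M$ inside $X$ and of the identity outside.\<close>

lemma L_ensemble_correlation: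
  assumes M: "is_resolvent U (gram Q A) M" and fin: "finite U" and X: "X \<subseteq> U"
  shows "(\<Sum>S | X \<subseteq> S \<and> S \<subseteq> U. det_on S (gram Q A))
      = (\<Sum>S | S \<subseteq> U. det_on S (gram Q A)) * det_on X (\<lambda>i j. delta i j - M i j)"
proof -
  let ?L = "gram Q A"
  let ?B = "\<lambda>i j. if j \<in> X then delta i j - M i j else delta i j"
  have prod: "(\<Sum>k\<in>U. (delta i k + ?L i k) * ?B k j) = (if i = j \<and> i \<notin> X then 1 else 0) + ?L i j"
    if ij: "i \<in> U" "j \<in> U" for i j
  proof -
    have "(\<Sum>k\<in>U. (delta i k + ?L i k) * ?B k j) = ?B i j + (\<Sum>k\<in>U. ?L i k * ?B k j)"
      unfolding distrib_right sum.distrib by (simp only: sum_delta_mult(1)[OF fin ij(1)])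
    moreover have "(\<Sum>k\<in>U. ?L i k * ?B k j) = ?L i j - (if j \<in> X then \<Sum>k\<in>U. ?L i k * M k j else 0)"
      using sum_delta_mult(3)[OF fin ij(2), of "?L i"] by (auto simp: right_diff_distrib sum_subtractf)
    ultimately show ?thesis using is_resolvent_eq[OF M ij] by (auto split: if_splits)
  qed
  have "(\<Sum>S | X \<subseteq> S \<and> S \<subseteq> U. det_on S ?L) = det_on U (\<lambda>i j. \<Sum>k\<in>U. (delta i k + ?L i k) * ?B k j)"
    unfolding sum_principal_minors[OF fin X] by (rule det_on_cong) (simp only: prod)
  also have "\<dots> = det_on U (\<lambda>i j. delta i j + ?L i j) * det_on X (\<lambda>i j. delta i j - M i j)"
    unfolding det_on_mult[OF fin] det_on_delta_outside[OF fin X] ..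
  also have "det_on U (\<lambda>i j. delta i j + ?L i j) = (\<Sum>S | S \<subseteq> U. det_on S ?L)"
    using sum_principal_minors[OF fin, of "{}" ?L] by simp
  finally show ?thesis .
qed

lemma resolvent_commutator:
  fixes U :: "nat set"
  assumes M: "is_resolvent U (gram Q A) M" and fin: "finite U" and pj: "p \<in> U" "j \<in> U"
    and comm: "\<And>i k. i \<in> U \<Longrightarrow> k \<in> U \<Longrightarrow> (real i - real k) * gram Q A i k = s i * l k - l i * s k"
  defines "Ms \<equiv> \<lambda>j. \<Sum>k\<in>U. M j k * s k" and "Ml \<equiv> \<lambda>j. \<Sum>k\<in>U. M j k * l k"
  shows "(real p - real j) * M p j = Ml p * Ms j - Ms p * Ml j"
proof -
  let ?T = "\<lambda>i k. delta i k + gram Q A i k"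
  have MT: "(\<Sum>i\<in>U. M p i * ?T i k) = delta p k" if "k \<in> U" for k
    using is_resolvent_gram_right[OF M pj(1) that] sum_delta_mult(3)[OF fin that, of "M p"]
    by (simp add: distrib_left sum.distrib)
  have TM: "(\<Sum>k\<in>U. ?T i k * M k j) = delta i j" if "i \<in> U" for i
    using is_resolvent_eq[OF M that pj(2)] sum_delta_mult(1)[OF fin that, of "\<lambda>k. M k j"]
    by (simp add: distrib_right sum.distrib)
  have "real p * M p j = (\<Sum>k\<in>U. (\<Sum>i\<in>U. M p i * ?T i k) * (real k * M k j))"
    using sum_delta_mult(1)[OF fin pj(1), of "\<lambda>k. real k * M k j"] MT by (simp cong: sum.cong)
  moreover have "real j * M p j = (\<Sum>i\<in>U. M p i * real i * (\<Sum>k\<in>U. ?T i k * M k j))"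
    using sum_delta_mult(3)[OF fin pj(2), of "\<lambda>i. M p i * real i"] TM by (simp add: mult.commute cong: sum.cong)
  hence "real j * M p j = (\<Sum>k\<in>U. \<Sum>i\<in>U. M p i * real i * (?T i k * M k j))"
    unfolding sum_distrib_left by (subst (asm) sum.swap)
  ultimately have "(real p - real j) * M p j = (\<Sum>k\<in>U. \<Sum>i\<in>U. M p i * ((real k - real i) * ?T i k) * M k j)"
    unfolding left_diff_distrib sum_distrib_right
    by (simp only: sum_subtractf[symmetric]) (intro sum.cong refl, simp add: algebra_simps)
  also have "\<dots> = (\<Sum>k\<in>U. \<Sum>i\<in>U. (M p i * l i) * (M j k * s k) - (M p i * s i) * (M j k * l k))"
  proof (intro sum.cong refl)
    fix k i assume ki: "k \<in> U" "i \<in> U"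
    have e: "(real k - real i) * ?T i k = l i * s k - s i * l k"
      using comm[OF ki(2,1)] by (auto simp: algebra_simps)
    show "M p i * ((real k - real i) * ?T i k) * M k j = (M p i * l i) * (M j k * s k) - (M p i * s i) * (M j k * l k)"
      unfolding e is_resolvent_sym[OF M ki(1) pj(2)] by (simp add: algebra_simps)
  qed
  also have "\<dots> = Ml p * Ms j - Ms p * Ml j"
    unfolding sum_subtractf Ml_def Ms_def sum_product
    by (subst (3) sum.swap, subst (4) sum.swap) (simp add: mult_ac)
  finally show ?thesis .
qed

lemma resolvent_commutator_extension:
  fixes x :: real and U :: "nat set"
  assumes M: "is_resolvent U (gram Q A) M" and fin: "finite U" and p: "p \<in> U"
    and comm: "\<And>i k. i \<in> U \<Longrightarrow> k \<in> U \<Longrightarrow> (real i - real k) * gram Q A i k = s i * l k - l i * s k"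
    and a: "\<And>j. j \<in> U \<Longrightarrow> (x - real j) * a j = l j - s j * lx"
  defines "Ms \<equiv> \<lambda>j. \<Sum>k\<in>U. M j k * s k" and "Ml \<equiv> \<lambda>j. \<Sum>k\<in>U. M j k * l k"
  shows "(x - real p) * (\<Sum>j\<in>U. M p j * a j)
      = Ml p * (1 - (\<Sum>j\<in>U. Ms j * a j)) - Ms p * (lx - (\<Sum>j\<in>U. Ml j * a j))"
proof -
  have "(x - real p) * (\<Sum>j\<in>U. M p j * a j) = (\<Sum>j\<in>U. M p j * ((x - real j) * a j) - (real p - real j) * M p j * a j)"
    unfolding sum_distrib_left by (intro sum.cong refl) (simp add: algebra_simps)
  also have "\<dots> = (\<Sum>j\<in>U. M p j * (l j - s j * lx) - (Ml p * Ms j - Ms p * Ml j) * a j)"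
    using a resolvent_commutator[OF M fin p _ comm] by (simp add: Ml_def Ms_def cong: sum.cong)
  also have "\<dots> = (\<Sum>j\<in>U. M p j * l j) - (\<Sum>j\<in>U. M p j * s j) * lx
      - (Ml p * (\<Sum>j\<in>U. Ms j * a j) - Ms p * (\<Sum>j\<in>U. Ml j * a j))"
    by (simp add: algebra_simps sum_subtractf sum.distrib sum_distrib_left)
  finally show ?thesis by (simp add: Ml_def Ms_def algebra_simps)
qed

section \<open>Gauss hypergeometric series\<close>

lemma pochhammer_ratio_bound:
  fixes b c :: complex
  assumes y: "0 < y" "y \<le> Re c" and b: "norm b \<le> real n"
  shows "norm (pochhammer (c - b) k / pochhammer c k) \<le> (1 + real k / y) ^ n"
proof (induction k)
  case 0 show ?case by simp
next
  case (Suc k)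
  have ck: "y + real k \<le> norm (c + of_nat k)"
    using complex_Re_le_cmod[of "c + of_nat k"] y by simp
  hence ck0: "c + of_nat k \<noteq> 0" using y by auto
  have "norm ((c - b + of_nat k) / (c + of_nat k)) = norm (1 - b / (c + of_nat k))"
    using ck0 by (simp add: field_simps)
  also have "\<dots> \<le> 1 + norm b / norm (c + of_nat k)"
    using norm_triangle_ineq4[of 1 "b / (c + of_nat k)"] by (simp add: norm_divide)
  also have "\<dots> \<le> 1 + real n * (1 / (y + real k))"
    using b ck y by (auto intro!: frac_le add_mono)
  also have "\<dots> \<le> (1 + 1 / (y + real k)) ^ n"
  proof -
    have "- 1 \<le> 1 / (y + real k)" by (rule order_trans[of _ 0]) (use y in auto)
    thus ?thesis using Bernoulli_inequality[of "1 / (y + real k)" n] by (simp add: mult.commute)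
  qed
  finally have factor: "norm ((c - b + of_nat k) / (c + of_nat k)) \<le> (1 + 1 / (y + real k)) ^ n" .
  have "norm (pochhammer (c - b) (Suc k) / pochhammer c (Suc k)) =
      norm (pochhammer (c - b) k / pochhammer c k) * norm ((c - b + of_nat k) / (c + of_nat k))"
    by (simp add: pochhammer_Suc norm_mult norm_divide)
  also have "\<dots> \<le> (1 + real k / y) ^ n * (1 + 1 / (y + real k)) ^ n"
    by (intro mult_mono Suc.IH factor) (use y in auto)
  also have "\<dots> = (1 + real (Suc k) / y) ^ n"
    unfolding power_mult_distrib[symmetric]
  proof (intro arg_cong2[where f="(^)"] refl)
    have "y \<noteq> 0" "y + real k \<noteq> 0" using y by auto
    thus "(1 + real k / y) * (1 + 1 / (y + real k)) = 1 + real (Suc k) / y" by (simp add: divide_simps)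
  qed
  finally show ?case .
qed

lemma summable_poly_geometric:
  fixes r :: real
  assumes "0 \<le> r" "r < 1"
  shows "summable (\<lambda>k. (1 + real k) ^ N * r ^ k)"
proof -
  let ?a = "\<lambda>k. (1 + real (Suc k)) / (1 + real k)"
  have "(\<lambda>k. (?a k) ^ N * r) \<longlonglongrightarrow> 1 ^ N * r"
    by (intro tendsto_intros) real_asymp
  hence "\<forall>\<^sub>F k in sequentially. (?a k) ^ N * r < (1 + r) / 2"
    using assms by (intro order_tendstoD) auto
  then obtain K where K: "\<And>k. k \<ge> K \<Longrightarrow> (?a k) ^ N * r < (1 + r) / 2"
    by (auto simp: eventually_sequentially)
  show ?thesis
  proof (rule summable_ratio_test[of "(1 + r) / 2" K])
    fix k assume k: "K \<le> k"
    have "(1 + real (Suc k)) ^ N * r ^ Suc k = ((?a k) ^ N * r) * ((1 + real k) ^ N * r ^ k)"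
      by (simp add: power_divide field_simps add_pos_nonneg)
    also have "\<dots> \<le> (1 + r) / 2 * ((1 + real k) ^ N * r ^ k)"
      using K[OF k] assms by (intro mult_right_mono) auto
    finally show "norm ((1 + real (Suc k)) ^ N * r ^ Suc k) \<le> (1 + r) / 2 * norm ((1 + real k) ^ N * r ^ k)"
      using assms by (simp add: abs_mult)
  qed (use assms in auto)
qed

definition poly_bounded :: "(nat \<Rightarrow> complex) \<Rightarrow> bool" where
  "poly_bounded u \<longleftrightarrow> (\<exists>C N. \<forall>k. norm (u k) \<le> C * (1 + real k) ^ N)"

lemma poly_boundedE:
  assumes "poly_bounded u"
  obtains C N where "0 \<le> C" "\<And>k. norm (u k) \<le> C * (1 + real k) ^ N"
proof -
  obtain C N where u: "\<And>k. norm (u k) \<le> C * (1 + real k) ^ N"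
    using assms unfolding poly_bounded_def by blast
  have "0 \<le> C" using order_trans[OF norm_ge_zero u[of 0]] by simp
  thus ?thesis using that u by blast
qed

lemma poly_bounded_mult:
  assumes "poly_bounded u" "poly_bounded v"
  shows "poly_bounded (\<lambda>k. u k * v k)"
proof -
  obtain C N where u: "0 \<le> C" "\<And>k. norm (u k) \<le> C * (1 + real k) ^ N"
    using assms(1) by (rule poly_boundedE) blast
  obtain D M where v: "0 \<le> D" "\<And>k. norm (v k) \<le> D * (1 + real k) ^ M"
    using assms(2) by (rule poly_boundedE) blast
  have "norm (u k * v k) \<le> (C * D) * (1 + real k) ^ (N + M)" for k
    using mult_mono[OF u(2) v(2), of k k] u(1) by (simp add: norm_mult power_add mult_ac)
  thus ?thesis unfolding poly_bounded_def by blast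
qed

lemma poly_bounded_Suc:
  assumes "poly_bounded u"
  shows "poly_bounded (\<lambda>k. u (Suc k))"
proof -
  obtain C N where u: "0 \<le> C" "\<And>k. norm (u k) \<le> C * (1 + real k) ^ N"
    using assms by (rule poly_boundedE) blast
  have "norm (u (Suc k)) \<le> (C * 2 ^ N) * (1 + real k) ^ N" for k
  proof -
    have "norm (u (Suc k)) \<le> C * (1 + real (Suc k)) ^ N" by (rule u)
    also have "\<dots> \<le> C * (2 * (1 + real k)) ^ N" using u(1) by (intro mult_left_mono power_mono) auto
    finally show ?thesis by (simp only: power_mult_distrib mult.assoc)
  qed
  thus ?thesis unfolding poly_bounded_def by blast
qed

lemma poly_bounded_pochhammer_fact: "poly_bounded (\<lambda>k. pochhammer a k / fact k)"
proof -
  obtain n where "norm (1 - a) \<le> real n" using real_arch_simple by blast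
  hence "norm (pochhammer a k / fact k) \<le> 1 * (1 + real k) ^ n" for k
    using pochhammer_ratio_bound[of 1 1 "1 - a" n k] by (simp add: pochhammer_fact)
  thus ?thesis unfolding poly_bounded_def by blast
qed

lemma poly_bounded_pochhammer_Suc_fact:
  "poly_bounded (\<lambda>k. pochhammer a (Suc k) / fact k)"
proof -
  have "poly_bounded (\<lambda>_. a)"
    unfolding poly_bounded_def by (intro exI[of _ "norm a"] exI[of _ 0]) simp
  from poly_bounded_mult[OF this poly_bounded_pochhammer_fact[of "a + 1"]]
  show ?thesis by (simp add: pochhammer_rec)
qed

lemma poly_bounded_summable:
  assumes "poly_bounded u" "0 \<le> r" "r < 1"
  shows "summable (\<lambda>k. norm (u k) * r ^ k)"
proof -
  obtain C N where u: "0 \<le> C" "\<And>k. norm (u k) \<le> C * (1 + real k) ^ N"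
    using assms(1) by (rule poly_boundedE) blast
  show ?thesis
  proof (rule summable_comparison_test')
    show "summable (\<lambda>k. C * ((1 + real k) ^ N * r ^ k))"
      by (intro summable_mult summable_poly_geometric assms)
    show "norm (norm (u k) * r ^ k) \<le> C * ((1 + real k) ^ N * r ^ k)" for k
      using mult_right_mono[OF u(2), of "r ^ k" k] assms by simp
  qed
qed

definition hyp_coeff :: "complex \<Rightarrow> complex \<Rightarrow> complex \<Rightarrow> nat \<Rightarrow> complex" where
  "hyp_coeff a b c k = pochhammer a k / fact k * (pochhammer (c - b) k / pochhammer c k)"

text \<open>The Gauss series $F(a, c - b; c; \xi)$, which by Pfaff's transformation is
  $(1 - \xi)^{-a} F(a, b; c; \xi / (\xi - 1))$.\<close>

definition hyp :: "complex \<Rightarrow> complex \<Rightarrow> complex \<Rightarrow> real \<Rightarrow> complex" where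
  "hyp a b c xi = (\<Sum>k. hyp_coeff a b c k * of_real xi ^ k)"

lemma hyp_coeff_uniform_bound:
  assumes y: "0 < y"
  obtains C N where "0 \<le> C" "\<And>c k. y \<le> Re c \<Longrightarrow> norm (hyp_coeff a b c k) \<le> C * (1 + real k) ^ N"
proof -
  obtain n where n: "norm b \<le> real n" using real_arch_simple by blast
  obtain C N where C: "0 \<le> C" "\<And>k. norm (pochhammer a k / fact k) \<le> C * (1 + real k) ^ N"
    using poly_bounded_pochhammer_fact by (rule poly_boundedE) blast
  have "norm (hyp_coeff a b c k) \<le> (C * (1 + 1 / y) ^ n) * (1 + real k) ^ (N + n)" if "y \<le> Re c" for c k
  proof -
    have "(1 + real k / y) ^ n \<le> ((1 + 1 / y) * (1 + real k)) ^ n"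
      using y by (intro power_mono) (auto simp: field_simps)
    hence "norm (pochhammer (c - b) k / pochhammer c k) \<le> ((1 + 1 / y) * (1 + real k)) ^ n"
      using pochhammer_ratio_bound[OF y that n, of k] by linarith
    from mult_mono[OF C(2)[of k] this] C(1) show ?thesis
      unfolding hyp_coeff_def norm_mult[of "pochhammer a k / fact k"]
      by (simp add: power_add power_mult_distrib mult_ac)
  qed
  thus ?thesis using that[of "C * (1 + 1 / y) ^ n" "N + n"] y C(1) by simp
qed

lemma poly_bounded_hyp_coeff: "0 < Re c \<Longrightarrow> poly_bounded (hyp_coeff a b c)"
  unfolding poly_bounded_def by (metis hyp_coeff_uniform_bound order_refl)

lemma hyp_sums:
  assumes "0 < Re c" "0 \<le> xi" "xi < 1"
  shows "(\<lambda>k. hyp_coeff a b c k * of_real xi ^ k) sums hyp a b c xi"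
proof -
  have "summable (\<lambda>k. norm (hyp_coeff a b c k * of_real xi ^ k))"
    using poly_bounded_summable[OF poly_bounded_hyp_coeff[OF assms(1)] assms(2,3)] assms(2)
    by (simp add: norm_mult norm_power)
  thus ?thesis unfolding hyp_def by (rule summable_sums[OF summable_norm_cancel])
qed

lemma hyp_sums_shift:
  assumes "0 < Re c" "0 \<le> xi" "xi < 1"
  shows "(\<lambda>k. (if k = 0 then 0 else hyp_coeff a b c (k - 1)) * of_real xi ^ k) sums (of_real xi * hyp a b c xi)"
proof -
  have "(\<lambda>k. (if Suc k = 0 then 0 else hyp_coeff a b c (Suc k - 1)) * of_real xi ^ Suc k) sums (of_real xi * hyp a b c xi)"
    using sums_mult[OF hyp_sums[OF assms], of "of_real xi" a b] by (simp add: mult_ac)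
  thus ?thesis by (subst (asm) sums_Suc_iff) simp
qed

lemma binomial_series:
  assumes "0 \<le> xi" "xi < 1"
  shows "(\<lambda>k. pochhammer a k / fact k * of_real xi ^ k) sums (of_real (1 - xi) powr (- a :: complex))"
proof -
  have "(\<lambda>n. ((-a) gchoose n) * (- of_real xi) ^ n) sums (1 + - of_real xi) powr (-a)"
    using assms by (intro gen_binomial_complex) auto
  moreover have "((-a) gchoose n) * (- of_real xi) ^ n = pochhammer a n / fact n * of_real xi ^ n" for n
  proof -
    have "(- of_real xi :: complex) ^ n = (-1) ^ n * of_real xi ^ n" by (rule power_minus)
    moreover have "(-1) ^ n * (-1) ^ n = (1::complex)" by (simp flip: power_mult_distrib)
    ultimately show ?thesis by (simp add: gbinomial_pochhammer mult.assoc)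
  qed
  ultimately show ?thesis by simp
qed

lemma of_nat_add_nonzero: "0 < Re c \<Longrightarrow> c + of_nat n \<noteq> 0"
  by (auto simp: complex_eq_iff)

lemma hyp_coeff_Suc:
  "hyp_coeff a b c (Suc n) = hyp_coeff a b c n * ((a + of_nat n) * (c - b + of_nat n) / ((of_nat n + 1) * (c + of_nat n)))"
  by (simp add: hyp_coeff_def pochhammer_Suc mult_ac)

lemma hyp_coeff_upper_shift: "a * hyp_coeff (a + 1) b c n = (a + of_nat n) * hyp_coeff a b c n"
proof -
  have "a * pochhammer (a + 1) n = (a + of_nat n) * pochhammer a n"
    by (metis mult.commute pochhammer_Suc pochhammer_rec)
  thus ?thesis by (simp add: hyp_coeff_def mult.assoc[symmetric])
qed

lemma hyp_contiguous_upper: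
  assumes c: "0 < Re c" and xi: "0 \<le> xi" "xi < 1"
  shows "(c - a) * hyp (a - 1) b c xi + (2 * a - c + (c - b - a) * of_real xi) * hyp a b c xi
      + a * (of_real xi - 1) * hyp (a + 1) b c xi = 0"
proof -
  let ?s = "\<lambda>a k. if k = 0 then 0 else hyp_coeff a b c (k - 1)"
  have coeff: "(c - a) * hyp_coeff (a - 1) b c k + (2 * a - c) * hyp_coeff a b c k + (c - b - a) * ?s a k
      + a * ?s (a + 1) k - a * hyp_coeff (a + 1) b c k = 0" for k
  proof (cases k)
    case (Suc n)
    define h r where "h = hyp_coeff a b c n" and "r = (c - b + of_nat n) / ((of_nat n + 1) * (c + of_nat n))"
    have "of_nat n + 1 \<noteq> (0::complex)" by (metis add.commute of_nat_Suc of_nat_neq_0)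
    hence r: "(of_nat n + 1) * (c + of_nat n) * r = c - b + of_nat n"
      using of_nat_add_nonzero[OF c, of n] by (simp add: r_def)
    have lower: "hyp_coeff (a - 1) b c k = (a - 1) * h * r"
      by (simp add: Suc hyp_coeff_def h_def r_def pochhammer_rec[of "a - 1"] pochhammer_Suc[of c]
          pochhammer_Suc[of "c - b"] mult_ac)
    have middle: "hyp_coeff a b c k = (a + of_nat n) * h * r"
      by (simp add: Suc hyp_coeff_Suc h_def r_def)
    have upper: "a * hyp_coeff (a + 1) b c k = (a + of_nat n + 1) * ((a + of_nat n) * h * r)"
      unfolding hyp_coeff_upper_shift middle by (simp add: Suc add_ac)
    have shifted: "?s a k = h" "a * ?s (a + 1) k = (a + of_nat n) * h"
      using hyp_coeff_upper_shift[of a b c n] by (simp_all add: Suc h_def)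
    have "(c - a) * hyp_coeff (a - 1) b c k + (2 * a - c) * hyp_coeff a b c k + (c - b - a) * ?s a k
        + a * ?s (a + 1) k - a * hyp_coeff (a + 1) b c k
        = h * (c - b + of_nat n - (of_nat n + 1) * (c + of_nat n) * r)"
      unfolding upper shifted unfolding lower middle by (simp add: algebra_simps)
    thus ?thesis by (simp add: r)
  qed (simp add: hyp_coeff_def)
  have "(\<lambda>k. (c - a) * (hyp_coeff (a - 1) b c k * of_real xi ^ k) + (2 * a - c) * (hyp_coeff a b c k * of_real xi ^ k)
      + (c - b - a) * (?s a k * of_real xi ^ k) + a * (?s (a + 1) k * of_real xi ^ k)
      - a * (hyp_coeff (a + 1) b c k * of_real xi ^ k))
    sums ((c - a) * hyp (a - 1) b c xi + (2 * a - c) * hyp a b c xi + (c - b - a) * (of_real xi * hyp a b c xi)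
      + a * (of_real xi * hyp (a + 1) b c xi) - a * hyp (a + 1) b c xi)" (is "?f sums ?S")
    by (intro sums_add sums_diff sums_mult hyp_sums hyp_sums_shift assms)
  moreover have "?f = (\<lambda>k. 0)"
    unfolding mult.assoc[symmetric] distrib_right[symmetric] left_diff_distrib[symmetric] coeff by simp
  ultimately have "?S = 0" using sums_unique2[OF sums_zero] by fastforce
  thus ?thesis by (simp add: algebra_simps)
qed

lemma hyp_contiguous_lower:
  assumes c: "0 < Re c" and xi: "0 \<le> xi" "xi < 1"
  shows "c * (hyp a b (c + 1) xi - hyp a b c xi)
      = a * (hyp a b (c + 1) xi - (1 - of_real xi) * hyp (a + 1) b (c + 1) xi)"
proof -
  let ?s = "\<lambda>a k. if k = 0 then 0 else hyp_coeff a b (c + 1) (k - 1)"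
  have c1: "0 < Re (c + 1)" using c by simp
  have coeff: "c * hyp_coeff a b c k - (c - a) * hyp_coeff a b (c + 1) k - a * hyp_coeff (a + 1) b (c + 1) k
      + a * ?s (a + 1) k = 0" for k
  proof (cases k)
    case (Suc n)
    define h r where "h = hyp_coeff a b (c + 1) n"
      and "r = (c + 1 - b + of_nat n) / ((of_nat n + 1) * (c + 1 + of_nat n))"
    have n1: "of_nat n + 1 \<noteq> (0::complex)" by (metis add.commute of_nat_Suc of_nat_neq_0)
    hence r: "(of_nat n + 1) * (c + 1 + of_nat n) * r = c + 1 - b + of_nat n"
      using of_nat_add_nonzero[OF c1, of n] by (simp add: r_def)
    have "c \<noteq> 0" using c by auto
    hence unshifted: "(of_nat n + 1) * (c * hyp_coeff a b c k) = (a + of_nat n) * (c - b) * h"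
      using n1 by (simp add: Suc hyp_coeff_def h_def pochhammer_Suc[of a] pochhammer_rec[of c]
          pochhammer_rec[of "c - b"] diff_add_eq add.commute[of "of_nat n"] mult_ac)
    have middle: "hyp_coeff a b (c + 1) k = (a + of_nat n) * h * r"
      by (simp add: Suc hyp_coeff_Suc h_def r_def)
    have upper: "a * hyp_coeff (a + 1) b (c + 1) k = (a + of_nat n + 1) * ((a + of_nat n) * h * r)"
      unfolding hyp_coeff_upper_shift middle by (simp add: Suc add_ac)
    have shifted: "a * ?s (a + 1) k = (a + of_nat n) * h"
      using hyp_coeff_upper_shift[of a b "c + 1" n] by (simp add: Suc h_def)
    have "(of_nat n + 1) * (c * hyp_coeff a b c k - (c - a) * hyp_coeff a b (c + 1) k
        - a * hyp_coeff (a + 1) b (c + 1) k + a * ?s (a + 1) k)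
        = (a + of_nat n) * h * (c + 1 - b + of_nat n - (of_nat n + 1) * (c + 1 + of_nat n) * r)"
      unfolding distrib_left right_diff_distrib unshifted upper middle shifted by (simp add: algebra_simps)
    thus ?thesis using n1 by (simp add: r)
  qed (simp add: hyp_coeff_def)
  have "(\<lambda>k. c * (hyp_coeff a b c k * of_real xi ^ k) - (c - a) * (hyp_coeff a b (c + 1) k * of_real xi ^ k)
      - a * (hyp_coeff (a + 1) b (c + 1) k * of_real xi ^ k) + a * (?s (a + 1) k * of_real xi ^ k))
    sums (c * hyp a b c xi - (c - a) * hyp a b (c + 1) xi - a * hyp (a + 1) b (c + 1) xi
      + a * (of_real xi * hyp (a + 1) b (c + 1) xi))" (is "?f sums ?S")
    by (intro sums_add sums_diff sums_mult hyp_sums hyp_sums_shift c c1 xi)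
  moreover have "?f = (\<lambda>k. 0)"
    unfolding mult.assoc[symmetric] distrib_right[symmetric] left_diff_distrib[symmetric] coeff by simp
  ultimately have "?S = 0" using sums_unique2[OF sums_zero] by fastforce
  thus ?thesis by (simp add: algebra_simps)
qed

lemma partial_fractions_simple_poles:
  fixes P :: "'a::field poly" and x :: "'i \<Rightarrow> 'a"
  assumes fin: "finite I" and inj: "inj_on x I" and deg: "degree P < card I"
    and c: "\<And>i. i \<in> I \<Longrightarrow> c \<noteq> x i"
  shows "poly P c / (\<Prod>i\<in>I. c - x i) = (\<Sum>i\<in>I. poly P (x i) / (\<Prod>j\<in>I - {i}. x i - x j) / (c - x i))"
proof -
  define B where "B i = (\<Prod>j\<in>I - {i}. [:- x j, 1:])" for i
  define Q where "Q = (\<Sum>i\<in>I. smult (poly P (x i) / (\<Prod>j\<in>I - {i}. x i - x j)) (B i))"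
  have poly_B: "poly (B i) y = (\<Prod>j\<in>I - {i}. y - x j)" for i y
    by (simp add: B_def poly_prod)
  have poly_Q: "poly Q y = (\<Sum>i\<in>I. poly P (x i) / (\<Prod>j\<in>I - {i}. x i - x j) * (\<Prod>j\<in>I - {i}. y - x j))" for y
    by (simp add: Q_def poly_sum poly_B)
  have "degree (B i) \<le> card I - 1" if "i \<in> I" for i
    using degree_prod_sum_le[of "I - {i}" "\<lambda>j. [:- x j, 1:]"] that fin by (simp add: B_def)
  hence "degree Q \<le> card I - 1"
    unfolding Q_def by (intro degree_sum_le fin) (simp add: order_trans[OF degree_smult_le])
  moreover have "poly P y = poly Q y" if "y \<in> x ` I" for y
  proof -
    obtain k where k: "k \<in> I" "y = x k" using \<open>y \<in> x ` I\<close> by auto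
    have "poly Q y = (\<Sum>i\<in>I. if i = k then poly P (x k) else 0)"
      unfolding poly_Q
    proof (intro sum.cong refl)
      fix i assume i: "i \<in> I"
      have "(\<Prod>j\<in>I - {k}. x k - x j) \<noteq> 0" using inj k fin by (auto simp: inj_on_def)
      moreover have "(\<Prod>j\<in>I - {i}. y - x j) = 0" if "i \<noteq> k"
        using that k fin by (intro prod_zero) auto
      ultimately show "poly P (x i) / (\<Prod>j\<in>I - {i}. x i - x j) * (\<Prod>j\<in>I - {i}. y - x j)
          = (if i = k then poly P (x k) else 0)" using k by auto
    qed
    thus ?thesis using k fin by simp
  qed
  ultimately have "P = Q"
    using deg by (intro poly_eqI_degree[where A="x ` I"]) (auto simp: card_image[OF inj])
  hence "poly P c = (\<Sum>i\<in>I. poly P (x i) / (\<Prod>j\<in>I - {i}. x i - x j) * (\<Prod>j\<in>I - {i}. c - x j))"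
    unfolding poly_Q[symmetric] by (rule arg_cong)
  also have "\<dots> = (\<Sum>i\<in>I. poly P (x i) / (\<Prod>j\<in>I - {i}. x i - x j) / (c - x i)) * (\<Prod>i\<in>I. c - x i)"
    unfolding sum_distrib_right
    by (intro sum.cong refl) (use c in \<open>simp add: prod.remove[OF fin, of _ "\<lambda>j. c - x j"]\<close>)
  finally show ?thesis using c fin by simp
qed

lemma prod_of_nat_diff:
  assumes "p \<le> k"
  shows "(\<Prod>j\<in>{..k} - {p}. of_nat j - of_nat p :: 'a::field_char_0) = (- 1) ^ p * fact p * fact (k - p)"
proof -
  have below: "(\<Prod>j<p. of_nat j - of_nat p :: 'a) = (- 1) ^ p * fact p"
  proof -
    have "(\<Prod>j<p. of_nat j - of_nat p :: 'a) = pochhammer (- of_nat p) p"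
      by (simp add: pochhammer_prod atLeast0LessThan algebra_simps)
    thus ?thesis by (simp add: pochhammer_same)
  qed
  have "(\<Prod>j\<in>{p<..k}. of_nat j - of_nat p :: 'a) = (\<Prod>j<k - p. of_nat (Suc j))"
    by (rule prod.reindex_bij_witness[of _ "\<lambda>j. j + Suc p" "\<lambda>j. j - Suc p"]) (auto simp: of_nat_diff)
  also have "\<dots> = fact (k - p)" by (simp add: fact_prod_Suc atLeast0LessThan)
  finally have above: "(\<Prod>j\<in>{p<..k}. of_nat j - of_nat p :: 'a) = fact (k - p)" .
  have "{..k} - {p} = {..<p} \<union> {p<..k}" using assms by auto
  thus ?thesis by (simp add: prod.union_disjoint Int_def below above)
qed

lemma pochhammer_ratio_partial_fractions:
  fixes a c :: complex
  assumes "0 < Re c"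
  shows "pochhammer (c + a) k / pochhammer c (Suc k)
      = (\<Sum>p\<le>k. pochhammer (1 - a) p * pochhammer a (k - p) / (fact p * fact (k - p)) / (c + of_nat p))"
proof -
  let ?P = "\<Prod>i<k. [:a + of_nat i, 1:]"
  have P: "poly ?P y = pochhammer (y + a) k" for y
    by (simp add: poly_prod pochhammer_prod atLeast0LessThan add_ac)
  have "degree ?P \<le> k" using degree_prod_sum_le[of "{..<k}" "\<lambda>i. [:a + of_nat i, 1:]"] by simp
  hence "poly ?P c / (\<Prod>p\<le>k. c - (- of_nat p))
      = (\<Sum>p\<le>k. poly ?P (- of_nat p) / (\<Prod>j\<in>{..k} - {p}. - of_nat p - (- of_nat j)) / (c - (- of_nat p)))"
    using of_nat_add_nonzero[OF assms]
    by (intro partial_fractions_simple_poles) (auto simp: inj_on_def eq_neg_iff_add_eq_0)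
  hence "pochhammer (c + a) k / pochhammer c (Suc k)
      = (\<Sum>p\<le>k. pochhammer (a - of_nat p) k / (\<Prod>j\<in>{..k} - {p}. of_nat j - of_nat p) / (c + of_nat p))"
    by (simp add: P pochhammer_prod[of c] atLeast0LessThan lessThan_Suc_atMost)
  also have "\<dots> = (\<Sum>p\<le>k. pochhammer (1 - a) p * pochhammer a (k - p) / (fact p * fact (k - p)) / (c + of_nat p))"
  proof (intro sum.cong refl)
    fix p assume "p \<in> {..k}"
    hence p: "p \<le> k" by simp
    have "pochhammer (a - of_nat p) k = (- 1) ^ p * pochhammer (1 - a) p * pochhammer a (k - p)"
      using pochhammer_product[OF p, of "a - of_nat p"] pochhammer_minus'[of "a - 1" p] by simp
    thus "pochhammer (a - of_nat p) k / (\<Prod>j\<in>{..k} - {p}. of_nat j - of_nat p) / (c + of_nat p)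
        = pochhammer (1 - a) p * pochhammer a (k - p) / (fact p * fact (k - p)) / (c + of_nat p)"
      by (simp add: prod_of_nat_diff[OF p])
  qed
  finally show ?thesis .
qed

lemma pochhammer_ratio_partial_fractions_minus_one:
  fixes b c :: complex
  assumes c: "0 < Re c"
  shows "1 - pochhammer (c - b) k / pochhammer c k
      = (\<Sum>q<k. pochhammer b (Suc q) * pochhammer (1 - b) (k - Suc q) / (fact q * fact (k - Suc q)) / (c + of_nat q))"
proof (induction k)
  case (Suc k)
  let ?r = "\<lambda>k q. pochhammer b (Suc q) * pochhammer (1 - b) (k - Suc q) / (fact q * fact (k - Suc q))"
  let ?s = "\<lambda>q. b * (pochhammer (1 + b) q * pochhammer (- b) (k - q) / (fact q * fact (k - q)))"
  have step: "?r (Suc k) q = ?r k q + ?s q" if "q < k" for q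
  proof -
    obtain m where m: "k = Suc (q + m)" using \<open>q < k\<close> less_imp_Suc_add by blast
    have "pochhammer (1 - b) (Suc m) = of_nat (Suc m) * pochhammer (1 - b) m + pochhammer (- b) (Suc m)"
      by (simp add: pochhammer_Suc[of "1 - b"] pochhammer_rec[of "- b"] algebra_simps)
    moreover have "of_nat (Suc m) \<noteq> (0::complex)" by (rule of_nat_neq_0)
    ultimately have "pochhammer (1 - b) (Suc m) / fact (Suc m)
        = pochhammer (1 - b) m / fact m + pochhammer (- b) (Suc m) / fact (Suc m)"
      by (simp add: add_divide_distrib del: of_nat_Suc)
    hence "pochhammer b (Suc q) / fact q * (pochhammer (1 - b) (Suc m) / fact (Suc m))
        = pochhammer b (Suc q) / fact q * (pochhammer (1 - b) m / fact m)
        + pochhammer b (Suc q) / fact q * (pochhammer (- b) (Suc m) / fact (Suc m))"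
      by (simp only: distrib_left)
    thus ?thesis by (simp add: m pochhammer_rec[of b] add.commute del: fact_Suc)
  qed
  have "pochhammer (c - b) (Suc k) / pochhammer c (Suc k)
      = pochhammer (c - b) k / pochhammer c k - b * (pochhammer (c - b) k / pochhammer c (Suc k))"
  proof -
    have "pochhammer c k \<noteq> 0"
      using of_nat_add_nonzero[OF c] by (simp add: pochhammer_eq_0_iff eq_neg_iff_add_eq_0)
    thus ?thesis using of_nat_add_nonzero[OF c, of k] by (simp add: pochhammer_Suc divide_simps) (simp add: algebra_simps)
  qed
  hence "1 - pochhammer (c - b) (Suc k) / pochhammer c (Suc k)
      = 1 - pochhammer (c - b) k / pochhammer c k + b * (pochhammer (c - b) k / pochhammer c (Suc k))"
    by simp
  also have "pochhammer (c - b) k / pochhammer c (Suc k)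
      = (\<Sum>p\<le>k. pochhammer (1 + b) p * pochhammer (- b) (k - p) / (fact p * fact (k - p)) / (c + of_nat p))"
    using pochhammer_ratio_partial_fractions[OF c, of "- b" k] by simp
  also have "1 - pochhammer (c - b) k / pochhammer c k + b * \<dots>
      = (\<Sum>q<k. ?r k q / (c + of_nat q)) + (\<Sum>q\<le>k. ?s q / (c + of_nat q))"
    unfolding Suc.IH by (simp add: sum_distrib_left)
  also have "\<dots> = (\<Sum>q<k. (?r k q + ?s q) / (c + of_nat q)) + ?s k / (c + of_nat k)"
    unfolding lessThan_Suc_atMost[symmetric] add_divide_distrib sum.distrib by simp
  also have "(\<Sum>q<k. (?r k q + ?s q) / (c + of_nat q)) = (\<Sum>q<k. ?r (Suc k) q / (c + of_nat q))"
    by (intro sum.cong refl) (simp only: step lessThan_iff)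
  also have "?s k = ?r (Suc k) k" by (simp add: pochhammer_rec add.commute)
  finally show ?case by simp
qed simp

lemma abs_summable_diagonal_sums:
  fixes g :: "nat \<Rightarrow> nat \<Rightarrow> complex"
  assumes abs: "(\<lambda>x. norm (case x of (q, j) \<Rightarrow> g q j)) summable_on UNIV"
  obtains S where "(\<lambda>n. \<Sum>q\<le>n. g q (n - q)) sums S" "(\<lambda>q. \<Sum>j. g q j) sums S"
proof -
  obtain S where S: "((\<lambda>(q, j). g q j) has_sum S) UNIV"
    using abs_summable_summable[OF abs] summable_on_def by blast
  have inner: "((\<lambda>j. g q j) has_sum (\<Sum>j. g q j)) UNIV" for q
  proof -
    have "(\<lambda>(q, j). g q j) summable_on (UNIV \<times> UNIV)" using abs_summable_summable[OF abs] by simp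
    hence "(\<lambda>j. g q j) summable_on UNIV" by (rule summable_on_SigmaD1) simp
    from has_sum_infsum[OF this] show ?thesis by (metis has_sum_imp_sums sums_unique)
  qed
  have "((\<lambda>q. \<Sum>j. g q j) has_sum S) UNIV"
    using has_sum_SigmaD[where A=UNIV and B="\<lambda>_. UNIV" and f="\<lambda>(q, j). g q j"] S inner by simp
  moreover have bij: "bij_betw (\<lambda>(n, q). (q, n - q)) (SIGMA n:UNIV. {..n::nat}) UNIV"
    by (rule bij_betwI[where g="\<lambda>(q, j). (q + j, q)"]) auto
  have "((\<lambda>(n, q). g q (n - q)) has_sum S) (SIGMA n:UNIV. {..n})"
    using S unfolding has_sum_reindex_bij_betw[OF bij, symmetric] by (simp add: case_prod_unfold)
  hence "((\<lambda>n. \<Sum>q\<le>n. g q (n - q)) has_sum S) UNIV"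
    by (rule has_sum_SigmaD) (auto intro!: has_sum_finiteI)
  ultimately show ?thesis using that has_sum_imp_sums by blast
qed

lemma poly_bounded_diagonal_sums:
  fixes u v w :: "nat \<Rightarrow> complex"
  assumes pb: "poly_bounded u" "poly_bounded v" "poly_bounded w"
    and c: "0 < Re c" and xi: "0 \<le> xi" "xi < 1"
  defines "g \<equiv> \<lambda>q j. v q / (c + of_nat q) * of_real xi ^ q * (u (q + j) * w j * of_real xi ^ j)"
  obtains S where "(\<lambda>n. \<Sum>q\<le>n. g q (n - q)) sums S" "(\<lambda>q. \<Sum>j. g q j) sums S"
proof -
  obtain C N where u: "0 \<le> C" "\<And>k. norm (u k) \<le> C * (1 + real k) ^ N"
    using pb(1) by (rule poly_boundedE) blast
  define y where "y f k = norm (of_real (1 + real k) ^ N * f k) * xi ^ k" for f :: "nat \<Rightarrow> complex" and k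
  have y: "y f summable_on UNIV" if "poly_bounded f" for f
  proof -
    have "poly_bounded (\<lambda>k. of_real (1 + real k) ^ N)"
      unfolding poly_bounded_def
      by (intro exI[of _ 1] exI[of _ N]) (simp add: norm_power del: of_real_add)
    from poly_bounded_summable[OF poly_bounded_mult[OF this that] xi]
    show ?thesis using xi unfolding y_def by (intro summable_nonneg_imp_summable_on) auto
  qed
  have "(\<lambda>(q, j). y v q * y w j) summable_on UNIV \<times> UNIV"
  proof (rule summable_on_SigmaI)
    show "((\<lambda>j. case (q, j) of (q, j) \<Rightarrow> y v q * y w j) has_sum (y v q * infsum (y w) UNIV)) UNIV" for q
      using has_sum_cmult_right[OF has_sum_infsum[OF y[OF pb(3)]]] by simp
    show "(\<lambda>q. y v q * infsum (y w) UNIV) summable_on UNIV"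
      by (rule summable_on_cmult_left[OF y[OF pb(2)]])
  qed (use xi in \<open>auto simp: y_def\<close>)
  hence "(\<lambda>(q, j). C / Re c * (y v q * y w j)) summable_on UNIV"
    using summable_on_cmult_right[of "\<lambda>(q, j). y v q * y w j" UNIV "C / Re c"] by (simp add: case_prod_unfold)
  moreover have "norm (g q j) \<le> C / Re c * (y v q * y w j)" for q j
  proof -
    have "norm (u (q + j)) \<le> C * ((1 + real q) ^ N * (1 + real j) ^ N)"
      unfolding power_mult_distrib[symmetric]
      by (rule order_trans[OF u(2)]) (intro mult_left_mono power_mono u(1), auto simp: algebra_simps)
    moreover have "Re c \<le> norm (c + of_nat q)" using complex_Re_le_cmod[of "c + of_nat q"] by simp
    ultimately have "norm (v q) / norm (c + of_nat q) * xi ^ q * (norm (u (q + j)) * norm (w j) * xi ^ j)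
        \<le> norm (v q) / Re c * xi ^ q * (C * ((1 + real q) ^ N * (1 + real j) ^ N) * norm (w j) * xi ^ j)"
      using c xi by (intro mult_mono frac_le mult_right_mono) auto
    thus ?thesis
      using xi by (simp add: g_def y_def norm_mult norm_divide norm_power mult_ac del: of_real_add)
  qed
  ultimately have "(\<lambda>x. norm (case x of (q, j) \<Rightarrow> g q j)) summable_on UNIV"
    by (intro Infinite_Sum.abs_summable_on_comparison_test'[where g="\<lambda>(q, j). C / Re c * (y v q * y w j)"]) auto
  thus ?thesis using that by (rule abs_summable_diagonal_sums)
qed

lemma hyp_row_sums:
  assumes xi: "0 \<le> xi" "xi < 1"
  shows "(\<lambda>j. pochhammer (1 - b) (q + j) / fact (q + j) * (pochhammer a j / fact j) * of_real xi ^ j)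
      sums (pochhammer (1 - b) q / fact q * hyp a b (of_nat q + 1) xi)"
proof -
  have "pochhammer (1 - b) (q + j) = pochhammer (1 - b) q * pochhammer (of_nat q + 1 - b) j"
    "fact (q + j) = fact q * pochhammer (of_nat q + 1 :: complex) j" for j
    using pochhammer_product'[of "1 - b" q j] pochhammer_product'[of "1 :: complex" q j]
    by (simp_all add: pochhammer_fact algebra_simps)
  thus ?thesis
    using sums_mult[OF hyp_sums[OF _ xi, of "of_nat q + 1" a b], of "pochhammer (1 - b) q / fact q"]
    by (simp add: hyp_coeff_def mult_ac)
qed

lemma hyp_first_system:
  fixes a b c :: complex
  assumes c: "0 < Re c" and xi: "0 \<le> xi" "xi < 1"
  shows "(\<lambda>q. pochhammer a (Suc q) * pochhammer b (Suc q) / (fact q)\<^sup>2 * of_real xi ^ Suc q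
      * (hyp (1 - b) (1 - a) (of_nat (Suc q) + 1) xi / of_nat (Suc q)) / (c + of_nat q))
      sums (of_real (1 - xi) powr (- a) - hyp a b c xi)"
proof -
  define g where "g q j = pochhammer b (Suc q) / fact q / (c + of_nat q) * of_real xi ^ q
      * (pochhammer a (Suc (q + j)) / fact (Suc (q + j)) * (pochhammer (1 - b) j / fact j) * of_real xi ^ j)" for q j
  obtain S where S: "(\<lambda>n. \<Sum>q\<le>n. g q (n - q)) sums S" "(\<lambda>q. \<Sum>j. g q j) sums S"
    unfolding g_def
    by (rule poly_bounded_diagonal_sums[OF poly_bounded_Suc[OF poly_bounded_pochhammer_fact]
          poly_bounded_pochhammer_Suc_fact poly_bounded_pochhammer_fact c xi])
  have "of_real xi * (\<Sum>q\<le>n. g q (n - q)) = pochhammer a (Suc n) / fact (Suc n) * of_real xi ^ Suc n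
      - hyp_coeff a b c (Suc n) * of_real xi ^ Suc n" for n
  proof -
    let ?t = "pochhammer a (Suc n) / fact (Suc n) * of_real xi ^ Suc n"
    have "of_real xi * (\<Sum>q\<le>n. g q (n - q))
        = ?t * (\<Sum>q\<le>n. pochhammer b (Suc q) * pochhammer (1 - b) (n - q) / (fact q * fact (n - q)) / (c + of_nat q))"
      unfolding sum_distrib_left
    proof (intro sum.cong refl)
      fix q assume "q \<in> {..n}"
      then obtain j where j: "n = q + j" using le_Suc_ex by auto
      show "of_real xi * g q (n - q)
          = ?t * (pochhammer b (Suc q) * pochhammer (1 - b) (n - q) / (fact q * fact (n - q)) / (c + of_nat q))"
        unfolding j by (simp add: g_def power_add mult_ac del: fact_Suc)
    qed
    also have "\<dots> = ?t * (1 - pochhammer (c - b) (Suc n) / pochhammer c (Suc n))"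
      using pochhammer_ratio_partial_fractions_minus_one[OF c, of b "Suc n"] by (simp add: lessThan_Suc_atMost)
    finally show ?thesis by (simp add: hyp_coeff_def right_diff_distrib diff_divide_distrib mult_ac del: fact_Suc)
  qed
  moreover have "(\<lambda>k. pochhammer a k / fact k * of_real xi ^ k - hyp_coeff a b c k * of_real xi ^ k)
      sums (of_real (1 - xi) powr (- a) - hyp a b c xi)"
    by (intro sums_diff binomial_series hyp_sums c xi)
  ultimately have "(\<lambda>n. of_real xi * (\<Sum>q\<le>n. g q (n - q))) sums (of_real (1 - xi) powr (- a) - hyp a b c xi)"
    using sums_Suc_iff[of "\<lambda>k. pochhammer a k / fact k * of_real xi ^ k - hyp_coeff a b c k * of_real xi ^ k"]
    by (simp add: hyp_coeff_def)
  from sums_unique2[OF this sums_mult[OF S(1)]]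
  have "(\<lambda>q. of_real xi * (\<Sum>j. g q j)) sums (of_real (1 - xi) powr (- a) - hyp a b c xi)"
    using sums_mult[OF S(2)] by simp
  moreover have "of_real xi * (\<Sum>j. g q j) = pochhammer a (Suc q) * pochhammer b (Suc q) / (fact q)\<^sup>2 * of_real xi ^ Suc q
      * (hyp (1 - b) (1 - a) (of_nat (Suc q) + 1) xi / of_nat (Suc q)) / (c + of_nat q)" for q
    using sums_unique[OF sums_mult[OF hyp_row_sums[OF xi, of "1 - a" "Suc q" "1 - b"],
        of "pochhammer b (Suc q) / fact q / (c + of_nat q) * of_real xi ^ q"], symmetric]
    by (simp add: g_def power2_eq_square mult_ac del: of_nat_Suc of_nat_add)
  ultimately show ?thesis by simp
qed

lemma hyp_second_system:
  fixes a b c :: complex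
  assumes c: "0 < Re c" and xi: "0 \<le> xi" "xi < 1"
  shows "(\<lambda>p. pochhammer (1 - a) p * pochhammer (1 - b) p / (fact p)\<^sup>2 * of_real xi ^ p
      * hyp a b (of_nat p + 1) xi / (c + of_nat p)) sums (hyp (1 - b) (1 - a) (c + 1) xi / c)"
proof -
  define g where "g q j = pochhammer (1 - a) q / fact q / (c + of_nat q) * of_real xi ^ q
      * (pochhammer (1 - b) (q + j) / fact (q + j) * (pochhammer a j / fact j) * of_real xi ^ j)" for q j
  obtain S where S: "(\<lambda>n. \<Sum>q\<le>n. g q (n - q)) sums S" "(\<lambda>q. \<Sum>j. g q j) sums S"
    unfolding g_def
    by (rule poly_bounded_diagonal_sums[OF poly_bounded_pochhammer_fact
          poly_bounded_pochhammer_fact poly_bounded_pochhammer_fact c xi])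
  have "(\<Sum>q\<le>n. g q (n - q)) = hyp_coeff (1 - b) (1 - a) (c + 1) n * of_real xi ^ n / c" for n
  proof -
    let ?t = "pochhammer (1 - b) n / fact n * of_real xi ^ n"
    have "(\<Sum>q\<le>n. g q (n - q))
        = ?t * (\<Sum>q\<le>n. pochhammer (1 - a) q * pochhammer a (n - q) / (fact q * fact (n - q)) / (c + of_nat q))"
      unfolding sum_distrib_left
    proof (intro sum.cong refl)
      fix q assume "q \<in> {..n}"
      then obtain j where j: "n = q + j" using le_Suc_ex by auto
      show "g q (n - q) = ?t * (pochhammer (1 - a) q * pochhammer a (n - q) / (fact q * fact (n - q)) / (c + of_nat q))"
        unfolding j by (simp add: g_def power_add mult_ac)
    qed
    thus ?thesis
      unfolding pochhammer_ratio_partial_fractions[OF c, symmetric]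
      by (simp add: hyp_coeff_def pochhammer_rec[of c] algebra_simps)
  qed
  moreover have "(\<lambda>n. hyp_coeff (1 - b) (1 - a) (c + 1) n * of_real xi ^ n / c) sums (hyp (1 - b) (1 - a) (c + 1) xi / c)"
    using c by (intro sums_divide hyp_sums xi) simp
  ultimately have "(\<lambda>q. \<Sum>j. g q j) sums (hyp (1 - b) (1 - a) (c + 1) xi / c)"
    using S sums_unique2 by fastforce
  moreover have "(\<Sum>j. g q j) = pochhammer (1 - a) q * pochhammer (1 - b) q / (fact q)\<^sup>2 * of_real xi ^ q
      * hyp a b (of_nat q + 1) xi / (c + of_nat q)" for q
    using sums_unique[OF sums_mult[OF hyp_row_sums[OF xi, of b q a],
        of "pochhammer (1 - a) q / fact q / (c + of_nat q) * of_real xi ^ q"]]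
    by (simp add: g_def power2_eq_square mult_ac)
  ultimately show ?thesis by simp
qed

section \<open>Limits of hypergeometric functions\<close>

lemma power_le_exp:
  fixes x :: real
  assumes "0 \<le> x"
  shows "x ^ N \<le> (2 * real N) ^ N * exp (x / 2)"
proof (cases "N = 0")
  case False
  have "(x / 2 / real N) ^ N \<le> (1 + x / 2 / real N) ^ N"
    using assms by (intro power_mono) auto
  also have "\<dots> \<le> exp (x / 2)"
    using exp_ge_one_plus_x_over_n_power_n[of N "x / 2"] assms False by simp
  finally have "x ^ N / (2 * real N) ^ N \<le> exp (x / 2)" by (simp add: power_divide power_mult_distrib)
  thus ?thesis using False by (simp add: pos_divide_le_eq mult.commute)
qed (use assms in simp)

lemma gamma_weight_integrable:
  fixes a :: real
  assumes "0 < a"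
  shows "integrable lborel (\<lambda>t. indicator {0<..} t * (t powr (a - 1) * (1 + t) ^ N * exp (- t)))"
proof (rule Bochner_Integration.integrable_bound)
  let ?K = "(2 * real N) ^ N * exp (1 / 2)"
  have "(\<lambda>t. complex_of_real t powr (of_real a - 1) / of_real (exp (1 / 2 * t))) absolutely_integrable_on {0<..}"
    by (rule absolutely_integrable_Gamma_integral) (use assms in auto)
  hence "integrable lebesgue (\<lambda>t. norm (indicator {0<..} t *\<^sub>R (complex_of_real t powr (of_real a - 1) / of_real (exp (1 / 2 * t)))))"
    unfolding set_integrable_def by (rule integrable_norm)
  also have "(\<lambda>t. norm (indicator {0<..} t *\<^sub>R (complex_of_real t powr (of_real a - 1) / of_real (exp (1 / 2 * t))))) =
      (\<lambda>t. indicator {0<..} t * (t powr (a - 1) * exp (- (t / 2))))"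
    by (auto simp: fun_eq_iff indicator_def norm_divide norm_powr_real_powr exp_minus field_simps)
  finally have "integrable lborel (\<lambda>t. indicator {0<..} t * (t powr (a - 1) * exp (- (t / 2))))"
    by (subst (asm) integrable_completion) auto
  thus "integrable lborel (\<lambda>t. ?K * (indicator {0<..} t * (t powr (a - 1) * exp (- (t / 2)))))"
    by (rule integrable_mult_right)
  show "AE t in lborel. norm (indicator {0<..} t * (t powr (a - 1) * (1 + t) ^ N * exp (- t)))
      \<le> norm (?K * (indicator {0<..} t * (t powr (a - 1) * exp (- (t / 2)))))"
  proof (intro AE_I2)
    fix t :: real
    show "norm (indicator {0<..} t * (t powr (a - 1) * (1 + t) ^ N * exp (- t)))
        \<le> norm (?K * (indicator {0<..} t * (t powr (a - 1) * exp (- (t / 2)))))"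
    proof (cases "t > 0")
      case True
      have "(1 + t) ^ N * exp (- t) \<le> (2 * real N) ^ N * exp ((1 + t) / 2) * exp (- t)"
        using power_le_exp[of "1 + t" N] True by (intro mult_right_mono) auto
      also have "\<dots> = ?K * exp (- (t / 2))"
        by (simp add: mult.assoc exp_add[symmetric])
      finally have "t powr (a - 1) * ((1 + t) ^ N * exp (- t)) \<le> t powr (a - 1) * (?K * exp (- (t / 2)))"
        by (intro mult_left_mono) auto
      thus ?thesis using True by (simp add: mult_ac)
    qed simp
  qed
qed auto

lemma nat_floor_eq_iff:
  fixes r x :: real
  assumes r: "0 < r"
  shows "real k / r \<le> x \<and> x < (real k + 1) / r \<longleftrightarrow> 0 \<le> x \<and> nat \<lfloor>r * x\<rfloor> = k"
proof -
  have "real k / r \<le> x \<and> x < (real k + 1) / r \<longleftrightarrow> \<lfloor>r * x\<rfloor> = int k" using r by (simp add: floor_eq_iff field_simps)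
  also have "\<dots> \<longleftrightarrow> 0 \<le> r * x \<and> nat \<lfloor>r * x\<rfloor> = k" by (metis nat_int of_nat_0_le_iff int_nat_eq zero_le_floor)
  finally show ?thesis using r by (simp add: zero_le_mult_iff)
qed

lemma distr_nat_floor:
  fixes r :: real
  assumes r: "0 < r"
  shows "distr (restrict_space lborel {0..}) (count_space UNIV) (\<lambda>t. nat \<lfloor>r * t\<rfloor>)
      = density (count_space UNIV) (\<lambda>_. ennreal (1 / r))"
proof (rule measure_eqI_countable[where A=UNIV])
  let ?M = "restrict_space lborel {0..}" and ?g = "\<lambda>t. nat \<lfloor>r * t\<rfloor>"
  have [measurable]: "?g \<in> measurable ?M (count_space UNIV)"
    by (intro measurable_restrict_space1) measurable
  fix k :: nat
  have "?g -` {k} \<inter> space ?M = {real k / r..<(real k + 1) / r}"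
    by (intro set_eqI) (simp add: space_restrict_space nat_floor_eq_iff[OF r] conj_commute)
  moreover have "emeasure ?M {real k / r..<(real k + 1) / r} = emeasure lborel {real k / r..<(real k + 1) / r}"
    by (rule emeasure_restrict_space) (use r in \<open>auto intro: order_trans[of 0 "real k / r"]\<close>)
  moreover have "emeasure lborel {real k / r..<(real k + 1) / r} = ennreal (1 / r)"
    using r by (subst emeasure_lborel_Ico) (auto simp: field_simps)
  ultimately show "emeasure (distr ?M (count_space UNIV) ?g) {k}
      = emeasure (density (count_space UNIV) (\<lambda>_. ennreal (1 / r))) {k}"
    by (subst emeasure_distr) (simp_all add: emeasure_density nn_integral_count_space_indicator[symmetric])
qed auto

lemma step_function_integral:
  fixes f :: "nat \<Rightarrow> 'a::{banach,second_countable_topology}"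
  assumes r: "0 < r" and f: "summable (\<lambda>k. norm (f k))"
  shows "(LINT t | lborel. indicat_real {0..} t *\<^sub>R f (nat \<lfloor>r * t\<rfloor>)) = (1 / r) *\<^sub>R (\<Sum>k. f k)"
proof -
  let ?g = "\<lambda>t::real. nat \<lfloor>r * t\<rfloor>" and ?M = "restrict_space lborel {0..}"
  have [measurable]: "?g \<in> measurable ?M (count_space UNIV)"
    by (intro measurable_restrict_space1) measurable
  have "(LINT t | lborel. indicat_real {0..} t *\<^sub>R f (?g t)) = (LINT t | ?M. f (?g t))"
    by (subst integral_restrict_space) auto
  also have "\<dots> = integral\<^sup>L (distr ?M (count_space UNIV) ?g) f" by (subst integral_distr) auto
  also have "\<dots> = (LINT k | count_space UNIV. (1 / r) *\<^sub>R f k)"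
    unfolding distr_nat_floor[OF r] using r by (subst integral_density) auto
  also have "\<dots> = (1 / r) *\<^sub>R (\<Sum>k. f k)"
    using f by (simp add: integral_count_space_nat integrable_count_space_nat_iff)
  finally show ?thesis .
qed

lemma pochhammer_fact_asymptotic:
  fixes a :: complex
  shows "(\<lambda>k. pochhammer a k / fact k * of_real (real k + 1) powr (1 - a)) \<longlonglongrightarrow> rGamma a"
proof -
  have "(\<lambda>k. pochhammer a k / fact k * exp ((1 - a) * of_real (ln (real k)))) \<longlonglongrightarrow> rGamma a"
    using gbinomial_asymptotic[of "- a"]
    by (simp add: gbinomial_pochhammer rGamma_inverse_Gamma mult.assoc[symmetric] power_mult_distrib[symmetric] divide_simps)
  moreover have "(\<lambda>k. exp ((1 - a) * of_real (ln (real k + 1) - ln (real k)))) \<longlonglongrightarrow> exp ((1 - a) * of_real 0)"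
    by (intro tendsto_intros) real_asymp
  ultimately have "(\<lambda>k. pochhammer a k / fact k * exp ((1 - a) * of_real (ln (real k)))
      * exp ((1 - a) * of_real (ln (real k + 1) - ln (real k)))) \<longlonglongrightarrow> rGamma a * exp ((1 - a) * of_real 0)"
    by (rule tendsto_mult)
  moreover have "of_real (real k + 1) powr (1 - a) = exp ((1 - a) * of_real (ln (real k + 1)))" for k
  proof -
    have "Ln (of_real (real k + 1)) = of_real (ln (real k + 1))" by (rule Ln_of_real) simp
    moreover have "(of_real (real k + 1) :: complex) \<noteq> 0" by (subst of_real_eq_0_iff) simp
    ultimately show ?thesis by (simp add: powr_def del: of_real_add)
  qed
  ultimately show ?thesis
    by (simp add: mult.assoc exp_add[symmetric] distrib_left[symmetric] del: of_real_add of_real_diff flip: of_real_add)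
qed

lemma nat_floor_bounds:
  fixes m :: nat and t :: real
  assumes "0 < m" "0 < t"
  defines "k \<equiv> nat \<lfloor>real m * t\<rfloor>"
  shows "real k / real m \<le> t" "t \<le> (real k + 1) / real m"
proof -
  have k: "real k = of_int \<lfloor>real m * t\<rfloor>" using assms by (simp add: k_def)
  have "real k \<le> real m * t" "real m * t \<le> real k + 1" unfolding k by linarith+
  thus "real k / real m \<le> t" "t \<le> (real k + 1) / real m" using assms by (auto simp: field_simps)
qed

lemma nat_floor_tendsto:
  fixes t :: real
  assumes "0 < t"
  shows "(\<lambda>m. real (nat \<lfloor>real m * t\<rfloor>) / real m) \<longlonglongrightarrow> t"
proof (rule tendsto_sandwich)
  show "\<forall>\<^sub>F m in sequentially. t - 1 / real m \<le> real (nat \<lfloor>real m * t\<rfloor>) / real m"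
    using eventually_gt_at_top[of 0]
    by eventually_elim (use nat_floor_bounds[OF _ assms] in \<open>force simp: add_divide_distrib algebra_simps\<close>)
  show "\<forall>\<^sub>F m in sequentially. real (nat \<lfloor>real m * t\<rfloor>) / real m \<le> t"
    using eventually_gt_at_top[of 0] by eventually_elim (use nat_floor_bounds[OF _ assms] in blast)
  show "(\<lambda>m. t - 1 / real m) \<longlonglongrightarrow> t" by real_asymp
qed auto

lemma geometric_power_tendsto:
  fixes t :: real
  assumes "0 < t"
  shows "(\<lambda>m. (1 - 1 / real m) ^ nat \<lfloor>real m * t\<rfloor>) \<longlonglongrightarrow> exp (- t)"
proof -
  let ?a = "\<lambda>m. exp ((real m * ln (1 - 1 / real m)) * (real (nat \<lfloor>real m * t\<rfloor>) / real m))"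
  have "(\<lambda>m. ?a m) \<longlonglongrightarrow> exp ((-1) * t)"
    by (intro tendsto_intros nat_floor_tendsto assms) real_asymp
  moreover have "\<forall>\<^sub>F m in sequentially. ?a m = (1 - 1 / real m) ^ nat \<lfloor>real m * t\<rfloor>"
    using eventually_gt_at_top[of 1]
  proof eventually_elim
    case (elim m)
    have "(1 - 1 / real m) ^ nat \<lfloor>real m * t\<rfloor> = exp (real (nat \<lfloor>real m * t\<rfloor>) * ln (1 - 1 / real m))"
      using elim by (subst exp_of_nat_mult) simp
    thus ?case using elim by simp
  qed
  ultimately show ?thesis using Lim_transform_eventually by fastforce
qed

lemma geometric_power_le:
  assumes "0 < m"
  shows "(1 - 1 / real m) ^ k \<le> exp (- (real k / real m))"
proof -
  have "(1 - 1 / real m) ^ k \<le> exp (- (1 / real m)) ^ k"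
    using assms exp_ge_add_one_self[of "- (1 / real m)"] by (intro power_mono) auto
  also have "\<dots> = exp (- (real k / real m))" by (simp add: exp_of_nat_mult[symmetric])
  finally show ?thesis .
qed

definition nb_weight :: "'a::real_normed_field \<Rightarrow> nat \<Rightarrow> nat \<Rightarrow> 'a" where
  "nb_weight a m k = pochhammer a k / fact k * of_real (1 - 1 / real m) ^ k"

definition gamma_kernel :: "complex \<Rightarrow> real \<Rightarrow> complex" where
  "gamma_kernel a t = indicat_real {0<..} t *\<^sub>R (of_real t powr (a - 1) * of_real (exp (- t)))"

lemma gamma_kernel_measurable [measurable]: "gamma_kernel a \<in> borel_measurable borel"
  unfolding gamma_kernel_def[abs_def] powr_def by measurable

lemma norm_gamma_kernel: "norm (gamma_kernel a t) = indicat_real {0<..} t * (t powr (Re a - 1) * exp (- t))"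
  by (auto simp: gamma_kernel_def norm_mult norm_powr_real_powr indicator_def)

definition scaled_nb_weight :: "complex \<Rightarrow> nat \<Rightarrow> real \<Rightarrow> complex" where
  "scaled_nb_weight a m t = indicat_real {0<..} t *\<^sub>R (of_real (real m) powr (1 - a) * nb_weight a m (nat \<lfloor>real m * t\<rfloor>))"

lemma nb_weight_summable:
  fixes h :: "nat \<Rightarrow> complex"
  assumes m: "0 < m" and h: "\<And>k. norm (h k) \<le> C * (1 + real k / real m) ^ M"
  shows "summable (\<lambda>k. norm (nb_weight a m k * h k))"
proof -
  have C: "0 \<le> C" using order_trans[OF norm_ge_zero h[of 0]] by simp
  have "norm (h k) \<le> C * (1 + real k) ^ M" for k
    using m C divide_left_mono[of 1 "real m" "real k"]
    by (intro order_trans[OF h] mult_left_mono power_mono) auto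
  hence "poly_bounded h" unfolding poly_bounded_def by blast
  from poly_bounded_summable[OF poly_bounded_mult[OF poly_bounded_pochhammer_fact this],
      of "1 - 1 / real m" a]
  show ?thesis
    using m by (simp add: nb_weight_def norm_mult norm_divide norm_power mult_ac del: of_real_diff)
qed

lemma scaled_nb_weight_tendsto:
  assumes "t \<noteq> 0"
  shows "(\<lambda>m. scaled_nb_weight a m t) \<longlonglongrightarrow> rGamma a * gamma_kernel a t"
proof (cases "0 < t")
  case True
  let ?k = "\<lambda>m. nat \<lfloor>real m * t\<rfloor>" and ?x = "\<lambda>m. (real (nat \<lfloor>real m * t\<rfloor>) + 1) / real m"
  have kernel: "gamma_kernel a t = of_real t powr (a - 1) * of_real (exp (- t))"
    using True by (simp add: gamma_kernel_def)
  have "filterlim ?k at_top sequentially" using True by real_asymp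
  hence "(\<lambda>m. pochhammer a (?k m) / fact (?k m) * of_real (real (?k m) + 1) powr (1 - a)) \<longlonglongrightarrow> rGamma a"
    by (rule filterlim_compose[OF pochhammer_fact_asymptotic])
  moreover have "(\<lambda>m. of_real (?x m) powr (a - 1)) \<longlonglongrightarrow> (of_real t powr (a - 1) :: complex)"
  proof -
    have "?x \<longlonglongrightarrow> t + 0"
      unfolding add_divide_distrib by (intro tendsto_add nat_floor_tendsto True) real_asymp
    thus ?thesis
      using True by (intro tendsto_powr_complex tendsto_intros) (auto simp: complex_nonpos_Reals_iff)
  qed
  moreover have "(\<lambda>m. of_real ((1 - 1 / real m) ^ ?k m)) \<longlonglongrightarrow> (of_real (exp (- t)) :: complex)"
    by (intro tendsto_of_real geometric_power_tendsto True)
  ultimately have "(\<lambda>m. (pochhammer a (?k m) / fact (?k m) * of_real (real (?k m) + 1) powr (1 - a))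
      * (of_real (?x m) powr (a - 1) * of_real ((1 - 1 / real m) ^ ?k m))) \<longlonglongrightarrow> rGamma a * gamma_kernel a t"
    unfolding kernel by (intro tendsto_mult)
  moreover have "\<forall>\<^sub>F m in sequentially.
      (pochhammer a (?k m) / fact (?k m) * of_real (real (?k m) + 1) powr (1 - a))
      * (of_real (?x m) powr (a - 1) * of_real ((1 - 1 / real m) ^ ?k m)) = scaled_nb_weight a m t"
    using eventually_gt_at_top[of 0]
  proof eventually_elim
    case (elim m)
    have powr: "of_real y powr b = exp (b * of_real (ln y))" if "0 < y" for y :: real and b :: complex
      using that by (simp add: powr_def Ln_of_real)
    have "of_real x powr (1 - a) * of_real (x / y) powr (a - 1) = (of_real y powr (1 - a) :: complex)"
      if "0 < x" "0 < y" for x y :: real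
      using that by (simp add: powr ln_div exp_add[symmetric] del: of_real_divide) (simp add: algebra_simps)
    from this[of "real (?k m) + 1" "real m"]
    have "of_real (real (?k m) + 1) powr (1 - a) * of_real (?x m) powr (a - 1)
        = (of_real (real m) powr (1 - a) :: complex)"
      using elim by (simp del: of_real_add of_real_divide of_real_of_nat_eq of_nat_nat)
    thus ?case
      unfolding scaled_nb_weight_def nb_weight_def using True
      by (simp add: of_real_power mult_ac del: of_real_add of_real_divide of_real_of_nat_eq of_real_diff)
  qed
  ultimately show ?thesis by (rule Lim_transform_eventually)
qed (use assms in \<open>simp add: scaled_nb_weight_def gamma_kernel_def\<close>)

lemma powr_le_powr_add_power:
  fixes t y s :: real
  assumes "0 < t" "t \<le> y" "y \<le> 1 + t" "s \<le> real N"
  shows "y powr s \<le> t powr s + (1 + t) ^ N"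
proof (cases "s \<le> 0")
  case True
  hence "y powr s \<le> t powr s" using assms by (intro powr_mono2') auto
  moreover have "0 \<le> (1 + t) ^ N" using assms by simp
  ultimately show ?thesis by linarith
next
  case False
  hence "y powr s \<le> (1 + t) powr s" using assms by (intro powr_mono2) auto
  also have "\<dots> \<le> (1 + t) powr real N" using assms by (intro powr_mono) auto
  also have "\<dots> = (1 + t) ^ N" using assms by (simp add: powr_realpow)
  finally show ?thesis using powr_ge_zero[of t s] by linarith
qed

lemma scaled_nb_weight_bound:
  obtains B N where "0 \<le> B" "\<And>m t. 0 < m \<Longrightarrow>
    norm (scaled_nb_weight a m t) \<le> B * (indicat_real {0<..} t * ((t powr (Re a - 1) + (1 + t) ^ N) * exp (- t)))"
proof -
  obtain C where C: "0 < C" "\<And>k. norm (pochhammer a k / fact k * of_real (real k + 1) powr (1 - a)) \<le> C"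
    using convergent_imp_Bseq[OF convergentI[OF pochhammer_fact_asymptotic[of a]]] by (auto simp: Bseq_def)
  have weight: "norm (pochhammer a k / fact k) \<le> C * (real k + 1) powr (Re a - 1)" for k
  proof -
    have "norm (of_real (real k + 1) powr (1 - a) :: complex) = (real k + 1) powr (1 - Re a)"
      by (subst norm_powr_real_powr) auto
    hence "norm (pochhammer a k / fact k) \<le> C / (real k + 1) powr (1 - Re a)"
      using C(2)[of k] unfolding norm_mult by (simp add: field_simps add_pos_nonneg)
    thus ?thesis by (simp add: powr_diff field_simps)
  qed
  obtain N :: nat where N: "Re a - 1 \<le> real N" using real_arch_simple by blast
  have "norm (scaled_nb_weight a m t) \<le> C * exp 1 * ((t powr (Re a - 1) + (1 + t) ^ N) * exp (- t))"
    if m: "0 < m" and t: "0 < t" for m t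
  proof -
    define k where "k = nat \<lfloor>real m * t\<rfloor>"
    define y where "y = (real k + 1) / real m"
    have k: "real k / real m \<le> t" "t \<le> y" unfolding k_def y_def by (rule nat_floor_bounds[OF m t])+
    have y: "y = real k / real m + 1 / real m" "1 / real m \<le> 1" using m by (simp_all add: y_def add_divide_distrib)
    have "norm (of_real (real m) powr (1 - a) :: complex) = real m powr (1 - Re a)"
      using m by (subst norm_powr_real_powr) auto
    hence "norm (scaled_nb_weight a m t)
        = real m powr (1 - Re a) * norm (pochhammer a k / fact k) * (1 - 1 / real m) ^ k"
      unfolding scaled_nb_weight_def nb_weight_def k_def[symmetric] norm_mult norm_power norm_of_real norm_scaleR
      using t m by (simp add: norm_divide del: of_real_of_nat_eq)
    also have "\<dots> \<le> (C * (t powr (Re a - 1) + (1 + t) ^ N)) * (exp 1 * exp (- t))"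
    proof (rule mult_mono)
      have "real m powr (1 - Re a) * norm (pochhammer a k / fact k)
          \<le> real m powr (1 - Re a) * (C * (real k + 1) powr (Re a - 1))"
        by (intro mult_left_mono weight) auto
      also have "\<dots> = C * y powr (Re a - 1)"
        unfolding y_def using m by (simp add: powr_divide powr_diff field_simps)
      also have "\<dots> \<le> C * (t powr (Re a - 1) + (1 + t) ^ N)"
        using k y C(1) t N by (intro mult_left_mono powr_le_powr_add_power) linarith+
      finally show "real m powr (1 - Re a) * norm (pochhammer a k / fact k) \<le> \<dots>" .
      have "(1 - 1 / real m) ^ k \<le> exp (- (real k / real m))" by (rule geometric_power_le[OF m])
      also have "\<dots> \<le> exp (1 - t)" using k(2) y unfolding exp_le_cancel_iff by linarith
      finally show "(1 - 1 / real m) ^ k \<le> exp 1 * exp (- t)" by (simp add: exp_diff exp_minus field_simps)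
    qed (use t C(1) m in auto)
    finally show ?thesis by (simp add: mult_ac)
  qed
  thus ?thesis
    using C(1) by (intro that[of "C * exp 1" N]) (auto simp: indicator_def scaled_nb_weight_def)
qed

lemma scaled_nb_weight_dominated:
  assumes a: "0 < Re a" and C: "0 \<le> C"
  obtains w where "integrable lborel w"
    "\<And>m t h. 0 < m \<Longrightarrow> norm h \<le> C * (1 + real (nat \<lfloor>real m * t\<rfloor>) / real m) ^ M \<Longrightarrow> norm (scaled_nb_weight a m t * h) \<le> w t"
proof -
  obtain B N where B: "0 \<le> B" "\<And>m t. 0 < m \<Longrightarrow> norm (scaled_nb_weight a m t)
      \<le> B * (indicat_real {0<..} t * ((t powr (Re a - 1) + (1 + t) ^ N) * exp (- t)))"
    using scaled_nb_weight_bound[of a] by metis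
  define w where "w t = B * C * (indicat_real {0<..} t * (t powr (Re a - 1) * (1 + t) ^ M * exp (- t))
      + indicat_real {0<..} t * (t powr (1 - 1) * (1 + t) ^ (N + M) * exp (- t)))" for t
  show ?thesis
  proof (rule that)
    show "integrable lborel w"
      unfolding w_def using a
      by (intro integrable_mult_right Bochner_Integration.integrable_add gamma_weight_integrable) auto
    fix m t and h :: complex
    assume m: "0 < m" and h: "norm h \<le> C * (1 + real (nat \<lfloor>real m * t\<rfloor>) / real m) ^ M"
    show "norm (scaled_nb_weight a m t * h) \<le> w t"
    proof (cases "0 < t")
      case True
      have "norm (scaled_nb_weight a m t) \<le> B * ((t powr (Re a - 1) + (1 + t) ^ N) * exp (- t))"
        using B(2)[OF m, of t] True by simp
      moreover have "norm h \<le> C * (1 + t) ^ M"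
        using True C nat_floor_bounds(1)[OF m True]
        by (intro order_trans[OF h] mult_left_mono power_mono) auto
      ultimately have "norm (scaled_nb_weight a m t * h) \<le> B * ((t powr (Re a - 1) + (1 + t) ^ N) * exp (- t)) * (C * (1 + t) ^ M)"
        unfolding norm_mult using B(1) True by (intro mult_mono) auto
      also have "\<dots> = w t" using True by (simp add: w_def algebra_simps power_add)
      finally show ?thesis .
    qed (simp add: scaled_nb_weight_def w_def)
  qed
qed

lemma scaled_nb_weight_integral:
  assumes m: "0 < m" and g: "\<And>k. norm (g k) \<le> C * (1 + real k / real m) ^ M"
  shows "(LINT t | lborel. scaled_nb_weight a m t * g (nat \<lfloor>real m * t\<rfloor>)) = of_real (real m) powr (- a) * (\<Sum>k. nb_weight a m k * g k)"
proof -
  let ?g = "\<lambda>k. nb_weight a m k * g k"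
  have "(LINT t | lborel. scaled_nb_weight a m t * g (nat \<lfloor>real m * t\<rfloor>))
      = (LINT t | lborel. of_real (real m) powr (1 - a) * (indicat_real {0..} t *\<^sub>R ?g (nat \<lfloor>real m * t\<rfloor>)))"
    by (rule integral_cong_AE) (use AE_lborel_singleton[of 0] in
      \<open>auto simp: scaled_nb_weight_def indicator_def elim!: eventually_mono\<close>)
  also have "\<dots> = of_real (real m) powr (1 - a) / of_real (real m) * (\<Sum>k. ?g k)"
    using step_function_integral[OF _ nb_weight_summable[OF m g], of "real m" a] m
    by (simp add: scaleR_conv_of_real)
  also have "of_real (real m) powr (1 - a) / of_real (real m) = (of_real (real m) powr (- a) :: complex)"
    using m by (simp add: powr_diff powr_minus field_simps)
  finally show ?thesis .
qed

lemma negative_binomial_limit: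
  fixes a :: complex and h :: "nat \<Rightarrow> nat \<Rightarrow> complex" and H :: "real \<Rightarrow> complex"
  assumes a: "0 < Re a"
    and conv: "\<And>t. 0 < t \<Longrightarrow> (\<lambda>m. h m (nat \<lfloor>real m * t\<rfloor>)) \<longlonglongrightarrow> H t"
    and bound: "\<And>m k. ms \<le> m \<Longrightarrow> norm (h m k) \<le> C * (1 + real k / real m) ^ M"
    and H [measurable]: "H \<in> borel_measurable borel"
  shows "(\<lambda>m. of_real (real m) powr (- a) * (\<Sum>k. nb_weight a m k * h m k))
      \<longlonglongrightarrow> rGamma a * (LINT t | lborel. gamma_kernel a t * H t)"
    and "integrable lborel (\<lambda>t. gamma_kernel a t * H t)"
proof -
  define f where "f m t = scaled_nb_weight a m t * h m (nat \<lfloor>real m * t\<rfloor>)" for m t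
  have "0 \<le> C" using order_trans[OF norm_ge_zero bound[of ms 0]] by simp
  from scaled_nb_weight_dominated[OF a this, of M] obtain w where w: "integrable lborel w"
    and f: "\<And>m t h. 0 < m \<Longrightarrow> norm h \<le> C * (1 + real (nat \<lfloor>real m * t\<rfloor>) / real m) ^ M \<Longrightarrow> norm (scaled_nb_weight a m t * h) \<le> w t"
    by blast
  have dom: "AE t in lborel. norm (f (m + Suc ms) t) \<le> w t" for m
    unfolding f_def by (intro AE_I2 f bound) simp_all
  have [measurable]: "f m \<in> borel_measurable lborel" for m
    unfolding f_def[abs_def] scaled_nb_weight_def by measurable
  have lim: "AE t in lborel. (\<lambda>m. f (m + Suc ms) t) \<longlonglongrightarrow> rGamma a * gamma_kernel a t * H t"
    using AE_lborel_singleton[of 0]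
  proof eventually_elim
    case (elim t)
    have "(\<lambda>m. f m t) \<longlonglongrightarrow> rGamma a * gamma_kernel a t * H t"
    proof (cases "0 < t")
      case True
      thus ?thesis unfolding f_def by (intro tendsto_mult scaled_nb_weight_tendsto conv elim)
    qed (simp add: f_def scaled_nb_weight_def gamma_kernel_def)
    thus ?case by (rule LIMSEQ_ignore_initial_segment)
  qed
  have "integrable lborel (\<lambda>t. inverse (rGamma a) * (rGamma a * gamma_kernel a t * H t))"
    by (intro integrable_mult_right integrable_dominated_convergence[OF _ _ w lim dom]) measurable
  moreover have "rGamma a \<noteq> 0" using a by (auto simp: rGamma_eq_zero_iff elim!: nonpos_Ints_cases)
  hence "inverse (rGamma a) * (rGamma a * gamma_kernel a t * H t) = gamma_kernel a t * H t" for t by simp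
  ultimately show "integrable lborel (\<lambda>t. gamma_kernel a t * H t)" by simp
  have "(\<lambda>m. LINT t | lborel. f (m + Suc ms) t) \<longlonglongrightarrow> (LINT t | lborel. rGamma a * gamma_kernel a t * H t)"
    by (rule integral_dominated_convergence[OF _ _ w lim dom]) measurable
  moreover have "(LINT t | lborel. f m t) = of_real (real m) powr (- a) * (\<Sum>k. nb_weight a m k * h m k)" if "Suc ms \<le> m" for m
    unfolding f_def by (rule scaled_nb_weight_integral[OF _ bound]) (use that in auto)
  ultimately show "(\<lambda>m. of_real (real m) powr (- a) * (\<Sum>k. nb_weight a m k * h m k))
      \<longlonglongrightarrow> rGamma a * (LINT t | lborel. gamma_kernel a t * H t)"
    by - (rule LIMSEQ_offset[where k="Suc ms"], simp add: mult.assoc)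
qed

lemma gamma_kernel_integral:
  assumes a: "0 < Re a"
  shows "rGamma a * (LINT t | lborel. gamma_kernel a t) = 1"
proof -
  have "(\<lambda>m. of_real (real m) powr (- a) * (\<Sum>k. nb_weight a m k * 1)) \<longlonglongrightarrow> rGamma a * (LINT t | lborel. gamma_kernel a t * 1)"
    by (rule negative_binomial_limit(1)[OF a, where ms=0 and C=1 and M=0]) auto
  moreover have "\<forall>\<^sub>F m in sequentially. of_real (real m) powr (- a) * (\<Sum>k. nb_weight a m k * 1) = 1"
    using eventually_gt_at_top[of 0]
  proof eventually_elim
    case (elim m)
    have "(\<Sum>k. nb_weight a m k * 1) = of_real (1 / real m) powr (- a)"
      using sums_unique[OF binomial_series[of "1 - 1 / real m" a]] elim by (simp add: nb_weight_def)
    moreover have "of_real (real m) powr (- a) * of_real (1 / real m) powr (- a)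
        = (of_real (real m) * of_real (1 / real m)) powr (- a :: complex)"
      by (rule powr_times_real[symmetric]) (use elim in auto)
    ultimately show ?case using elim by simp
  qed
  ultimately have "(\<lambda>m. 1) \<longlonglongrightarrow> rGamma a * (LINT t | lborel. gamma_kernel a t)"
    by (simp add: Lim_transform_eventually)
  thus ?thesis by (simp add: LIMSEQ_const_iff)
qed

lemma gamma_kernel_of_real:
  assumes "0 < t"
  shows "rGamma (of_real t) * gamma_kernel (of_real t) s
      = of_real (indicator {0<..} s * s powr (t - 1) * exp (- s) / Gamma t)"
proof (cases "0 < s")
  case True
  hence "complex_of_real s powr (of_real t - 1) = of_real (s powr (t - 1))"
    using powr_of_real[of s "t - 1"] by simp
  thus ?thesis using True
    by (simp add: gamma_kernel_def rGamma_inverse_Gamma Gamma_complex_of_real field_simps)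
qed (simp add: gamma_kernel_def)

lemma of_real_nb_weight: "of_real (nb_weight t m k) = (nb_weight (of_real t) m k :: complex)"
  by (simp add: nb_weight_def pochhammer_of_real)

lemma gamma_meas_integral:
  fixes H :: "real \<Rightarrow> real"
  assumes t: "0 < t" and H [measurable]: "H \<in> borel_measurable borel"
  shows "of_real (\<integral>s. H s \<partial>gamma_meas t)
      = rGamma (of_real t) * (LINT s | lborel. gamma_kernel (of_real t) s * of_real (H s))"
    and "integrable lborel (\<lambda>s. gamma_kernel (of_real t) s * of_real (H s)) \<Longrightarrow> integrable (gamma_meas t) H"
proof -
  let ?d = "\<lambda>s. indicator {0<..} s * s powr (t - 1) * exp (- s) / Gamma t"
  have d: "AE s in lborel. 0 \<le> ?d s"
    using t by (auto simp: indicator_def Gamma_real_pos less_imp_le)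
  have kernel: "rGamma (of_real t) * (gamma_kernel (of_real t) s * of_real (H s)) = of_real (?d s * H s)" for s
    unfolding mult.assoc[symmetric] gamma_kernel_of_real[OF t] by simp
  have "(\<integral>s. H s \<partial>gamma_meas t) = (LINT s | lborel. ?d s * H s)"
    unfolding gamma_meas_def using d by (subst integral_density) auto
  thus "of_real (\<integral>s. H s \<partial>gamma_meas t)
      = rGamma (of_real t) * (LINT s | lborel. gamma_kernel (of_real t) s * of_real (H s))"
    unfolding integral_mult_right_zero[symmetric] kernel integral_complex_of_real by simp
  assume "integrable lborel (\<lambda>s. gamma_kernel (of_real t) s * of_real (H s))"
  hence "integrable lborel (\<lambda>s. rGamma (of_real t) * (gamma_kernel (of_real t) s * of_real (H s)))"
    by (rule integrable_mult_right)
  hence "integrable lborel (\<lambda>s. ?d s * H s)" unfolding kernel using integrable_Re by fastforce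
  thus "integrable (gamma_meas t) H"
    unfolding gamma_meas_def using d by (subst integrable_density) auto
qed

lemma negative_binomial_limit_real:
  fixes t :: real and h :: "nat \<Rightarrow> nat \<Rightarrow> real"
  assumes t: "0 < t"
    and conv: "\<And>s. 0 < s \<Longrightarrow> (\<lambda>m. h m (nat \<lfloor>real m * s\<rfloor>)) \<longlonglongrightarrow> H s"
    and bound: "\<And>m k. ms \<le> m \<Longrightarrow> \<bar>h m k\<bar> \<le> C * (1 + real k / real m) ^ M"
    and H [measurable]: "H \<in> borel_measurable borel"
  shows "(\<lambda>m. real m powr (- t) * (\<Sum>k. nb_weight t m k * h m k)) \<longlonglongrightarrow> (\<integral>s. H s \<partial>gamma_meas t)"
    and "integrable (gamma_meas t) H"
    and "\<And>m. ms \<le> m \<Longrightarrow> 0 < m \<Longrightarrow> summable (\<lambda>k. \<bar>nb_weight t m k * h m k\<bar>)"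
proof -
  have cH: "(\<lambda>s. complex_of_real (H s)) \<in> borel_measurable borel" by measurable
  have cconv: "(\<lambda>m. complex_of_real (h m (nat \<lfloor>real m * s\<rfloor>))) \<longlonglongrightarrow> of_real (H s)" if "0 < s" for s
    by (intro tendsto_of_real conv that)
  have cbound: "norm (complex_of_real (h m k)) \<le> C * (1 + real k / real m) ^ M" if "ms \<le> m" for m k
    using bound[OF that] by simp
  have "0 < Re (complex_of_real t)" using t by simp
  note limit = negative_binomial_limit[OF this cconv cbound cH]
  show "integrable (gamma_meas t) H" by (rule gamma_meas_integral(2)[OF t H limit(2)])
  show summable: "summable (\<lambda>k. \<bar>nb_weight t m k * h m k\<bar>)" if "ms \<le> m" "0 < m" for m
    using nb_weight_summable[OF that(2) cbound[OF that(1)], of "of_real t"]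
    unfolding of_real_nb_weight[symmetric] of_real_mult[symmetric] norm_of_real .
  have "\<forall>\<^sub>F m in sequentially. of_real (real m) powr (- of_real t) * (\<Sum>k. nb_weight (of_real t) m k * complex_of_real (h m k))
      = complex_of_real (real m powr (- t) * (\<Sum>k. nb_weight t m k * h m k))"
    using eventually_ge_at_top[of "max 1 ms"]
  proof eventually_elim
    case (elim m)
    have "complex_of_real (real m) powr (- of_real t) = of_real (real m powr (- t))"
      using powr_of_real[of "real m" "- t"] by simp
    moreover have "(\<Sum>k. nb_weight (of_real t) m k * complex_of_real (h m k)) = of_real (\<Sum>k. nb_weight t m k * h m k)"
      unfolding of_real_nb_weight[symmetric] of_real_mult[symmetric]
      by (rule suminf_of_real[symmetric], rule summable_rabs_cancel, rule summable) (use elim in auto)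
    ultimately show ?case by simp
  qed
  with limit(1) have "(\<lambda>m. complex_of_real (real m powr (- t) * (\<Sum>k. nb_weight t m k * h m k)))
      \<longlonglongrightarrow> of_real (\<integral>s. H s \<partial>gamma_meas t)"
    unfolding gamma_meas_integral(1)[OF t H] by (rule Lim_transform_eventually)
  thus "(\<lambda>m. real m powr (- t) * (\<Sum>k. nb_weight t m k * h m k)) \<longlonglongrightarrow> (\<integral>s. H s \<partial>gamma_meas t)"
    unfolding tendsto_of_real_iff .
qed

lemma Ln_add_of_nat_telescope:
  assumes c: "0 < Re c"
  shows "(\<Sum>j<k. Ln (1 + 1 / (c + of_nat j))) = Ln (c + of_nat k) - Ln c"
proof (induction k)
  case (Suc k)
  have pos: "0 < Re (c + of_nat k)" "0 < Re (c + of_nat (Suc k))" using c by auto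
  have nz: "c + of_nat k \<noteq> 0" "c + of_nat (Suc k) \<noteq> 0" using of_nat_add_nonzero[OF c] by blast+
  have "Ln (1 + 1 / (c + of_nat k)) = Ln (c + of_nat (Suc k)) - Ln (c + of_nat k)"
  proof (rule Ln_unique)
    let ?L = "Ln (c + of_nat (Suc k)) - Ln (c + of_nat k)"
    show "exp ?L = 1 + 1 / (c + of_nat k)" using nz by (simp add: exp_diff field_simps)
    show "- pi < Im ?L" "Im ?L \<le> pi"
      using Re_Ln_pos_lt_imp[OF pos(1)] Re_Ln_pos_lt_imp[OF pos(2)] by (auto simp del: of_nat_Suc)
  qed
  thus ?case using Suc by simp
qed simp

lemma Ln_linear_bound:
  fixes z :: complex
  assumes "norm z \<le> e" "e \<le> 1 / 2"
  shows "norm (Ln (1 + z) - z) \<le> 2 * e\<^sup>2" "1 + z \<noteq> 0"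
proof -
  have z: "norm z \<le> 1 / 2" using assms by linarith
  have "norm (Ln (1 + z) - z) \<le> norm z^2 / (1 - norm z)" using z by (intro Ln_approx_linear) auto
  also have "\<dots> \<le> e\<^sup>2 / (1 / 2)"
  proof (rule frac_le)
    show "(norm z)\<^sup>2 \<le> e\<^sup>2" by (intro power_mono assms) auto
  qed (use z in auto)
  finally show "norm (Ln (1 + z) - z) \<le> 2 * e\<^sup>2" by simp
  show "1 + z \<noteq> 0"
  proof
    assume "1 + z = 0" hence "z = - 1" by (metis add.commute eq_neg_iff_add_eq_0)
    thus False using z by simp
  qed
qed

text \<open>$(w - b)/w = ((w + 1)/w)^{-b}$ up to an error of order $|w|^{-2}$ in the logarithm.\<close>

definition ratio_log_error :: "complex \<Rightarrow> complex \<Rightarrow> complex" where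
  "ratio_log_error b w = Ln (1 + (- b / w)) + b * Ln (1 + 1 / w)"

lemma norm_ratio_log_error:
  assumes B: "1 \<le> B" "norm b \<le> B" and w: "2 * B \<le> norm w"
  shows "norm (ratio_log_error b w) \<le> 2 * B\<^sup>2 * (1 + B) / (norm w)\<^sup>2" "1 + (- b / w) \<noteq> 0"
proof -
  have "0 < norm w" using B w by linarith
  define e where "e = B / norm w"
  have e: "e \<le> 1 / 2" using w \<open>0 < norm w\<close> by (simp add: e_def field_simps)
  have b: "norm (- b / w) \<le> e" "norm (1 / w) \<le> e"
    using B \<open>0 < norm w\<close> by (auto simp: e_def norm_divide divide_right_mono)
  show "1 + (- b / w) \<noteq> 0" by (rule Ln_linear_bound(2)[OF b(1) e])
  have "ratio_log_error b w = (Ln (1 + (- b / w)) - (- b / w)) + b * (Ln (1 + 1 / w) - 1 / w)"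
    by (simp add: ratio_log_error_def algebra_simps)
  also have "norm \<dots> \<le> norm (Ln (1 + (- b / w)) - (- b / w)) + norm b * norm (Ln (1 + 1 / w) - 1 / w)"
    by (rule order_trans[OF norm_triangle_ineq]) (simp add: norm_mult)
  also have "\<dots> \<le> 2 * e\<^sup>2 + B * (2 * e\<^sup>2)"
    using B by (intro add_mono mult_mono Ln_linear_bound(1)[OF b(1) e] Ln_linear_bound(1)[OF b(2) e]) auto
  also have "\<dots> = 2 * B\<^sup>2 * (1 + B) / (norm w)\<^sup>2"
    by (simp add: e_def power_divide add_divide_distrib distrib_left)
  finally show "norm (ratio_log_error b w) \<le> 2 * B\<^sup>2 * (1 + B) / (norm w)\<^sup>2" .
qed

lemma pochhammer_ratio_exp:
  assumes c: "0 < Re c" and nz: "\<And>j. j < k \<Longrightarrow> 1 + (- b / (c + of_nat j)) \<noteq> 0"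
  shows "pochhammer (c - b) k / pochhammer c k
      = exp ((\<Sum>j<k. ratio_log_error b (c + of_nat j)) - b * (Ln (c + of_nat k) - Ln c))"
proof -
  have "pochhammer (c - b) k / pochhammer c k = exp (\<Sum>j<k. Ln (1 + (- b / (c + of_nat j))))"
    using nz
  proof (induction k)
    case (Suc k)
    have "pochhammer (c - b) (Suc k) / pochhammer c (Suc k)
        = pochhammer (c - b) k / pochhammer c k * (1 + (- b / (c + of_nat k)))"
      unfolding pochhammer_Suc using of_nat_add_nonzero[OF c, of k] by (simp add: field_simps)
    also have "1 + (- b / (c + of_nat k)) = exp (Ln (1 + (- b / (c + of_nat k))))"
      by (rule exp_Ln[symmetric, OF Suc.prems]) simp
    also have "pochhammer (c - b) k / pochhammer c k = exp (\<Sum>j<k. Ln (1 + (- b / (c + of_nat j))))"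
      using Suc by simp
    finally show ?case by (simp add: exp_add)
  qed simp
  thus ?thesis
    unfolding ratio_log_error_def sum.distrib sum_distrib_left[symmetric] Ln_add_of_nat_telescope[OF c] by simp
qed

lemma norm_sum_ratio_log_error:
  assumes B: "1 \<le> B" "norm b \<le> B" and D: "2 * B \<le> D" "\<And>j. D \<le> norm (c + of_nat j)"
  shows "norm (\<Sum>j<k. ratio_log_error b (c + of_nat j)) \<le> real k * (2 * B\<^sup>2 * (1 + B) / D\<^sup>2)"
proof -
  have "norm (\<Sum>j<k. ratio_log_error b (c + of_nat j)) \<le> (\<Sum>j<k. 2 * B\<^sup>2 * (1 + B) / D\<^sup>2)"
  proof (rule sum_norm_le)
    fix j
    have "norm (ratio_log_error b (c + of_nat j)) \<le> 2 * B\<^sup>2 * (1 + B) / (norm (c + of_nat j))\<^sup>2"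
      using D(1) D(2)[of j] by (intro norm_ratio_log_error B) linarith
    also have "\<dots> \<le> 2 * B\<^sup>2 * (1 + B) / D\<^sup>2"
      using B D(1) order_less_le_trans[OF _ D(2)[of j], of 0]
      by (intro divide_left_mono power_mono D(2) mult_pos_pos zero_less_power) auto
    finally show "norm (ratio_log_error b (c + of_nat j)) \<le> 2 * B\<^sup>2 * (1 + B) / D\<^sup>2" .
  qed
  thus ?thesis by simp
qed

lemma pochhammer_ratio_tendsto:
  fixes xs :: "nat \<Rightarrow> complex"
  assumes x: "0 < Re x" and xs: "xs \<longlonglongrightarrow> x" and t: "0 < t"
  shows "(\<lambda>m. pochhammer (of_nat m * xs m - b) (nat \<lfloor>real m * t\<rfloor>) / pochhammer (of_nat m * xs m) (nat \<lfloor>real m * t\<rfloor>))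
      \<longlonglongrightarrow> exp (- b * (Ln (x + of_real t) - Ln x))"
proof -
  define k where "k m = nat \<lfloor>real m * t\<rfloor>" for m
  define d where "d = Re x / 2"
  define B where "B = max 1 (norm b)"
  define E where "E m = (\<Sum>j<k m. ratio_log_error b (of_nat m * xs m + of_nat j))" for m
  have d: "0 < d" and B: "1 \<le> B" "norm b \<le> B" using x by (auto simp: d_def B_def)
  have "\<forall>\<^sub>F m in sequentially. d < Re (xs m)"
    using order_tendstoD(1)[OF tendsto_Re[OF xs], of d] x by (simp add: d_def)
  moreover have "\<forall>\<^sub>F m in sequentially. 2 * B / d < real m"
    using filterlim_real_sequentially unfolding filterlim_at_top_dense by blast
  ultimately have main: "\<forall>\<^sub>F m in sequentially. norm (E m) \<le> 2 * B\<^sup>2 * (1 + B) / d\<^sup>2 * t * (1 / real m)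
      \<and> exp (E m - b * (Ln (xs m + of_real (real (k m) / real m)) - Ln (xs m)))
      = pochhammer (of_nat m * xs m - b) (k m) / pochhammer (of_nat m * xs m) (k m)"
    using eventually_gt_at_top[of 0]
  proof eventually_elim
    case (elim m)
    define c where "c = of_nat m * xs m"
    have md: "2 * B \<le> real m * d" "0 < real m * d" using elim d by (auto simp: field_simps)
    have "real m * d \<le> Re c" using mult_left_mono[of d "Re (xs m)" "real m"] elim(1) by (simp add: c_def)
    hence c: "0 < Re c" "real m * d \<le> norm (c + of_nat j)" for j
      using md complex_Re_le_cmod[of "c + of_nat j"] by auto
    have "norm (E m) \<le> real (k m) * (2 * B\<^sup>2 * (1 + B) / (real m * d)\<^sup>2)"
      unfolding E_def c_def[symmetric] by (intro norm_sum_ratio_log_error B md(1) c(2))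
    also have "\<dots> \<le> real m * t * (2 * B\<^sup>2 * (1 + B) / (real m * d)\<^sup>2)"
      using nat_floor_bounds(1)[OF elim(3) t] elim(3) B by (intro mult_right_mono) (auto simp: k_def field_simps)
    also have "\<dots> = 2 * B\<^sup>2 * (1 + B) / d\<^sup>2 * t * (1 / real m)"
      using elim(3) d by (simp add: power2_eq_square divide_simps)
    finally have bound: "norm (E m) \<le> 2 * B\<^sup>2 * (1 + B) / d\<^sup>2 * t * (1 / real m)" .
    have ck: "c + of_nat (k m) = of_nat m * (xs m + of_real (real (k m) / real m))"
      using elim(3) by (simp add: c_def field_simps)
    hence "xs m \<noteq> 0" "xs m + of_real (real (k m) / real m) \<noteq> 0"
      using c(1) of_nat_add_nonzero[OF c(1), of "k m"] by (auto simp: c_def)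
    hence "Ln (c + of_nat (k m)) - Ln c = Ln (xs m + of_real (real (k m) / real m)) - Ln (xs m)"
      unfolding ck unfolding c_def by (simp add: Ln_times_of_nat[OF elim(3)])
    moreover have "1 + (- b / (c + of_nat j)) \<noteq> 0" for j
      using md c(2)[of j] by (intro norm_ratio_log_error(2)[OF B]) linarith
    ultimately show ?case using bound pochhammer_ratio_exp[OF c(1), of "k m" b] by (simp add: E_def c_def)
  qed
  have "E \<longlonglongrightarrow> 0"
  proof (rule Lim_null_comparison)
    show "\<forall>\<^sub>F m in sequentially. norm (E m) \<le> 2 * B\<^sup>2 * (1 + B) / d\<^sup>2 * t * (1 / real m)"
      using main by eventually_elim auto
  qed (rule tendsto_mult_right_zero[OF lim_1_over_n])
  moreover have "(\<lambda>m. real (k m) / real m) \<longlonglongrightarrow> t" unfolding k_def by (rule nat_floor_tendsto[OF t])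
  moreover have "x + of_real t \<notin> \<real>\<^sub>\<le>\<^sub>0" "x \<notin> \<real>\<^sub>\<le>\<^sub>0" using x t by (auto simp: complex_nonpos_Reals_iff)
  ultimately have "(\<lambda>m. exp (E m - b * (Ln (xs m + of_real (real (k m) / real m)) - Ln (xs m))))
      \<longlonglongrightarrow> exp (0 - b * (Ln (x + of_real t) - Ln x))"
    by (intro tendsto_intros xs)
  moreover have "\<forall>\<^sub>F m in sequentially. exp (E m - b * (Ln (xs m + of_real (real (k m) / real m)) - Ln (xs m)))
      = pochhammer (of_nat m * xs m - b) (k m) / pochhammer (of_nat m * xs m) (k m)"
    using main by eventually_elim auto
  ultimately show ?thesis unfolding k_def by (simp add: Lim_transform_eventually)
qed

definition scaled_hyp :: "nat \<Rightarrow> complex \<Rightarrow> complex \<Rightarrow> complex \<Rightarrow> complex" where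
  "scaled_hyp m a b x = of_real (real m) powr (- a) * hyp a b (of_nat m * x) (1 - 1 / real m)"

text \<open>With Tricomi's function $U$, the limit of the rescaled hypergeometric functions is $x^a\, U(a, a - b + 1, x)$.\<close>

definition tricomi :: "complex \<Rightarrow> complex \<Rightarrow> complex \<Rightarrow> complex" where
  "tricomi a b x = lim (\<lambda>m. scaled_hyp m a b x)"

definition tricomi_integral :: "complex \<Rightarrow> complex \<Rightarrow> complex \<Rightarrow> complex" where
  "tricomi_integral a b x = rGamma a * (LINT t | lborel. gamma_kernel a t * exp (- b * (Ln (x + of_real t) - Ln x)))"

lemma scaled_hyp_tendsto_integral:
  assumes a: "0 < Re a" and x: "0 < Re x" and xs: "xs \<longlonglongrightarrow> x"
  shows "(\<lambda>m. scaled_hyp m a b (xs m)) \<longlonglongrightarrow> tricomi_integral a b x"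
proof -
  define d where "d = Re x / 2"
  have d: "0 < d" using x by (simp add: d_def)
  obtain n where n: "norm b \<le> real n" using real_arch_simple by blast
  have "\<forall>\<^sub>F m in sequentially. d < Re (xs m)"
    using order_tendstoD(1)[OF tendsto_Re[OF xs], of d] x by (simp add: d_def)
  then obtain M where M: "\<And>m. M \<le> m \<Longrightarrow> d < Re (xs m)" by (auto simp: eventually_sequentially)
  let ?h = "\<lambda>m k. pochhammer (of_nat m * xs m - b) k / pochhammer (of_nat m * xs m) k"
  have "(\<lambda>m. of_real (real m) powr (- a) * (\<Sum>k. nb_weight a m k * ?h m k)) \<longlonglongrightarrow> tricomi_integral a b x"
    unfolding tricomi_integral_def
  proof (rule negative_binomial_limit(1)[OF a, where ms="Suc M" and C="(1 + 1 / d) ^ n" and M=n])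
    fix m k assume m: "Suc M \<le> m"
    hence "0 < real m" by simp
    have "norm (?h m k) \<le> (1 + real k / (real m * d)) ^ n"
      by (rule pochhammer_ratio_bound) (use M[of m] m n d in \<open>auto simp: mult_left_mono less_imp_le\<close>)
    also have "\<dots> \<le> ((1 + 1 / d) * (1 + real k / real m)) ^ n"
      using d \<open>0 < real m\<close> by (intro power_mono) (auto simp: divide_simps algebra_simps)
    finally show "norm (?h m k) \<le> (1 + 1 / d) ^ n * (1 + real k / real m) ^ n"
      by (simp only: power_mult_distrib)
  qed (use pochhammer_ratio_tendsto[OF x xs] in auto)
  moreover have "of_real (real m) powr (- a) * (\<Sum>k. nb_weight a m k * ?h m k) = scaled_hyp m a b (xs m)" for m
    unfolding scaled_hyp_def hyp_def hyp_coeff_def nb_weight_def by (simp add: mult_ac)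
  ultimately show ?thesis by simp
qed

lemma scaled_hyp_recurrence:
  assumes m: "0 < m" and x: "0 < Re x"
  shows "(x - a / of_nat m) * scaled_hyp m (a - 1) b x
      = (x - (a - b) - (a + b) / of_nat m) * scaled_hyp m a b x + a * scaled_hyp m (a + 1) b x"
proof -
  define c where "c = of_nat m * x"
  define P where "P = (of_real (real m) :: complex) powr (- a)"
  define X where "X = 1 - 1 / real m"
  have c: "0 < Re c" and nz: "(of_nat m :: complex) \<noteq> 0" using m x by (simp_all add: c_def)
  have lower: "scaled_hyp m (a - 1) b x = of_nat m * (P * hyp (a - 1) b c X)"
    and upper: "P * hyp (a + 1) b c X = of_nat m * scaled_hyp m (a + 1) b x"
    and middle: "scaled_hyp m a b x = P * hyp a b c X"
    unfolding scaled_hyp_def P_def c_def X_def using m by (simp_all add: powr_diff powr_minus powr_add field_simps)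
  have X: "0 \<le> X" "X < 1" "of_real X = 1 - 1 / (of_nat m :: complex)" using m by (simp_all add: X_def)
  have "P * ((c - a) * hyp (a - 1) b c X + (2 * a - c + (c - b - a) * of_real X) * hyp a b c X
      + a * (of_real X - 1) * hyp (a + 1) b c X) = 0"
    unfolding hyp_contiguous_upper[OF c X(1,2)] by simp
  hence "(c - a) * (P * hyp (a - 1) b c X) = - (2 * a - c + (c - b - a) * of_real X) * scaled_hyp m a b x
      - a * (of_real X - 1) * (P * hyp (a + 1) b c X)"
    unfolding middle by (simp add: algebra_simps add_eq_0_iff2)
  also have "\<dots> = (x - (a - b) - (a + b) / of_nat m) * scaled_hyp m a b x + a * scaled_hyp m (a + 1) b x"
    unfolding upper X(3) using nz by (simp add: c_def field_simps)
  finally show ?thesis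
    unfolding lower using nz by (simp add: c_def field_simps)
qed

lemma scaled_hyp_difference:
  assumes m: "0 < m" and x: "0 < Re x"
  shows "of_nat m * (scaled_hyp m a b (x + 1 / of_nat m) - scaled_hyp m a b x)
      = a * (scaled_hyp m a b (x + 1 / of_nat m) - scaled_hyp m (a + 1) b (x + 1 / of_nat m)) / x"
proof -
  define c where "c = of_nat m * x"
  define P where "P = (of_real (real m) :: complex) powr (- a)"
  define X where "X = 1 - 1 / real m"
  have c: "0 < Re c" and nz: "(of_nat m :: complex) \<noteq> 0" using m x by (simp_all add: c_def)
  have shift: "of_nat m * (x + 1 / of_nat m) = c + 1" using nz by (simp add: c_def field_simps)
  have X: "0 \<le> X" "X < 1" "of_real X = 1 - 1 / (of_nat m :: complex)" using m by (simp_all add: X_def)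
  have "P * (c * (hyp a b (c + 1) X - hyp a b c X))
      = P * (a * (hyp a b (c + 1) X - (1 - of_real X) * hyp (a + 1) b (c + 1) X))"
    unfolding hyp_contiguous_lower[OF c X(1,2)] ..
  moreover have expand: "scaled_hyp m a b (x + 1 / of_nat m) = P * hyp a b (c + 1) X"
    "scaled_hyp m (a + 1) b (x + 1 / of_nat m) = P * ((1 - of_real X) * hyp (a + 1) b (c + 1) X)"
    "scaled_hyp m a b x = P * hyp a b c X"
    unfolding scaled_hyp_def shift X(3) unfolding P_def c_def X_def
    using m by (simp_all add: powr_diff powr_minus powr_add field_simps)
  ultimately have "c * (scaled_hyp m a b (x + 1 / of_nat m) - scaled_hyp m a b x)
      = a * (scaled_hyp m a b (x + 1 / of_nat m) - scaled_hyp m (a + 1) b (x + 1 / of_nat m))"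
    unfolding expand by (simp add: algebra_simps)
  moreover have "x \<noteq> 0" using x by auto
  ultimately show ?thesis unfolding c_def by (simp add: field_simps)
qed

lemma Re_downward_induct [case_names positive shift]:
  fixes a :: complex
  assumes positive: "\<And>a. 0 < Re a \<Longrightarrow> Q a" and shift: "\<And>a. Q (a + 1) \<Longrightarrow> Q (a + 2) \<Longrightarrow> Q a"
  shows "Q a"
proof -
  have "\<forall>a. - real n < Re a \<longrightarrow> Q a" for n
  proof (induction n)
    case (Suc n)
    show ?case
    proof (intro allI impI)
      fix a assume "- real (Suc n) < Re a"
      hence "Q (a + 1)" "Q (a + 2)" using Suc by simp_all
      thus "Q a" by (rule shift)
    qed
  qed (use positive in simp)
  moreover obtain n where "- Re a < real n" using reals_Archimedean2 by blast
  ultimately show ?thesis by (simp add: minus_less_iff)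
qed

lemma scaled_hyp_tendsto:
  assumes "0 < Re x" "xs \<longlonglongrightarrow> x"
  shows "(\<lambda>m. scaled_hyp m a b (xs m)) \<longlonglongrightarrow> tricomi a b x"
  using assms
proof (induction a arbitrary: x xs rule: Re_downward_induct)
  case (positive a)
  have "tricomi a b x = tricomi_integral a b x"
    unfolding tricomi_def by (intro limI scaled_hyp_tendsto_integral positive) simp
  thus ?case using scaled_hyp_tendsto_integral[OF positive] by simp
next
  case (shift a)
  define L where "L = ((x - (a + 1 - b)) * tricomi (a + 1) b x + (a + 1) * tricomi (a + 2) b x) / x"
  have lim: "(\<lambda>m. scaled_hyp m a b (ys m)) \<longlonglongrightarrow> L" if ys: "ys \<longlonglongrightarrow> x" for ys
  proof -
    let ?d = "\<lambda>m. ys m - (a + 1) * (1 / of_nat m)"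
    let ?n = "\<lambda>m. (ys m - (a + 1 - b) - (a + 1 + b) * (1 / of_nat m)) * scaled_hyp m (a + 1) b (ys m)
        + (a + 1) * scaled_hyp m (a + 2) b (ys m)"
    have "x \<noteq> 0" using shift.prems by auto
    have inv: "(\<lambda>m. 1 / (of_nat m :: complex)) \<longlonglongrightarrow> 0" by (rule lim_1_over_n)
    have d: "?d \<longlonglongrightarrow> x - (a + 1) * 0" by (intro tendsto_intros ys inv)
    have "?n \<longlonglongrightarrow> (x - (a + 1 - b) - (a + 1 + b) * 0) * tricomi (a + 1) b x + (a + 1) * tricomi (a + 2) b x"
      by (intro tendsto_intros ys inv shift.IH shift.prems)
    with d have "(\<lambda>m. ?n m / ?d m) \<longlonglongrightarrow> L"
      unfolding L_def using tendsto_divide[of ?n _ sequentially ?d] \<open>x \<noteq> 0\<close> by simp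
    moreover have "\<forall>\<^sub>F m in sequentially. ?d m \<noteq> 0"
      using d \<open>x \<noteq> 0\<close> by (intro tendsto_imp_eventually_ne) auto
    hence "\<forall>\<^sub>F m in sequentially. ?n m / ?d m = scaled_hyp m a b (ys m)"
      using order_tendstoD(1)[OF tendsto_Re[OF ys] shift.prems(1)] eventually_gt_at_top[of 0]
    proof eventually_elim
      case (elim m)
      show ?case
        using scaled_hyp_recurrence[OF elim(3,2), of "a + 1" b] elim(1)
        by (simp add: divide_eq_eq mult.commute add.assoc)
    qed
    ultimately show ?thesis by (rule Lim_transform_eventually)
  qed
  have "tricomi a b x = L" unfolding tricomi_def by (intro limI lim) simp
  thus ?case using lim[OF shift.prems(2)] by simp
qed

lemma tricomi_recurrence:
  assumes x: "0 < Re x"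
  shows "x * tricomi (a - 1) b x = (x - (a - b)) * tricomi a b x + a * tricomi (a + 1) b x"
proof -
  have inv: "(\<lambda>m. 1 / (of_nat m :: complex)) \<longlonglongrightarrow> 0" by (rule lim_1_over_n)
  have lower: "(\<lambda>m. (x - a * (1 / of_nat m)) * scaled_hyp m (a - 1) b x) \<longlonglongrightarrow> (x - a * 0) * tricomi (a - 1) b x"
    by (intro tendsto_intros inv scaled_hyp_tendsto x)
  have upper: "(\<lambda>m. (x - (a - b) - (a + b) * (1 / of_nat m)) * scaled_hyp m a b x + a * scaled_hyp m (a + 1) b x)
      \<longlonglongrightarrow> (x - (a - b) - (a + b) * 0) * tricomi a b x + a * tricomi (a + 1) b x"
    by (intro tendsto_intros inv scaled_hyp_tendsto x)
  have "\<forall>\<^sub>F m in sequentially. (x - (a - b) - (a + b) * (1 / of_nat m)) * scaled_hyp m a b x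
      + a * scaled_hyp m (a + 1) b x = (x - a * (1 / of_nat m)) * scaled_hyp m (a - 1) b x"
    using eventually_gt_at_top[of 0] by eventually_elim (simp add: scaled_hyp_recurrence[OF _ x, simplified])
  from LIMSEQ_unique[OF lower Lim_transform_eventually[OF upper this]] show ?thesis by simp
qed

lemma seq_reparametrize:
  fixes f :: "nat \<Rightarrow> 'a::metric_space \<Rightarrow> 'b::metric_space"
  assumes cc: "\<And>xs. (\<forall>m. xs m \<in> K) \<Longrightarrow> xs \<longlonglongrightarrow> x \<Longrightarrow> (\<lambda>m. f m (xs m)) \<longlonglongrightarrow> g x"
    and r: "strict_mono r" and x: "x \<in> K" and y: "\<And>j. y j \<in> K" "y \<longlonglongrightarrow> x"
  shows "(\<lambda>j. f (r j) (y j)) \<longlonglongrightarrow> g x"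
proof -
  define X where "X m = (if m \<in> range r then y (inv r m) else x)" for m
  have inj: "inj r" using r strict_mono_imp_inj_on by blast
  have XK: "\<forall>m. X m \<in> K" using x y by (auto simp: X_def)
  have "X \<longlonglongrightarrow> x"
  proof (rule metric_LIMSEQ_I)
    fix e :: real assume e: "0 < e"
    then obtain J where J: "\<And>j. j \<ge> J \<Longrightarrow> dist (y j) x < e" using y(2) metric_LIMSEQ_D by blast
    show "\<exists>no. \<forall>m \<ge> no. dist (X m) x < e"
    proof (intro exI allI impI)
      fix m assume m: "r J \<le> m"
      show "dist (X m) x < e"
      proof (cases "m \<in> range r")
        case True
        then obtain j where j: "m = r j" by auto
        have "J \<le> j" using m j r by (simp add: strict_mono_less_eq)
        thus ?thesis using J inj by (simp add: X_def j)
      qed (use e in \<open>simp add: X_def\<close>)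
    qed
  qed
  from LIMSEQ_subseq_LIMSEQ[OF cc[OF XK this] r] show ?thesis using inj by (simp add: X_def o_def)
qed

lemma continuous_convergence_uniform:
  fixes f :: "nat \<Rightarrow> 'a::metric_space \<Rightarrow> 'b::metric_space"
  assumes K: "compact K"
    and conv: "\<And>x xs. x \<in> K \<Longrightarrow> (\<forall>m. xs m \<in> K) \<Longrightarrow> xs \<longlonglongrightarrow> x \<Longrightarrow> (\<lambda>m. f m (xs m)) \<longlonglongrightarrow> g x"
  shows "uniform_limit K f g sequentially"
proof (rule ccontr)
  assume "\<not> ?thesis"
  then obtain e where e: "0 < e" and not_close: "\<not> (\<forall>\<^sub>F m in sequentially. \<forall>x\<in>K. dist (f m x) (g x) < e)"
    unfolding uniform_limit_iff by blast
  have "\<forall>M. \<exists>m>M. \<exists>x\<in>K. e \<le> dist (f m x) (g x)"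
    using not_close unfolding eventually_sequentially by (meson Suc_le_lessD not_less)
  then obtain later where later: "\<And>M. later M > M" "\<And>M. \<exists>x\<in>K. e \<le> dist (f (later M) x) (g x)" by metis
  define r where "r = rec_nat (later 0) (\<lambda>_ M. later M)"
  have r: "strict_mono r" unfolding strict_mono_Suc_iff by (simp add: r_def later(1))
  have "\<exists>x\<in>K. e \<le> dist (f (r j) x) (g x)" for j by (cases j) (simp_all add: r_def later(2))
  then obtain y where y: "\<And>j. y j \<in> K" "\<And>j. e \<le> dist (f (r j) (y j)) (g (y j))" by metis
  obtain l s where l: "l \<in> K" and s: "strict_mono s" "(y \<circ> s) \<longlonglongrightarrow> l"
    using K y(1) unfolding compact_def by blast
  have z: "\<And>j. (y \<circ> s) j \<in> K" using y(1) by simp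
  have "\<exists>n. \<forall>m\<ge>n. dist (f m (y (s j))) (g (y (s j))) < e / 4" for j
    using conv[of "y (s j)" "\<lambda>_. y (s j)"] y(1) e metric_LIMSEQ_D[of _ "g (y (s j))" "e / 4"] by auto
  then obtain n where n: "\<And>j m. n j \<le> m \<Longrightarrow> dist (f m (y (s j))) (g (y (s j))) < e / 4" by metis
  define t where "t j = (\<Sum>i\<le>j. Suc (n i))" for j
  have t: "strict_mono t" unfolding strict_mono_Suc_iff by (simp add: t_def)
  have "n j \<le> t j" for j using member_le_sum[of j "{..j}" "\<lambda>i. Suc (n i)"] by (simp add: t_def)
  hence near: "dist (f (t j) (y (s j))) (g (y (s j))) < e / 4" for j by (intro n)
  have "(\<lambda>j. f ((r \<circ> s) j) ((y \<circ> s) j)) \<longlonglongrightarrow> g l"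
    by (rule seq_reparametrize[where K=K and f=f and g=g, OF conv[OF l] strict_mono_o[OF r s(1)] l z s(2)])
  hence "\<forall>\<^sub>F j in sequentially. dist (f (r (s j)) (y (s j))) (g l) < e / 4"
    using tendstoD[of _ "g l" sequentially "e / 4"] e by simp
  moreover have "(\<lambda>j. f (t j) ((y \<circ> s) j)) \<longlonglongrightarrow> g l"
    by (rule seq_reparametrize[where K=K and f=f and g=g, OF conv[OF l] t l z s(2)])
  hence "\<forall>\<^sub>F j in sequentially. dist (f (t j) (y (s j))) (g l) < e / 4"
    using tendstoD[of _ "g l" sequentially "e / 4"] e by simp
  ultimately have "\<forall>\<^sub>F j in sequentially. False"
  proof eventually_elim
    case (elim j)
    thus False
      using e y(2)[of "s j"] near[of j]
        dist_triangle[of "f (r (s j)) (y (s j))" "g (y (s j))" "g l"]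
        dist_triangle[of "g (y (s j))" "g l" "f (t j) (y (s j))"]
      by (simp add: dist_commute)
  qed
  thus False by simp
qed

lemma open_Re_pos: "open {x. 0 < Re x}"
  by (intro open_Collect_less continuous_intros)

lemma cball_Re_pos:
  assumes "0 < Re x" "z \<in> cball x (Re x / 4)"
  shows "Re x / 2 < Re z"
  using assms abs_Re_le_cmod[of "x - z"] by (simp add: dist_norm)

lemma hyp_holomorphic:
  assumes xi: "0 \<le> xi" "xi < 1"
  shows "(\<lambda>c. hyp a b c xi) holomorphic_on {c. 0 < Re c}"
proof (rule holomorphic_uniform_sequence[where f="\<lambda>n c. \<Sum>k<n. hyp_coeff a b c k * of_real xi ^ k", OF open_Re_pos])
  fix n
  show "(\<lambda>c. \<Sum>k<n. hyp_coeff a b c k * of_real xi ^ k) holomorphic_on {c. 0 < Re c}"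
    unfolding hyp_coeff_def pochhammer_prod
    by (intro holomorphic_intros) (simp add: of_nat_add_nonzero)
next
  fix c :: complex assume "c \<in> {c. 0 < Re c}"
  hence c: "0 < Re c" by simp
  obtain C N where C: "0 \<le> C" "\<And>c' k. Re c / 2 \<le> Re c' \<Longrightarrow> norm (hyp_coeff a b c' k) \<le> C * (1 + real k) ^ N"
    using hyp_coeff_uniform_bound[of "Re c / 2"] c by (metis half_gt_zero)
  have "uniform_limit (cball c (Re c / 4)) (\<lambda>n c'. \<Sum>k<n. hyp_coeff a b c' k * of_real xi ^ k)
      (\<lambda>c'. hyp a b c' xi) sequentially"
    unfolding hyp_def
  proof (rule Weierstrass_m_test)
    show "summable (\<lambda>k. C * ((1 + real k) ^ N * xi ^ k))" by (intro summable_mult summable_poly_geometric xi)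
    fix k c' assume "c' \<in> cball c (Re c / 4)"
    hence "norm (hyp_coeff a b c' k) \<le> C * (1 + real k) ^ N"
      using cball_Re_pos[OF c] by (intro C(2)) (auto intro: less_imp_le)
    from mult_right_mono[OF this, of "xi ^ k"]
    show "norm (hyp_coeff a b c' k * of_real xi ^ k) \<le> C * ((1 + real k) ^ N * xi ^ k)"
      using xi by (simp add: norm_mult norm_power mult_ac)
  qed
  moreover have "cball c (Re c / 4) \<subseteq> {c. 0 < Re c}" using cball_Re_pos[OF c] c by force
  ultimately show "\<exists>d>0. cball c d \<subseteq> {c. 0 < Re c} \<and> uniform_limit (cball c d)
      (\<lambda>n c'. \<Sum>k<n. hyp_coeff a b c' k * of_real xi ^ k) (\<lambda>c'. hyp a b c' xi) sequentially"
    using c by (intro exI[of _ "Re c / 4"]) simp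
qed

lemma scaled_hyp_holomorphic: "scaled_hyp m a b holomorphic_on {x. 0 < Re x}"
proof (cases "m = 0")
  case False
  hence "(*) (of_nat m) ` {x. 0 < Re x} \<subseteq> {c. 0 < Re c}" by auto
  hence "(\<lambda>x. hyp a b (of_nat m * x) (1 - 1 / real m)) holomorphic_on {x. 0 < Re x}"
    using holomorphic_on_compose_gen[OF _ hyp_holomorphic[of "1 - 1 / real m" a b], of "\<lambda>x. of_nat m * x"] False
    by (auto simp: o_def intro!: holomorphic_intros)
  thus ?thesis unfolding scaled_hyp_def[abs_def] by (intro holomorphic_intros)
qed (simp add: scaled_hyp_def[abs_def])

lemma uniform_limit_continuous_convergence:
  fixes f :: "nat \<Rightarrow> complex \<Rightarrow> complex"
  assumes conv: "\<And>x xs. x \<in> S \<Longrightarrow> xs \<longlonglongrightarrow> x \<Longrightarrow> (\<lambda>m. f m (xs m)) \<longlonglongrightarrow> g x"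
    and K: "compact K" "K \<subseteq> S" and ys: "ys \<longlonglongrightarrow> 0"
  shows "uniform_limit K (\<lambda>m z. f m (z + ys m)) g sequentially"
proof (rule continuous_convergence_uniform[OF K(1)])
  fix x xs assume "x \<in> K" "xs \<longlonglongrightarrow> x"
  thus "(\<lambda>m. f m (xs m + ys m)) \<longlonglongrightarrow> g x"
    using tendsto_add[OF _ ys, of xs x] K(2) by (intro conv) auto
qed

lemma holomorphic_continuous_convergence:
  fixes f :: "nat \<Rightarrow> complex \<Rightarrow> complex"
  assumes S: "open S" and hol: "\<And>m. f m holomorphic_on S"
    and conv: "\<And>x xs. x \<in> S \<Longrightarrow> xs \<longlonglongrightarrow> x \<Longrightarrow> (\<lambda>m. f m (xs m)) \<longlonglongrightarrow> g x"
  shows "g holomorphic_on S"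
proof (rule holomorphic_uniform_sequence[OF S hol])
  fix x assume "x \<in> S"
  then obtain d where d: "0 < d" "cball x d \<subseteq> S" using S open_contains_cball by blast
  hence "uniform_limit (cball x d) (\<lambda>m z. f m (z + 0)) g sequentially"
    by (intro uniform_limit_continuous_convergence[OF conv]) auto
  thus "\<exists>d>0. cball x d \<subseteq> S \<and> uniform_limit (cball x d) f g sequentially" using d by auto
qed

lemma deriv_continuous_convergence:
  fixes f :: "nat \<Rightarrow> complex \<Rightarrow> complex"
  assumes S: "open S" and hol: "\<And>m. f m holomorphic_on S"
    and conv: "\<And>x xs. x \<in> S \<Longrightarrow> xs \<longlonglongrightarrow> x \<Longrightarrow> (\<lambda>m. f m (xs m)) \<longlonglongrightarrow> g x"
    and x: "x \<in> S" and ys: "ys \<longlonglongrightarrow> x"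
  shows "(\<lambda>m. deriv (f m) (ys m)) \<longlonglongrightarrow> deriv g x"
proof -
  obtain d where d: "0 < d" "cball x (2 * d) \<subseteq> S"
    using x S open_contains_cball by (metis field_sum_of_halves half_gt_zero mult_2)
  define h where "h m z = f m (z + (ys m - x))" for m z
  have shift: "(\<lambda>m. ys m - x) \<longlonglongrightarrow> 0" using tendsto_diff[OF ys tendsto_const[of x]] by simp
  have "cball x d \<subseteq> S" using d by (auto intro: order_trans)
  hence "uniform_limit (cball x d) h g sequentially"
    unfolding h_def by (intro uniform_limit_continuous_convergence[OF conv] shift) auto
  hence unif: "uniform_limit (ball x d) h g sequentially"
    by (rule uniform_limit_on_subset) auto
  have close: "\<forall>\<^sub>F m in sequentially. norm (ys m - x) < d" using tendstoD[OF shift d(1)] by simp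
  have inside: "z + (ys m - x) \<in> S" if "norm (ys m - x) < d" "z \<in> ball x d" for m z
  proof -
    have "norm (x - (z + (ys m - x))) \<le> norm (x - z) + norm (ys m - x)"
      using norm_triangle_ineq4[of "x - z" "ys m - x"] by (simp only: diff_diff_eq)
    hence "z + (ys m - x) \<in> cball x (2 * d)" using that by (simp add: dist_norm)
    thus ?thesis using d(2) by blast
  qed
  from close have "\<forall>\<^sub>F m in sequentially. h m holomorphic_on ball x d"
  proof eventually_elim
    case (elim m)
    hence "f m \<circ> (\<lambda>z. z + (ys m - x)) holomorphic_on ball x d"
      using inside by (intro holomorphic_on_compose_gen[OF _ hol] holomorphic_intros) auto
    thus ?case by (simp add: h_def[abs_def] o_def)
  qed
  hence "(\<lambda>m. deriv (h m) x) \<longlonglongrightarrow> deriv g x"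
    by (rule deriv_complex_uniform_limit[OF unif]) (use d in auto)
  moreover have "\<forall>\<^sub>F m in sequentially. deriv (h m) x = deriv (f m) (ys m)"
    using close
  proof eventually_elim
    case (elim m)
    have "(f m has_field_derivative deriv (f m) (ys m)) (at (x + (ys m - x)))"
      using holomorphic_derivI[OF hol S, of "ys m" m] inside[OF elim, of x] d(1) by simp
    thus ?case unfolding h_def by (intro DERIV_imp_deriv DERIV_shift[THEN iffD1])
  qed
  ultimately show ?thesis by (rule Lim_transform_eventually)
qed

lemma tricomi_holomorphic: "tricomi a b holomorphic_on {x. 0 < Re x}"
  by (rule holomorphic_continuous_convergence[OF open_Re_pos scaled_hyp_holomorphic scaled_hyp_tendsto]) auto

lemma scaled_hyp_has_derivative:
  "0 < Re x \<Longrightarrow> (scaled_hyp m a b has_field_derivative deriv (scaled_hyp m a b) x) (at x)"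
  by (rule holomorphic_derivI[OF scaled_hyp_holomorphic open_Re_pos]) simp

lemma scaled_hyp_deriv_tendsto:
  assumes "0 < Re x" "ys \<longlonglongrightarrow> x"
  shows "(\<lambda>m. deriv (scaled_hyp m a b) (ys m)) \<longlonglongrightarrow> deriv (tricomi a b) x"
  by (rule deriv_continuous_convergence[OF open_Re_pos scaled_hyp_holomorphic scaled_hyp_tendsto]) (use assms in auto)

lemma difference_quotient_tendsto:
  fixes f f' :: "nat \<Rightarrow> complex \<Rightarrow> complex"
  assumes S: "convex S" "x \<in> S" and ys: "\<And>m. ys m \<in> S" "\<And>m. ys m \<noteq> x" "ys \<longlonglongrightarrow> x"
    and deriv: "\<And>m u. u \<in> S \<Longrightarrow> (f m has_field_derivative f' m u) (at u)"
    and lim: "\<And>us. (\<forall>m. us m \<in> S) \<Longrightarrow> us \<longlonglongrightarrow> x \<Longrightarrow> (\<lambda>m. f' m (us m)) \<longlonglongrightarrow> D"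
  shows "(\<lambda>m. (f m (ys m) - f m x) / (ys m - x)) \<longlonglongrightarrow> D"
proof -
  have "\<exists>u\<in>closed_segment x (ys m). norm ((f m (ys m) - f m x) / (ys m - x) - D) \<le> 2 * norm (f' m u - D)" for m
  proof (rule ccontr)
    let ?q = "norm ((f m (ys m) - f m x) / (ys m - x) - D)"
    assume "\<not> ?thesis"
    hence small: "norm (f' m u - D) < ?q / 2" if "u \<in> closed_segment x (ys m)" for u
      using that by (auto simp: not_le field_simps)
    have "closed_segment x (ys m) \<subseteq> S" using S ys(1) by (simp add: closed_segment_subset)
    hence "norm ((f m (ys m) - D * ys m) - (f m x - D * x)) \<le> ?q / 2 * norm (ys m - x)"
      using small by (intro field_differentiable_bound[where f'="\<lambda>u. f' m u - D" and S="closed_segment x (ys m)"]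
          convex_closed_segment less_imp_le)
        (auto intro!: derivative_eq_intros DERIV_subset[OF deriv])
    moreover have "(f m (ys m) - D * ys m) - (f m x - D * x) = ((f m (ys m) - f m x) / (ys m - x) - D) * (ys m - x)"
      using ys(2)[of m] by (simp add: field_simps)
    ultimately have "?q * norm (ys m - x) \<le> ?q / 2 * norm (ys m - x)" by (simp only: norm_mult)
    hence "?q \<le> ?q / 2" by (rule mult_right_le_imp_le) (simp add: ys(2))
    thus False using small[of x] norm_ge_zero[of "f' m x - D"] by simp
  qed
  then obtain us where us: "\<And>m. us m \<in> closed_segment x (ys m)"
      "\<And>m. norm ((f m (ys m) - f m x) / (ys m - x) - D) \<le> 2 * norm (f' m (us m) - D)" by metis
  have "\<forall>m. us m \<in> S" using us(1) S ys(1) closed_segment_subset by blast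
  moreover have "us \<longlonglongrightarrow> x"
    by (rule metric_tendsto_imp_tendsto[OF ys(3)])
      (use us(1) dist_in_closed_segment in \<open>force simp: dist_commute intro!: always_eventually\<close>)
  ultimately have "(\<lambda>m. 2 * norm (f' m (us m) - D)) \<longlonglongrightarrow> 2 * 0"
    by (intro tendsto_mult tendsto_const tendsto_norm_zero LIM_zero lim)
  hence "(\<lambda>m. 2 * norm (f' m (us m) - D)) \<longlonglongrightarrow> 0" by simp
  with us(2) have "(\<lambda>m. (f m (ys m) - f m x) / (ys m - x) - D) \<longlonglongrightarrow> 0"
    by (rule Lim_null_comparison[OF always_eventually[OF allI]])
  thus ?thesis by (rule LIM_zero_cancel)
qed

lemma tricomi_has_derivative:
  assumes x: "0 < Re x"
  shows "(tricomi a b has_field_derivative a * (tricomi a b x - tricomi (a + 1) b x) / x) (at x)"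
proof -
  let ?y = "\<lambda>m. x + 1 / of_nat (Suc m)"
  have y: "?y \<longlonglongrightarrow> x" using tendsto_add[OF tendsto_const LIMSEQ_Suc[OF lim_1_over_n], of x] by simp
  have "x \<noteq> 0" using x by auto
  have "(\<lambda>m. (scaled_hyp (Suc m) a b (?y m) - scaled_hyp (Suc m) a b x) / (?y m - x)) \<longlonglongrightarrow> deriv (tricomi a b) x"
  proof (rule difference_quotient_tendsto[where S="{x. 0 < Re x}"])
    fix us assume "us \<longlonglongrightarrow> x"
    hence "(\<lambda>m. us (m - 1)) \<longlonglongrightarrow> x" by (simp add: LIMSEQ_imp_Suc)
    from LIMSEQ_Suc[OF scaled_hyp_deriv_tendsto[OF x this]]
    show "(\<lambda>m. deriv (scaled_hyp (Suc m) a b) (us m)) \<longlonglongrightarrow> deriv (tricomi a b) x" by simp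
  qed (use x y in \<open>auto intro: scaled_hyp_has_derivative convex_halfspace_Re_gt simp: add_pos_nonneg simp del: of_nat_Suc\<close>)
  moreover have "(scaled_hyp (Suc m) a b (?y m) - scaled_hyp (Suc m) a b x) / (?y m - x)
      = a * (scaled_hyp (Suc m) a b (?y m) - scaled_hyp (Suc m) (a + 1) b (?y m)) / x" for m
    using scaled_hyp_difference[OF _ x, of "Suc m" a b] by (simp add: mult.commute)
  moreover have "(\<lambda>m. a * (scaled_hyp m a b (x + 1 / of_nat m) - scaled_hyp m (a + 1) b (x + 1 / of_nat m)) / x)
      \<longlonglongrightarrow> a * (tricomi a b x - tricomi (a + 1) b x) / x"
    using tendsto_add[OF tendsto_const lim_1_over_n, of x] by (intro tendsto_intros scaled_hyp_tendsto x \<open>x \<noteq> 0\<close>) simp_all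
  from LIMSEQ_Suc[OF this]
  have "(\<lambda>m. a * (scaled_hyp (Suc m) a b (?y m) - scaled_hyp (Suc m) (a + 1) b (?y m)) / x)
      \<longlonglongrightarrow> a * (tricomi a b x - tricomi (a + 1) b x) / x" .
  ultimately have "deriv (tricomi a b) x = a * (tricomi a b x - tricomi (a + 1) b x) / x"
    by (simp only:) (rule LIMSEQ_unique)
  thus ?thesis using holomorphic_derivI[OF tricomi_holomorphic open_Re_pos, of x a b] x by simp
qed

lemma tricomi_Suc_has_derivative:
  assumes x: "0 < Re x"
  shows "(tricomi (a + 1) b has_field_derivative ((x + b) * tricomi (a + 1) b x - x * tricomi a b x) / x) (at x)"
proof -
  have "(a + 1) * (tricomi (a + 1) b x - tricomi (a + 1 + 1) b x) = (x + b) * tricomi (a + 1) b x - x * tricomi a b x"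
    using tricomi_recurrence[OF x, of "a + 1" b] by (simp add: algebra_simps)
  thus ?thesis using tricomi_has_derivative[OF x, of "a + 1" b] by simp
qed

lemma Ln_add_of_real_diff:
  assumes "0 < x" "0 < t"
  shows "Ln (of_real x + of_real t) - Ln (of_real x) = of_real (ln (1 + t / x))"
proof -
  have "1 + t / x = (x + t) / x" using assms by (simp add: field_simps)
  hence "ln (1 + t / x) = ln (x + t) - ln x" using assms by (simp add: ln_div)
  thus ?thesis using assms Ln_of_real[of "x + t"] Ln_of_real[of x] by simp
qed

lemma norm_exp_Ln_diff_le:
  assumes N: "norm b \<le> real N" and x: "1 \<le> x" and t: "0 < t"
  shows "norm (exp (- b * (Ln (of_real x + of_real t) - Ln (of_real x)))) \<le> (1 + t) ^ N"
proof -
  have "norm (exp (- b * (Ln (of_real x + of_real t) - Ln (of_real x)))) = exp (- Re b * ln (1 + t / x))"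
    using Ln_add_of_real_diff[of x t] x t by (simp add: norm_exp_eq_Re)
  also have "- Re b * ln (1 + t / x) \<le> real N * ln (1 + t)"
  proof (rule mult_mono)
    show "- Re b \<le> real N" using N abs_Re_le_cmod[of b] by linarith
    show "ln (1 + t / x) \<le> ln (1 + t)"
      using x t divide_left_mono[of 1 x t] by (subst ln_le_cancel_iff) (auto intro: add_pos_nonneg)
    show "0 \<le> ln (1 + t / x)" using x t by simp
  qed simp
  also have "exp (real N * ln (1 + t)) = (1 + t) ^ N" using t by (simp add: exp_of_nat_mult)
  finally show ?thesis by simp
qed

lemma tricomi_integral_at_top:
  assumes a: "0 < Re a"
  shows "((\<lambda>x. tricomi_integral a b (of_real x)) \<longlongrightarrow> 1) at_top"
proof -
  obtain N where N: "norm b \<le> real N" using real_arch_simple by blast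
  let ?e = "\<lambda>x t. exp (- b * (Ln (of_real x + of_real t) - Ln (of_real x)))"
  have "((\<lambda>x. LINT t | lborel. gamma_kernel a t * ?e x t) \<longlongrightarrow> (LINT t | lborel. gamma_kernel a t)) at_top"
  proof (rule integral_dominated_convergence_at_top)
    show "integrable lborel (\<lambda>t. indicat_real {0<..} t * (t powr (Re a - 1) * (1 + t) ^ N * exp (- t)))"
      by (rule gamma_weight_integrable[OF a])
    show "\<forall>\<^sub>F x in at_top. AE t in lborel. norm (gamma_kernel a t * ?e x t)
        \<le> indicat_real {0<..} t * (t powr (Re a - 1) * (1 + t) ^ N * exp (- t))"
      using eventually_ge_at_top[of 1]
    proof eventually_elim
      case (elim x)
      have "norm (gamma_kernel a t * ?e x t) \<le> indicat_real {0<..} t * (t powr (Re a - 1) * (1 + t) ^ N * exp (- t))" for t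
      proof (cases "0 < t")
        case True
        thus ?thesis
          using mult_left_mono[OF norm_exp_Ln_diff_le[OF N elim True], of "t powr (Re a - 1) * exp (- t)"]
          by (simp add: norm_mult norm_gamma_kernel mult_ac)
      qed (simp add: gamma_kernel_def)
      thus ?case by (intro AE_I2)
    qed
    have "((\<lambda>x. gamma_kernel a t * ?e x t) \<longlongrightarrow> gamma_kernel a t) at_top" for t
    proof (cases "0 < t")
      case True
      have "((\<lambda>x. exp (- b * of_real (ln (1 + t / x)))) \<longlongrightarrow> exp (- b * of_real 0)) at_top"
        using True by (intro tendsto_intros) real_asymp
      moreover have "\<forall>\<^sub>F x in at_top. exp (- b * of_real (ln (1 + t / x))) = ?e x t"
        using eventually_gt_at_top[of 0] by eventually_elim (use Ln_add_of_real_diff True in simp)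
      ultimately have "((\<lambda>x. ?e x t) \<longlongrightarrow> 1) at_top" by (simp add: Lim_transform_eventually)
      from tendsto_mult[OF tendsto_const this] show ?thesis by simp
    qed (simp add: gamma_kernel_def)
    thus "AE t in lborel. ((\<lambda>x. gamma_kernel a t * ?e x t) \<longlongrightarrow> gamma_kernel a t) at_top"
      by (intro AE_I2)
  qed measurable
  hence "((\<lambda>x. tricomi_integral a b (of_real x)) \<longlongrightarrow> rGamma a * (LINT t | lborel. gamma_kernel a t)) at_top"
    unfolding tricomi_integral_def by (intro tendsto_mult tendsto_const)
  thus ?thesis unfolding gamma_kernel_integral[OF a] .
qed

lemma tricomi_at_top: "((\<lambda>x. tricomi a b (of_real x)) \<longlongrightarrow> 1) at_top"
proof (induction a rule: Re_downward_induct)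
  case (positive a)
  have "\<forall>\<^sub>F x in at_top. tricomi_integral a b (of_real x) = tricomi a b (of_real x)"
    using eventually_gt_at_top[of 0]
    by eventually_elim (auto simp: tricomi_def positive intro!: limI[symmetric] scaled_hyp_tendsto_integral)
  with tricomi_integral_at_top[OF positive] show ?case by (rule Lim_transform_eventually)
next
  case (shift a)
  let ?r = "\<lambda>x. (1 - (a + 1 - b) * of_real (1 / x)) * tricomi (a + 1) b (of_real x)
      + (a + 1) * of_real (1 / x) * tricomi (a + 2) b (of_real x)"
  have "((\<lambda>x::real. 1 / x) \<longlongrightarrow> 0) at_top" by real_asymp
  hence "(?r \<longlongrightarrow> (1 - (a + 1 - b) * of_real 0) * 1 + (a + 1) * of_real 0 * 1) at_top"
    by (intro tendsto_intros shift)
  moreover have "\<forall>\<^sub>F x in at_top. ?r x = tricomi a b (of_real x)"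
    using eventually_gt_at_top[of 0]
  proof eventually_elim
    case (elim x)
    let ?x = "complex_of_real x"
    have solved: "tricomi a b ?x = ((?x - (a + 1 - b)) * tricomi (a + 1) b ?x + (a + 1) * tricomi (a + 2) b ?x) / ?x"
      using tricomi_recurrence[of ?x "a + 1" b] elim by (simp add: eq_divide_eq mult.commute add.assoc)
    show ?case unfolding solved using elim by (simp add: field_simps)
  qed
  ultimately show ?case by (simp add: Lim_transform_eventually)
qed

lemma ode_zero_backwards:
  fixes d d' d'' :: "real \<Rightarrow> 'a::real_inner"
  assumes ab: "a \<le> b" and M: "0 \<le> M"
    and d: "\<And>x. a \<le> x \<Longrightarrow> x \<le> b \<Longrightarrow> (d has_vector_derivative d' x) (at x)"
    and d': "\<And>x. a \<le> x \<Longrightarrow> x \<le> b \<Longrightarrow> (d' has_vector_derivative d'' x) (at x)"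
    and bound: "\<And>x. a \<le> x \<Longrightarrow> x \<le> b \<Longrightarrow> norm (d'' x) \<le> M * norm (d x)"
    and zero: "d b = 0" "d' b = 0"
  shows "d a = 0"
proof -
  define energy where "energy x = d x \<bullet> d x + d' x \<bullet> d' x" for x
  define slope where "slope x = 2 * (d x \<bullet> d' x) + 2 * (d' x \<bullet> d'' x)" for x
  have "energy a * exp ((1 + M) * a) \<le> energy b * exp ((1 + M) * b)"
  proof (rule DERIV_nonneg_imp_nondecreasing[OF ab])
    fix x assume x: "a \<le> x" "x \<le> b"
    note inner = bounded_bilinear.has_vector_derivative[OF bounded_bilinear_inner]
    have "(energy has_real_derivative slope x) (at x)"
      using has_vector_derivative_add[OF inner[OF d[OF x] d[OF x]] inner[OF d'[OF x] d'[OF x]]]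
      unfolding energy_def[abs_def] slope_def has_real_derivative_iff_has_vector_derivative
      by (simp add: inner_commute)
    hence "((\<lambda>x. energy x * exp ((1 + M) * x)) has_real_derivative
        (slope x + (1 + M) * energy x) * exp ((1 + M) * x)) (at x)"
      by (auto intro!: derivative_eq_intros simp: algebra_simps)
    moreover have "- slope x \<le> (1 + M) * energy x"
    proof -
      have "- (d' x \<bullet> d'' x) \<le> norm (d' x) * (M * norm (d x))"
        using Cauchy_Schwarz_ineq2[of "d' x" "d'' x"] mult_left_mono[OF bound[OF x], of "norm (d' x)"] by simp
      hence "- slope x \<le> (1 + M) * (2 * norm (d x) * norm (d' x))"
        using Cauchy_Schwarz_ineq2[of "d x" "d' x"] by (simp add: slope_def algebra_simps)
      also have "\<dots> \<le> (1 + M) * energy x"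
        unfolding energy_def dot_square_norm using M by (intro mult_left_mono sum_squares_bound) auto
      finally show ?thesis .
    qed
    ultimately show "\<exists>y. ((\<lambda>x. energy x * exp ((1 + M) * x)) has_real_derivative y) (at x) \<and> 0 \<le> y"
      by (intro exI[of _ "(slope x + (1 + M) * energy x) * exp ((1 + M) * x)"]) simp
  qed
  also have "energy b = 0" by (simp add: energy_def zero)
  finally have "energy a \<le> 0" by (simp add: mult_le_0_iff)
  moreover have "0 \<le> d a \<bullet> d a" "0 \<le> d' a \<bullet> d' a" by simp_all
  ultimately have "d a \<bullet> d a = 0" unfolding energy_def by linarith
  thus ?thesis by simp
qed

lemma wronskian_constant:
  fixes q u u' v v' :: "real \<Rightarrow> complex"
  assumes "\<And>x. 0 < x \<Longrightarrow> (u has_vector_derivative u' x) (at x)" "\<And>x. 0 < x \<Longrightarrow> (u' has_vector_derivative q x * u x) (at x)"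
    and "\<And>x. 0 < x \<Longrightarrow> (v has_vector_derivative v' x) (at x)" "\<And>x. 0 < x \<Longrightarrow> (v' has_vector_derivative q x * v x) (at x)"
  obtains C where "\<And>x. 0 < x \<Longrightarrow> u x * v' x - u' x * v x = C"
proof -
  have "((\<lambda>x. u x * v' x - u' x * v x) has_vector_derivative 0) (at x within {0<..})" if "x \<in> {0<..}" for x
  proof -
    have "((\<lambda>x. u x * v' x - u' x * v x) has_vector_derivative
        (u x * (q x * v x) + u' x * v' x) - (u' x * v' x + q x * u x * v x)) (at x)"
      using that by (intro has_vector_derivative_diff has_vector_derivative_mult assms) auto
    thus ?thesis by (simp add: has_vector_derivative_at_within algebra_simps)
  qed
  from has_vector_derivative_zero_constant[OF convex_real_interval(3) this]
  obtain C where "\<And>x. x \<in> {0<..} \<Longrightarrow> u x * v' x - u' x * v x = C" by blast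
  thus ?thesis using that by simp
qed

lemma has_vector_derivative_quotient_wronskian:
  fixes u v :: "real \<Rightarrow> complex"
  assumes "(u has_vector_derivative u') (at x)" "(v has_vector_derivative v') (at x)" "u x \<noteq> 0"
  shows "((\<lambda>x. v x / u x) has_vector_derivative (u x * v' - u' * v x) * (1 / (u x)\<^sup>2)) (at x)"
  using has_derivative_divide[OF assms(2,1)[unfolded has_vector_derivative_def] assms(3)]
  unfolding has_vector_derivative_def
  by (rule has_derivative_eq_rhs) (use assms(3) in \<open>simp add: fun_eq_iff power2_eq_square field_simps scaleR_conv_of_real\<close>)

lemma derivative_constant_zero_if_convergent:
  fixes f h :: "real \<Rightarrow> complex"
  assumes deriv: "\<And>x. X \<le> x \<Longrightarrow> (f has_vector_derivative C * h x) (at x)"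
    and h: "\<And>x. X \<le> x \<Longrightarrow> 1 \<le> Re (h x)" and lim: "(f \<longlongrightarrow> l) at_top"
  shows "C = 0"
proof (rule ccontr)
  assume C: "C \<noteq> 0"
  define g where "g x = Re (f x / C)" for x
  have "(g has_real_derivative Re (h x)) (at x)" if "X \<le> x" for x
  proof -
    have "((\<lambda>x. f x / C) has_vector_derivative C * h x / C) (at x)"
      using has_vector_derivative_divide[OF deriv[OF that]] .
    from bounded_linear.has_vector_derivative[OF bounded_linear_Re this] C show ?thesis
      by (simp add: has_real_derivative_iff_has_vector_derivative g_def[abs_def])
  qed
  hence growth: "g X - X \<le> g x - x" if "X \<le> x" for x
    by (rule_tac DERIV_nonneg_imp_nondecreasing[OF that], intro exI[of _ "Re (h _) - 1"])
      (use h in \<open>auto intro!: derivative_eq_intros\<close>)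
  have "(g \<longlongrightarrow> Re (l / C)) at_top" unfolding g_def using C by (intro tendsto_intros lim)
  hence "\<forall>\<^sub>F x in at_top. g x < Re (l / C) + 1" by (rule order_tendstoD) simp
  hence "\<forall>\<^sub>F x in at_top. g x < Re (l / C) + 1 \<and> Re (l / C) + 1 + X - g X \<le> x \<and> X \<le> x"
    by (intro eventually_conj eventually_ge_at_top)
  then obtain x where "g x < Re (l / C) + 1" "Re (l / C) + 1 + X - g X \<le> x" "X \<le> x"
    using eventually_happens'[OF trivial_limit_at_top_linorder] by blast
  thus False using growth[of x] by linarith
qed

definition whittaker_potential :: "complex \<Rightarrow> complex \<Rightarrow> real \<Rightarrow> complex" where
  "whittaker_potential k \<mu> x = 1 / 4 - k / of_real x + (\<mu>\<^sup>2 - 1 / 4) / of_real (x\<^sup>2)"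

lemma is_whittakerWE:
  assumes "is_whittakerW k \<mu> w"
  obtains w' where "\<And>x. 0 < x \<Longrightarrow> (w has_vector_derivative w' x) (at x)"
    "\<And>x. 0 < x \<Longrightarrow> (w' has_vector_derivative whittaker_potential k \<mu> x * w x) (at x)"
    "((\<lambda>x. w x / (of_real (exp (- x / 2)) * of_real x powr k)) \<longlongrightarrow> 1) at_top" "\<And>x. x \<le> 0 \<Longrightarrow> w x = 0"
  using assms unfolding is_whittakerW_def whittaker_potential_def by blast

lemma norm_whittaker_potential_le:
  assumes "0 < x" "x \<le> y"
  shows "norm (whittaker_potential k \<mu> y) \<le> 1 / 4 + norm k / x + norm (\<mu>\<^sup>2 - 1 / 4) / x\<^sup>2"
proof -
  have "norm (whittaker_potential k \<mu> y)
      \<le> norm (1 / 4 :: complex) + norm (k / of_real y) + norm ((\<mu>\<^sup>2 - 1 / 4) / of_real (y\<^sup>2))"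
    unfolding whittaker_potential_def by (intro order_trans[OF norm_triangle_ineq] add_right_mono norm_triangle_ineq4)
  also have "\<dots> = 1 / 4 + norm k / y + norm (\<mu>\<^sup>2 - 1 / 4) / y\<^sup>2"
    unfolding norm_divide norm_of_real using assms by simp
  also have "\<dots> \<le> 1 / 4 + norm k / x + norm (\<mu>\<^sup>2 - 1 / 4) / x\<^sup>2"
    using assms by (intro add_mono divide_left_mono power_mono) auto
  finally show ?thesis .
qed

lemma whittaker_ode_zero_if_eventually_zero:
  assumes D: "\<And>x. 0 < x \<Longrightarrow> (d has_vector_derivative d' x) (at x)"
    "\<And>x. 0 < x \<Longrightarrow> (d' has_vector_derivative whittaker_potential k \<mu> x * d x) (at x)"
    and zero: "\<And>x. X \<le> x \<Longrightarrow> d x = 0" and x: "0 < x"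
  shows "d x = 0"
proof (cases "X \<le> x")
  case False
  have "(d has_vector_derivative 0) (at (X + 1))"
    by (rule has_vector_derivative_transform_within_open[of "\<lambda>_. 0" _ _ "{X<..}"]) (use zero in auto)
  hence "d' (X + 1) = 0"
    using D(1)[of "X + 1"] x False by (intro vector_derivative_unique_at) auto
  thus ?thesis
    using x False zero[of "X + 1"] norm_whittaker_potential_le[OF x, of _ k \<mu>]
    by (intro ode_zero_backwards[of x "X + 1" "1 / 4 + norm k / x + norm (\<mu>\<^sup>2 - 1 / 4) / x\<^sup>2" d d'
          "\<lambda>x. whittaker_potential k \<mu> x * d x"] D) (auto simp: norm_mult intro!: mult_right_mono add_nonneg_nonneg)
qed (rule zero)

lemma whittaker_asymptotic_square:
  fixes k :: real and w :: "real \<Rightarrow> complex"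
  assumes "((\<lambda>x. w x / (of_real (exp (- x / 2)) * of_real x powr of_real k)) \<longlongrightarrow> 1) at_top"
  shows "\<forall>\<^sub>F x in at_top. w x \<noteq> 0 \<and> 1 \<le> Re (1 / (w x)\<^sup>2) \<and> 0 < x"
proof -
  define g where "g x = exp (- x / 2) * x powr k" for x :: real
  have "\<forall>\<^sub>F x in at_top. w x / (of_real (exp (- x / 2)) * of_real x powr of_real k) = w x / of_real (g x)"
    using eventually_gt_at_top[of 0] by eventually_elim (simp add: g_def powr_of_real)
  with assms have lim: "((\<lambda>x. w x / of_real (g x)) \<longlongrightarrow> 1) at_top" by (rule Lim_transform_eventually)
  have "((\<lambda>x. Re (1 / (w x / of_real (g x))\<^sup>2)) \<longlongrightarrow> Re (1 / 1\<^sup>2)) at_top" by (intro tendsto_intros lim) simp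
  hence "\<forall>\<^sub>F x in at_top. 1 / 2 < Re (1 / (w x / of_real (g x))\<^sup>2)" by (rule order_tendstoD(1)) simp
  moreover have "filterlim (\<lambda>x. 1 / (g x)\<^sup>2) at_top at_top" unfolding g_def by real_asymp
  hence "\<forall>\<^sub>F x in at_top. 2 < 1 / (g x)\<^sup>2" by (simp add: filterlim_at_top_dense)
  ultimately show ?thesis
    using tendsto_imp_eventually_ne[OF lim, of 0, OF zero_neq_one[symmetric]] eventually_gt_at_top[of 0]
  proof eventually_elim
    case (elim x)
    have "0 < g x" using elim(4) by (simp add: g_def)
    hence "1 / (w x)\<^sup>2 = of_real (1 / (g x)\<^sup>2) * (1 / (w x / of_real (g x))\<^sup>2)" by (simp add: power_divide)
    hence "Re (1 / (w x)\<^sup>2) = 1 / (g x)\<^sup>2 * Re (1 / (w x / of_real (g x))\<^sup>2)"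
      by (simp only: times_complex.sel Re_complex_of_real Im_complex_of_real)
    also have "\<dots> \<ge> 2 * (1 / 2)" using elim(1,2) by (intro mult_mono) auto
    finally show ?case using elim(3,4) by auto
  qed
qed

lemma is_whittakerW_unique:
  fixes k :: real
  assumes "is_whittakerW (of_real k) \<mu> w1" "is_whittakerW (of_real k) \<mu> w2"
  shows "w1 = w2"
proof -
  obtain w1' where w1: "\<And>x. 0 < x \<Longrightarrow> (w1 has_vector_derivative w1' x) (at x)"
    "\<And>x. 0 < x \<Longrightarrow> (w1' has_vector_derivative whittaker_potential (of_real k) \<mu> x * w1 x) (at x)"
    "((\<lambda>x. w1 x / (of_real (exp (- x / 2)) * of_real x powr of_real k)) \<longlongrightarrow> 1) at_top" "\<And>x. x \<le> 0 \<Longrightarrow> w1 x = 0"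
    using assms(1) by (rule is_whittakerWE) blast
  obtain w2' where w2: "\<And>x. 0 < x \<Longrightarrow> (w2 has_vector_derivative w2' x) (at x)"
    "\<And>x. 0 < x \<Longrightarrow> (w2' has_vector_derivative whittaker_potential (of_real k) \<mu> x * w2 x) (at x)"
    "((\<lambda>x. w2 x / (of_real (exp (- x / 2)) * of_real x powr of_real k)) \<longlongrightarrow> 1) at_top" "\<And>x. x \<le> 0 \<Longrightarrow> w2 x = 0"
    using assms(2) by (rule is_whittakerWE) blast
  define d where "d x = w1 x - w2 x" for x
  define d' where "d' x = w1' x - w2' x" for x
  have d: "(d has_vector_derivative d' x) (at x)"
    "(d' has_vector_derivative whittaker_potential (of_real k) \<mu> x * d x) (at x)" if "0 < x" for x
    unfolding d_def d'_def right_diff_distrib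
    by (intro has_vector_derivative_diff w1 w2 that)+
  obtain C where C: "\<And>x. 0 < x \<Longrightarrow> w1 x * d' x - w1' x * d x = C"
    using wronskian_constant[OF w1(1,2) d] by metis
  obtain X where X: "\<And>x. X \<le> x \<Longrightarrow> w1 x \<noteq> 0" "\<And>x. X \<le> x \<Longrightarrow> 1 \<le> Re (1 / (w1 x)\<^sup>2)" "\<And>x. X \<le> x \<Longrightarrow> 0 < x"
    using whittaker_asymptotic_square[OF w1(3)] unfolding eventually_at_top_linorder by blast
  have deriv: "((\<lambda>x. d x / w1 x) has_vector_derivative C * (1 / (w1 x)\<^sup>2)) (at x)" if "X \<le> x" for x
    using has_vector_derivative_quotient_wronskian[OF w1(1) d(1), of x] C X that by simp
  have lim: "((\<lambda>x. d x / w1 x) \<longlongrightarrow> 0) at_top"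
  proof -
    let ?g = "\<lambda>x. of_real (exp (- x / 2)) * of_real x powr of_real k :: complex"
    have "((\<lambda>x. 1 - (w2 x / ?g x) / (w1 x / ?g x)) \<longlongrightarrow> 1 - 1 / 1) at_top"
      by (intro tendsto_intros w1 w2) simp
    moreover have "\<forall>\<^sub>F x in at_top. 1 - (w2 x / ?g x) / (w1 x / ?g x) = d x / w1 x"
      using eventually_ge_at_top[of X]
      by eventually_elim (use X in \<open>force simp: d_def diff_divide_distrib\<close>)
    ultimately show ?thesis by (simp add: Lim_transform_eventually)
  qed
  have "C = 0" by (rule derivative_constant_zero_if_convergent[OF deriv X(2) lim])
  hence "((\<lambda>x. d x / w1 x) has_vector_derivative 0) (at x within {X..})" if "x \<in> {X..}" for x
    using deriv[of x] that by (simp add: has_vector_derivative_at_within)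
  from has_vector_derivative_zero_constant[OF convex_real_interval(1) this]
  obtain c where c: "\<And>x. X \<le> x \<Longrightarrow> d x / w1 x = c" by auto
  have "((\<lambda>x. d x / w1 x) \<longlongrightarrow> c) at_top"
    by (rule tendsto_eventually, rule eventually_mono[OF eventually_ge_at_top[of X] c])
  hence "c = 0" using lim tendsto_unique trivial_limit_at_top_linorder by blast
  hence zero: "d x = 0" if "X \<le> x" for x using c X that by force
  have "d x = 0" if "0 < x" for x by (rule whittaker_ode_zero_if_eventually_zero[OF d zero that])
  hence "w1 x = w2 x" for x using w1(4)[of x] w2(4)[of x] by (cases "0 < x") (auto simp: d_def)
  thus ?thesis by auto
qed

definition whittaker_candidate :: "complex \<Rightarrow> complex \<Rightarrow> complex \<Rightarrow> complex \<Rightarrow> complex" where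
  "whittaker_candidate k a b s = exp (- s / 2) * s powr k * tricomi a b s"

definition whittaker_candidate_deriv :: "complex \<Rightarrow> complex \<Rightarrow> complex \<Rightarrow> complex \<Rightarrow> complex" where
  "whittaker_candidate_deriv k a b s = exp (- s / 2) * s powr k
      * ((- 1 / 2 + k / s) * tricomi a b s + a * (tricomi a b s - tricomi (a + 1) b s) / s)"

lemma exp_powr_has_derivative:
  assumes "0 < Re s"
  shows "((\<lambda>s. exp (- s / 2) * s powr k) has_field_derivative exp (- s / 2) * s powr k * (- 1 / 2 + k / s)) (at s)"
proof -
  have "s \<notin> \<real>\<^sub>\<le>\<^sub>0" "s \<noteq> 0" using assms by (auto simp: complex_nonpos_Reals_iff)
  thus ?thesis by (auto intro!: derivative_eq_intros simp: powr_diff field_simps)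
qed

lemma whittaker_candidate_has_derivative:
  "0 < Re s \<Longrightarrow> (whittaker_candidate k a b has_field_derivative whittaker_candidate_deriv k a b s) (at s)"
  unfolding whittaker_candidate_def[abs_def] whittaker_candidate_deriv_def
  by (rule derivative_eq_intros exp_powr_has_derivative tricomi_has_derivative | assumption)+ (simp add: algebra_simps)

lemma whittaker_candidate_deriv_has_derivative:
  assumes k: "2 * k = 1 - a - b" and \<mu>: "4 * \<mu>\<^sup>2 = (a - b)\<^sup>2" and s: "0 < Re s"
  shows "(whittaker_candidate_deriv k a b has_field_derivative
    (1 / 4 - k / s + (\<mu>\<^sup>2 - 1 / 4) / s\<^sup>2) * whittaker_candidate k a b s) (at s)"
proof -
  define H where "H = tricomi a b"
  define H1 where "H1 = tricomi (a + 1) b"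
  define E where "E s = exp (- s / 2) * s powr k" for s :: complex
  have nz: "s \<noteq> 0" using s by auto
  have H: "(H has_field_derivative a * (H s - H1 s) / s) (at s)"
    and H1: "(H1 has_field_derivative ((s + b) * H1 s - s * H s) / s) (at s)"
    unfolding H_def H1_def by (rule tricomi_has_derivative[OF s] tricomi_Suc_has_derivative[OF s])+
  have E: "(E has_field_derivative E s * (- 1 / 2 + k / s)) (at s)"
    unfolding E_def by (rule exp_powr_has_derivative[OF s])
  have "((\<lambda>s. E s * ((- 1 / 2 + k / s) * H s + a * (H s - H1 s) / s)) has_field_derivative
      E s * ((- 1 / 2 + k / s) * ((- 1 / 2 + k / s) * H s + a * (H s - H1 s) / s)
      + ((- k / s\<^sup>2) * H s + (- 1 / 2 + k / s) * (a * (H s - H1 s) / s)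
          + (a * (a * (H s - H1 s) / s - ((s + b) * H1 s - s * H s) / s) * s - a * (H s - H1 s)) / s\<^sup>2))) (at s)"
    by (rule derivative_eq_intros E H H1 nz refl)+ (use nz in \<open>simp add: power2_eq_square field_simps\<close>)
  moreover have "(- 1 / 2 + k / s) * ((- 1 / 2 + k / s) * H s + a * (H s - H1 s) / s)
      + ((- k / s\<^sup>2) * H s + (- 1 / 2 + k / s) * (a * (H s - H1 s) / s)
          + (a * (a * (H s - H1 s) / s - ((s + b) * H1 s - s * H s) / s) * s - a * (H s - H1 s)) / s\<^sup>2)
      = (1 / 4 - k / s + (\<mu>\<^sup>2 - 1 / 4) / s\<^sup>2) * H s"
  proof -
    have kappa: "k = (1 - a - b) / 2" and mu: "\<mu>\<^sup>2 = (a - b)\<^sup>2 / 4"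
      using k \<mu> by (metis nonzero_mult_div_cancel_left zero_neq_numeral)+
    define h where "h = H s / s\<^sup>2"
    define h1 where "h1 = H1 s / s\<^sup>2"
    have h: "H s = h * s\<^sup>2" "H1 s = h1 * s\<^sup>2" using nz by (auto simp: h_def h1_def)
    show ?thesis unfolding kappa mu h using nz by (simp add: power2_eq_square field_simps)
  qed
  ultimately show ?thesis
    by (simp add: whittaker_candidate_deriv_def[abs_def] whittaker_candidate_def E_def H_def H1_def mult_ac)
qed

lemma is_whittakerW_candidate:
  assumes k: "2 * k = 1 - a - b" and \<mu>: "4 * \<mu>\<^sup>2 = (a - b)\<^sup>2"
  shows "is_whittakerW k \<mu> (\<lambda>x. if x \<le> 0 then 0 else whittaker_candidate k a b (of_real x))"
    (is "is_whittakerW k \<mu> ?w")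
  unfolding is_whittakerW_def
proof (intro conjI exI allI impI)
  let ?v = "\<lambda>x. whittaker_candidate_deriv k a b (of_real x)"
  fix x :: real assume x: "0 < x"
  have "((\<lambda>x. whittaker_candidate k a b (of_real x)) has_vector_derivative ?v x) (at x)"
    using has_vector_derivative_real_field[OF whittaker_candidate_has_derivative[of "of_real x"]] x by simp
  thus "(?w has_vector_derivative ?v x) (at x)"
    by (rule has_vector_derivative_transform_within_open[of _ _ _ "{0<..}"]) (use x in auto)
  show "(?v has_vector_derivative (1 / 4 - k / of_real x + (\<mu>\<^sup>2 - 1 / 4) / of_real (x\<^sup>2)) * ?w x) (at x)"
    using has_vector_derivative_real_field[OF whittaker_candidate_deriv_has_derivative[OF k \<mu>, of "of_real x"]] x
    by simp
next
  show "((\<lambda>x. ?w x / (of_real (exp (- x / 2)) * of_real x powr k)) \<longlongrightarrow> 1) at_top"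
  proof (rule Lim_transform_eventually[OF tricomi_at_top[of a b]])
    show "\<forall>\<^sub>F x in at_top. tricomi a b (of_real x) = ?w x / (of_real (exp (- x / 2)) * of_real x powr k)"
      using eventually_gt_at_top[of 0]
      by eventually_elim (simp add: whittaker_candidate_def flip: exp_of_real)
  qed
qed simp

lemma whittakerW_eq_tricomi:
  fixes k :: real
  assumes "2 * of_real k = 1 - a - b" "4 * \<mu>\<^sup>2 = (a - b)\<^sup>2" "0 < x"
  shows "whittakerW (of_real k) \<mu> x = of_real (exp (- x / 2) * x powr k) * tricomi a b (of_real x)"
proof -
  note candidate = is_whittakerW_candidate[OF assms(1,2)]
  have "whittakerW (of_real k) \<mu> = (\<lambda>x. if x \<le> 0 then 0 else whittaker_candidate (of_real k) a b (of_real x))"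
    unfolding whittakerW_def
    by (rule the_equality[where P="is_whittakerW (of_real k) \<mu>", OF candidate]) (rule is_whittakerW_unique[OF _ candidate])
  thus ?thesis using assms(3) by (simp add: whittaker_candidate_def powr_of_real flip: exp_of_real)
qed

section \<open>Correlations of Frobenius coordinates\<close>

text \<open>Pairs of decreasing lists of equal length are the (modified) Frobenius coordinates of Young diagrams.\<close>

type_synonym frobenius = "nat list \<times> nat list"

definition frob_pairs :: "frobenius set" where
  "frob_pairs = {(ps, qs). length ps = length qs \<and> sorted_wrt (>) ps \<and> sorted_wrt (>) qs}"

definition frob_pairs_below :: "nat \<Rightarrow> frobenius set" where
  "frob_pairs_below N = {c \<in> frob_pairs. set (fst c) \<subseteq> {..<N} \<and> set (snd c) \<subseteq> {..<N}}"

definition frob_weight :: "(nat \<Rightarrow> real) \<Rightarrow> (nat \<Rightarrow> real) \<Rightarrow> frobenius \<Rightarrow> real" where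
  "frob_weight F G c = (\<Prod>i<length (fst c). F (fst c ! i) * G (snd c ! i)) *
    (detN (length (fst c)) (\<lambda>i j. 1 / real (fst c ! i + snd c ! j + 1)))\<^sup>2"

definition cauchy_matrix :: "(nat \<Rightarrow> real) \<Rightarrow> (nat \<Rightarrow> real) \<Rightarrow> nat \<Rightarrow> nat \<Rightarrow> real" where
  "cauchy_matrix F G p q = sqrt (F p) * sqrt (G q) / (real p + real q + 1)"

lemma detN_scale:
  "detN d (\<lambda>i j. r i * s j * M i j) = (\<Prod>i<d. r i) * (\<Prod>j<d. s j) * detN d (M :: nat \<Rightarrow> nat \<Rightarrow> 'a::comm_ring_1)"
  unfolding detN_def sum_distrib_left
proof (intro sum.cong refl)
  fix p assume "p \<in> {p. p permutes {..<d}}"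
  hence "(\<Prod>i<d. s (p i)) = (\<Prod>i<d. s i)" using prod.permute[of p "{..<d}" s] by (simp add: o_def)
  thus "of_int (sign p) * (\<Prod>i<d. r i * s (p i) * M i (p i))
      = (\<Prod>i<d. r i) * (\<Prod>j<d. s j) * (of_int (sign p) * (\<Prod>i<d. M i (p i)))"
    by (simp add: prod.distrib mult_ac)
qed

lemma frob_weight_nonneg:
  "(\<And>p. 0 \<le> F p) \<Longrightarrow> (\<And>q. 0 \<le> G q) \<Longrightarrow> 0 \<le> frob_weight F G c"
  unfolding frob_weight_def by (intro mult_nonneg_nonneg prod_nonneg) auto

lemma frob_weight_det:
  assumes "\<And>p. 0 \<le> F p" "\<And>q. 0 \<le> G q" "length qs = length ps"
  shows "frob_weight F G (ps, qs) = (detN (length ps) (\<lambda>i j. cauchy_matrix F G (ps ! i) (qs ! j)))\<^sup>2"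
proof -
  have "detN (length ps) (\<lambda>i j. cauchy_matrix F G (ps ! i) (qs ! j))
      = (\<Prod>i<length ps. sqrt (F (ps ! i))) * (\<Prod>j<length ps. sqrt (G (qs ! j)))
      * detN (length ps) (\<lambda>i j. 1 / real (ps ! i + qs ! j + 1))"
    unfolding detN_scale[symmetric] by (simp add: cauchy_matrix_def add_ac)
  moreover have "(\<Prod>i<length ps. sqrt (F (ps ! i)))\<^sup>2 = (\<Prod>i<length ps. F (ps ! i))"
      "(\<Prod>i<length ps. sqrt (G (qs ! i)))\<^sup>2 = (\<Prod>i<length ps. G (qs ! i))"
    unfolding prod_power_distrib using assms by simp_all
  ultimately show ?thesis unfolding frob_weight_def by (simp add: power_mult_distrib prod.distrib del: of_nat_add)
qed

lemma sum_frob_weight_snd: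
  assumes F: "\<And>p. 0 \<le> F p" and G: "\<And>q. 0 \<le> G q" and ps: "sorted_wrt (>) ps" and T: "finite T"
  shows "(\<Sum>qs\<in>decreasing_lists (length ps) T. frob_weight F G (ps, qs))
      = det_on (set ps) (gram T (cauchy_matrix F G))"
proof -
  let ?A = "cauchy_matrix F G"
  have "(\<Sum>qs\<in>decreasing_lists (length ps) T. frob_weight F G (ps, qs))
      = (\<Sum>qs\<in>decreasing_lists (length ps) T.
          detN (length ps) (\<lambda>i j. ?A (ps ! i) (qs ! j)) * detN (length ps) (\<lambda>i j. ?A (ps ! i) (qs ! j)))"
    by (intro sum.cong refl) (subst frob_weight_det[OF F G], auto simp: decreasing_lists_def power2_eq_square)
  also have "\<dots> = detN (length ps) (\<lambda>i j. \<Sum>q\<in>T. ?A (ps ! i) q * ?A (ps ! j) q)"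
    by (rule cauchy_binet[OF T, symmetric])
  also have "\<dots> = det_on ((!) ps ` {..<length ps}) (gram T ?A)"
    unfolding detN_eq_det_on gram_def
    by (rule det_on_reindex[symmetric])
      (use distinct_decreasing_list[OF ps] in \<open>auto simp: inj_on_nth\<close>)
  also have "(!) ps ` {..<length ps} = set ps" by (auto simp: set_conv_nth)
  finally show ?thesis .
qed

lemma bij_betw_set_decreasing_lists:
  "bij_betw set {ps :: nat list. sorted_wrt (>) ps \<and> set ps \<subseteq> {..<N} \<and> X \<subseteq> set ps} {S. X \<subseteq> S \<and> S \<subseteq> {..<N}}"
  unfolding bij_betw_def
proof (intro conjI inj_onI equalityI subsetI)
  fix S assume S: "S \<in> {S. X \<subseteq> S \<and> S \<subseteq> {..<N}}"
  hence "finite S" using finite_subset by auto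
  note d = decreasing_list_of_set[OF this]
  thus "S \<in> set ` {ps :: nat list. sorted_wrt (>) ps \<and> set ps \<subseteq> {..<N} \<and> X \<subseteq> set ps}"
    using S by (intro image_eqI[of _ _ "rev (sorted_list_of_set S)"]) auto
qed (auto intro: decreasing_list_unique)

lemma sum_frob_weight_principal_minors:
  assumes F: "\<And>p. 0 \<le> F p" and G: "\<And>q. 0 \<le> G q"
  shows "(\<Sum>c | c \<in> frob_pairs_below N \<and> X \<subseteq> set (fst c). frob_weight F G c)
      = (\<Sum>S | X \<subseteq> S \<and> S \<subseteq> {..<N}. det_on S (gram {..<N} (cauchy_matrix F G)))"
proof -
  define PS where "PS = {ps :: nat list. sorted_wrt (>) ps \<and> set ps \<subseteq> {..<N} \<and> X \<subseteq> set ps}"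
  have bij: "bij_betw set PS {S. X \<subseteq> S \<and> S \<subseteq> {..<N}}"
    unfolding PS_def by (rule bij_betw_set_decreasing_lists)
  have "finite {S. X \<subseteq> S \<and> S \<subseteq> {..<N}}" by (rule finite_subset[of _ "Pow {..<N}"]) auto
  hence fin: "finite PS" using bij_betw_finite[OF bij] by simp
  have "{c \<in> frob_pairs_below N. X \<subseteq> set (fst c)} = Sigma PS (\<lambda>ps. decreasing_lists (length ps) {..<N})"
    by (auto simp: frob_pairs_below_def frob_pairs_def PS_def decreasing_lists_def)
  hence "(\<Sum>c | c \<in> frob_pairs_below N \<and> X \<subseteq> set (fst c). frob_weight F G c)
      = (\<Sum>ps\<in>PS. \<Sum>qs\<in>decreasing_lists (length ps) {..<N}. frob_weight F G (ps, qs))"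
    using sum.Sigma[of PS "\<lambda>ps. decreasing_lists (length ps) {..<N}" "\<lambda>ps qs. frob_weight F G (ps, qs)"] fin
    by (simp add: finite_decreasing_lists)
  also have "\<dots> = (\<Sum>ps\<in>PS. det_on (set ps) (gram {..<N} (cauchy_matrix F G)))"
    by (intro sum.cong refl sum_frob_weight_snd F G) (auto simp: PS_def)
  also have "\<dots> = (\<Sum>S | X \<subseteq> S \<and> S \<subseteq> {..<N}. det_on S (gram {..<N} (cauchy_matrix F G)))"
    by (rule sum.reindex_bij_betw[OF bij])
  finally show ?thesis .
qed

lemma truncated_correlation:
  assumes F: "\<And>p. 0 \<le> F p" and G: "\<And>q. 0 \<le> G q" and X: "X \<subseteq> {..<N}"
    and M: "is_resolvent {..<N} (gram {..<N} (cauchy_matrix F G)) M"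
  shows "(\<Sum>c | c \<in> frob_pairs_below N \<and> X \<subseteq> set (fst c). frob_weight F G c)
      = (\<Sum>c\<in>frob_pairs_below N. frob_weight F G c) * det_on X (\<lambda>i j. delta i j - M i j)"
  using L_ensemble_correlation[OF M _ X] sum_frob_weight_principal_minors[of F G N X, OF F G]
    sum_frob_weight_principal_minors[of F G N "{}", OF F G]
  by simp

lemma has_sum_exhaust:
  assumes sum: "(f has_sum S) A" and fin: "\<And>N. finite (B N)" and sub: "\<And>N. B N \<subseteq> A"
    and mono: "mono B" and exhaust: "A \<subseteq> (\<Union>N. B N)"
  shows "(\<lambda>N. sum f (B N)) \<longlonglongrightarrow> S"
proof -
  have "filterlim B (finite_subsets_at_top A) sequentially"
    unfolding filterlim_finite_subsets_at_top
  proof (intro allI impI, elim conjE)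
    fix X assume "finite X" "X \<subseteq> A"
    hence "\<exists>N. X \<subseteq> B N"
    proof (induction X rule: finite_induct)
      case (insert x X)
      then obtain N1 N2 where "x \<in> B N1" "X \<subseteq> B N2" using exhaust by blast
      hence "insert x X \<subseteq> B (max N1 N2)"
        using monoD[OF mono, of N1 "max N1 N2"] monoD[OF mono, of N2 "max N1 N2"] by auto
      thus ?case by blast
    qed simp
    then obtain N where "X \<subseteq> B N" by blast
    hence "\<forall>M\<ge>N. X \<subseteq> B M" using monoD[OF mono] by blast
    thus "\<forall>\<^sub>F M in sequentially. finite (B M) \<and> X \<subseteq> B M \<and> B M \<subseteq> A"
      using fin sub by (auto simp: eventually_sequentially)
  qed
  with sum[unfolded has_sum_def] show ?thesis by (rule filterlim_compose)
qed

lemma finite_frob_pairs_below: "finite (frob_pairs_below N)"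
proof (rule finite_subset)
  let ?L = "{xs. set xs \<subseteq> {..<N} \<and> length xs \<le> N}"
  have "length xs \<le> N" if "sorted_wrt (>) xs" "set xs \<subseteq> {..<N}" for xs :: "nat list"
    using card_mono[OF _ that(2)] distinct_card[OF distinct_decreasing_list[OF that(1)]] by simp
  thus "frob_pairs_below N \<subseteq> ?L \<times> ?L"
    unfolding frob_pairs_below_def frob_pairs_def by force
  show "finite (?L \<times> ?L)" by (intro finite_cartesian_product finite_lists_length_le) auto
qed

lemma sum_frob_pairs_below_tendsto:
  fixes f :: "frobenius \<Rightarrow> real"
  assumes "f summable_on frob_pairs"
  shows "(\<lambda>N. \<Sum>c | c \<in> frob_pairs_below N \<and> X \<subseteq> set (fst c). f c) \<longlonglongrightarrow> infsum f {c \<in> frob_pairs. X \<subseteq> set (fst c)}"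
proof (rule has_sum_exhaust)
  show "(f has_sum infsum f {c \<in> frob_pairs. X \<subseteq> set (fst c)}) {c \<in> frob_pairs. X \<subseteq> set (fst c)}"
    by (intro has_sum_infsum summable_on_subset_banach[OF assms]) auto
  show "finite {c \<in> frob_pairs_below N. X \<subseteq> set (fst c)}" for N
    by (rule finite_subset[OF _ finite_frob_pairs_below[of N]]) auto
  have "c \<in> frob_pairs_below (Suc (Max (set (fst c) \<union> set (snd c))))" if "c \<in> frob_pairs" for c
    using that by (auto simp: frob_pairs_below_def less_Suc_eq_le)
  thus "{c \<in> frob_pairs. X \<subseteq> set (fst c)} \<subseteq> (\<Union>N. {c \<in> frob_pairs_below N. X \<subseteq> set (fst c)})" by blast
qed (auto simp: frob_pairs_below_def mono_def)

lemma frob_weight_correlation: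
  fixes K :: "nat \<Rightarrow> nat \<Rightarrow> complex"
  assumes F: "\<And>p. 0 \<le> F p" and G: "\<And>q. 0 \<le> G q"
    and sum: "frob_weight F G summable_on frob_pairs"
    and M: "\<And>N. is_resolvent {..<N} (gram {..<N} (cauchy_matrix F G)) (M N)"
    and lim: "\<And>p p'. (\<lambda>N. of_real (delta p' p - M N p' p)) \<longlonglongrightarrow> K p' p"
    and x: "inj_on x {..<n}"
  shows "complex_of_real (infsum (frob_weight F G) {c \<in> frob_pairs. x ` {..<n} \<subseteq> set (fst c)})
      = of_real (infsum (frob_weight F G) frob_pairs) * detN n (\<lambda>i j. K (x i) (x j))"
proof -
  define X where "X = x ` {..<n}"
  let ?w = "frob_weight F G" and ?D = "\<lambda>N. detN n (\<lambda>i j. delta (x i) (x j) - M N (x i) (x j))"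
  have "(\<lambda>N. \<Sum>c\<in>frob_pairs_below N. ?w c) \<longlonglongrightarrow> infsum ?w frob_pairs"
    using sum_frob_pairs_below_tendsto[OF sum, of "{}"] by simp
  moreover have "(\<lambda>N. complex_of_real (?D N)) \<longlonglongrightarrow> detN n (\<lambda>i j. K (x i) (x j))"
    unfolding detN_def of_real_sum of_real_mult of_real_prod of_real_of_int_eq
    by (intro tendsto_intros lim)
  ultimately have "(\<lambda>N. of_real (\<Sum>c\<in>frob_pairs_below N. ?w c) * complex_of_real (?D N))
      \<longlonglongrightarrow> of_real (infsum ?w frob_pairs) * detN n (\<lambda>i j. K (x i) (x j))"
    by (intro tendsto_intros)
  moreover have "\<forall>\<^sub>F N in sequentially. of_real (\<Sum>c\<in>frob_pairs_below N. ?w c) * complex_of_real (?D N)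
      = of_real (\<Sum>c | c \<in> frob_pairs_below N \<and> X \<subseteq> set (fst c). ?w c)"
    using eventually_gt_at_top[of "Max (insert 0 X)"]
  proof eventually_elim
    case (elim N)
    hence "X \<subseteq> {..<N}" by (auto simp: X_def)
    from truncated_correlation[OF F G this M]
    have "(\<Sum>c | c \<in> frob_pairs_below N \<and> X \<subseteq> set (fst c). ?w c)
        = (\<Sum>c\<in>frob_pairs_below N. ?w c) * det_on X (\<lambda>i j. delta i j - M N i j)" .
    also have "det_on X (\<lambda>i j. delta i j - M N i j) = ?D N"
      unfolding X_def detN_eq_det_on by (rule det_on_reindex[OF x]) simp
    finally show ?case by simp
  qed
  ultimately have "(\<lambda>N. complex_of_real (\<Sum>c | c \<in> frob_pairs_below N \<and> X \<subseteq> set (fst c). ?w c))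
      \<longlonglongrightarrow> of_real (infsum ?w frob_pairs) * detN n (\<lambda>i j. K (x i) (x j))"
    by (rule Lim_transform_eventually)
  from LIMSEQ_unique[OF tendsto_of_real[OF sum_frob_pairs_below_tendsto[OF sum]] this]
  show ?thesis unfolding X_def .
qed

lemma sums_tail_bound:
  fixes f :: "nat \<Rightarrow> 'a::banach"
  assumes f: "f sums S" and b: "summable b" and bound: "\<And>n. norm (f n) \<le> C * b n"
  shows "norm (S - (\<Sum>n<N. f n)) \<le> C * (\<Sum>n. b (n + N))"
proof -
  have "S - (\<Sum>n<N. f n) = (\<Sum>n. f (n + N))"
    using suminf_minus_initial_segment[OF sums_summable[OF f]] sums_unique[OF f] by simp
  also have "norm \<dots> \<le> (\<Sum>n. C * b (n + N))"
    using b bound by (intro norm_suminf_le summable_mult summable_ignore_initial_segment)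
  also have "\<dots> = C * (\<Sum>n. b (n + N))" using b by (intro suminf_mult summable_ignore_initial_segment)
  finally show ?thesis .
qed

lemma equilipschitz_limit:
  fixes f :: "nat \<Rightarrow> real \<Rightarrow> 'a::metric_space"
  assumes lip: "\<forall>\<^sub>F n in sequentially. \<forall>x\<ge>p. dist (f n x) (f n p) \<le> C * (x - p)"
    and lim: "\<And>x. p < x \<Longrightarrow> (\<lambda>n. f n x) \<longlonglongrightarrow> g x" and g: "(g \<longlongrightarrow> D) (at_right p)"
  shows "(\<lambda>n. f n p) \<longlonglongrightarrow> D"
proof (rule tendstoI)
  fix e :: real assume e: "0 < e"
  have "((\<lambda>x. C * (x - p)) \<longlongrightarrow> C * (p - p)) (at_right p)" by (intro tendsto_intros)
  hence "\<forall>\<^sub>F x in at_right p. C * (x - p) < e / 3" by (rule order_tendstoD) (use e in simp)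
  moreover have "\<forall>\<^sub>F x in at_right p. dist (g x) D < e / 3" using tendstoD[OF g, of "e / 3"] e by simp
  ultimately have "\<forall>\<^sub>F x in at_right p. C * (x - p) < e / 3 \<and> dist (g x) D < e / 3 \<and> p < x"
    by (intro eventually_conj eventually_at_right_less)
  then obtain x where x: "C * (x - p) < e / 3" "dist (g x) D < e / 3" "p < x"
    using eventually_happens'[OF trivial_limit_at_right_real] by blast
  have "\<forall>\<^sub>F n in sequentially. dist (f n x) (g x) < e / 3" using tendstoD[OF lim[OF x(3)], of "e / 3"] e by simp
  with lip show "\<forall>\<^sub>F n in sequentially. dist (f n p) D < e"
  proof eventually_elim
    case (elim n)
    hence "dist (f n x) (f n p) < e / 3" using x(1,3) by (meson less_imp_le order_le_less_trans)
    thus ?case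
      using dist_triangle[of "f n p" D "f n x"] dist_triangle[of "f n x" D "g x"] elim(2) x(2)
      by (simp add: dist_commute)
  qed
qed

locale cauchy_system =
  fixes F G :: "nat \<Rightarrow> real" and M :: "nat \<Rightarrow> nat \<Rightarrow> nat \<Rightarrow> real"
  assumes F: "\<And>p. 0 \<le> F p" "summable F" and G: "\<And>q. 0 \<le> G q" "summable G"
    and M: "\<And>N. is_resolvent {..<N} (gram {..<N} (cauchy_matrix F G)) (M N)"
begin

definition s :: "nat \<Rightarrow> real" where "s p = sqrt (F p)"

definition row :: "nat \<Rightarrow> real \<Rightarrow> nat \<Rightarrow> real" where
  "row N x j = s j * (\<Sum>q<N. G q / ((x + real q + 1) * (real j + real q + 1)))"

definition transform :: "nat \<Rightarrow> (nat \<Rightarrow> complex) \<Rightarrow> real \<Rightarrow> complex" where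
  "transform N Y x = (\<Sum>j<N. of_real (s j) * Y j * of_real (row N x j))"

text \<open>The solution of the truncated system with right-hand side $h$, extended from the integers to all $x > -1$.\<close>

definition solution :: "nat \<Rightarrow> (real \<Rightarrow> real) \<Rightarrow> real \<Rightarrow> real" where
  "solution N h x = h x - (\<Sum>j<N. (\<Sum>k<N. M N j k * (s k * h (real k))) * row N x j)"

lemma s_square: "s p * s p = F p" and s_nonneg: "0 \<le> s p"
  unfolding s_def using F(1)[of p] by simp_all

lemma suminf_nonneg_FG: "0 \<le> suminf F" "0 \<le> suminf G"
  using F G by (auto intro: suminf_nonneg)

lemma gram_eq_row: "gram {..<N} (cauchy_matrix F G) p k = s p * row N (real p) k"
  unfolding gram_def row_def sum_distrib_left
proof (intro sum.cong refl)
  fix q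
  have "sqrt (G q) * sqrt (G q) = G q" using G(1) by simp
  thus "cauchy_matrix F G p q * cauchy_matrix F G k q
      = s p * (s k * (G q / ((real p + real q + 1) * (real k + real q + 1))))"
    unfolding cauchy_matrix_def s_def times_divide_times_eq by (simp add: mult_ac)
qed

lemma solution_at_nat:
  assumes "p < N"
  shows "s p * solution N h (real p) = (\<Sum>k<N. M N p k * (s k * h (real k)))"
proof -
  let ?v = "\<lambda>j. \<Sum>k<N. M N j k * (s k * h (real k))"
  have "?v p + (\<Sum>k<N. gram {..<N} (cauchy_matrix F G) p k * ?v k) = s p * h (real p)"
    using is_resolvent_apply[OF M, of N p "\<lambda>k. s k * h (real k)"] assms by simp
  moreover have "(\<Sum>k<N. gram {..<N} (cauchy_matrix F G) p k * ?v k) = s p * (\<Sum>k<N. ?v k * row N (real p) k)"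
    unfolding gram_eq_row sum_distrib_left[of "s p"] by (intro sum.cong refl) (simp only: mult_ac)
  ultimately show ?thesis by (simp add: solution_def right_diff_distrib)
qed

lemma solution_eq:
  "of_real (solution N h x) + transform N (\<lambda>j. of_real (solution N h (real j))) x = of_real (h x)"
proof -
  have "transform N (\<lambda>j. of_real (solution N h (real j))) x
      = of_real (\<Sum>j<N. (\<Sum>k<N. M N j k * (s k * h (real k))) * row N x j)"
    unfolding transform_def of_real_sum
    by (intro sum.cong refl) (simp add: solution_at_nat[symmetric])
  thus ?thesis by (simp add: solution_def)
qed

lemma abs_row_le:
  assumes x: "- 1 < x"
  shows "\<bar>row N x j\<bar> \<le> s j * (suminf G / (x + 1))"
proof -
  let ?t = "\<lambda>q. G q / ((x + real q + 1) * (real j + real q + 1))"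
  have "0 \<le> ?t q" "?t q \<le> G q / (x + 1)" for q
  proof -
    show "0 \<le> ?t q" using x G by auto
    have "(x + 1) * 1 \<le> (x + real q + 1) * (real j + real q + 1)" using x by (intro mult_mono) auto
    thus "?t q \<le> G q / (x + 1)" using x G by (intro divide_left_mono) (auto intro!: mult_pos_pos)
  qed
  hence "\<bar>\<Sum>q<N. ?t q\<bar> \<le> (\<Sum>q<N. G q) / (x + 1)"
    unfolding sum_divide_distrib by (subst abs_of_nonneg) (auto intro!: sum_nonneg sum_mono)
  also have "\<dots> \<le> suminf G / (x + 1)" using G x by (intro divide_right_mono sum_le_suminf) auto
  finally show ?thesis unfolding row_def abs_mult abs_of_nonneg[OF s_nonneg] by (intro mult_left_mono s_nonneg)
qed

lemma norm_weighted_sum_le: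
  fixes v b :: "nat \<Rightarrow> 'a::real_normed_algebra"
  assumes b: "\<And>j. j < N \<Longrightarrow> norm (b j) \<le> s j * C" and C: "0 \<le> C"
  shows "norm (\<Sum>j<N. v j * b j) \<le> sqrt (\<Sum>j<N. (norm (v j))\<^sup>2) * (C * sqrt (suminf F))"
proof -
  have "norm (\<Sum>j<N. v j * b j) \<le> (\<Sum>j<N. \<bar>norm (v j)\<bar> * \<bar>norm (b j)\<bar>)"
    by (rule order_trans[OF norm_sum]) (simp add: norm_mult_ineq sum_mono)
  also have "\<dots> \<le> L2_set (\<lambda>j. norm (v j)) {..<N} * L2_set (\<lambda>j. norm (b j)) {..<N}" by (rule L2_set_mult_ineq)
  also have "\<dots> \<le> sqrt (\<Sum>j<N. (norm (v j))\<^sup>2) * (C * sqrt (suminf F))"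
  proof (intro mult_mono)
    have "(\<Sum>j<N. (norm (b j))\<^sup>2) \<le> (\<Sum>j<N. F j * C\<^sup>2)"
    proof (rule sum_mono)
      fix j assume "j \<in> {..<N}"
      hence "(norm (b j))\<^sup>2 \<le> (s j * C)\<^sup>2" using b by (intro power_mono) auto
      thus "(norm (b j))\<^sup>2 \<le> F j * C\<^sup>2"
        by (simp add: power_mult_distrib power2_eq_square[of "s j"] s_square)
    qed
    also have "\<dots> \<le> suminf F * C\<^sup>2"
      unfolding sum_distrib_right[symmetric] using F by (intro mult_right_mono sum_le_suminf) auto
    finally show "L2_set (\<lambda>j. norm (b j)) {..<N} \<le> C * sqrt (suminf F)"
      unfolding L2_set_def using C real_sqrt_le_mono[of _ "suminf F * C\<^sup>2"] by (simp add: real_sqrt_mult mult.commute)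
  qed (auto simp: L2_set_def sum_nonneg)
  finally show ?thesis .
qed

lemma transform_contraction:
  fixes d :: "nat \<Rightarrow> complex"
  assumes small: "\<And>p. p < N \<Longrightarrow> norm (d p + transform N d (real p)) \<le> e" and e: "0 \<le> e"
  shows "sqrt (\<Sum>p<N. (norm (of_real (s p) * d p))\<^sup>2) \<le> sqrt (suminf F) * e"
proof -
  have "(\<Sum>p<N. (norm (of_real (s p) * d p))\<^sup>2) \<le> (\<Sum>p<N. (norm (of_real (s p) * d p
      + (\<Sum>k<N. of_real (gram {..<N} (cauchy_matrix F G) p k) * (of_real (s k) * d k))))\<^sup>2)"
    by (rule sum_squares_le_one_plus_gram)
  also have "\<dots> \<le> (\<Sum>p<N. F p * e\<^sup>2)"
  proof (rule sum_mono)
    fix p assume "p \<in> {..<N}"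
    hence "(s p * norm (d p + transform N d (real p)))\<^sup>2 \<le> (s p * e)\<^sup>2"
      by (intro power_mono mult_left_mono s_nonneg small) (auto simp: s_nonneg)
    moreover have "of_real (s p) * d p + (\<Sum>k<N. of_real (gram {..<N} (cauchy_matrix F G) p k) * (of_real (s k) * d k))
        = of_real (s p) * (d p + transform N d (real p))"
      unfolding gram_eq_row transform_def by (simp add: distrib_left sum_distrib_left mult_ac)
    ultimately show "(norm (of_real (s p) * d p
        + (\<Sum>k<N. of_real (gram {..<N} (cauchy_matrix F G) p k) * (of_real (s k) * d k))))\<^sup>2 \<le> F p * e\<^sup>2"
      using s_square[of p] s_nonneg[of p] by (simp add: norm_mult power_mult_distrib power2_eq_square[of "s p"])
  qed
  also have "\<dots> \<le> suminf F * e\<^sup>2"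
    unfolding sum_distrib_right[symmetric] using F by (intro mult_right_mono sum_le_suminf) auto
  finally show ?thesis using real_sqrt_le_mono e by (fastforce simp: real_sqrt_mult)
qed

lemma solution_tendsto:
  fixes Y :: "real \<Rightarrow> complex"
  assumes residual: "\<And>N x. - 1 < x \<Longrightarrow> norm (Y x + transform N (\<lambda>j. Y (real j)) x - of_real (h N x)) \<le> e N / (x + 1)"
    and e: "e \<longlonglongrightarrow> 0" and x: "- 1 < x"
  shows "(\<lambda>N. of_real (solution N (h N) x)) \<longlonglongrightarrow> Y x"
proof -
  define B where "B = (1 + suminf F * suminf G) / (x + 1)"
  have "norm (of_real (solution N (h N) x) - Y x) \<le> e N * B" for N
  proof -
    define d where "d y = Y y - of_real (solution N (h N) y)" for y
    have d: "d y + transform N (\<lambda>j. d (real j)) y = Y y + transform N (\<lambda>j. Y (real j)) y - of_real (h N y)" for y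
      unfolding solution_eq[of N "h N" y, symmetric] d_def transform_def by (simp add: algebra_simps sum_subtractf)
    have e0: "0 \<le> e N" using order_trans[OF norm_ge_zero residual[of 0]] by simp
    have "e N / (real p + 1) \<le> e N" for p using e0 by (simp add: divide_le_eq mult_le_cancel_left1)
    hence "norm (d (real p) + transform N (\<lambda>j. d (real j)) (real p)) \<le> e N" for p
      unfolding d by (rule order_trans[OF residual, rotated]) simp
    from transform_contraction[OF this e0]
    have l2: "sqrt (\<Sum>p<N. (norm (of_real (s p) * d (real p)))\<^sup>2) \<le> sqrt (suminf F) * e N" .
    have "norm (d x) \<le> norm (d x + transform N (\<lambda>j. d (real j)) x) + norm (transform N (\<lambda>j. d (real j)) x)"
      using norm_triangle_ineq4[of "d x + transform N (\<lambda>j. d (real j)) x" "transform N (\<lambda>j. d (real j)) x"] by simp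
    also have "\<dots> \<le> e N / (x + 1) + sqrt (\<Sum>p<N. (norm (of_real (s p) * d (real p)))\<^sup>2) * (suminf G / (x + 1) * sqrt (suminf F))"
      unfolding d unfolding transform_def using x suminf_nonneg_FG abs_row_le[OF x]
      by (intro add_mono residual[unfolded transform_def] norm_weighted_sum_le) auto
    also have "\<dots> \<le> e N / (x + 1) + sqrt (suminf F) * e N * (suminf G / (x + 1) * sqrt (suminf F))"
      using x suminf_nonneg_FG by (intro add_left_mono mult_right_mono l2) auto
    also have "\<dots> = e N / (x + 1) + (sqrt (suminf F) * sqrt (suminf F)) * (e N * (suminf G / (x + 1)))"
      by (simp only: mult_ac)
    also have "\<dots> = e N * B" using suminf_nonneg_FG by (simp add: B_def add_divide_distrib distrib_left)
    finally show ?thesis by (simp add: d_def norm_minus_commute)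
  qed
  hence bound: "\<forall>\<^sub>F N in sequentially. norm (of_real (solution N (h N) x) - Y x) \<le> e N * B"
    by (intro always_eventually allI)
  have "(\<lambda>N. e N * B) \<longlonglongrightarrow> 0" using tendsto_mult_left_zero[OF e] .
  from Lim_null_comparison[OF bound this] show ?thesis by (rule LIM_zero_cancel)
qed

definition kernel :: "nat \<Rightarrow> real \<Rightarrow> nat \<Rightarrow> real" where
  "kernel N x p = (\<Sum>j<N. M N p j * row N x j)"

definition truncated_stieltjes :: "nat \<Rightarrow> real \<Rightarrow> real" where
  "truncated_stieltjes N x = (\<Sum>q<N. G q / (x + real q + 1))"

lemma row_commutator:
  assumes "- 1 < x"
  shows "(x - real j) * row N x j = s j * truncated_stieltjes N (real j) - s j * truncated_stieltjes N x"
  unfolding row_def truncated_stieltjes_def right_diff_distrib[symmetric] sum_subtractf[symmetric] sum_distrib_left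
proof (intro sum.cong refl)
  fix q
  have "x + real q + 1 \<noteq> 0" "real j + real q + 1 \<noteq> 0" using assms by linarith+
  hence "(x - real j) * (G q / ((x + real q + 1) * (real j + real q + 1)))
      = G q / (real j + real q + 1) - G q / (x + real q + 1)"
    by (simp add: divide_simps) (simp add: algebra_simps)
  thus "(x - real j) * (s j * (G q / ((x + real q + 1) * (real j + real q + 1))))
      = s j * (G q / (real j + real q + 1) - G q / (x + real q + 1))"
    by (simp only: mult.left_commute[of _ "s j"])
qed

lemma kernel_formula:
  assumes p: "p < N" and x: "- 1 < x"
  shows "(x - real p) * kernel N x p
      = s p * (solution N (truncated_stieltjes N) (real p) * solution N (\<lambda>_. 1) x
      - solution N (\<lambda>_. 1) (real p) * solution N (truncated_stieltjes N) x)"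
proof -
  let ?l = "truncated_stieltjes N"
  have comm: "(real i - real k) * gram {..<N} (cauchy_matrix F G) i k = s i * (s k * ?l (real k)) - (s i * ?l (real i)) * s k" for i k
  proof -
    have "(real i - real k) * gram {..<N} (cauchy_matrix F G) i k = s i * ((real i - real k) * row N (real i) k)"
      unfolding gram_eq_row by simp
    also have "(real i - real k) * row N (real i) k = s k * ?l (real k) - s k * ?l (real i)"
      by (rule row_commutator) simp
    finally show ?thesis by (simp add: algebra_simps)
  qed
  have "(x - real p) * kernel N x p
      = (s p * solution N ?l (real p)) * solution N (\<lambda>_. 1) x - (s p * solution N (\<lambda>_. 1) (real p)) * solution N ?l x"
    unfolding solution_at_nat[OF p] unfolding solution_def mult_1_right kernel_def
    by (rule resolvent_commutator_extension[OF M finite_lessThan])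
      (use p comm row_commutator[OF x] in auto)
  thus ?thesis by (simp add: right_diff_distrib)
qed

lemma delta_minus_resolvent:
  assumes "p < N" "p' < N"
  shows "delta p' p - M N p' p = s p' * kernel N (real p') p"
proof -
  have "(\<Sum>k<N. M N p k * gram {..<N} (cauchy_matrix F G) k p') = s p' * kernel N (real p') p"
    unfolding gram_sym[of _ _ _ p'] gram_eq_row kernel_def sum_distrib_left
    by (intro sum.cong refl) (simp add: mult_ac)
  thus ?thesis
    using is_resolvent_gram_right[OF M, of p N p'] is_resolvent_sym[OF M, of p N p'] assms
    by (auto split: if_splits)
qed

lemma kernel_lipschitz:
  assumes p: "p < N" and x: "real p \<le> x"
  shows "\<bar>kernel N x p - kernel N (real p) p\<bar> \<le> suminf G * sqrt (suminf F) * (x - real p)"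
proof -
  have "\<bar>row N x j - row N (real p) j\<bar> \<le> s j * (suminf G * (x - real p))" for j
  proof -
    have "\<bar>G q / ((x + real q + 1) * (real j + real q + 1)) - G q / ((real p + real q + 1) * (real j + real q + 1))\<bar>
        \<le> G q * (x - real p)" for q
    proof -
      let ?d = "(x + real q + 1) * ((real p + real q + 1) * (real j + real q + 1))"
      have d: "1 * (1 * 1) \<le> ?d" using x by (intro mult_mono) auto
      have "G q / ((x + real q + 1) * (real j + real q + 1)) - G q / ((real p + real q + 1) * (real j + real q + 1))
          = - (G q * (x - real p)) / ?d"
        using x by (simp add: divide_simps) (simp add: algebra_simps)
      also have "\<bar>\<dots>\<bar> = G q * (x - real p) / ?d" using d x G(1)[of q] by (simp add: abs_mult)
      also have "\<dots> \<le> G q * (x - real p) / 1" using d x G(1)[of q] by (intro divide_left_mono) auto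
      finally show ?thesis by simp
    qed
    hence "\<bar>\<Sum>q<N. G q / ((x + real q + 1) * (real j + real q + 1)) - G q / ((real p + real q + 1) * (real j + real q + 1))\<bar>
        \<le> (\<Sum>q<N. G q * (x - real p))"
      by (intro order_trans[OF sum_abs] sum_mono)
    also have "\<dots> \<le> suminf G * (x - real p)"
      unfolding sum_distrib_right[symmetric] using G x by (intro mult_right_mono sum_le_suminf) auto
    finally show ?thesis
      unfolding row_def right_diff_distrib[symmetric] sum_subtractf[symmetric] abs_mult abs_of_nonneg[OF s_nonneg]
      by (intro mult_left_mono s_nonneg)
  qed
  hence "norm (\<Sum>j<N. M N p j * (row N x j - row N (real p) j))
      \<le> sqrt (\<Sum>j<N. (norm (M N p j))\<^sup>2) * (suminf G * (x - real p) * sqrt (suminf F))"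
    using x suminf_nonneg_FG by (intro norm_weighted_sum_le) auto
  also have "\<dots> \<le> 1 * (suminf G * (x - real p) * sqrt (suminf F))"
    using resolvent_row_norm_le[OF M, of N p] p x suminf_nonneg_FG by (intro mult_right_mono) auto
  finally show ?thesis by (simp add: kernel_def right_diff_distrib sum_subtractf mult_ac)
qed

end

text \<open>Solutions of the limiting systems: $W = 1 - T W$ and $V = \ell - T V$, where
  $(T Y)(x) = \sum_q \frac{G_q}{x + q + 1} \sum_j \frac{F_j Y(j)}{j + q + 1}$ and $\ell(x) = \sum_q \frac{G_q}{x + q + 1}$.\<close>

locale solved_cauchy_system = cauchy_system +
  fixes W V :: "real \<Rightarrow> complex" and U T :: "nat \<Rightarrow> complex"
  assumes W: "summable (\<lambda>j. F j * norm (W (real j)))"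
      "\<And>q. (\<lambda>j. of_real (F j) * W (real j) / of_real (real j + real q + 1)) sums U q"
      "\<And>x. - 1 < x \<Longrightarrow> (\<lambda>q. of_real (G q) * U q / of_real (x + real q + 1)) sums (1 - W x)"
    and V: "summable (\<lambda>j. F j * norm (V (real j)))"
      "\<And>q. (\<lambda>j. of_real (F j) * V (real j) / of_real (real j + real q + 1)) sums (1 - T q)"
      "\<And>x. - 1 < x \<Longrightarrow> (\<lambda>q. of_real (G q) * T q / of_real (x + real q + 1)) sums V x"
begin

definition error :: "(nat \<Rightarrow> complex) \<Rightarrow> real \<Rightarrow> nat \<Rightarrow> real" where
  "error Y B N = suminf G * (\<Sum>j. F (j + N) * norm (Y (j + N))) + B * (\<Sum>q. G (q + N))"

lemma error_tendsto:
  assumes "summable (\<lambda>j. F j * norm (Y j))"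
  shows "error Y B \<longlonglongrightarrow> 0"
proof -
  have "(\<lambda>N. \<Sum>j. f (j + N)) \<longlonglongrightarrow> 0" if "summable f" for f :: "nat \<Rightarrow> real"
    using suminf_exist_split2[OF that] .
  from this[OF assms] this[OF G(2)]
  have "error Y B \<longlonglongrightarrow> suminf G * 0 + B * 0" unfolding error_def by (intro tendsto_intros)
  thus ?thesis by simp
qed

lemma transform_eq:
  "transform N Y x = (\<Sum>q<N. of_real (G q / (x + real q + 1)) * (\<Sum>j<N. of_real (F j) * Y j / of_real (real j + real q + 1)))"
proof -
  have "of_real (s j) * Y j * of_real (row N x j)
      = (\<Sum>q<N. of_real (G q / (x + real q + 1)) * (of_real (F j) * Y j / of_real (real j + real q + 1)))" for j
    unfolding row_def s_square[of j, symmetric] of_real_sum of_real_mult sum_distrib_left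
    by (intro sum.cong refl) (simp add: mult_ac del: of_real_add)
  thus ?thesis unfolding transform_def sum_distrib_left by (simp only:) (rule sum.swap)
qed

lemma norm_cauchy_term_le:
  fixes y :: complex
  shows "norm (of_real (F j) * y / of_real (real j + real q + 1)) \<le> 1 * (F j * norm y)"
proof -
  have "F j * norm y / (real j + real q + 1) \<le> F j * norm y / 1"
    using F(1)[of j] by (intro divide_left_mono) auto
  thus ?thesis using F(1)[of j] by (simp add: norm_mult norm_divide del: of_real_add)
qed

lemma residual_bound:
  fixes Y S :: "nat \<Rightarrow> complex"
  assumes Y: "summable (\<lambda>j. F j * norm (Y j))"
    and R: "\<And>q. (\<lambda>j. of_real (F j) * Y j / of_real (real j + real q + 1)) sums R q"
    and L: "(\<lambda>q. of_real (G q) * S q / of_real (x + real q + 1)) sums L"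
    and B: "\<And>q. norm (S q) \<le> B" and x: "- 1 < x"
  shows "norm (L - (\<Sum>q<N. of_real (G q / (x + real q + 1)) * S q)) \<le> B * (\<Sum>q. G (q + N)) / (x + 1)" (is ?tail)
    and "norm ((\<Sum>q<N. of_real (G q / (x + real q + 1)) * R q) - transform N Y x)
      \<le> suminf G * (\<Sum>j. F (j + N) * norm (Y (j + N))) / (x + 1)" (is ?inner)
proof -
  have weight: "norm (of_real (G q / (x + real q + 1)) * c) \<le> 1 / (x + 1) * G q * norm c" for q and c :: complex
  proof -
    have "G q / (x + real q + 1) \<le> G q / (x + 1)" using x G(1)[of q] by (intro divide_left_mono) auto
    from mult_right_mono[OF this norm_ge_zero[of c]] show ?thesis
      using x G(1)[of q] by (simp add: norm_mult del: of_real_divide of_real_add)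
  qed
  have "norm (of_real (G q) * S q / of_real (x + real q + 1)) \<le> B / (x + 1) * G q" for q
    using order_trans[OF weight[of q "S q"] mult_left_mono[OF B[of q], of "1 / (x + 1) * G q"]] x G(1)[of q]
    by (simp add: mult.commute)
  from sums_tail_bound[OF L G(2) this, of N] show ?tail by (simp add: mult_ac)
  have tail: "norm (R q - (\<Sum>j<N. of_real (F j) * Y j / of_real (real j + real q + 1)))
      \<le> (\<Sum>j. F (j + N) * norm (Y (j + N)))" (is "norm (?d q) \<le> ?t") for q
    using sums_tail_bound[OF R Y norm_cauchy_term_le] by simp
  have "norm ((\<Sum>q<N. of_real (G q / (x + real q + 1)) * R q) - transform N Y x)
      = norm (\<Sum>q<N. of_real (G q / (x + real q + 1)) * ?d q)"
    unfolding transform_eq right_diff_distrib sum_subtractf ..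
  also have "\<dots> \<le> (\<Sum>q<N. 1 / (x + 1) * G q * ?t)"
    using x G(1) by (intro sum_norm_le order_trans[OF weight] mult_left_mono tail) auto
  also have "\<dots> = (\<Sum>q<N. G q) * ?t / (x + 1)"
    by (simp add: sum_distrib_left sum_distrib_right sum_divide_distrib mult_ac)
  also have "\<dots> \<le> suminf G * ?t / (x + 1)"
    using x G order_trans[OF norm_ge_zero tail] by (intro divide_right_mono mult_right_mono sum_le_suminf) auto
  finally show ?inner .
qed

lemma norm_cauchy_sum_le:
  fixes Y :: "nat \<Rightarrow> complex"
  assumes "summable (\<lambda>j. F j * norm (Y j))"
    and "(\<lambda>j. of_real (F j) * Y j / of_real (real j + real q + 1)) sums R"
  shows "norm R \<le> (\<Sum>j. F j * norm (Y j))"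
  using sums_tail_bound[OF assms(2,1) norm_cauchy_term_le, of 0] by simp

lemma solution_one_tendsto:
  assumes "- 1 < x"
  shows "(\<lambda>N. of_real (solution N (\<lambda>_. 1) x)) \<longlonglongrightarrow> W x"
proof (rule solution_tendsto[where h="\<lambda>N _. 1" and e="error (\<lambda>j. W (real j)) (\<Sum>j. F j * norm (W (real j)))",
      OF _ error_tendsto[OF W(1)] assms])
  fix N and x :: real assume x: "- 1 < x"
  note bounds = residual_bound[OF W(1,2) W(3)[OF x] norm_cauchy_sum_le[OF W(1,2)] x, of N]
  show "norm (W x + transform N (\<lambda>j. W (real j)) x - of_real 1)
      \<le> error (\<lambda>j. W (real j)) (\<Sum>j. F j * norm (W (real j))) N / (x + 1)"
    using norm_triangle_le[OF add_mono[OF bounds]]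
    by (simp add: error_def add_divide_distrib norm_minus_commute algebra_simps)
qed

lemma solution_stieltjes_tendsto:
  assumes "- 1 < x"
  shows "(\<lambda>N. of_real (solution N (truncated_stieltjes N) x)) \<longlonglongrightarrow> V x"
proof (rule solution_tendsto[where h=truncated_stieltjes and e="error (\<lambda>j. V (real j)) (1 + (\<Sum>j. F j * norm (V (real j))))",
      OF _ error_tendsto[OF V(1)] assms])
  have "norm (T q) \<le> 1 + (\<Sum>j. F j * norm (V (real j)))" for q
    using norm_cauchy_sum_le[OF V(1,2), of q] norm_triangle_ineq4[of 1 "1 - T q"] by simp
  fix N and x :: real assume x: "- 1 < x"
  note bounds = residual_bound[OF V(1,2) V(3)[OF x] \<open>\<And>q. norm (T q) \<le> _\<close> x, of N]
  have "of_real (truncated_stieltjes N x) = (\<Sum>q<N. of_real (G q / (x + real q + 1)) * T q)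
      + (\<Sum>q<N. of_real (G q / (x + real q + 1)) * (1 - T q))"
    unfolding truncated_stieltjes_def sum.distrib[symmetric] by (simp add: right_diff_distrib)
  hence "V x + transform N (\<lambda>j. V (real j)) x - of_real (truncated_stieltjes N x)
      = (V x - (\<Sum>q<N. of_real (G q / (x + real q + 1)) * T q))
      - ((\<Sum>q<N. of_real (G q / (x + real q + 1)) * (1 - T q)) - transform N (\<lambda>j. V (real j)) x)"
    by simp
  thus "norm (V x + transform N (\<lambda>j. V (real j)) x - of_real (truncated_stieltjes N x))
      \<le> error (\<lambda>j. V (real j)) (1 + (\<Sum>j. F j * norm (V (real j)))) N / (x + 1)"
    unfolding error_def add_divide_distrib
    by (simp only:) (rule order_trans[OF norm_triangle_ineq4], use add_mono[OF bounds] in linarith)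
qed

lemma kernel_tendsto:
  assumes x: "- 1 < x" "x \<noteq> real p"
  shows "(\<lambda>N. of_real (kernel N x p)) \<longlonglongrightarrow> of_real (s p) * ((V (real p) * W x - W (real p) * V x) / of_real (x - real p))"
proof -
  let ?l = truncated_stieltjes
  have "(\<lambda>N. of_real (s p) * ((of_real (solution N (?l N) (real p)) * of_real (solution N (\<lambda>_. 1) x)
      - of_real (solution N (\<lambda>_. 1) (real p)) * of_real (solution N (?l N) x)) / of_real (x - real p)))
      \<longlonglongrightarrow> of_real (s p) * ((V (real p) * W x - W (real p) * V x) / of_real (x - real p))"
    using x by (intro tendsto_intros solution_one_tendsto solution_stieltjes_tendsto) (auto simp flip: of_real_diff)
  moreover have "\<forall>\<^sub>F N in sequentially. of_real (s p) * ((of_real (solution N (?l N) (real p)) * of_real (solution N (\<lambda>_. 1) x)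
      - of_real (solution N (\<lambda>_. 1) (real p)) * of_real (solution N (?l N) x)) / of_real (x - real p))
      = complex_of_real (kernel N x p)"
    using eventually_gt_at_top[of p]
  proof eventually_elim
    case (elim N)
    have "kernel N x p = s p * ((solution N (?l N) (real p) * solution N (\<lambda>_. 1) x
        - solution N (\<lambda>_. 1) (real p) * solution N (?l N) x) / (x - real p))"
      using kernel_formula[OF elim x(1)] x(2) by (simp add: field_simps)
    thus ?case by simp
  qed
  ultimately show ?thesis by (rule Lim_transform_eventually)
qed

lemma resolvent_limit_offdiag:
  assumes "p' \<noteq> p"
  shows "(\<lambda>N. of_real (delta p' p - M N p' p)) \<longlonglongrightarrow> of_real (s p' * s p)
    * ((V (real p) * W (real p') - W (real p) * V (real p')) / of_real (real p' - real p))"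
proof -
  have "(\<lambda>N. of_real (s p') * of_real (kernel N (real p') p)) \<longlonglongrightarrow> of_real (s p')
      * (of_real (s p) * ((V (real p) * W (real p') - W (real p) * V (real p')) / of_real (real p' - real p)))"
    using assms by (intro tendsto_intros kernel_tendsto) auto
  moreover have "\<forall>\<^sub>F N in sequentially. of_real (s p') * of_real (kernel N (real p') p) = complex_of_real (delta p' p - M N p' p)"
    using eventually_gt_at_top[of "max p p'"] by eventually_elim (simp add: delta_minus_resolvent del: of_real_diff)
  ultimately show ?thesis by (simp add: Lim_transform_eventually mult.assoc)
qed

lemma resolvent_limit_diag:
  assumes D: "((\<lambda>x. (V (real p) * W x - W (real p) * V x) / of_real (x - real p)) \<longlongrightarrow> D) (at_right (real p))"
  shows "(\<lambda>N. of_real (1 - M N p p)) \<longlonglongrightarrow> of_real (F p) * D"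
proof -
  have "(\<lambda>N. complex_of_real (kernel N (real p) p)) \<longlonglongrightarrow> of_real (s p) * D"
  proof (rule equilipschitz_limit)
    show "\<forall>\<^sub>F N in sequentially. \<forall>x\<ge>real p. dist (complex_of_real (kernel N x p)) (of_real (kernel N (real p) p))
        \<le> suminf G * sqrt (suminf F) * (x - real p)"
      using eventually_gt_at_top[of p]
      by eventually_elim (simp add: dist_norm kernel_lipschitz flip: of_real_diff)
    show "((\<lambda>x. of_real (s p) * ((V (real p) * W x - W (real p) * V x) / of_real (x - real p))) \<longlongrightarrow> of_real (s p) * D) (at_right (real p))"
      by (intro tendsto_intros D)
  qed (rule kernel_tendsto, auto)
  hence "(\<lambda>N. of_real (s p) * complex_of_real (kernel N (real p) p)) \<longlonglongrightarrow> of_real (s p) * (of_real (s p) * D)"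
    by (intro tendsto_intros)
  moreover have "\<forall>\<^sub>F N in sequentially. of_real (s p) * of_real (kernel N (real p) p) = complex_of_real (1 - M N p p)"
    using eventually_gt_at_top[of p]
  proof eventually_elim
    case (elim N)
    show ?case using delta_minus_resolvent[OF elim elim] by (simp del: of_real_diff flip: of_real_mult)
  qed
  ultimately show ?thesis
    by (simp add: Lim_transform_eventually mult.assoc[symmetric] s_square flip: of_real_mult)
qed

end

section \<open>The discrete kernel and its limit\<close>

lemma admissible_uminus: "admissible z z' \<Longrightarrow> admissible (- z) (- z')"
  unfolding admissible_def
proof (elim disjE conjE exE)
  fix m :: int
  assume "z \<in> \<real>" "z' \<in> \<real>" "of_int m < Re z" "Re z < of_int m + 1" "of_int m < Re z'" "Re z' < of_int m + 1"
  thus "(- z' = cnj (- z) \<and> - z \<notin> \<int>) | (- z \<in> \<real> \<and> - z' \<in> \<real> \<and>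
      (\<exists>m::int. of_int m < Re (- z) \<and> Re (- z) < of_int m + 1 \<and> of_int m < Re (- z') \<and> Re (- z') < of_int m + 1))"
    by (intro disjI2 conjI exI[of _ "- m - 1"]) auto
qed (auto simp: Ints_minus minus_in_Ints_iff)

lemma admissible_shift_pos:
  assumes "admissible z z'"
  obtains r where "0 < r" "(z + of_int k) * (z' + of_int k) = of_real r"
  using assms unfolding admissible_def
proof (elim disjE conjE exE)
  assume z: "z' = cnj z" "z \<notin> \<int>"
  have "z + of_int k \<noteq> 0"
  proof
    assume "z + of_int k = 0"
    hence "z = of_int (- k)" by (simp add: add_eq_0_iff2)
    thus False using z(2) by simp
  qed
  moreover have "(z + of_int k) * (z' + of_int k) = of_real ((norm (z + of_int k))\<^sup>2)"
    unfolding z complex_norm_square by simp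
  ultimately show thesis using that[of "(norm (z + of_int k))\<^sup>2"] by simp
next
  fix m :: int
  assume z: "z \<in> \<real>" "z' \<in> \<real>" "of_int m < Re z" "Re z < of_int m + 1" "of_int m < Re z'" "Re z' < of_int m + 1"
  have "0 < (Re z + of_int k) * (Re z' + of_int k)"
  proof (cases "0 \<le> m + k")
    case True
    hence "0 \<le> real_of_int m + real_of_int k" by linarith
    thus ?thesis using z by (intro mult_pos_pos) linarith+
  next
    case False
    hence "real_of_int m + 1 + real_of_int k \<le> 0" by linarith
    thus ?thesis using z by (intro mult_neg_neg) linarith+
  qed
  moreover have "(z + of_int k) * (z' + of_int k) = of_real ((Re z + of_int k) * (Re z' + of_int k))"
    using z(1,2) by (simp add: complex_eq_iff complex_is_Real_iff)
  ultimately show thesis using that by blast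
qed

lemma admissible_pochhammer:
  assumes "admissible z z'"
  shows "\<exists>r > 0. pochhammer (z + 1) p * pochhammer (z' + 1) p = of_real r"
proof (induction p)
  case 0 show ?case by (intro exI[of _ 1]) simp
next
  case (Suc p)
  then obtain r where r: "0 < r" "pochhammer (z + 1) p * pochhammer (z' + 1) p = of_real r" by blast
  obtain r' where r': "0 < r'" "(z + of_int (1 + int p)) * (z' + of_int (1 + int p)) = of_real r'"
    using admissible_shift_pos[OF assms] by blast
  have "pochhammer (z + 1) (Suc p) * pochhammer (z' + 1) (Suc p) =
      (pochhammer (z + 1) p * pochhammer (z' + 1) p) * ((z + of_int (1 + int p)) * (z' + of_int (1 + int p)))"
    by (simp add: pochhammer_Suc algebra_simps)
  thus ?case using r r' by (intro exI[of _ "r * r'"]) simp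
qed

lemma admissible_sum_real:
  assumes "admissible z z'"
  shows "z + z' = of_real (Re (z + z'))"
  using assms unfolding admissible_def by (auto simp: complex_is_Real_iff complex_eq_iff)

lemma zz_t_uminus [simp]: "zz_t (- z) (- z') = zz_t z z'"
  by (simp add: zz_t_def)

lemma of_real_lim:
  assumes "(\<lambda>N. of_real (f N)) \<longlonglongrightarrow> (L :: complex)"
  shows "of_real (lim f) = L"
proof -
  have "(\<lambda>N. Re (of_real (f N))) \<longlonglongrightarrow> Re L" "(\<lambda>N. Im (of_real (f N))) \<longlonglongrightarrow> Im L" by (intro tendsto_intros assms)+
  hence "f \<longlonglongrightarrow> Re L" "Im L = 0" by (simp_all add: LIMSEQ_const_iff)
  thus ?thesis by (simp add: limI complex_eq_iff)
qed

locale admissible_pair =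
  fixes z z' :: complex
  assumes adm: "admissible z z'"
begin

abbreviation t :: real where
  "t \<equiv> zz_t z z'"

lemma uminus_pair: "admissible_pair (- z) (- z')"
  by unfold_locales (rule admissible_uminus[OF adm])

definition poch_weight :: "nat \<Rightarrow> real" where
  "poch_weight p = Re (pochhammer (z + 1) p * pochhammer (z' + 1) p) / (fact p)\<^sup>2"

definition p_weight :: "real \<Rightarrow> nat \<Rightarrow> real" where
  "p_weight xi p = poch_weight p * xi ^ p"

definition q_weight :: "real \<Rightarrow> nat \<Rightarrow> real" where
  "q_weight xi q = t * xi * admissible_pair.p_weight (- z) (- z') xi q"

interpretation neg: admissible_pair "- z" "- z'" by (rule uminus_pair)

lemma q_weight_uminus: "neg.q_weight xi q = t * xi * p_weight xi q"
  by (simp add: neg.q_weight_def)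

lemma zz_t_pos: "0 < t" and zz_t_eq: "z * z' = of_real t"
proof -
  obtain r where "0 < r" "(z + of_int 0) * (z' + of_int 0) = of_real r" using admissible_shift_pos[OF adm] by blast
  thus "0 < t" "z * z' = of_real t" by (auto simp: zz_t_def)
qed

lemma poch_weight_pos: "0 < poch_weight p"
  and poch_weight_eq: "of_real (poch_weight p) = pochhammer (z + 1) p * pochhammer (z' + 1) p / (fact p)\<^sup>2"
proof -
  obtain r where "0 < r" "pochhammer (z + 1) p * pochhammer (z' + 1) p = of_real r"
    using admissible_pochhammer[OF adm] by blast
  thus "0 < poch_weight p" "of_real (poch_weight p) = pochhammer (z + 1) p * pochhammer (z' + 1) p / (fact p)\<^sup>2"
    by (auto simp: poch_weight_def)
qed

lemma p_weight_complex:
  "of_real (p_weight xi p) = pochhammer (1 + z) p * pochhammer (1 + z') p / (fact p)\<^sup>2 * of_real xi ^ p"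
  by (simp add: p_weight_def poch_weight_eq add.commute)

lemma pochhammer_Suc_weight:
  "pochhammer z (Suc p) * pochhammer z' (Suc p) / (fact p)\<^sup>2 * of_real xi ^ Suc p = of_real (neg.q_weight xi p)"
  by (simp add: q_weight_uminus p_weight_complex zz_t_eq[symmetric] pochhammer_rec add.commute mult_ac)

lemma poch_weight_summable:
  assumes "0 \<le> xi" "xi < 1"
  shows "summable (p_weight xi)"
proof -
  have "poly_bounded (\<lambda>p. pochhammer (z + 1) p / fact p * (pochhammer (z' + 1) p / fact p))"
    by (intro poly_bounded_mult poly_bounded_pochhammer_fact)
  hence "poly_bounded (\<lambda>p. of_real (poch_weight p))"
    by (simp add: poch_weight_eq power2_eq_square)
  from poly_bounded_summable[OF this assms] show ?thesis
    using poch_weight_pos by (simp add: p_weight_def[abs_def] abs_of_pos)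
qed

lemma poch_weight_asymptotic:
  "(\<lambda>p. of_real (poch_weight p * (real p + 1) powr (- Re (z + z')))) \<longlonglongrightarrow> rGamma (z + 1) * rGamma (z' + 1)"
proof -
  let ?y = "\<lambda>p. of_real (real p + 1)"
  have "(\<lambda>p. (pochhammer (z + 1) p / fact p * ?y p powr (1 - (z + 1))) * (pochhammer (z' + 1) p / fact p * ?y p powr (1 - (z' + 1))))
      \<longlonglongrightarrow> rGamma (z + 1) * rGamma (z' + 1)"
    by (intro tendsto_mult pochhammer_fact_asymptotic)
  moreover have "(pochhammer (z + 1) p / fact p * ?y p powr (1 - (z + 1))) * (pochhammer (z' + 1) p / fact p * ?y p powr (1 - (z' + 1)))
      = of_real (poch_weight p * (real p + 1) powr (- Re (z + z')))" for p
  proof -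
    have "?y p powr (1 - (z + 1)) * ?y p powr (1 - (z' + 1)) = (?y p :: complex) powr (- (z + z'))"
      by (simp add: powr_add[symmetric] add_ac del: of_real_add)
    also have "\<dots> = ?y p powr (of_real (- Re (z + z')))"
      using admissible_sum_real[OF adm] by (simp only: of_real_minus)
    also have "\<dots> = of_real ((real p + 1) powr (- Re (z + z')))" by (rule powr_of_real) simp_all
    finally have powr: "?y p powr (1 - (z + 1)) * ?y p powr (1 - (z' + 1)) = of_real ((real p + 1) powr (- Re (z + z')))" .
    have "(pochhammer (z + 1) p / fact p * ?y p powr (1 - (z + 1))) * (pochhammer (z' + 1) p / fact p * ?y p powr (1 - (z' + 1)))
        = (pochhammer (z + 1) p * pochhammer (z' + 1) p / (fact p)\<^sup>2) * (?y p powr (1 - (z + 1)) * ?y p powr (1 - (z' + 1)))"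
      by (simp add: power2_eq_square)
    thus ?thesis unfolding powr poch_weight_eq[symmetric] by simp
  qed
  ultimately show ?thesis by simp
qed

lemma rGamma_product:
  shows "of_real (Re (rGamma (z + 1) * rGamma (z' + 1))) = rGamma (z + 1) * rGamma (z' + 1)"
    and "0 < Re (rGamma (z + 1) * rGamma (z' + 1))"
    and "of_real t * (rGamma (z + 1) * rGamma (z' + 1)) = 1 / (Gamma z * Gamma z')"
proof -
  let ?R = "rGamma (z + 1) * rGamma (z' + 1)"
  have "(\<lambda>p. 0::real) \<longlonglongrightarrow> Im ?R" using tendsto_Im[OF poch_weight_asymptotic] by simp
  thus real: "of_real (Re ?R) = ?R" by (simp add: complex_eq_iff LIMSEQ_const_iff)
  have "of_real t * ?R = (z * rGamma (z + 1)) * (z' * rGamma (z' + 1))"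
    unfolding zz_t_eq[symmetric] by (simp add: mult_ac)
  thus gamma: "of_real t * ?R = 1 / (Gamma z * Gamma z')"
    unfolding rGamma_plus1 rGamma_inverse_Gamma[of z] rGamma_inverse_Gamma[of z'] by (simp add: inverse_eq_divide)
  have "0 \<le> Re ?R"
    using tendsto_Re[OF poch_weight_asymptotic]
    by (rule tendsto_lowerbound) (use poch_weight_pos in \<open>auto intro!: always_eventually less_imp_le\<close>)
  moreover have nonzero: "(z + 1 + of_nat n) * (z' + 1 + of_nat n) \<noteq> 0" for n
  proof -
    obtain r where "0 < r" "(z + of_int (1 + int n)) * (z' + of_int (1 + int n)) = of_real r"
      using admissible_shift_pos[OF adm] by blast
    thus ?thesis by (auto simp: add.assoc)
  qed
  have "z + 1 \<noteq> - of_nat n" "z' + 1 \<noteq> - of_nat n" for n using nonzero[of n] by auto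
  hence "?R \<noteq> 0" by (auto simp: rGamma_eq_zero_iff elim!: nonpos_Ints_cases')
  with real have "Re ?R \<noteq> 0" by (metis of_real_0)
  ultimately show "0 < Re ?R" by simp
qed

lemma poch_weight_bounds:
  obtains a b where "0 < a" "0 < b"
    "\<And>p. a * (real p + 1) powr (Re (z + z')) \<le> poch_weight p"
    "\<And>p. poch_weight p \<le> b * (real p + 1) powr (Re (z + z'))"
proof -
  define r where "r p = poch_weight p * (real p + 1) powr (- Re (z + z'))" for p
  have lim: "r \<longlonglongrightarrow> Re (rGamma (z + 1) * rGamma (z' + 1))"
    using tendsto_Re[OF poch_weight_asymptotic] unfolding r_def by simp
  have pos: "0 < r p" for p using poch_weight_pos by (simp add: r_def)
  obtain b where b: "0 < b" "\<And>p. norm (r p) \<le> b"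
    using convergent_imp_Bseq[OF convergentI[OF lim]] by (auto simp: Bseq_def)
  obtain a where a: "0 < a" "\<And>p. norm (inverse (r p)) \<le> a"
    using convergent_imp_Bseq[OF convergentI[OF tendsto_inverse[OF lim]]] rGamma_product(2) by (auto simp: Bseq_def)
  have weight: "poch_weight p = r p * (real p + 1) powr (Re (z + z'))" for p
    by (simp add: r_def mult.assoc powr_add[symmetric])
  show ?thesis
  proof (rule that[of "inverse a" b])
    fix p
    have "inverse a \<le> r p" using a(2)[of p] pos[of p] le_imp_inverse_le[of "inverse (r p)" a] by simp
    thus "inverse a * (real p + 1) powr (Re (z + z')) \<le> poch_weight p"
      by (subst weight) (intro mult_right_mono, simp_all)
    have "r p \<le> b" using b(2)[of p] by simp
    thus "poch_weight p \<le> b * (real p + 1) powr (Re (z + z'))"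
      by (subst weight) (intro mult_right_mono, simp_all)
  qed (use a b in auto)
qed

end

lemma hyp_uniform_bound:
  assumes "0 \<le> xi" "xi < 1"
  obtains C where "\<And>c. 1 \<le> Re c \<Longrightarrow> norm (hyp a b c xi) \<le> C"
proof -
  obtain C N where C: "0 \<le> C" "\<And>c k. 1 \<le> Re c \<Longrightarrow> norm (hyp_coeff a b c k) \<le> C * (1 + real k) ^ N"
    using hyp_coeff_uniform_bound[of 1 a b] by (metis zero_less_one)
  have s: "summable (\<lambda>k. C * ((1 + real k) ^ N * xi ^ k))" by (intro summable_mult summable_poly_geometric assms)
  have "norm (hyp a b c xi) \<le> (\<Sum>k. C * ((1 + real k) ^ N * xi ^ k))" if c: "1 \<le> Re c" for c
    unfolding hyp_def
  proof (rule norm_suminf_le[OF _ s])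
    show "norm (hyp_coeff a b c k * of_real xi ^ k) \<le> C * ((1 + real k) ^ N * xi ^ k)" for k
      using mult_right_mono[OF C(2)[OF c, of k], of "xi ^ k"] assms by (simp add: norm_mult norm_power mult_ac)
  qed
  thus ?thesis using that by blast
qed

definition divided_wronskian :: "(complex \<Rightarrow> complex) \<Rightarrow> (complex \<Rightarrow> complex) \<Rightarrow> complex \<Rightarrow> complex \<Rightarrow> complex" where
  "divided_wronskian A B x y
    = (if x = y then deriv A x * B x - deriv B x * A x else (A x * B y - B x * A y) / (x - y))"

lemma divided_wronskian_sym: "divided_wronskian A B x y = divided_wronskian A B y x"
  by (simp add: divided_wronskian_def minus_divide_left[symmetric] divide_simps) (simp add: algebra_simps)

lemma divided_wronskian_tendsto_diag:
  assumes "A field_differentiable at y" "B field_differentiable at y"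
  shows "((\<lambda>x. divided_wronskian A B x y) \<longlongrightarrow> divided_wronskian A B y y) (at y)"
proof -
  have "((\<lambda>x. A x * B y - B x * A y) has_field_derivative deriv A y * B y - deriv B y * A y) (at y)"
    by (intro DERIV_diff DERIV_cmult_right field_differentiable_derivI assms)
  hence "((\<lambda>x. (A x * B y - B x * A y) / (x - y)) \<longlongrightarrow> divided_wronskian A B y y) (at y)"
    by (simp add: has_field_derivative_iff divided_wronskian_def)
  thus ?thesis
    by (rule Lim_transform_eventually) (auto simp: divided_wronskian_def eventually_at_filter)
qed

lemma field_differentiable_Re_pos:
  "f holomorphic_on {c. 0 < Re c} \<Longrightarrow> 0 < Re c \<Longrightarrow> f field_differentiable at c"
  using holomorphic_on_imp_differentiable_at[OF _ open_Re_pos] by blast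

definition node :: "nat \<Rightarrow> nat \<Rightarrow> complex" where
  "node m p = (of_nat p + 1) / of_nat m"

lemma node_tendsto:
  assumes "(\<lambda>m. real (ps m) / real m) \<longlonglongrightarrow> x"
  shows "(\<lambda>m. node m (ps m)) \<longlonglongrightarrow> complex_of_real x"
proof -
  have "(\<lambda>m. real (ps m) / real m + 1 / real m) \<longlonglongrightarrow> x + 0" by (intro tendsto_add assms lim_1_over_n)
  from tendsto_of_real[OF this, where 'a=complex] show ?thesis by (simp add: node_def add_divide_distrib)
qed

context admissible_pair
begin

interpretation neg: admissible_pair "- z" "- z'" by (rule uminus_pair)

definition disc_W :: "real \<Rightarrow> real \<Rightarrow> complex" where
  "disc_W xi x = of_real (1 - xi) powr (- z) * hyp (- z) (- z') (of_real x + 1) xi"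

definition disc_V :: "real \<Rightarrow> real \<Rightarrow> complex" where
  "disc_V xi x = of_real (1 - xi) powr z
      * (of_real (t * xi) * (hyp (1 - z') (1 - z) (of_real x + 2) xi / (of_real x + 1)))"

definition disc_U :: "real \<Rightarrow> nat \<Rightarrow> complex" where
  "disc_U xi q = of_real (1 - xi) powr (- z) * (hyp (1 + z') (1 + z) (of_nat q + 2) xi / (of_nat q + 1))"

definition disc_T :: "real \<Rightarrow> nat \<Rightarrow> complex" where
  "disc_T xi q = of_real (1 - xi) powr z * hyp z z' (of_nat q + 1) xi"

definition disc_resolvent :: "real \<Rightarrow> nat \<Rightarrow> nat \<Rightarrow> nat \<Rightarrow> real" where
  "disc_resolvent xi N
    = (SOME M. is_resolvent {..<N} (gram {..<N} (cauchy_matrix (p_weight xi) (q_weight xi))) M)"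

lemma is_resolvent_disc_resolvent:
  "is_resolvent {..<N} (gram {..<N} (cauchy_matrix (p_weight xi) (q_weight xi))) (disc_resolvent xi N)"
  unfolding disc_resolvent_def by (rule someI_ex[OF gram_resolvent_exists]) simp_all

context
  fixes xi :: real
  assumes xi: "0 < xi" "xi < 1"
begin

lemma p_weight_pos: "0 < p_weight xi p" and q_weight_pos: "0 < q_weight xi p"
  using poch_weight_pos neg.poch_weight_pos zz_t_pos xi
  by (auto simp: p_weight_def neg.p_weight_def q_weight_def)

lemma powr_cancel: "(of_real (1 - xi) :: complex) powr (- z) * of_real (1 - xi) powr z = 1"
proof -
  have "(of_real (1 - xi) :: complex) \<noteq> 0" using xi by (subst of_real_eq_0_iff) simp
  thus ?thesis by (simp add: powr_add[symmetric] del: of_real_diff)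
qed

lemma disc_W_inner:
  "(\<lambda>j. of_real (p_weight xi j) * disc_W xi (real j) / of_real (real j + real q + 1)) sums disc_U xi q"
  using sums_mult[OF hyp_second_system[of "of_nat q + 1" xi "- z" "- z'"], of "of_real (1 - xi) powr (- z)"] xi
  by (simp add: p_weight_complex disc_W_def disc_U_def mult_ac add_ac)

lemma disc_W_outer:
  assumes "- 1 < x"
  shows "(\<lambda>q. of_real (q_weight xi q) * disc_U xi q / of_real (x + real q + 1)) sums (1 - disc_W xi x)"
  using sums_mult[OF hyp_first_system[of "of_real x + 1" xi "- z" "- z'",
        unfolded neg.pochhammer_Suc_weight], of "of_real (1 - xi) powr (- z)"] xi assms
    powr_cancel
  by (simp add: disc_W_def disc_U_def right_diff_distrib mult_ac add_ac)

lemma disc_V_inner: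
  "(\<lambda>j. of_real (p_weight xi j) * disc_V xi (real j) / of_real (real j + real q + 1)) sums (1 - disc_T xi q)"
  using sums_mult[OF hyp_first_system[of "of_nat q + 1" xi z z', unfolded pochhammer_Suc_weight],
      of "of_real (1 - xi) powr z"] xi powr_cancel
  by (simp add: q_weight_uminus disc_V_def disc_T_def right_diff_distrib mult_ac add_ac)

lemma disc_V_outer:
  assumes "- 1 < x"
  shows "(\<lambda>q. of_real (q_weight xi q) * disc_T xi q / of_real (x + real q + 1)) sums disc_V xi x"
  using sums_mult[OF hyp_second_system[of "of_real x + 1" xi z z'],
      of "of_real (1 - xi) powr z * of_real (t * xi)"] xi assms
  by (simp add: q_weight_def neg.p_weight_complex disc_V_def disc_T_def mult_ac add_ac)

lemma summable_p_weight_norm: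
  assumes "\<And>p. norm (Y p) \<le> C"
  shows "summable (\<lambda>p. p_weight xi p * norm (Y p))"
proof (rule summable_comparison_test'[OF summable_mult2[OF poch_weight_summable, of xi C]])
  show "norm (p_weight xi p * norm (Y p)) \<le> p_weight xi p * C" for p
    using p_weight_pos[of p] assms[of p] by (simp add: mult_left_mono)
qed (use xi in auto)

lemma disc_W_summable: "summable (\<lambda>p. p_weight xi p * norm (disc_W xi (real p)))"
proof -
  obtain C where C: "\<And>c. 1 \<le> Re c \<Longrightarrow> norm (hyp (- z) (- z') c xi) \<le> C"
    using hyp_uniform_bound[of xi] xi by (metis less_imp_le)
  hence "norm (disc_W xi (real p)) \<le> norm (of_real (1 - xi) powr (- z) :: complex) * C" for p
    unfolding disc_W_def norm_mult by (intro mult_left_mono C) auto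
  thus ?thesis by (rule summable_p_weight_norm)
qed

lemma disc_V_summable: "summable (\<lambda>p. p_weight xi p * norm (disc_V xi (real p)))"
proof -
  obtain C where C: "\<And>c. 1 \<le> Re c \<Longrightarrow> norm (hyp (1 - z') (1 - z) c xi) \<le> C"
    using hyp_uniform_bound[of xi] xi by (metis less_imp_le)
  have "norm (hyp (1 - z') (1 - z) (of_real (real p) + 2) xi / (of_real (real p) + 1)) \<le> C / 1" for p
  proof -
    have "norm (of_real (real p) + 1 :: complex) = real p + 1"
      using norm_of_real[of "real p + 1", where 'a=complex] by simp
    moreover have "norm (hyp (1 - z') (1 - z) (of_real (real p) + 2) xi) \<le> C" by (rule C) simp
    ultimately show ?thesis unfolding norm_divide using order_trans[OF norm_ge_zero] by (intro frac_le) auto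
  qed
  hence "norm (disc_V xi (real p)) \<le> norm (of_real (1 - xi) powr z :: complex) * (\<bar>t * xi\<bar> * (C / 1))" for p
    unfolding disc_V_def norm_mult norm_of_real by (intro mult_left_mono abs_ge_zero norm_ge_zero mult_nonneg_nonneg)
  thus ?thesis by (rule summable_p_weight_norm)
qed

lemma solved_cauchy_system_disc:
  "solved_cauchy_system (p_weight xi) (q_weight xi) (disc_resolvent xi)
    (disc_W xi) (disc_V xi) (disc_U xi) (disc_T xi)"
proof
  show "0 \<le> p_weight xi p" "0 \<le> q_weight xi p" for p
    using p_weight_pos[of p] q_weight_pos[of p] by auto
  show "summable (p_weight xi)" "summable (q_weight xi)"
    unfolding q_weight_def[abs_def] using xi poch_weight_summable neg.poch_weight_summable
    by (auto intro!: summable_mult)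
qed (use is_resolvent_disc_resolvent disc_W_inner disc_W_outer disc_V_inner disc_V_outer disc_W_summable disc_V_summable in auto)

end

definition disc_A :: "nat \<Rightarrow> complex \<Rightarrow> complex" where
  "disc_A m c = scaled_hyp m (- z) (- z') c"

definition disc_B :: "nat \<Rightarrow> complex \<Rightarrow> complex" where
  "disc_B m c = scaled_hyp m (1 - z') (1 - z) (c + 1 / of_nat m) / c"

definition whit_A :: "complex \<Rightarrow> complex" where
  "whit_A c = tricomi (- z) (- z') c"

definition whit_B :: "complex \<Rightarrow> complex" where
  "whit_B c = tricomi (1 - z') (1 - z) c / c"

definition disc_wronskian :: "nat \<Rightarrow> complex \<Rightarrow> complex \<Rightarrow> complex" where
  "disc_wronskian m = divided_wronskian (disc_A m) (disc_B m)"

definition whit_wronskian :: "complex \<Rightarrow> complex \<Rightarrow> complex" where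
  "whit_wronskian = divided_wronskian whit_A whit_B"

lemma disc_A_tendsto:
  "0 < Re x \<Longrightarrow> xs \<longlonglongrightarrow> x \<Longrightarrow> (\<lambda>m. disc_A m (xs m)) \<longlonglongrightarrow> whit_A x"
  unfolding disc_A_def whit_A_def by (rule scaled_hyp_tendsto)

lemma disc_B_tendsto:
  assumes "0 < Re x" "xs \<longlonglongrightarrow> x"
  shows "(\<lambda>m. disc_B m (xs m)) \<longlonglongrightarrow> whit_B x"
proof -
  have "(\<lambda>m. xs m + 1 / of_nat m) \<longlonglongrightarrow> x" using tendsto_add[OF assms(2) lim_1_over_n] by simp
  moreover have "x \<noteq> 0" using assms(1) by auto
  ultimately show ?thesis unfolding disc_B_def whit_B_def by (intro tendsto_divide scaled_hyp_tendsto assms)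
qed

lemma disc_A_holomorphic: "disc_A m holomorphic_on {c. 0 < Re c}"
  unfolding disc_A_def[abs_def] by (rule scaled_hyp_holomorphic)

lemma disc_B_holomorphic: "disc_B m holomorphic_on {c. 0 < Re c}"
proof -
  have "(\<lambda>c. c + 1 / of_nat m) ` {c. 0 < Re c} \<subseteq> {c. 0 < Re c}" by (auto simp: add_pos_nonneg)
  hence "(\<lambda>c. scaled_hyp m (1 - z') (1 - z) (c + 1 / of_nat m)) holomorphic_on {c. 0 < Re c}"
    using holomorphic_on_compose_gen[OF _ scaled_hyp_holomorphic, of "\<lambda>c. c + 1 / of_nat m"]
    by (simp add: o_def holomorphic_intros)
  thus ?thesis unfolding disc_B_def[abs_def] by (intro holomorphic_intros) auto
qed

lemma whit_holomorphic:
  "whit_A holomorphic_on {c. 0 < Re c}" "whit_B holomorphic_on {c. 0 < Re c}"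
  unfolding whit_A_def[abs_def] whit_B_def[abs_def] by (intro holomorphic_intros tricomi_holomorphic; force)+

lemma disc_wronskian_tendsto:
  assumes x: "0 < Re x" "xs \<longlonglongrightarrow> x" and y: "0 < Re y" "ys \<longlonglongrightarrow> y" and xy: "x = y \<Longrightarrow> xs = ys"
  shows "(\<lambda>m. disc_wronskian m (xs m) (ys m)) \<longlonglongrightarrow> whit_wronskian x y"
proof (cases "x = y")
  case True
  have "(\<lambda>m. deriv (disc_A m) (xs m)) \<longlonglongrightarrow> deriv (whit_A) x"
    by (rule deriv_continuous_convergence[OF open_Re_pos disc_A_holomorphic disc_A_tendsto]) (use x in auto)
  moreover have "(\<lambda>m. deriv (disc_B m) (xs m)) \<longlonglongrightarrow> deriv (whit_B) x"
    by (rule deriv_continuous_convergence[OF open_Re_pos disc_B_holomorphic disc_B_tendsto]) (use x in auto)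
  ultimately have "(\<lambda>m. deriv (disc_A m) (xs m) * disc_B m (xs m) - deriv (disc_B m) (xs m) * disc_A m (xs m))
      \<longlonglongrightarrow> deriv (whit_A) x * whit_B x - deriv (whit_B) x * whit_A x"
    by (intro tendsto_intros disc_A_tendsto disc_B_tendsto x)
  thus ?thesis using True xy by (simp add: disc_wronskian_def whit_wronskian_def divided_wronskian_def)
next
  case False
  have "(\<lambda>m. (disc_A m (xs m) * disc_B m (ys m) - disc_B m (xs m) * disc_A m (ys m)) / (xs m - ys m))
      \<longlonglongrightarrow> (whit_A x * whit_B y - whit_B x * whit_A y) / (x - y)"
    using False by (intro tendsto_intros disc_A_tendsto disc_B_tendsto x y) auto
  moreover have "\<forall>\<^sub>F m in sequentially. xs m - ys m \<noteq> 0"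
    using tendsto_diff[OF x(2) y(2)] False by (intro tendsto_imp_eventually_ne) auto
  hence "\<forall>\<^sub>F m in sequentially. (disc_A m (xs m) * disc_B m (ys m) - disc_B m (xs m) * disc_A m (ys m)) / (xs m - ys m)
      = disc_wronskian m (xs m) (ys m)"
    by eventually_elim (simp add: disc_wronskian_def divided_wronskian_def)
  ultimately show ?thesis using False by (simp add: whit_wronskian_def divided_wronskian_def Lim_transform_eventually)
qed

definition disc_kernel :: "nat \<Rightarrow> nat \<Rightarrow> nat \<Rightarrow> real" where
  "disc_kernel m p' p = lim (\<lambda>N. delta p' p - disc_resolvent (1 - 1 / real m) N p' p)"

definition scaled_weight :: "nat \<Rightarrow> nat \<Rightarrow> real" where
  "scaled_weight m p = real m powr (- Re (z + z')) * p_weight (1 - 1 / real m) p"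

definition whit_weight :: "real \<Rightarrow> real" where
  "whit_weight x = x powr (Re (z + z') / 2) * exp (- x / 2)"

lemma disc_W_scaled:
  assumes m: "2 \<le> m"
  shows "disc_W (1 - 1 / real m) x = disc_A m ((of_real x + 1) / of_nat m)"
    and "disc_V (1 - 1 / real m) x
      = of_real (t * (1 - 1 / real m) * real m powr (- Re (z + z'))) * disc_B m ((of_real x + 1) / of_nat m)"
proof -
  define M where "M = (of_real (real m) :: complex)"
  have M: "M \<noteq> 0" "of_nat m = M" using m by (simp_all add: M_def)
  have inv: "(of_real (1 - (1 - 1 / real m)) :: complex) powr w = M powr (- w)" for w
  proof -
    have "(of_real (1 - (1 - 1 / real m)) :: complex) = inverse M" by (simp add: M_def inverse_eq_divide)
    moreover have "Ln (inverse M) = - Ln M" using m by (intro Ln_inverse) (auto simp: M_def complex_nonpos_Reals_iff)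
    ultimately show ?thesis using M(1) by (simp add: powr_def)
  qed
  have arg: "M * ((of_real x + 1) / M) = of_real x + 1" "M * ((of_real x + 1) / M + 1 / M) = of_real x + 2"
    unfolding add_divide_distrib[symmetric] using M(1) by simp_all
  show "disc_W (1 - 1 / real m) x = disc_A m ((of_real x + 1) / of_nat m)"
    unfolding disc_W_def disc_A_def scaled_hyp_def inv M(2) arg M_def[symmetric] by simp
  have "- of_real (Re (z + z')) = - z - z'" unfolding admissible_sum_real[OF adm, symmetric] by simp
  hence sigma: "of_real (real m powr (- Re (z + z'))) = M powr (- z - z')"
    unfolding M_def using powr_of_real[of "real m" "- Re (z + z')"] by simp
  have "M powr (- z) = M powr ((- z - z') + - (1 - z') + 1)" by simp
  also have "\<dots> = M powr (- z - z') * M powr (- (1 - z')) * M" unfolding powr_add using M(1) by simp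
  finally have split: "M powr (- z) = M powr (- z - z') * M powr (- (1 - z')) * M" .
  show "disc_V (1 - 1 / real m) x
      = of_real (t * (1 - 1 / real m) * real m powr (- Re (z + z'))) * disc_B m ((of_real x + 1) / of_nat m)"
    unfolding disc_V_def disc_B_def scaled_hyp_def inv M(2) arg of_real_mult[of _ "real m powr _"] sigma M_def[symmetric] split
    by simp
qed

lemma disc_WV_quotient:
  assumes m: "2 \<le> m" and x: "x \<noteq> y"
  defines "W \<equiv> disc_W (1 - 1 / real m)" and "V \<equiv> disc_V (1 - 1 / real m)"
  shows "(V y * W x - W y * V x) / of_real (x - y)
      = of_real (t * (1 - 1 / real m) * real m powr (- Re (z + z'))) / of_nat m
      * disc_wronskian m ((of_real x + 1) / of_nat m) ((of_real y + 1) / of_nat m)"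
proof -
  define X Y where "X = (of_real x + 1) / (of_nat m :: complex)" and "Y = (of_real y + 1) / (of_nat m :: complex)"
  have diff: "X - Y = of_real (x - y) / of_nat m" by (simp add: X_def Y_def diff_divide_distrib[symmetric])
  have nz: "(of_real (x - y) :: complex) \<noteq> 0" using x by (subst of_real_eq_0_iff) simp
  have neq: "X \<noteq> Y" using m x by (simp add: X_def Y_def)
  have algebra: "(c * b' * a - a' * (c * b)) / d = c / M * ((a * b' - b * a') / (d / M))"
    if "M \<noteq> 0" "d \<noteq> 0" for c a a' b b' d M :: complex
    using that by (simp add: field_simps)
  show ?thesis
    unfolding W_def V_def disc_W_scaled[OF m] X_def[symmetric] Y_def[symmetric]
      disc_wronskian_def divided_wronskian_def diff if_not_P[OF neq]
    by (rule algebra) (use m nz in auto)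
qed

lemma disc_kernel_limit:
  assumes m: "2 \<le> m"
  shows "(\<lambda>N. complex_of_real (delta p' p - disc_resolvent (1 - 1 / real m) N p' p))
      \<longlonglongrightarrow> of_real (t * (1 - 1 / real m) * (sqrt (scaled_weight m p') * sqrt (scaled_weight m p)))
      / of_nat m * disc_wronskian m (node m p') (node m p)"
proof -
  define xi where "xi = 1 - 1 / real m"
  define c where "c = t * xi * real m powr (- Re (z + z'))"
  define D where "D x y = disc_wronskian m ((of_real x + 1) / of_nat m) ((of_real y + 1) / of_nat m)" for x y
  have xi: "0 < xi" "xi < 1" using m by (auto simp: xi_def)
  interpret solved_cauchy_system "p_weight xi" "q_weight xi" "disc_resolvent xi"
    "disc_W xi" "disc_V xi" "disc_U xi" "disc_T xi"
    by (rule solved_cauchy_system_disc[OF xi])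
  have quot: "(disc_V xi y * disc_W xi x - disc_W xi y * disc_V xi x) / of_real (x - y)
      = of_real c / of_nat m * D x y" if "x \<noteq> y" for x y
    using disc_WV_quotient[OF m that] by (simp add: xi_def c_def D_def)
  have "(\<lambda>N. complex_of_real (delta p' p - disc_resolvent xi N p' p))
      \<longlonglongrightarrow> of_real (s p' * s p) * (of_real c / of_nat m * D (real p') (real p))"
  proof (cases "p' = p")
    case False
    hence neq: "real p' \<noteq> real p" by simp
    from resolvent_limit_offdiag[OF False] show ?thesis
      unfolding quot[OF neq] using False by simp
  next
    case True
    have node: "0 < Re ((of_real (real p) + 1) / of_nat m)" using m by (simp add: Re_divide_of_nat)
    have "filterlim (\<lambda>x. (complex_of_real x + 1) / of_nat m) (at ((of_real (real p) + 1) / of_nat m)) (at_right (real p))"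
      using m by (intro filterlim_atI tendsto_intros) (auto simp: eventually_at_filter simp del: of_real_of_nat_eq)
    from filterlim_compose[OF divided_wronskian_tendsto_diag this]
    have "((\<lambda>x. D x (real p)) \<longlongrightarrow> D (real p) (real p)) (at_right (real p))"
      unfolding D_def disc_wronskian_def using node
      by (simp add: field_differentiable_Re_pos disc_A_holomorphic disc_B_holomorphic)
    hence "((\<lambda>x. of_real c / of_nat m * D x (real p)) \<longlongrightarrow> of_real c / of_nat m * D (real p) (real p)) (at_right (real p))"
      by (intro tendsto_intros)
    moreover have "\<forall>\<^sub>F x in at_right (real p). of_real c / of_nat m * D x (real p)
        = (disc_V xi (real p) * disc_W xi x - disc_W xi (real p) * disc_V xi x) / of_real (x - real p)"
      using eventually_at_right_less by eventually_elim (rule quot[symmetric], simp)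
    ultimately have "(\<lambda>N. complex_of_real (1 - disc_resolvent xi N p p))
        \<longlonglongrightarrow> of_real (p_weight xi p) * (of_real c / of_nat m * D (real p) (real p))"
      by (intro resolvent_limit_diag) (rule Lim_transform_eventually)
    thus ?thesis using True s_square[of p] by simp
  qed
  moreover have "c * (s p' * s p) = t * xi * (sqrt (scaled_weight m p') * sqrt (scaled_weight m p))"
    unfolding scaled_weight_def xi_def[symmetric] c_def s_def by (simp add: real_sqrt_mult)
  hence "of_real (s p' * s p) * of_real c
      = complex_of_real (t * xi * (sqrt (scaled_weight m p') * sqrt (scaled_weight m p)))"
    by (simp only: of_real_mult[symmetric] mult.commute[of "s p' * s p" c])
  ultimately show ?thesis
    unfolding xi_def[symmetric] by (simp add: D_def node_def mult.assoc[symmetric] del: of_real_mult)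
qed

lemma of_real_disc_kernel:
  assumes m: "2 \<le> m"
  shows "of_real (real m * disc_kernel m p' p)
      = of_real (t * (1 - 1 / real m) * (sqrt (scaled_weight m p') * sqrt (scaled_weight m p)))
      * disc_wronskian m (node m p') (node m p)"
  using of_real_lim[OF disc_kernel_limit[OF m], of p' p, folded disc_kernel_def] m by (simp del: of_real_mult) simp

lemma disc_kernel_tendsto:
  assumes "2 \<le> m"
  shows "(\<lambda>N. complex_of_real (delta p' p - disc_resolvent (1 - 1 / real m) N p' p)) \<longlonglongrightarrow> of_real (disc_kernel m p' p)"
  using disc_kernel_limit[OF assms] of_real_lim[OF disc_kernel_limit[OF assms], folded disc_kernel_def] by simp

lemma scaled_weight_tendsto:
  assumes x: "0 < x" and ps: "(\<lambda>m. real (ps m) / real m) \<longlonglongrightarrow> x"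
  shows "(\<lambda>m. scaled_weight m (ps m)) \<longlonglongrightarrow> Re (rGamma (z + 1) * rGamma (z' + 1)) * (whit_weight x)\<^sup>2"
proof -
  define e where "e = Re (z + z')"
  have "filterlim (\<lambda>m. (real (ps m) / real m) * real m) at_top sequentially"
    by (rule filterlim_tendsto_pos_mult_at_top[OF ps x filterlim_real_sequentially])
  moreover have cancel: "\<forall>\<^sub>F m in sequentially. (real (ps m) / real m) * real m = real (ps m)"
    using eventually_gt_at_top[of 0] by eventually_elim simp
  ultimately have "filterlim (\<lambda>m. real (ps m)) at_top sequentially"
    unfolding filterlim_cong[OF refl refl cancel] by simp
  hence "filterlim ps at_top sequentially" using filterlim_sequentially_iff_filterlim_real by blast
  from tendsto_Re[OF filterlim_compose[OF poch_weight_asymptotic this]]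
  have "(\<lambda>m. poch_weight (ps m) * (real (ps m) + 1) powr (- e)) \<longlonglongrightarrow> Re (rGamma (z + 1) * rGamma (z' + 1))"
    by (simp add: e_def)
  moreover have "(\<lambda>m. ((real (ps m) + 1) / real m) powr e) \<longlonglongrightarrow> x powr e"
  proof -
    have "(\<lambda>m. real (ps m) / real m + 1 / real m) \<longlonglongrightarrow> x + 0" by (intro tendsto_add ps lim_1_over_n)
    hence "(\<lambda>m. (real (ps m) + 1) / real m) \<longlonglongrightarrow> x" by (simp add: add_divide_distrib)
    thus ?thesis using x by (intro tendsto_intros) auto
  qed
  moreover have "(\<lambda>m. (1 - 1 / real m) ^ ps m) \<longlonglongrightarrow> exp (- x)"
  proof -
    have "(\<lambda>m. real m * ln (1 - 1 / real m)) \<longlonglongrightarrow> -1" by real_asymp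
    from tendsto_exp[OF tendsto_mult[OF ps this]]
    have "(\<lambda>m. exp (real (ps m) / real m * (real m * ln (1 - 1 / real m)))) \<longlonglongrightarrow> exp (- x)" by simp
    moreover have "\<forall>\<^sub>F m in sequentially. exp (real (ps m) / real m * (real m * ln (1 - 1 / real m))) = (1 - 1 / real m) ^ ps m"
      using eventually_gt_at_top[of 1] by eventually_elim (simp add: exp_of_nat_mult)
    ultimately show ?thesis by (rule Lim_transform_eventually)
  qed
  ultimately have "(\<lambda>m. (poch_weight (ps m) * (real (ps m) + 1) powr (- e)) * ((real (ps m) + 1) / real m) powr e * (1 - 1 / real m) ^ ps m)
      \<longlonglongrightarrow> Re (rGamma (z + 1) * rGamma (z' + 1)) * x powr e * exp (- x)"
    by (intro tendsto_mult)
  moreover have "\<forall>\<^sub>F m in sequentially.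
      (poch_weight (ps m) * (real (ps m) + 1) powr (- e)) * ((real (ps m) + 1) / real m) powr e * (1 - 1 / real m) ^ ps m
      = scaled_weight m (ps m)"
    using eventually_gt_at_top[of 0]
    unfolding scaled_weight_def p_weight_def e_def[symmetric]
    by eventually_elim (simp add: powr_minus powr_divide field_simps)
  moreover have "x powr (e / 2) * x powr (e / 2) = x powr e" "exp (- x / 2) * exp (- x / 2) = exp (- x)"
    unfolding powr_add[symmetric] exp_add[symmetric] by simp_all
  hence "(whit_weight x)\<^sup>2 = x powr e * exp (- x)"
    unfolding whit_weight_def e_def[symmetric] power2_eq_square by (metis mult.assoc mult.left_commute)
  ultimately show ?thesis by (simp add: Lim_transform_eventually mult.assoc)
qed

lemma phi_eq:
  assumes x: "0 < x"
  shows "phi1 z z' x = of_real (whit_weight x) * whit_A (of_real x)"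
    and "phi2 z z' x = of_real (whit_weight x) * whit_B (of_real x)"
proof -
  define e where "e = Re (z + z')"
  have s: "of_real e = z + z'" using admissible_sum_real[OF adm] by (simp add: e_def)
  let ?k1 = "(e + 1) / 2" and ?k2 = "(e - 1) / 2"
  have W1: "whittakerW (of_real ?k1) ((z - z') / 2) x = of_real (exp (- x / 2) * x powr ?k1) * tricomi (- z) (- z') (of_real x)"
    and W2: "whittakerW (of_real ?k2) ((z - z') / 2) x = of_real (exp (- x / 2) * x powr ?k2) * tricomi (1 - z') (1 - z) (of_real x)"
    by (rule whittakerW_eq_tricomi; use x in \<open>auto simp: s power2_eq_square field_simps\<close>)+
  have k: "(of_real ?k1 :: complex) = (z + z' + 1) / 2" "(of_real ?k2 :: complex) = (z + z' - 1) / 2"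
    using s by simp_all
  have "- 1 / 2 + ?k1 = e / 2" "- 1 / 2 + ?k2 = e / 2 - 1" by (simp_all add: field_simps)
  hence "x powr (- 1 / 2) * x powr ?k1 = x powr (e / 2)" "x powr (- 1 / 2) * x powr ?k2 = x powr (e / 2 - 1)"
    by (simp_all only: powr_add[symmetric])
  hence weights: "x powr (- 1 / 2) * (exp (- x / 2) * x powr ?k1) = whit_weight x"
    "x powr (- 1 / 2) * (exp (- x / 2) * x powr ?k2) = whit_weight x / x"
    unfolding whit_weight_def e_def[symmetric] using x by (simp_all add: powr_diff mult_ac)
  show "phi1 z z' x = of_real (whit_weight x) * whit_A (of_real x)"
    unfolding phi1_def W1[unfolded k] whit_A_def weights(1)[symmetric] by simp
  have "of_real (whit_weight x / x) * tricomi (1 - z') (1 - z) (of_real x) = of_real (whit_weight x) * whit_B (of_real x)"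
    by (simp add: whit_B_def)
  thus "phi2 z z' x = of_real (whit_weight x) * whit_B (of_real x)"
    unfolding phi2_def W2[unfolded k] weights(2)[symmetric] by (simp add: mult_ac)
qed

lemma K_offdiag_eq:
  assumes "0 < x" "0 < y" "x \<noteq> y"
  shows "K_offdiag z z' x y = 1 / (Gamma z * Gamma z') * of_real (whit_weight x * whit_weight y)
    * whit_wronskian (of_real x) (of_real y)"
proof -
  have "of_real (x - y) \<noteq> (0::complex)" using assms by (subst of_real_eq_0_iff) simp
  thus ?thesis
    unfolding K_offdiag_def phi_eq[OF assms(1)] phi_eq[OF assms(2)] whit_wronskian_def divided_wronskian_def
    using assms(3) by (simp add: field_simps del: of_real_diff) (simp add: field_simps)
qed

lemma Kwh_eq:
  assumes x: "0 < x" and y: "0 < y"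
  shows "Kwh z z' x y = 1 / (Gamma z * Gamma z') * of_real (whit_weight x * whit_weight y)
    * whit_wronskian (of_real x) (of_real y)"
proof (cases "x = y")
  case False
  thus ?thesis using K_offdiag_eq[OF x y] by (simp add: Kwh_def)
next
  case True
  let ?D = "whit_wronskian"
  let ?K = "\<lambda>u. 1 / (Gamma z * Gamma z') * of_real (whit_weight x * whit_weight u) * ?D (of_real u) (of_real x)"
  have "filterlim complex_of_real (at (of_real x)) (at x)"
    by (rule filterlim_atI) (auto intro!: tendsto_intros simp: eventually_at_filter)
  from filterlim_compose[OF divided_wronskian_tendsto_diag this]
  have "((\<lambda>u. ?D (of_real u) (of_real x)) \<longlongrightarrow> ?D (of_real x) (of_real x)) (at x)"
    unfolding whit_wronskian_def using x by (simp add: field_differentiable_Re_pos whit_holomorphic)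
  moreover have "isCont (whit_weight) x"
    unfolding whit_weight_def[abs_def] using x by (intro continuous_intros) auto
  ultimately have "(?K \<longlongrightarrow> ?K x) (at x)" by (intro tendsto_intros) (simp_all add: isCont_def)
  moreover have "\<forall>\<^sub>F u in at x. ?K u = K_offdiag z z' x u"
  proof -
    have "\<forall>\<^sub>F u in at x. u \<in> {0<..} - {x}" using eventually_at_in_open[of "{0<..}" x] x by simp
    thus ?thesis
      by eventually_elim (use K_offdiag_eq[OF x] in \<open>auto simp: whit_wronskian_def divided_wronskian_sym[of _ _ "of_real x"]\<close>)
  qed
  ultimately have "((\<lambda>u. K_offdiag z z' x u) \<longlongrightarrow> ?K x) (at x)" by (rule Lim_transform_eventually)
  thus ?thesis using True by (simp add: Kwh_def tendsto_Lim)
qed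

lemma disc_kernel_tendsto_Kwh:
  assumes x: "0 < x" "(\<lambda>m. real (ps m) / real m) \<longlonglongrightarrow> x" and y: "0 < y" "(\<lambda>m. real (qs m) / real m) \<longlonglongrightarrow> y"
    and xy: "x = y \<Longrightarrow> ps = qs"
  shows "(\<lambda>m. of_real (real m * disc_kernel m (ps m) (qs m))) \<longlonglongrightarrow> Kwh z z' x y"
proof -
  define R where "R = Re (rGamma (z + 1) * rGamma (z' + 1))"
  have R: "0 < R" "of_real t * of_real R = 1 / (Gamma z * Gamma z')"
    unfolding R_def using rGamma_product by auto
  have "0 \<le> whit_weight u" for u by (simp add: whit_weight_def)
  hence sqrt: "sqrt (R * (whit_weight x)\<^sup>2) * sqrt (R * (whit_weight y)\<^sup>2) = R * (whit_weight x * whit_weight y)"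
    using R by (simp add: real_sqrt_mult)
  let ?D = "\<lambda>m. disc_wronskian m (node m (ps m)) (node m (qs m))"
  let ?w = "\<lambda>m. t * (1 - 1 / real m) * (sqrt (scaled_weight m (ps m)) * sqrt (scaled_weight m (qs m)))"
  have "(\<lambda>m. of_real (?w m) * ?D m)
      \<longlonglongrightarrow> of_real (t * (1 - 0) * (sqrt (R * (whit_weight x)\<^sup>2) * sqrt (R * (whit_weight y)\<^sup>2)))
      * whit_wronskian (of_real x) (of_real y)"
    unfolding R_def using x y xy
    by (intro tendsto_intros disc_wronskian_tendsto scaled_weight_tendsto node_tendsto lim_1_over_n) auto
  also have "of_real (t * (1 - 0) * (sqrt (R * (whit_weight x)\<^sup>2) * sqrt (R * (whit_weight y)\<^sup>2)))
      * whit_wronskian (of_real x) (of_real y) = Kwh z z' x y"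
    unfolding sqrt Kwh_eq[OF x(1) y(1)] R(2)[symmetric] by simp
  finally have lim: "(\<lambda>m. of_real (?w m) * ?D m) \<longlonglongrightarrow> Kwh z z' x y" .
  have "\<forall>\<^sub>F m in sequentially. of_real (?w m) * ?D m = of_real (real m * disc_kernel m (ps m) (qs m))"
    using eventually_ge_at_top[of 2] by eventually_elim (rule of_real_disc_kernel[symmetric])
  with lim show ?thesis by (rule Lim_transform_eventually)
qed

end

section \<open>A bound for the diagonal of the kernel\<close>

lemma finite_difference_cauchy:
  fixes P :: "'a::field_char_0 poly"
  assumes deg: "degree P \<le> n" and h: "h \<noteq> 0" and nz: "\<And>j. j \<le> n \<Longrightarrow> x - of_nat j * h + y \<noteq> 0"
  shows "(\<Sum>j\<le>n. (- 1) ^ j * of_nat (n choose j) * poly P (x - of_nat j * h) / (x - of_nat j * h + y))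
      = fact n * h ^ n * (- 1) ^ n * poly P (- y) / (\<Prod>j\<le>n. x - of_nat j * h + y)"
proof -
  let ?x = "\<lambda>j. x - of_nat j * h"
  let ?S = "\<Sum>j\<le>n. (- 1) ^ j * of_nat (n choose j) * poly P (?x j) / (?x j + y)"
  have sign: "a / ((- 1) ^ k * b) = (- 1) ^ k * a / b" for a b :: 'a and k by (cases "even k") auto
  have "poly P (- y) / (\<Prod>j\<le>n. - y - ?x j)
      = (\<Sum>i\<le>n. poly P (?x i) / (\<Prod>j\<in>{..n} - {i}. ?x i - ?x j) / (- y - ?x i))"
  proof (rule partial_fractions_simple_poles)
    show "- y \<noteq> ?x i" if "i \<in> {..n}" for i using nz[of i] that by (metis atMost_iff left_minus)
  qed (use h deg in \<open>auto simp: inj_on_def\<close>)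
  also have "(\<Prod>j\<le>n. - y - ?x j) = (\<Prod>j\<le>n. (- 1) * (?x j + y))" by (intro prod.cong refl) simp
  also have "\<dots> = (- 1) ^ Suc n * (\<Prod>j\<le>n. ?x j + y)" by (simp only: prod.distrib) simp
  also have "(\<Sum>i\<le>n. poly P (?x i) / (\<Prod>j\<in>{..n} - {i}. ?x i - ?x j) / (- y - ?x i))
      = - ?S / (fact n * h ^ n)"
    unfolding sum_negf[symmetric] sum_divide_distrib
  proof (intro sum.cong refl)
    fix i assume "i \<in> {..n}"
    hence i: "i \<le> n" by simp
    have "(\<Prod>j\<in>{..n} - {i}. ?x i - ?x j) = (\<Prod>j\<in>{..n} - {i}. (of_nat j - of_nat i) * h)"
      by (intro prod.cong refl) (simp add: algebra_simps)
    also have "\<dots> = (- 1) ^ i * fact i * fact (n - i) * h ^ n"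
      using i by (simp add: prod.distrib prod_of_nat_diff)
    finally have prod: "(\<Prod>j\<in>{..n} - {i}. ?x i - ?x j) = (- 1) ^ i * fact i * fact (n - i) * h ^ n" .
    define w where "w = ?x i + y"
    have w: "- y - ?x i = - w" by (simp add: w_def)
    show "poly P (?x i) / (\<Prod>j\<in>{..n} - {i}. ?x i - ?x j) / (- y - ?x i)
        = - ((- 1) ^ i * of_nat (n choose i) * poly P (?x i) / (?x i + y)) / (fact n * h ^ n)"
      unfolding prod binomial_fact[OF i] w w_def[symmetric] by (simp add: sign mult.assoc)
  qed
  finally have "?S / (fact n * h ^ n) = (- 1) ^ n * poly P (- y) / (\<Prod>j\<le>n. ?x j + y)"
    unfolding sign by simp
  moreover have "?S = fact n * h ^ n * (?S / (fact n * h ^ n))" using h by simp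
  ultimately show ?thesis by (simp only: times_divide_eq_right mult.assoc)
qed

lemma finite_difference_cauchy_bound:
  fixes p h y :: real
  assumes h: "0 < h" "real (2 * r) * h \<le> p / 2" "h \<le> p" and y: "0 < y"
  shows "\<bar>\<Sum>j\<le>2 * r. (- 1) ^ j * of_nat (2 * r choose j) * ((p - real j * h) / p) ^ r / (p - real j * h + y)\<bar>
      \<le> fact (2 * r) * 2 ^ (2 * r + 1) * (p * y) ^ r / (p + y) ^ (2 * r + 1)"
proof -
  have p: "0 < p" using h by linarith
  have node: "(p + y) / 2 \<le> p - real j * h + y" if "j \<le> 2 * r" for j
  proof -
    have "real j * h \<le> real (2 * r) * h" using that h by (intro mult_right_mono) auto
    hence "real j * h \<le> p / 2" using h(2) by (rule order_trans)
    thus ?thesis using y by (simp add: field_simps)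
  qed
  have "((p + y) / 2) ^ (2 * r + 1) = (\<Prod>j\<le>2 * r. (p + y) / 2)" by simp
  also have "\<dots> \<le> (\<Prod>j\<le>2 * r. p - real j * h + y)" using p y node by (intro prod_mono) auto
  finally have prod: "((p + y) / 2) ^ (2 * r + 1) \<le> (\<Prod>j\<le>2 * r. p - real j * h + y)" .
  have pos: "0 < ((p + y) / 2) ^ (2 * r + 1)" using p y by simp
  have prod_pos: "0 < (\<Prod>j\<le>2 * r. p - real j * h + y)" by (rule less_le_trans[OF pos prod])
  have "0 < p - real j * h + y" if "j \<le> 2 * r" for j
    using p y by (intro order_less_le_trans[OF _ node[OF that]]) simp
  from finite_difference_cauchy[of "monom (1 / p ^ r) r" "2 * r" h p y, OF _ _ less_imp_neq[OF this, symmetric]]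
  have "(\<Sum>j\<le>2 * r. (- 1) ^ j * of_nat (2 * r choose j) * ((p - real j * h) / p) ^ r / (p - real j * h + y))
      = fact (2 * r) * h ^ (2 * r) * ((- y) ^ r / p ^ r) / (\<Prod>j\<le>2 * r. p - real j * h + y)"
    using h by (simp add: poly_monom degree_monom_le[THEN order_trans] power_divide)
  also have "\<bar>\<dots>\<bar> = fact (2 * r) * h ^ (2 * r) * (y ^ r / p ^ r) / (\<Prod>j\<le>2 * r. p - real j * h + y)"
    using h p y prod_pos by (simp add: abs_mult power_abs abs_of_pos)
  also have "\<dots> \<le> fact (2 * r) * p ^ (2 * r) * (y ^ r / p ^ r) / ((p + y) / 2) ^ (2 * r + 1)"
    using h p y prod pos by (intro frac_le mult_right_mono mult_left_mono power_mono) auto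
  also have "\<dots> = fact (2 * r) * 2 ^ (2 * r + 1) * (p * y) ^ r / (p + y) ^ (2 * r + 1)"
    unfolding mult_2[of r] power_add[of p r r] using p by (simp add: power_divide power_mult_distrib)
  finally show ?thesis .
qed

text \<open>Coefficient, at the site $k$, of the average over the step sizes $h \le H$ of the (negated) $n$-th backward
  difference at $p$ without its term at $p$; its $\ell^2$ norm is small because the average spreads over many sites.\<close>

definition averaged_difference :: "nat \<Rightarrow> nat \<Rightarrow> nat \<Rightarrow> nat \<Rightarrow> real" where
  "averaged_difference n H p k
    = (\<Sum>h=1..H. \<Sum>j=1..n. if k = p - j * h then - ((- 1) ^ j * of_nat (n choose j)) else 0) / real H"

lemma sum_choose_le: "(\<Sum>j=1..n. real (n choose j)) \<le> 2 ^ n"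
proof -
  have "(\<Sum>j=1..n. real (n choose j)) \<le> (\<Sum>j\<le>n. real (n choose j))" by (intro sum_mono2) auto
  also have "\<dots> = 2 ^ n" by (simp add: choose_row_sum flip: of_nat_sum)
  finally show ?thesis .
qed

lemma averaged_difference_support:
  assumes "averaged_difference n H p k \<noteq> 0" "2 * n * H \<le> p"
  shows "p \<le> 2 * k" "k \<le> p"
proof -
  have "\<exists>h\<in>{1..H}. \<exists>j\<in>{1..n}. k = p - j * h"
  proof (rule ccontr)
    assume "\<not> ?thesis"
    hence "averaged_difference n H p k = 0" unfolding averaged_difference_def by (auto intro!: sum.neutral)
    thus False using assms(1) by simp
  qed
  then obtain h j where hj: "h \<in> {1..H}" "j \<in> {1..n}" "k = p - j * h" by blast
  hence "j * h \<le> n * H" by (intro mult_mono) auto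
  thus "p \<le> 2 * k" "k \<le> p" using hj(3) assms(2) by auto
qed

lemma abs_averaged_difference_le:
  assumes p: "n * H \<le> p"
  shows "\<bar>averaged_difference n H p k\<bar> \<le> 2 ^ n / real H"
proof -
  have "\<bar>\<Sum>h=1..H. \<Sum>j=1..n. if k = p - j * h then - ((- 1) ^ j * of_nat (n choose j)) else 0\<bar>
      \<le> (\<Sum>h=1..H. \<Sum>j=1..n. if k = p - j * h then real (n choose j) else 0)"
    by (intro order_trans[OF sum_abs] sum_mono) (auto simp: abs_mult power_abs)
  also have "\<dots> = (\<Sum>j=1..n. real (n choose j) * real (card {h \<in> {1..H}. k = p - j * h}))"
    by (subst sum.swap) (simp add: sum.If_cases Int_def mult.commute)
  also have "\<dots> \<le> (\<Sum>j=1..n. real (n choose j) * 1)"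
  proof (intro sum_mono mult_left_mono)
    fix j assume j: "j \<in> {1..n}"
    have "h = h'" if "h \<in> {1..H}" "h' \<in> {1..H}" "p - j * h = p - j * h'" for h h'
    proof -
      have "j * h \<le> n * H" "j * h' \<le> n * H" using that(1,2) j by (auto intro!: mult_mono)
      hence "j * h = j * h'" using that(3) p by linarith
      thus ?thesis using j by simp
    qed
    hence "card {h \<in> {1..H}. k = p - j * h} \<le> 1" by (subst card_le_Suc0_iff_eq[simplified One_nat_def[symmetric]]) auto
    thus "real (card {h \<in> {1..H}. k = p - j * h}) \<le> 1" by simp
  qed auto
  finally show ?thesis
    unfolding averaged_difference_def abs_divide using sum_choose_le[of n] by (simp add: divide_right_mono)
qed

lemma sum_averaged_difference:
  assumes p: "p < N"
  shows "(\<Sum>k<N. f k * averaged_difference n H p k)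
      = (\<Sum>h=1..H. \<Sum>j=1..n. - ((- 1) ^ j * of_nat (n choose j)) * f (p - j * h)) / real H"
proof -
  have "(\<Sum>k<N. f k * averaged_difference n H p k)
      = (\<Sum>k<N. \<Sum>h=1..H. \<Sum>j=1..n. if k = p - j * h then - ((- 1) ^ j * of_nat (n choose j)) * f k else 0) / real H"
    unfolding averaged_difference_def sum_divide_distrib sum_distrib_left
    by (intro sum.cong refl) (auto simp: mult_ac)
  also have "(\<Sum>k<N. \<Sum>h=1..H. \<Sum>j=1..n. if k = p - j * h then - ((- 1) ^ j * of_nat (n choose j)) * f k else 0)
      = (\<Sum>h=1..H. \<Sum>j=1..n. \<Sum>k<N. if k = p - j * h then - ((- 1) ^ j * of_nat (n choose j)) * f k else 0)"
    by (subst sum.swap, rule sum.cong[OF refl], rule sum.swap)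
  also have "\<dots> = (\<Sum>h=1..H. \<Sum>j=1..n. - ((- 1) ^ j * of_nat (n choose j)) * f (p - j * h))"
    using p by (intro sum.cong refl) (auto simp: less_imp_diff_less)
  finally show ?thesis .
qed

lemma sum_averaged_difference_squares_le:
  assumes p: "p < N" "n * H \<le> p" and H: "0 < H"
  shows "(\<Sum>k<N. (averaged_difference n H p k)\<^sup>2) \<le> 4 ^ n / real H"
proof -
  have "(\<Sum>k<N. (averaged_difference n H p k)\<^sup>2)
      = (\<Sum>k<N. averaged_difference n H p k * averaged_difference n H p k)"
    by (simp add: power2_eq_square)
  also have "\<dots> = (\<Sum>h=1..H. \<Sum>j=1..n. - ((- 1) ^ j * of_nat (n choose j)) * averaged_difference n H p (p - j * h)) / real H"
    by (rule sum_averaged_difference[OF p(1)])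
  also have "\<dots> \<le> (\<Sum>h=1..H. \<Sum>j=1..n. real (n choose j) * (2 ^ n / real H)) / real H"
  proof (intro divide_right_mono sum_mono)
    fix h j
    have "- ((- 1) ^ j * of_nat (n choose j)) * averaged_difference n H p (p - j * h)
        \<le> \<bar>- ((- 1) ^ j * of_nat (n choose j)) * averaged_difference n H p (p - j * h)\<bar>" by (rule abs_ge_self)
    also have "\<dots> = real (n choose j) * \<bar>averaged_difference n H p (p - j * h)\<bar>" by (simp add: abs_mult power_abs)
    also have "\<dots> \<le> real (n choose j) * (2 ^ n / real H)"
      by (intro mult_left_mono abs_averaged_difference_le p) simp
    finally show "- ((- 1) ^ j * of_nat (n choose j)) * averaged_difference n H p (p - j * h) \<le> \<dots>" .
  qed simp
  also have "\<dots> = (\<Sum>j=1..n. real (n choose j)) * (2 ^ n / real H)"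
    using H by (simp add: sum_distrib_right sum_divide_distrib)
  also have "\<dots> \<le> 2 ^ n * (2 ^ n / real H)" by (intro mult_right_mono sum_choose_le) simp
  finally show ?thesis by (simp flip: power_mult_distrib)
qed

lemma sum_inverse_squares_le:
  assumes p: "0 < p"
  shows "(\<Sum>q<N. 1 / (real p + real q + 1)\<^sup>2) \<le> 1 / real p"
proof -
  have "(\<Sum>q<N. 1 / (real p + real q + 1)\<^sup>2) \<le> (\<Sum>q<N. 1 / (real p + real q) - 1 / (real p + real (Suc q)))"
    using p by (intro sum_mono) (simp add: divide_simps power2_eq_square, simp add: algebra_simps)
  also have "\<dots> = 1 / real p - 1 / (real p + real N)"
    using sum_lessThan_telescope'[of "\<lambda>q. 1 / (real p + real q)" N] by simp
  also have "\<dots> \<le> 1 / real p" by simp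
  finally show ?thesis .
qed

lemma cauchy_matrix_averaged_difference:
  assumes F: "\<And>p. 0 < F p" and p: "0 < p" "p < N" "n * H \<le> p" and H: "0 < H"
  shows "cauchy_matrix F G p q - (\<Sum>i<N. cauchy_matrix F G i q
      * (sqrt (F p) / sqrt (F i) * (real i / real p) ^ r * averaged_difference n H p i))
    = sqrt (F p) * sqrt (G q) * (\<Sum>h=1..H. \<Sum>j\<le>n. (- 1) ^ j * of_nat (n choose j)
      * ((real p - real j * real h) / real p) ^ r / (real p - real j * real h + (real q + 1))) / real H"
proof -
  define a where "a = sqrt (F p) * sqrt (G q)"
  define f where "f i = a * ((real i / real p) ^ r / (real i + (real q + 1)))" for i
  let ?c = "\<lambda>j. (- 1) ^ j * of_nat (n choose j) :: real"
  have "(\<Sum>i<N. cauchy_matrix F G i q * (sqrt (F p) / sqrt (F i) * (real i / real p) ^ r * averaged_difference n H p i))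
      = (\<Sum>i<N. f i * averaged_difference n H p i)"
  proof (intro sum.cong refl)
    fix i
    have "sqrt (F i) \<noteq> 0" using F[of i] by simp
    thus "cauchy_matrix F G i q * (sqrt (F p) / sqrt (F i) * (real i / real p) ^ r * averaged_difference n H p i)
        = f i * averaged_difference n H p i"
      by (simp add: cauchy_matrix_def f_def a_def add_ac)
  qed
  also have "\<dots> = (\<Sum>h=1..H. \<Sum>j=1..n. - ?c j * f (p - j * h)) / real H"
    by (rule sum_averaged_difference[OF p(2)])
  finally have "cauchy_matrix F G p q - (\<Sum>i<N. cauchy_matrix F G i q
      * (sqrt (F p) / sqrt (F i) * (real i / real p) ^ r * averaged_difference n H p i))
      = (\<Sum>h=1..H. f p + (\<Sum>j=1..n. ?c j * f (p - j * h))) / real H"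
    using p(1) H by (simp add: cauchy_matrix_def f_def a_def sum.distrib sum_negf add_divide_distrib add_ac)
  also have "(\<Sum>h=1..H. f p + (\<Sum>j=1..n. ?c j * f (p - j * h)))
      = a * (\<Sum>h=1..H. \<Sum>j\<le>n. ?c j * ((real p - real j * real h) / real p) ^ r / (real p - real j * real h + (real q + 1)))"
    unfolding sum_distrib_left
  proof (intro sum.cong refl)
    fix h assume h: "h \<in> {1..H}"
    have "j * h \<le> p" if "j \<le> n" for j
      using mult_le_mono[OF that, of h H] h p(3) by simp
    hence "real (p - j * h) = real p - real j * real h" if "j \<le> n" for j using that by (simp add: of_nat_diff)
    hence "(\<Sum>j\<le>n. ?c j * f (p - j * h))
        = (\<Sum>j\<le>n. a * (?c j * ((real p - real j * real h) / real p) ^ r / (real p - real j * real h + (real q + 1))))"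
      by (intro sum.cong refl) (simp add: f_def)
    thus "f p + (\<Sum>j=1..n. ?c j * f (p - j * h))
        = (\<Sum>j\<le>n. a * (?c j * ((real p - real j * real h) / real p) ^ r / (real p - real j * real h + (real q + 1))))"
      by (simp add: atMost_atLeast0 sum.atLeast_Suc_atMost[of 0 n])
  qed
  finally show ?thesis by (simp add: a_def)
qed

lemma powr_weights_le:
  fixes x y w :: real
  assumes "0 < x" "x \<le> w" "0 < y" "y \<le> w" "\<bar>e\<bar> \<le> real (2 * r)"
  shows "x powr e * y powr (- e) * (x * y) ^ (2 * r) \<le> w ^ (4 * r)"
proof -
  have "x powr e * y powr (- e) * (x * y) ^ (2 * r) = x powr (real (2 * r) + e) * y powr (real (2 * r) - e)"
    using assms(1,3) by (simp add: powr_add powr_diff powr_minus powr_realpow[symmetric] powr_mult field_simps)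
  also have "\<dots> \<le> w powr (real (2 * r) + e) * w powr (real (2 * r) - e)"
    using assms by (intro mult_mono powr_mono2) auto
  also have "\<dots> = w powr real (4 * r)" by (simp add: powr_add[symmetric])
  also have "\<dots> = w ^ (4 * r)" using assms(1,2) by (intro powr_realpow) auto
  finally show ?thesis .
qed

lemma cauchy_matrix_averaged_difference_bound:
  assumes F: "\<And>p. 0 < F p" and G: "\<And>q. 0 \<le> G q"
    and FG: "\<And>p q. F p * G q \<le> D * ((real p + 1) powr e * (real q + 1) powr (- e))" and D: "0 \<le> D"
    and r: "0 < r" "\<bar>e\<bar> \<le> real (2 * r)" and p: "p < N" "2 * (2 * r * H) \<le> p" and H: "0 < H"
  shows "(cauchy_matrix F G p q - (\<Sum>i<N. cauchy_matrix F G i q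
      * (sqrt (F p) / sqrt (F i) * (real i / real p) ^ r * averaged_difference (2 * r) H p i)))\<^sup>2
    \<le> D * (fact (2 * r) * 2 ^ (2 * r + 1))\<^sup>2 * (1 / (real p + real q + 1)\<^sup>2)"
proof -
  define y where "y = real q + 1"
  define E where "E = fact (2 * r) * 2 ^ (2 * r + 1) * (real p * y) ^ r / (real p + y) ^ (2 * r + 1)"
  let ?R = "\<lambda>h. \<Sum>j\<le>2 * r. (- 1) ^ j * of_nat (2 * r choose j) * ((real p - real j * real h) / real p) ^ r
      / (real p - real j * real h + y)"
  have y: "0 < y" by (simp add: y_def)
  have "0 < 2 * (2 * r * H)" using r(1) H by simp
  hence p0: "0 < p" using p(2) by linarith
  have R: "\<bar>?R h\<bar> \<le> E" if h: "h \<in> {1..H}" for h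
    unfolding E_def
  proof (rule finite_difference_cauchy_bound)
    have "2 * r * h \<le> 2 * r * H" "1 * h \<le> 2 * r * H"
      using h r(1) mult_le_mono[of 1 "2 * r" h H] by simp_all
    hence "2 * (2 * r * h) \<le> p" "h \<le> p" using p(2) by linarith+
    thus "real (2 * r) * real h \<le> real p / 2" "real h \<le> real p"
      using of_nat_mono[of "2 * (2 * r * h)" p, where 'a=real] by simp_all
  qed (use h y in auto)
  define S where "S = (\<Sum>h=1..H. ?R h)"
  have "\<bar>S\<bar> \<le> (\<Sum>h=1..H. E)" unfolding S_def by (intro order_trans[OF sum_abs] sum_mono R)
  hence "\<bar>S\<bar> / real H \<le> E" using H by (simp add: divide_le_eq mult.commute)
  hence "\<bar>sqrt (F p) * sqrt (G q) * S / real H\<bar> \<le> sqrt (F p) * sqrt (G q) * E"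
    using F[of p] G[of q] mult_left_mono[of "\<bar>S\<bar> / real H" E "sqrt (F p) * sqrt (G q)"] by (simp add: abs_mult)
  hence "(cauchy_matrix F G p q - (\<Sum>i<N. cauchy_matrix F G i q
      * (sqrt (F p) / sqrt (F i) * (real i / real p) ^ r * averaged_difference (2 * r) H p i)))\<^sup>2
      \<le> (sqrt (F p) * sqrt (G q) * E)\<^sup>2"
    using cauchy_matrix_averaged_difference[where F=F and n="2 * r" and H=H and G=G and q=q and r=r, OF F p0 p(1)] p(2) H
    by (simp add: S_def y_def abs_le_square_iff[symmetric] abs_of_nonneg F G less_imp_le E_def)
  also have "\<dots> = F p * G q * E\<^sup>2" using F[of p] G[of q] by (simp add: power_mult_distrib)
  also have "\<dots> \<le> D * ((real p + 1) powr e * y powr (- e)) * E\<^sup>2"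
    using FG[of p q] by (intro mult_right_mono) (auto simp: y_def)
  also have "\<dots> \<le> D * ((real p + 1) powr e * y powr (- e) * ((real p + 1) * y) ^ (2 * r))
      * ((fact (2 * r) * 2 ^ (2 * r + 1))\<^sup>2 / (real p + y) ^ (4 * r + 2))"
  proof -
    have "E\<^sup>2 = (real p * y) ^ (2 * r) * ((fact (2 * r) * 2 ^ (2 * r + 1))\<^sup>2 / (real p + y) ^ (4 * r + 2))"
      using power_even_eq[of "real p + y" "2 * r + 1"] power_even_eq[of "real p * y" r]
      unfolding E_def by (simp add: power_divide power_mult_distrib[of _ "(real p * y) ^ r"])
    also have "\<dots> \<le> ((real p + 1) * y) ^ (2 * r) * ((fact (2 * r) * 2 ^ (2 * r + 1))\<^sup>2 / (real p + y) ^ (4 * r + 2))"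
      using y by (intro mult_right_mono power_mono) auto
    finally have E: "E\<^sup>2 \<le> ((real p + 1) * y) ^ (2 * r) * ((fact (2 * r) * 2 ^ (2 * r + 1))\<^sup>2 / (real p + y) ^ (4 * r + 2))" .
    have "0 \<le> D * ((real p + 1) powr e * y powr (- e))" using D by simp
    from mult_left_mono[OF E this] show ?thesis by (simp only: mult.assoc)
  qed
  also have "\<dots> \<le> D * (real p + y) ^ (4 * r) * ((fact (2 * r) * 2 ^ (2 * r + 1))\<^sup>2 / (real p + y) ^ (4 * r + 2))"
    using D by (intro mult_right_mono mult_left_mono powr_weights_le r) (auto simp: y_def)
  also have "\<dots> = D * (fact (2 * r) * 2 ^ (2 * r + 1))\<^sup>2 * (1 / (real p + y)\<^sup>2)"
    using y by (simp add: power_add power2_eq_square[of "real p + y"])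
  finally show ?thesis by (simp add: y_def add.assoc)
qed

lemma resolvent_complement_le_one:
  assumes M: "is_resolvent U (gram Q A) M" and fin: "finite U" and p: "p \<in> U"
  shows "1 - M p p \<le> 1"
  using resolvent_complement_diag_le[OF M fin p, of "\<lambda>i. delta i p"] fin p
  by (simp add: sum_delta_mult power2_eq_square)

lemma cauchy_resolvent_complement_le:
  assumes F: "\<And>p. 0 < F p" and G: "\<And>q. 0 \<le> G q" and D: "0 \<le> D"
    and doubling: "\<And>p k. k \<le> p \<Longrightarrow> p \<le> 2 * k \<Longrightarrow> F p \<le> D * F k"
    and FG: "\<And>p q. F p * G q \<le> D * ((real p + 1) powr e * (real q + 1) powr (- e))"
    and M: "is_resolvent {..<N} (gram {..<N} (cauchy_matrix F G)) M"
    and r: "0 < r" "\<bar>e\<bar> \<le> real (2 * r)" and p: "p < N" "4 * r \<le> p"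
  shows "1 - M p p \<le> D * (8 * real r * 4 ^ (2 * r) + (fact (2 * r) * 2 ^ (2 * r + 1))\<^sup>2) / real p"
proof -
  define H where "H = p div (4 * r)"
  define c where "c = averaged_difference (2 * r) H p"
  define u where "u i = sqrt (F p) / sqrt (F i) * (real i / real p) ^ r * c i" for i
  define K where "K = (fact (2 * r) * 2 ^ (2 * r + 1) :: real)\<^sup>2"
  have H: "0 < H" "2 * (2 * r * H) \<le> p"
    using p r(1) by (simp_all add: H_def div_greater_zero_iff mult.assoc[symmetric])
  have "p < 4 * r * (H + 1)" using r(1) by (simp add: H_def dividend_less_times_div)
  also have "\<dots> \<le> 4 * r * (2 * H)" using H(1) by (intro mult_le_mono) auto
  finally have "p \<le> 8 * r * H" by simp
  from of_nat_mono[OF this] have "real p \<le> 8 * real r * real H" by simp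
  hence inverse_H: "1 / real H \<le> 8 * real r / real p" using H(1) p r(1) by (simp add: divide_simps mult.commute)
  have "(u i)\<^sup>2 \<le> D * (c i)\<^sup>2" for i
  proof (cases "c i = 0")
    case False
    hence "p \<le> 2 * i" "i \<le> p"
      using averaged_difference_support[of "2 * r" H p i] H(2) by (auto simp: c_def mult_ac)
    hence "F p / F i \<le> D" "(real i / real p) ^ (2 * r) \<le> 1"
      using doubling[of i p] F[of i] by (auto simp: divide_le_eq intro!: power_le_one divide_le_eq_1[THEN iffD2])
    hence "F p / F i * (real i / real p) ^ (2 * r) \<le> D * 1"
      using F less_imp_le by (intro mult_mono D) auto
    moreover have "(u i)\<^sup>2 = F p / F i * (real i / real p) ^ (2 * r) * (c i)\<^sup>2"
      using F[of p] F[of i] by (simp add: u_def power_mult_distrib power_divide power_mult[symmetric] mult.commute)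
    ultimately show ?thesis using mult_right_mono[of "F p / F i * (real i / real p) ^ (2 * r)" "D * 1" "(c i)\<^sup>2"] by simp
  qed (simp add: u_def)
  hence "(\<Sum>i<N. (u i)\<^sup>2) \<le> D * (\<Sum>i<N. (c i)\<^sup>2)" unfolding sum_distrib_left by (intro sum_mono)
  also have "\<dots> \<le> D * (4 ^ (2 * r) / real H)"
    unfolding c_def using H D p by (intro mult_left_mono sum_averaged_difference_squares_le) auto
  also have "\<dots> \<le> D * (4 ^ (2 * r) * (8 * real r / real p))"
    using D inverse_H by (intro mult_left_mono) (simp_all add: divide_inverse)
  finally have norm: "(\<Sum>i<N. (u i)\<^sup>2) \<le> D * (8 * real r * 4 ^ (2 * r)) / real p" by (simp add: mult_ac)
  have "(\<Sum>q<N. (cauchy_matrix F G p q - (\<Sum>i<N. cauchy_matrix F G i q * u i))\<^sup>2)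
      \<le> (\<Sum>q<N. D * K * (1 / (real p + real q + 1)\<^sup>2))"
    unfolding u_def c_def K_def
    by (intro sum_mono cauchy_matrix_averaged_difference_bound[where e=e] F G FG D r p(1) H)
  also have "\<dots> \<le> D * K * (1 / real p)"
    unfolding sum_distrib_left[symmetric] using D p r(1)
    by (intro mult_left_mono sum_inverse_squares_le) (auto simp: K_def)
  finally have "(\<Sum>q<N. (cauchy_matrix F G p q - (\<Sum>i<N. cauchy_matrix F G i q * u i))\<^sup>2) \<le> D * K / real p" by simp
  with norm show ?thesis
    using resolvent_complement_diag_le[OF M, of p u] p(1) unfolding K_def[symmetric]
    by (simp add: distrib_left add_divide_distrib)
qed

lemma cauchy_resolvent_complement_bound:
  fixes D e :: real
  assumes D: "0 \<le> D"
  obtains C where "0 \<le> C" "\<And>F G N M p. (\<And>p. 0 < F p) \<Longrightarrow> (\<And>q. 0 \<le> G q) \<Longrightarrow>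
    (\<And>p k. k \<le> p \<Longrightarrow> p \<le> 2 * k \<Longrightarrow> F p \<le> D * F k) \<Longrightarrow>
    (\<And>p q. F p * G q \<le> D * ((real p + 1) powr e * (real q + 1) powr (- e))) \<Longrightarrow>
    is_resolvent {..<N} (gram {..<N} (cauchy_matrix F G)) M \<Longrightarrow> p < N \<Longrightarrow> 1 - M p p \<le> C / (real p + 1)"
proof -
  obtain n where n: "\<bar>e\<bar> \<le> real n" using real_arch_simple by blast
  define r where "r = Suc n"
  have r: "0 < r" "\<bar>e\<bar> \<le> real (2 * r)" using n by (simp_all add: r_def)
  define B where "B = D * (8 * real r * 4 ^ (2 * r) + (fact (2 * r) * 2 ^ (2 * r + 1))\<^sup>2)"
  have B: "0 \<le> B" using D by (simp add: B_def)
  show ?thesis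
  proof (rule that[of "4 * real r + 2 * B"])
    fix F G :: "nat \<Rightarrow> real" and N p :: nat and M :: "nat \<Rightarrow> nat \<Rightarrow> real"
    assume hyps: "\<And>p. 0 < F p" "\<And>q. 0 \<le> G q" "\<And>p k. k \<le> p \<Longrightarrow> p \<le> 2 * k \<Longrightarrow> F p \<le> D * F k"
      "\<And>p q. F p * G q \<le> D * ((real p + 1) powr e * (real q + 1) powr (- e))"
      and M: "is_resolvent {..<N} (gram {..<N} (cauchy_matrix F G)) M" and p: "p < N"
    show "1 - M p p \<le> (4 * real r + 2 * B) / (real p + 1)"
    proof (cases "4 * r \<le> p")
      case True
      have "1 - M p p \<le> B / real p"
        unfolding B_def by (rule cauchy_resolvent_complement_le[OF hyps(1,2) D hyps(3,4) M r p True])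
      also have "\<dots> \<le> (2 * B) / (real p + 1)"
        using B True r(1) mult_left_mono[of 1 "real p" B] by (simp add: field_simps)
      also have "\<dots> \<le> (4 * real r + 2 * B) / (real p + 1)" by (simp add: divide_right_mono)
      finally show ?thesis .
    next
      case False
      have "1 - M p p \<le> 1" using resolvent_complement_le_one[OF M] p by simp
      also have "1 \<le> (4 * real r + 2 * B) / (real p + 1)" using False B by (simp add: field_simps)
      finally show ?thesis .
    qed
  qed (use B in simp)
qed

lemma powr_le_two_powr_mult:
  fixes x y e :: real
  assumes "0 < x" "x \<le> y" "y \<le> 2 * x"
  shows "y powr e \<le> 2 powr \<bar>e\<bar> * x powr e"
proof -
  have "(y / x) powr e \<le> (y / x) powr \<bar>e\<bar>" using assms by (intro powr_mono) auto
  also have "\<dots> \<le> 2 powr \<bar>e\<bar>" using assms by (intro powr_mono2) (auto simp: divide_le_eq)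
  finally have "(y / x) powr e * x powr e \<le> 2 powr \<bar>e\<bar> * x powr e" by (intro mult_right_mono) auto
  thus ?thesis using assms by (simp add: powr_divide)
qed

context admissible_pair
begin

interpretation neg: admissible_pair "- z" "- z'" by (rule uminus_pair)

lemma disc_kernel_diag_bound:
  obtains C where "0 \<le> C" "\<And>m p. 2 \<le> m \<Longrightarrow> disc_kernel m p p \<le> C / (real p + 1)"
proof -
  define e where "e = Re (z + z')"
  obtain a b where ab: "0 < a" "0 < b" "\<And>p. a * (real p + 1) powr e \<le> poch_weight p"
    "\<And>p. poch_weight p \<le> b * (real p + 1) powr e"
    using poch_weight_bounds unfolding e_def by metis
  obtain b' where b': "0 < b'" "\<And>q. neg.poch_weight q \<le> b' * (real q + 1) powr (- e)"
    using neg.poch_weight_bounds unfolding e_def by (metis minus_add_distrib uminus_complex.sel(1))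
  note t = zz_t_pos
  define D where "D = max (b / a * 2 powr \<bar>e\<bar>) (b * (t * b'))"
  have D: "0 \<le> D" using ab b' t by (simp add: D_def le_max_iff_disj)
  obtain C where C: "0 \<le> C" "\<And>F G N M p. (\<And>p. 0 < F p) \<Longrightarrow> (\<And>q. 0 \<le> G q) \<Longrightarrow>
    (\<And>p k. k \<le> p \<Longrightarrow> p \<le> 2 * k \<Longrightarrow> F p \<le> D * F k) \<Longrightarrow>
    (\<And>p q. F p * G q \<le> D * ((real p + 1) powr e * (real q + 1) powr (- e))) \<Longrightarrow>
    is_resolvent {..<N} (gram {..<N} (cauchy_matrix F G)) M \<Longrightarrow> p < N \<Longrightarrow> 1 - M p p \<le> C / (real p + 1)"
    using cauchy_resolvent_complement_bound[OF D, of e] by blast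
  have "disc_kernel m p p \<le> C / (real p + 1)" if m: "2 \<le> m" for m p
  proof -
    define xi where "xi = 1 - 1 / real m"
    have xi: "0 < xi" "xi < 1" using m by (auto simp: xi_def)
    have "1 - disc_resolvent xi N p p \<le> C / (real p + 1)" if "p < N" for N
    proof (rule C(2)[OF _ _ _ _ is_resolvent_disc_resolvent that])
      show "0 < p_weight xi p" for p by (rule p_weight_pos[OF xi])
      show "0 \<le> q_weight xi q" for q using q_weight_pos[OF xi] less_imp_le by blast
      show "p_weight xi p \<le> D * p_weight xi k" if k: "k \<le> p" "p \<le> 2 * k" for p k
      proof -
        have "poch_weight p \<le> b * (2 powr \<bar>e\<bar> * (real k + 1) powr e)"
          using k ab(2) by (intro order_trans[OF ab(4)] mult_left_mono powr_le_two_powr_mult) auto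
        also have "\<dots> = b / a * 2 powr \<bar>e\<bar> * (a * (real k + 1) powr e)" using ab(1) by simp
        also have "\<dots> \<le> D * poch_weight k"
          using ab by (intro mult_mono ab(3)) (auto simp: D_def le_max_iff_disj)
        finally have "poch_weight p * xi ^ p \<le> D * poch_weight k * xi ^ k"
          using xi k D poch_weight_pos[of k] by (intro mult_mono power_decreasing) auto
        thus ?thesis by (simp add: p_weight_def mult.assoc)
      qed
      show "p_weight xi p * q_weight xi q \<le> D * ((real p + 1) powr e * (real q + 1) powr (- e))" for p q
      proof -
        have "p_weight xi p * q_weight xi q
            = t * poch_weight p * neg.poch_weight q * xi ^ (p + q + 1)"
          by (simp add: p_weight_def neg.p_weight_def q_weight_def power_add)
        also have "\<dots> \<le> t * (b * (real p + 1) powr e) * (b' * (real q + 1) powr (- e)) * 1"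
          using t xi ab(2) b'(1) poch_weight_pos[of p] neg.poch_weight_pos[of q]
          by (intro mult_mono ab(4) b'(2) power_le_one) auto
        also have "\<dots> = b * (t * b') * ((real p + 1) powr e * (real q + 1) powr (- e))" by simp
        also have "\<dots> \<le> D * ((real p + 1) powr e * (real q + 1) powr (- e))"
          by (intro mult_right_mono) (auto simp: D_def)
        finally show ?thesis .
      qed
    qed
    hence "\<forall>\<^sub>F N in sequentially. 1 - disc_resolvent xi N p p \<le> C / (real p + 1)"
      by (rule eventually_mono[OF eventually_gt_at_top[of p]])
    moreover have "(\<lambda>N. 1 - disc_resolvent xi N p p) \<longlonglongrightarrow> disc_kernel m p p"
      using tendsto_Re[OF disc_kernel_tendsto[OF m, of p p]] by (simp add: xi_def)
    ultimately show ?thesis by (intro tendsto_upperbound) auto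
  qed
  thus ?thesis using that C(1) by blast
qed

end

section \<open>Mixtures over the levels\<close>

definition frob_size :: "frobenius \<Rightarrow> nat" where
  "frob_size c = sum_list (fst c) + sum_list (snd c) + length (fst c)"

definition frob_pairs_of_size :: "nat \<Rightarrow> frobenius set" where
  "frob_pairs_of_size k = {c \<in> frob_pairs. frob_size c = k}"

lemma frob_size_eq_sum:
  assumes "c \<in> frob_pairs"
  shows "frob_size c = (\<Sum>i<length (fst c). fst c ! i + Suc (snd c ! i))"
proof -
  have "length (snd c) = length (fst c)" using assms by (auto simp: frob_pairs_def)
  thus ?thesis
    unfolding frob_size_def sum_list_sum_nth by (simp add: sum.distrib sum_Suc atLeast0LessThan)
qed

lemma configs_eq_frob_pairs_of_size: "1 \<le> k \<Longrightarrow> configs k = frob_pairs_of_size k"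
  unfolding configs_def frob_pairs_of_size_def frob_pairs_def frob_size_def by (auto simp: Suc_le_eq)

lemma finite_frob_pairs_of_size: "finite (frob_pairs_of_size k)"
proof (rule finite_subset[OF subsetI finite_frob_pairs_below[of "Suc k"]])
  fix c assume c: "c \<in> frob_pairs_of_size k"
  have "x \<le> k" if "x \<in> set (fst c) \<or> x \<in> set (snd c)" for x
    using c that member_le_sum_list[of x "fst c"] member_le_sum_list[of x "snd c"]
    unfolding frob_pairs_of_size_def frob_size_def by auto
  thus "c \<in> frob_pairs_below (Suc k)"
    using c unfolding frob_pairs_of_size_def frob_pairs_below_def by (auto simp: less_Suc_eq_le)
qed

lemma frob_weight_swap:
  assumes "c \<in> frob_pairs"
  shows "frob_weight F (\<lambda>q. r * G q) (prod.swap c) = frob_weight G (\<lambda>q. r * F q) c"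
proof -
  define d where "d = length (fst c)"
  have d: "length (snd c) = d" using assms by (auto simp: frob_pairs_def d_def)
  have "detN d (\<lambda>i j. 1 / real (snd c ! i + fst c ! j + 1)) = detN d (\<lambda>i j. 1 / real (fst c ! i + snd c ! j + 1))"
    unfolding detN_eq_det_on
    using det_on_transpose[of "{..<d}" "\<lambda>i j. 1 / real (fst c ! i + snd c ! j + 1)"] by (simp add: add.commute)
  thus ?thesis unfolding frob_weight_def by (simp add: d_def[symmetric] d mult_ac)
qed

lemma bij_betw_swap_frob_pairs: "bij_betw prod.swap frob_pairs frob_pairs"
  by (rule bij_betw_byWitness[where f'=prod.swap]) (auto simp: frob_pairs_def)

context admissible_pair
begin

definition level_mass :: "nat \<Rightarrow> frobenius \<Rightarrow> real" where
  "level_mass k c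
    = fact k / pochhammer t k * frob_weight (p_weight 1) (q_weight 1) c"

definition level_expectation :: "nat \<Rightarrow> (frobenius \<Rightarrow> real) \<Rightarrow> real" where
  "level_expectation k g = (\<Sum>c\<in>frob_pairs_of_size k. level_mass k c * g c)"

definition mixture_weight :: "nat \<Rightarrow> frobenius \<Rightarrow> real" where
  "mixture_weight m = frob_weight (p_weight (1 - 1 / real m)) (q_weight (1 - 1 / real m))"

abbreviation mixture_total :: "nat \<Rightarrow> real" where
  "mixture_total m \<equiv> (\<Sum>\<^sub>\<infinity>c\<in>frob_pairs. mixture_weight m c)"

abbreviation mixture_sum :: "nat \<Rightarrow> (frobenius \<Rightarrow> real) \<Rightarrow> real" where
  "mixture_sum m g \<equiv> (\<Sum>\<^sub>\<infinity>c\<in>frob_pairs. mixture_weight m c * g c)"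

definition mixture_mean :: "nat \<Rightarrow> (frobenius \<Rightarrow> real) \<Rightarrow> real" where
  "mixture_mean m g = mixture_sum m g / mixture_total m"

interpretation neg: admissible_pair "- z" "- z'" by (rule uminus_pair)

lemma frob_weight_power:
  assumes "c \<in> frob_pairs"
  shows "frob_weight (p_weight xi) (q_weight xi) c
      = xi ^ frob_size c * frob_weight (p_weight 1) (q_weight 1) c"
proof -
  have "p_weight xi p * q_weight xi q = xi ^ (p + Suc q) * (p_weight 1 p * q_weight 1 q)" for p q
    by (simp add: p_weight_def neg.p_weight_def q_weight_def power_add mult_ac)
  thus ?thesis
    unfolding frob_weight_def frob_size_eq_sum[OF assms] by (simp add: prod.distrib power_sum)
qed

lemma mixture_weight_swap:
  "c \<in> frob_pairs \<Longrightarrow> neg.mixture_weight m (prod.swap c) = mixture_weight m c"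
  using frob_weight_swap[of c "neg.p_weight (1 - 1 / real m)" "t * (1 - 1 / real m)"
      "p_weight (1 - 1 / real m)"]
  unfolding mixture_weight_def neg.mixture_weight_def q_weight_def[abs_def] neg.q_weight_def[abs_def] by simp

lemma mixture_weight_summable_uminus:
  assumes "mixture_weight m summable_on frob_pairs"
  shows "neg.mixture_weight m summable_on frob_pairs"
  using assms unfolding summable_on_reindex_bij_betw[OF bij_betw_swap_frob_pairs, symmetric, of "neg.mixture_weight m"]
  by (rule summable_on_cong[THEN iffD2, rotated]) (simp add: mixture_weight_swap)

lemma mixture_mean_uminus: "neg.mixture_mean m g = mixture_mean m (\<lambda>c. g (prod.swap c))"
proof -
  have "neg.mixture_sum m h = mixture_sum m (\<lambda>c. h (prod.swap c))" for h
    unfolding infsum_reindex_bij_betw[OF bij_betw_swap_frob_pairs, symmetric, of "\<lambda>c. neg.mixture_weight m c * h c"]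
    by (rule infsum_cong) (simp add: mixture_weight_swap)
  from this[of g] this[of "\<lambda>_. 1"] show ?thesis unfolding mixture_mean_def neg.mixture_mean_def by simp
qed

lemma weights_nonneg:
  assumes "0 \<le> xi"
  shows "0 \<le> p_weight xi p" "0 \<le> q_weight xi q"
  using assms poch_weight_pos[of p] neg.poch_weight_pos[of q] zz_t_pos
  by (auto simp: p_weight_def neg.p_weight_def q_weight_def less_imp_le)

lemma level_mass_nonneg: "0 \<le> level_mass k c"
  unfolding level_mass_def using zz_t_pos
  by (intro mult_nonneg_nonneg divide_nonneg_nonneg frob_weight_nonneg weights_nonneg pochhammer_nonneg) auto

lemma config_mass_eq: "config_mass z z' k c = level_mass k c"
proof -
  define d where "d = length (fst c)"
  let ?w = "\<lambda>i. poch_weight (fst c ! i) * neg.poch_weight (snd c ! i)"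
  have "pochhammer (z + 1) p * pochhammer (z' + 1) p * pochhammer (- z + 1) q * pochhammer (- z' + 1) q
      / of_real ((fact p)\<^sup>2 * (fact q)\<^sup>2) = of_real (poch_weight p * neg.poch_weight q)" for p q
    unfolding of_real_mult poch_weight_eq neg.poch_weight_eq by simp
  hence "config_mass z z' k c = fact k * t ^ d / pochhammer t k * (\<Prod>i<d. ?w i)
      * (detN d (\<lambda>i j. 1 / real (fst c ! i + snd c ! j + 1)))\<^sup>2"
    unfolding config_mass_def Let_def d_def[symmetric]
    by (simp only: of_real_prod[symmetric] of_real_mult[symmetric] Re_complex_of_real)
  moreover have "(\<Prod>i<d. p_weight 1 (fst c ! i) * q_weight 1 (snd c ! i)) = t ^ d * (\<Prod>i<d. ?w i)"
    unfolding p_weight_def neg.p_weight_def q_weight_def by (simp add: prod.distrib mult_ac)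
  ultimately show ?thesis
    unfolding level_mass_def frob_weight_def d_def[symmetric] by (simp add: mult_ac)
qed

lemma mixture_weight_eq:
  assumes "c \<in> frob_pairs_of_size k"
  shows "mixture_weight m c = nb_weight t m k * level_mass k c"
proof -
  have "pochhammer t k \<noteq> 0" using pochhammer_pos[OF zz_t_pos, of k] by simp
  thus ?thesis
    using assms unfolding mixture_weight_def level_mass_def nb_weight_def frob_pairs_of_size_def
    by (simp add: frob_weight_power[of c "1 - 1 / real m"])
qed

lemma mixture_weight_nonneg: "0 \<le> mixture_weight m c"
  unfolding mixture_weight_def by (intro frob_weight_nonneg weights_nonneg) (cases m; auto)+

lemma mixture_has_sum:
  assumes g: "\<And>c. c \<in> frob_pairs \<Longrightarrow> 0 \<le> g c"
    and sum: "summable (\<lambda>k. \<bar>nb_weight t m k * level_expectation k g\<bar>)"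
  shows "((\<lambda>c. mixture_weight m c * g c) has_sum (\<Sum>k. nb_weight t m k * level_expectation k g)) frob_pairs"
proof -
  define G where "G k = nb_weight t m k * level_expectation k g" for k
  let ?f = "\<lambda>c. mixture_weight m c * g c"
  have G: "(G has_sum (\<Sum>k. G k)) UNIV"
    using sum summable_sums[OF summable_rabs_cancel[OF sum]] unfolding G_def[symmetric]
    by (intro norm_summable_imp_has_sum) auto
  have level: "((\<lambda>c. ?f (snd (k, c))) has_sum G k) (frob_pairs_of_size k)" for k
  proof -
    have "(\<Sum>c\<in>frob_pairs_of_size k. ?f c) = G k"
      unfolding G_def level_expectation_def sum_distrib_left
      by (intro sum.cong refl) (simp add: mixture_weight_eq mult_ac)
    thus ?thesis using has_sum_finite[OF finite_frob_pairs_of_size, of ?f k] by simp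
  qed
  have "(\<lambda>x. ?f (snd x)) summable_on Sigma UNIV frob_pairs_of_size"
    using level G mixture_weight_nonneg g
    by (intro summable_on_SigmaI[where g=G]) (auto simp: frob_pairs_of_size_def summable_on_def)
  from has_sum_SigmaI[OF _ G this]
  have "((\<lambda>x. ?f (snd x)) has_sum (\<Sum>k. G k)) (Sigma UNIV frob_pairs_of_size)" using level by auto
  moreover have "bij_betw snd (Sigma UNIV frob_pairs_of_size) frob_pairs"
    by (rule bij_betw_byWitness[where f'="\<lambda>c. (frob_size c, c)"]) (auto simp: frob_pairs_of_size_def)
  ultimately show ?thesis unfolding G_def[symmetric] using has_sum_reindex_bij_betw by blast
qed

context
  fixes m :: nat
  assumes m: "2 \<le> m" and summable: "mixture_weight m summable_on frob_pairs"
begin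

lemma mixture_total_pos: "0 < mixture_total m"
proof -
  have "(\<Sum>\<^sub>\<infinity>c\<in>{([], [])}. mixture_weight m c) \<le> mixture_total m"
    using mixture_weight_nonneg by (intro infsum_mono2 summable) (auto simp: frob_pairs_def)
  thus ?thesis by (simp add: mixture_weight_def frob_weight_def detN_def)
qed

lemma mixture_summable_bounded:
  assumes "\<And>c. c \<in> frob_pairs \<Longrightarrow> \<bar>g c\<bar> \<le> B"
  shows "(\<lambda>c. mixture_weight m c * g c) summable_on frob_pairs"
proof (rule abs_summable_summable, rule summable_on_comparison_test)
  show "(\<lambda>c. mixture_weight m c * B) summable_on frob_pairs" by (rule summable_on_cmult_left[OF summable])
qed (use assms mixture_weight_nonneg in \<open>auto simp: abs_mult intro!: mult_left_mono\<close>)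

lemma mixture_mean_nonneg: "(\<And>c. 0 \<le> g c) \<Longrightarrow> 0 \<le> mixture_mean m g"
  unfolding mixture_mean_def
  by (intro divide_nonneg_nonneg infsum_nonneg mult_nonneg_nonneg mixture_weight_nonneg) auto

lemma mixture_mean_sum:
  assumes "finite X"
  shows "mixture_mean m (\<lambda>c. \<Sum>x\<in>X. f x * of_bool (Q x c)) = (\<Sum>x\<in>X. f x * mixture_mean m (\<lambda>c. of_bool (Q x c)))"
proof -
  have "((\<lambda>c. f x * (mixture_weight m c * of_bool (Q x c))) has_sum
      f x * mixture_sum m (\<lambda>c. of_bool (Q x c))) frob_pairs" for x
    by (intro has_sum_cmult_right has_sum_infsum mixture_summable_bounded[where B=1]) auto
  with assms have "((\<lambda>c. \<Sum>x\<in>X. f x * (mixture_weight m c * of_bool (Q x c))) has_sum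
      (\<Sum>x\<in>X. f x * mixture_sum m (\<lambda>c. of_bool (Q x c)))) frob_pairs"
    by (induction X) (auto intro!: has_sum_add)
  hence "mixture_sum m (\<lambda>c. \<Sum>x\<in>X. f x * of_bool (Q x c))
      = (\<Sum>x\<in>X. f x * mixture_sum m (\<lambda>c. of_bool (Q x c)))"
    unfolding sum_distrib_left mult.left_commute[of _ "f _"] by (rule infsumI)
  thus ?thesis unfolding mixture_mean_def by (simp add: sum_divide_distrib)
qed

lemma mixture_mean_le_sum:
  assumes X: "finite X" and f: "\<And>x. 0 \<le> f x"
    and g: "\<And>c. c \<in> frob_pairs \<Longrightarrow> 0 \<le> g c" "\<And>c. c \<in> frob_pairs \<Longrightarrow> g c \<le> (\<Sum>x\<in>X. f x * of_bool (Q x c))"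
  shows "mixture_mean m g \<le> (\<Sum>x\<in>X. f x * mixture_mean m (\<lambda>c. of_bool (Q x c)))"
proof -
  have h: "0 \<le> (\<Sum>x\<in>X. f x * of_bool (Q x c))" "(\<Sum>x\<in>X. f x * of_bool (Q x c)) \<le> sum f X" for c
    by (auto intro!: sum_nonneg sum_mono simp: f)
  show ?thesis
    unfolding mixture_mean_sum[OF X, symmetric] unfolding mixture_mean_def
  proof (intro divide_right_mono infsum_mono mult_left_mono mixture_weight_nonneg g(2))
    show "(\<lambda>c. mixture_weight m c * g c) summable_on frob_pairs"
    proof (rule mixture_summable_bounded)
      show "\<bar>g c\<bar> \<le> sum f X" if "c \<in> frob_pairs" for c using g[OF that] h(2)[of c] by linarith
    qed
    show "(\<lambda>c. mixture_weight m c * (\<Sum>x\<in>X. f x * of_bool (Q x c))) summable_on frob_pairs"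
      by (rule mixture_summable_bounded[of _ "sum f X"]) (simp add: h)
  qed (use mixture_total_pos in auto)
qed

lemma mixture_mean_contains:
  assumes x: "inj_on x {..<n}"
  shows "mixture_mean m (\<lambda>c. of_bool (x ` {..<n} \<subseteq> set (fst c))) = detN n (\<lambda>i j. disc_kernel m (x i) (x j))"
proof -
  let ?w = "mixture_weight m" and ?X = "{c \<in> frob_pairs. x ` {..<n} \<subseteq> set (fst c)}"
  have "(\<Sum>\<^sub>\<infinity>c\<in>frob_pairs. ?w c * of_bool (x ` {..<n} \<subseteq> set (fst c))) = infsum ?w ?X"
    by (rule infsum_cong_neutral) auto
  moreover have "complex_of_real (infsum ?w ?X)
      = of_real (infsum ?w frob_pairs) * detN n (\<lambda>i j. of_real (disc_kernel m (x i) (x j)))"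
    using m summable unfolding mixture_weight_def
    by (intro frob_weight_correlation[OF _ _ _ is_resolvent_disc_resolvent disc_kernel_tendsto[OF m] x] weights_nonneg) auto
  moreover have "detN n (\<lambda>i j. complex_of_real (disc_kernel m (x i) (x j)))
      = of_real (detN n (\<lambda>i j. disc_kernel m (x i) (x j)))"
    by (simp add: detN_def)
  ultimately have "(\<Sum>\<^sub>\<infinity>c\<in>frob_pairs. ?w c * of_bool (x ` {..<n} \<subseteq> set (fst c)))
      = infsum ?w frob_pairs * detN n (\<lambda>i j. disc_kernel m (x i) (x j))"
    by (simp only: of_real_mult[symmetric] of_real_eq_iff)
  thus ?thesis unfolding mixture_mean_def using mixture_total_pos by simp
qed

lemma mixture_mean_contains_point: "mixture_mean m (\<lambda>c. of_bool (p \<in> set (fst c))) = disc_kernel m p p"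
  using mixture_mean_contains[of "\<lambda>_. p" 1] by (simp add: detN_def lessThan_Suc)

lemma disc_kernel_det_nonneg: "0 \<le> detN n (\<lambda>i j. disc_kernel m (x i) (x j))"
proof (cases "inj_on x {..<n}")
  case True
  show ?thesis unfolding mixture_mean_contains[OF True, symmetric] by (rule mixture_mean_nonneg) simp
next
  case False
  thus ?thesis
    using det_on_noninj_cols[OF finite_lessThan False, of "\<lambda>i j. disc_kernel m (x i) j"]
    unfolding detN_eq_det_on by simp
qed

lemma disc_kernel_diag_nonneg: "0 \<le> disc_kernel m p p"
  using disc_kernel_det_nonneg[of 1 "\<lambda>_. p"] by (simp add: detN_def lessThan_Suc)

lemma disc_kernel_commute: "disc_kernel m p q = disc_kernel m q p"
proof -
  have "complex_of_real (real m * disc_kernel m p q) = of_real (real m * disc_kernel m q p)"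
    using divided_wronskian_sym[of "disc_A m" "disc_B m" "node m p" "node m q"]
    unfolding of_real_disc_kernel[OF m] disc_wronskian_def by (simp add: mult_ac)
  thus ?thesis unfolding of_real_eq_iff using m by simp
qed

lemma abs_disc_kernel_le:
  assumes C: "disc_kernel m p p \<le> C" "disc_kernel m q q \<le> C"
  shows "\<bar>disc_kernel m p q\<bar> \<le> C"
proof -
  let ?K = "disc_kernel m" and ?x = "\<lambda>i::nat. if i = 0 then p else q"
  have C0: "0 \<le> C" using disc_kernel_diag_nonneg[of p] C by linarith
  have "{p. p permutes {..<2::nat}} = {id, Transposition.transpose 0 1}"
    using permutes_doubleton_iff[of _ 0 "1::nat"] by (auto simp: numeral_2_eq_2 lessThan_Suc insert_commute)
  moreover have "(id :: nat \<Rightarrow> nat) \<noteq> Transposition.transpose 0 1" by (auto simp: fun_eq_iff Transposition.transpose_def)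
  ultimately have "detN 2 (\<lambda>i j. ?K (?x i) (?x j)) = ?K p p * ?K q q - ?K p q * ?K q p"
    unfolding detN_def by (simp add: numeral_2_eq_2 lessThan_Suc sign_swap_id mult.commute)
  hence "?K p q * ?K p q \<le> ?K p p * ?K q q"
    using disc_kernel_det_nonneg[of 2 ?x] disc_kernel_commute[of p q] by simp
  also have "\<dots> \<le> C * C" using C C0 disc_kernel_diag_nonneg by (intro mult_mono) auto
  finally have "(?K p q)\<^sup>2 \<le> C\<^sup>2" by (simp add: power2_eq_square)
  thus ?thesis using C0 by (simp add: abs_le_square_iff[symmetric])
qed

end

end

locale spectral_limit = admissible_pair +
  fixes P
  assumes P: "Pn_weak_limit z z' P"
begin

lemma level_expectation_tendsto:
  assumes f: "continuous_on Thoma f" "bounded (f ` Thoma)"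
  shows "(\<lambda>k. level_expectation k (\<lambda>c. f (config_point k c))) \<longlonglongrightarrow> (\<integral>\<omega>. indicator Thoma \<omega> * f \<omega> \<partial>P)"
proof (rule Lim_transform_eventually)
  show "(\<lambda>n. \<Sum>c\<in>configs n. config_mass z z' n c * f (config_point n c)) \<longlonglongrightarrow> (\<integral>\<omega>. indicator Thoma \<omega> * f \<omega> \<partial>P)"
    using P f unfolding Pn_weak_limit_def by blast
  show "\<forall>\<^sub>F k in sequentially. (\<Sum>c\<in>configs k. config_mass z z' k c * f (config_point k c))
      = level_expectation k (\<lambda>c. f (config_point k c))"
    using eventually_ge_at_top[of 1]
    by eventually_elim (simp add: level_expectation_def configs_eq_frob_pairs_of_size config_mass_eq)
qed

lemma prob_Thoma: "(\<integral>\<omega>. indicator Thoma \<omega> \<partial>P) = (1 :: real)"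
proof -
  have "Thoma \<inter> space P = Thoma" using P sets_eq_imp_space_eq[of P borel] by (simp add: Pn_weak_limit_def)
  moreover have "measure P Thoma = 1" using P by (simp add: Pn_weak_limit_def measure_def)
  ultimately show ?thesis by simp
qed

lemma level_expectation_one_tendsto: "(\<lambda>k. level_expectation k (\<lambda>c. 1)) \<longlonglongrightarrow> 1"
proof -
  have "bounded ((\<lambda>_. 1 :: real) ` Thoma)" by (rule bounded_subset[of "{1}"]) auto
  thus ?thesis using level_expectation_tendsto[of "\<lambda>_. 1"] prob_Thoma by simp
qed

lemma level_expectation_bound:
  obtains D where "0 \<le> D" "\<And>k g B. (\<And>c. c \<in> frob_pairs_of_size k \<Longrightarrow> \<bar>g c\<bar> \<le> B) \<Longrightarrow> 0 \<le> B \<Longrightarrow>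
    \<bar>level_expectation k g\<bar> \<le> D * B"
proof -
  obtain D where D: "0 < D" "\<And>k. norm (level_expectation k (\<lambda>c. 1)) \<le> D"
    using convergent_imp_Bseq[OF convergentI[OF level_expectation_one_tendsto]] by (auto simp: Bseq_def)
  show ?thesis
  proof (rule that[of D])
    fix k g and B :: real assume g: "\<And>c. c \<in> frob_pairs_of_size k \<Longrightarrow> \<bar>g c\<bar> \<le> B" and B: "0 \<le> B"
    have "\<bar>level_expectation k g\<bar> \<le> (\<Sum>c\<in>frob_pairs_of_size k. level_mass k c * B)"
      unfolding level_expectation_def
      by (rule sum_abs[THEN order_trans], rule sum_mono)
        (auto simp: abs_mult level_mass_nonneg intro!: mult_left_mono g)
    also have "\<dots> = level_expectation k (\<lambda>c. 1) * B" by (simp add: level_expectation_def sum_distrib_right)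
    also have "\<dots> \<le> D * B" using D(2)[of k] B by (intro mult_right_mono) auto
    finally show "\<bar>level_expectation k g\<bar> \<le> D * B" .
  qed (use D in simp)
qed

lemma mixture_sum_tendsto:
  assumes g: "\<And>m k c. ms \<le> m \<Longrightarrow> c \<in> frob_pairs_of_size k \<Longrightarrow> 0 \<le> g m c \<and> g m c \<le> C * (1 + real k / real m) ^ M"
    and C: "0 \<le> C"
    and conv: "\<And>s. 0 < s \<Longrightarrow> (\<lambda>m. level_expectation (nat \<lfloor>real m * s\<rfloor>) (g m)) \<longlonglongrightarrow> H s"
    and H: "H \<in> borel_measurable borel"
  shows "(\<lambda>m. real m powr (- t) * mixture_sum m (g m)) \<longlonglongrightarrow> (\<integral>s. H s \<partial>gamma_meas t)"
    and "integrable (gamma_meas t) H"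
    and "\<And>m. ms \<le> m \<Longrightarrow> 1 \<le> m \<Longrightarrow> (\<lambda>c. mixture_weight m c * g m c) summable_on frob_pairs"
proof -
  obtain D where D: "0 \<le> D" "\<And>k g B. (\<And>c. c \<in> frob_pairs_of_size k \<Longrightarrow> \<bar>g c\<bar> \<le> B) \<Longrightarrow> 0 \<le> B \<Longrightarrow>
      \<bar>level_expectation k g\<bar> \<le> D * B"
    using level_expectation_bound by blast
  have bound: "\<bar>level_expectation k (g m)\<bar> \<le> (D * C) * (1 + real k / real m) ^ M" if "ms \<le> m" for m k
    unfolding mult.assoc by (rule D(2)) (use g[OF that] C in auto)
  note limit = negative_binomial_limit_real[OF zz_t_pos conv bound H]
  have hs: "((\<lambda>c. mixture_weight m c * g m c) has_sum (\<Sum>k. nb_weight t m k * level_expectation k (g m))) frob_pairs"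
      if "ms \<le> m" "1 \<le> m" for m
    using that g[of m] by (intro mixture_has_sum limit(3)) (auto simp: frob_pairs_of_size_def)
  thus "\<And>m. ms \<le> m \<Longrightarrow> 1 \<le> m \<Longrightarrow> (\<lambda>c. mixture_weight m c * g m c) summable_on frob_pairs"
    using has_sum_imp_summable by blast
  show "integrable (gamma_meas t) H" by (rule limit(2))
  have "\<forall>\<^sub>F m in sequentially. real m powr (- t) * (\<Sum>k. nb_weight t m k * level_expectation k (g m))
      = real m powr (- t) * mixture_sum m (g m)"
    using eventually_ge_at_top[of "max 1 ms"] by eventually_elim (simp add: infsumI[OF hs])
  from Lim_transform_eventually[OF limit(1) this]
  show "(\<lambda>m. real m powr (- t) * mixture_sum m (g m)) \<longlonglongrightarrow> (\<integral>s. H s \<partial>gamma_meas t)" .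
qed

lemma gamma_meas_total: "(\<integral>s. 1 \<partial>gamma_meas t) = (1 :: real)"
proof -
  have "complex_of_real (\<integral>s. 1 \<partial>gamma_meas t) = of_real 1"
    using gamma_meas_integral(1)[OF zz_t_pos, of "\<lambda>_. 1"] gamma_kernel_integral[of "of_real t"] zz_t_pos
    by simp
  thus ?thesis unfolding of_real_eq_iff .
qed

lemma mixture_weight_summable: "1 \<le> m \<Longrightarrow> mixture_weight m summable_on frob_pairs"
  and mixture_total_tendsto: "(\<lambda>m. real m powr (- t) * mixture_total m) \<longlonglongrightarrow> 1"
proof -
  have conv: "(\<lambda>m. level_expectation (nat \<lfloor>real m * s\<rfloor>) (\<lambda>c. 1)) \<longlonglongrightarrow> 1" if "0 < s" for s
    by (rule filterlim_compose[OF level_expectation_one_tendsto]) (use that in real_asymp)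
  note limit = mixture_sum_tendsto[of 0 "\<lambda>m c. 1" 1 0 "\<lambda>s. 1", OF _ _ conv]
  show "mixture_weight m summable_on frob_pairs" if "1 \<le> m" using limit(3)[of m] that by simp
  show "(\<lambda>m. real m powr (- t) * mixture_total m) \<longlonglongrightarrow> 1"
    using limit(1) gamma_meas_total by simp
qed

lemma mixture_mean_tendsto:
  assumes g: "\<And>m k c. ms \<le> m \<Longrightarrow> c \<in> frob_pairs_of_size k \<Longrightarrow> 0 \<le> g m c \<and> g m c \<le> C * (1 + real k / real m) ^ M"
    and C: "0 \<le> C"
    and conv: "\<And>s. 0 < s \<Longrightarrow> (\<lambda>m. level_expectation (nat \<lfloor>real m * s\<rfloor>) (g m)) \<longlonglongrightarrow> H s"
    and H: "H \<in> borel_measurable borel"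
  shows "(\<lambda>m. mixture_mean m (g m)) \<longlonglongrightarrow> (\<integral>s. H s \<partial>gamma_meas t)"
proof -
  let ?a = "\<lambda>m. real m powr (- t)"
  have "(\<lambda>m. (?a m * mixture_sum m (g m)) / (?a m * mixture_total m)) \<longlonglongrightarrow> (\<integral>s. H s \<partial>gamma_meas t) / 1"
    by (intro tendsto_divide mixture_sum_tendsto(1)[OF g C conv H] mixture_total_tendsto) auto
  moreover have "\<forall>\<^sub>F m in sequentially. (?a m * mixture_sum m (g m))
      / (?a m * mixture_total m) = mixture_mean m (g m)"
    using eventually_gt_at_top[of 0] by eventually_elim (simp add: mixture_mean_def)
  ultimately show ?thesis by (simp add: Lim_transform_eventually)
qed

end

section \<open>Concentration on total mass one\<close>

lemma Thoma_coordinates_continuous: "continuous_on S (\<lambda>w::thoma. fst w i)" "continuous_on S (\<lambda>w::thoma. snd w i)"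
  by (rule continuous_on_subset[OF continuous_on_compose2[OF continuous_on_product_coordinates[of i]], of UNIV];
      (intro continuous_intros)?; simp)+

lemma Thoma_coordinate_bounds:
  assumes "w \<in> Thoma"
  shows "0 \<le> fst w i" "0 \<le> snd w i" "real (Suc i) * fst w i \<le> 1" "real (Suc i) * snd w i \<le> 1"
    "(\<Sum>i<L. fst w i + snd w i) \<le> 1"
proof -
  have dec: "fst w i \<le> fst w j" "snd w i \<le> snd w j" if "j \<le> i" for i j
    using assms that by (auto simp: Thoma_def decseq_def)
  show nonneg: "0 \<le> fst w i" "0 \<le> snd w i" for i using assms by (auto simp: Thoma_def)
  have "summable (\<lambda>i. fst w i + snd w i)" "(\<Sum>i. fst w i + snd w i) \<le> 1"
    using assms by (auto simp: Thoma_def case_prod_unfold)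
  thus total: "(\<Sum>i<L. fst w i + snd w i) \<le> 1" for L
    using sum_le_suminf[of "\<lambda>i. fst w i + snd w i" "{..<L}"] nonneg by (simp add: order_trans)
  have "real (Suc i) * fst w i = (\<Sum>j<Suc i. fst w i)" by simp
  also have "\<dots> \<le> (\<Sum>j<Suc i. fst w j + snd w j)" using dec nonneg by (intro sum_mono) (simp add: add_increasing2)
  finally show "real (Suc i) * fst w i \<le> 1" using total[of "Suc i"] by linarith
  have "real (Suc i) * snd w i = (\<Sum>j<Suc i. snd w i)" by simp
  also have "\<dots> \<le> (\<Sum>j<Suc i. fst w j + snd w j)" using dec nonneg by (intro sum_mono) (simp add: add_increasing)
  finally show "real (Suc i) * snd w i \<le> 1" using total[of "Suc i"] by linarith
qed

lemma Thoma_in_sets: "Pn_weak_limit z z' P \<Longrightarrow> Thoma \<in> sets P"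
  using emeasure_notin_sets[of Thoma P] by (auto simp: Pn_weak_limit_def)

lemma decseq_scaled_list:
  assumes "sorted_wrt (>) (xs :: nat list)" "0 \<le> r"
  shows "decseq (\<lambda>i. if i < length xs then (real (xs ! i) + 1 / 2) / r else 0)"
  unfolding decseq_def
proof (intro allI impI)
  fix i j :: nat assume "i \<le> j"
  hence "xs ! j \<le> xs ! i" if "j < length xs"
    using sorted_wrt_nth_less[OF assms(1), of i j] that by (cases "i = j") auto
  thus "(if j < length xs then (real (xs ! j) + 1 / 2) / r else 0)
      \<le> (if i < length xs then (real (xs ! i) + 1 / 2) / r else 0)"
    using assms(2) \<open>i \<le> j\<close> by (auto simp: divide_right_mono)
qed

lemma config_point_sums:
  assumes c: "c \<in> frob_pairs_of_size k" and k: "1 \<le> k"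
  shows "(\<Sum>i<length (fst c). fst (config_point k c) i + snd (config_point k c) i) = 1"
    and "(\<lambda>i. fst (config_point k c) i + snd (config_point k c) i) sums 1"
proof -
  let ?d = "length (fst c)"
  have d: "length (snd c) = ?d" and "c \<in> frob_pairs" "frob_size c = k"
    using c by (auto simp: frob_pairs_of_size_def frob_pairs_def)
  hence "real k = real (\<Sum>i<?d. fst c ! i + Suc (snd c ! i))" using frob_size_eq_sum[of c] by simp
  also have "\<dots> = (\<Sum>i<?d. (real (fst c ! i) + 1 / 2) + (real (snd c ! i) + 1 / 2))"
    unfolding of_nat_sum by (intro sum.cong) auto
  finally show total: "(\<Sum>i<?d. fst (config_point k c) i + snd (config_point k c) i) = 1"
    using k by (simp add: config_point_def d add_divide_distrib[symmetric] sum_divide_distrib[symmetric])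
  have "(\<lambda>i. fst (config_point k c) i + snd (config_point k c) i) sums (\<Sum>i<?d. fst (config_point k c) i + snd (config_point k c) i)"
    by (rule sums_finite) (auto simp: config_point_def d)
  thus "(\<lambda>i. fst (config_point k c) i + snd (config_point k c) i) sums 1" unfolding total .
qed

lemma config_point_in_Thoma:
  assumes c: "c \<in> frob_pairs_of_size k" and k: "1 \<le> k"
  shows "config_point k c \<in> Thoma"
proof -
  have "sorted_wrt (>) (fst c)" "sorted_wrt (>) (snd c)"
    using c by (auto simp: frob_pairs_of_size_def frob_pairs_def)
  hence "decseq (fst (config_point k c))" "decseq (snd (config_point k c))"
    by (simp_all add: config_point_def decseq_scaled_list)
  moreover have "0 \<le> fst (config_point k c) i \<and> 0 \<le> snd (config_point k c) i" for i by (simp add: config_point_def)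
  ultimately show ?thesis
    using sums_summable[OF config_point_sums(2)[OF assms]] sums_unique[OF config_point_sums(2)[OF assms], symmetric]
    by (simp add: Thoma_def case_prod_unfold)
qed

definition thoma_defect :: "nat \<Rightarrow> thoma \<Rightarrow> real" where
  "thoma_defect L w = 1 - (\<Sum>i<L. fst w i + snd w i)"

lemma thoma_defect_bounds:
  assumes "w \<in> Thoma"
  shows "0 \<le> thoma_defect L w" "thoma_defect L w \<le> 1"
  using Thoma_coordinate_bounds[OF assms] by (auto simp: thoma_defect_def intro!: sum_nonneg add_nonneg_nonneg)

lemma thoma_defect_continuous: "continuous_on S (thoma_defect L)"
  unfolding thoma_defect_def[abs_def] by (intro continuous_intros Thoma_coordinates_continuous)

lemma decreasing_list_tail_le:
  assumes xs: "sorted_wrt (>) (xs :: nat list)"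
    and bound: "\<And>i. i < length xs \<Longrightarrow> real (Suc i) * (real (xs ! i) + 1 / 2) \<le> real (L * R)"
  shows "(\<Sum>i=L..<length xs. real (xs ! i) + 1 / 2) \<le> (\<Sum>p<R. (real p + 1 / 2) * of_bool (p \<in> set xs))"
proof -
  have small: "xs ! i < R" if "i \<in> {L..<length xs}" for i
  proof -
    have "real (Suc L) * (real (xs ! i) + 1 / 2) \<le> real (Suc i) * (real (xs ! i) + 1 / 2)"
      using that by (intro mult_right_mono) auto
    also have "\<dots> \<le> real (L * R)" using bound that by simp
    also have "\<dots> \<le> real (Suc L) * real R" by (simp add: distrib_right)
    finally show ?thesis by simp
  qed
  have "inj_on ((!) xs) {L..<length xs}"
    by (rule inj_on_nth) (use distinct_decreasing_list[OF xs] in auto)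
  hence "(\<Sum>i=L..<length xs. real (xs ! i) + 1 / 2) = (\<Sum>p\<in>(!) xs ` {L..<length xs}. real p + 1 / 2)"
    by (simp add: sum.reindex)
  also have "\<dots> \<le> (\<Sum>p\<in>{..<R} \<inter> set xs. real p + 1 / 2)" using small by (intro sum_mono2) auto
  finally show ?thesis by simp
qed

lemma config_defect_le:
  assumes c: "c \<in> frob_pairs_of_size k" and k: "1 \<le> k" "k \<le> L * R"
  shows "real k * thoma_defect L (config_point k c)
    \<le> (\<Sum>p<R. (real p + 1 / 2) * of_bool (p \<in> set (fst c))) + (\<Sum>p<R. (real p + 1 / 2) * of_bool (p \<in> set (snd c)))"
proof -
  define w where "w = config_point k c"
  let ?d = "length (fst c)"
  have d: "length (snd c) = ?d" and sorted: "sorted_wrt (>) (fst c)" "sorted_wrt (>) (snd c)"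
    using c by (auto simp: frob_pairs_of_size_def frob_pairs_def)
  note bounds = Thoma_coordinate_bounds[OF config_point_in_Thoma[OF c k(1)], folded w_def]
  have coordinates: "real k * fst w i = real (fst c ! i) + 1 / 2" "real k * snd w i = real (snd c ! i) + 1 / 2" if "i < ?d" for i
    using that k d by (auto simp: w_def config_point_def)
  have "1 = (\<Sum>i<?d. fst w i + snd w i)" using config_point_sums(1)[OF c k(1)] by (simp add: w_def)
  also have "\<dots> \<le> (\<Sum>i\<in>{..<L} \<union> {L..<?d}. fst w i + snd w i)" using bounds by (intro sum_mono2) auto
  also have "\<dots> = (\<Sum>i<L. fst w i + snd w i) + (\<Sum>i=L..<?d. fst w i + snd w i)" by (rule sum.union_disjoint) auto
  finally have "real k * thoma_defect L w \<le> real k * (\<Sum>i=L..<?d. fst w i + snd w i)"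
    by (intro mult_left_mono) (auto simp: thoma_defect_def)
  also have "\<dots> = (\<Sum>i=L..<?d. real (fst c ! i) + 1 / 2) + (\<Sum>i=L..<?d. real (snd c ! i) + 1 / 2)"
    unfolding sum_distrib_left sum.distrib[symmetric] by (intro sum.cong) (auto simp: distrib_left coordinates)
  also have "\<dots> \<le> (\<Sum>p<R. (real p + 1 / 2) * of_bool (p \<in> set (fst c))) + (\<Sum>p<R. (real p + 1 / 2) * of_bool (p \<in> set (snd c)))"
  proof -
    have scaled: "real (Suc i) * (real k * x) \<le> real (L * R)" if "real (Suc i) * x \<le> 1" for i x
    proof -
      have "real k * (real (Suc i) * x) \<le> real k * 1" using that by (intro mult_left_mono) auto
      also have "\<dots> \<le> real (L * R)" using of_nat_mono[OF k(2)] by simp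
      finally show ?thesis by (simp add: mult.left_commute)
    qed
    have "real (Suc i) * (real (fst c ! i) + 1 / 2) \<le> real (L * R)" "real (Suc i) * (real (snd c ! i) + 1 / 2) \<le> real (L * R)"
      if "i < ?d" for i
      using scaled[OF bounds(3)[of i]] scaled[OF bounds(4)[of i]] unfolding coordinates[OF that] .
    thus ?thesis
      by (intro add_mono decreasing_list_tail_le[OF sorted(1)] decreasing_list_tail_le[OF sorted(2), unfolded d])
  qed
  finally show ?thesis unfolding w_def .
qed

text \<open>The factor $x(1-x)^+$ with $x = k/m$ vanishes for $k > m$, where coordinates far out need not be small in units of $m$.\<close>

definition damped_defect :: "nat \<Rightarrow> nat \<Rightarrow> frobenius \<Rightarrow> real" where
  "damped_defect L m c = real (frob_size c) / real m * max 0 (1 - real (frob_size c) / real m)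
    * thoma_defect L (config_point (frob_size c) c)"

lemma damped_defect_bounds:
  assumes c: "c \<in> frob_pairs" and m: "1 \<le> m"
  shows "0 \<le> damped_defect L m c" "damped_defect L m c \<le> 1"
    and "m \<le> L * R \<Longrightarrow> damped_defect L m c
      \<le> (\<Sum>p<R. (real p + 1 / 2) / real m * of_bool (p \<in> set (fst c))) + (\<Sum>p<R. (real p + 1 / 2) / real m * of_bool (p \<in> set (snd c)))"
proof -
  define k where "k = frob_size c"
  let ?x = "real k / real m" and ?f = "thoma_defect L (config_point k c)"
  have ck: "c \<in> frob_pairs_of_size k" using c by (simp add: frob_pairs_of_size_def k_def)
  have eq: "damped_defect L m c = ?x * max 0 (1 - ?x) * ?f" by (simp add: damped_defect_def k_def)
  let ?S = "\<lambda>R. (\<Sum>p<R. (real p + 1 / 2) / real m * of_bool (p \<in> set (fst c)))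
      + (\<Sum>p<R. (real p + 1 / 2) / real m * of_bool (p \<in> set (snd c)))"
  have S: "0 \<le> ?S R" for R by (intro add_nonneg_nonneg sum_nonneg) auto
  show "0 \<le> damped_defect L m c" "damped_defect L m c \<le> 1" "m \<le> L * R \<Longrightarrow> damped_defect L m c \<le> ?S R"
  proof (atomize (full), cases "1 \<le> k \<and> k \<le> m")
    case True
    hence x: "0 \<le> ?x" "?x \<le> 1" by auto
    note f = thoma_defect_bounds[OF config_point_in_Thoma[OF ck], of L]
    have "damped_defect L m c \<le> ?x * 1 * ?f" unfolding eq using x f(1) True by (intro mult_right_mono mult_left_mono) auto
    moreover have "?x * ?f \<le> ?S R" if "m \<le> L * R"
    proof -
      have "real k * ?f / real m \<le> ((\<Sum>p<R. (real p + 1 / 2) * of_bool (p \<in> set (fst c)))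
          + (\<Sum>p<R. (real p + 1 / 2) * of_bool (p \<in> set (snd c)))) / real m"
        using config_defect_le[OF ck, of L R] True that by (intro divide_right_mono) auto
      thus ?thesis by (simp add: add_divide_distrib sum_divide_distrib mult_ac)
    qed
    moreover have "?x * ?f \<le> 1" using x f True by (intro mult_le_one) auto
    moreover have "0 \<le> damped_defect L m c" unfolding eq using x f(1) True by (intro mult_nonneg_nonneg) auto
    ultimately show "0 \<le> damped_defect L m c \<and> damped_defect L m c \<le> 1 \<and> (m \<le> L * R \<longrightarrow> damped_defect L m c \<le> ?S R)"
      by auto
  next
    case False
    hence "damped_defect L m c = 0" unfolding eq using m by (auto simp: max_def field_simps)
    thus "0 \<le> damped_defect L m c \<and> damped_defect L m c \<le> 1 \<and> (m \<le> L * R \<longrightarrow> damped_defect L m c \<le> ?S R)"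
      using S by simp
  qed
qed

lemma damping_integral_pos:
  assumes t: "0 < t" and int: "integrable (gamma_meas t) (\<lambda>s. s * max 0 (1 - s))"
  shows "0 < (\<integral>s. s * max 0 (1 - s) \<partial>gamma_meas t)"
proof -
  have nonneg: "AE s in gamma_meas t. 0 \<le> s * max 0 (1 - s)"
    unfolding gamma_meas_def by (subst AE_density) (auto simp: indicator_def)
  have "\<not> (AE s in gamma_meas t. s * max 0 (1 - s) = 0)"
  proof
    assume "AE s in gamma_meas t. s * max 0 (1 - s) = 0"
    hence "AE s in lborel. s \<notin> {0<..<1::real}"
      unfolding gamma_meas_def using t
      by (subst (asm) AE_density) (auto elim!: eventually_mono simp: Gamma_real_pos max_def split: if_splits)
    hence "{0<..<1::real} \<in> null_sets lborel" by (subst AE_iff_null_sets) auto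
    thus False by (simp add: null_sets_def)
  qed
  thus ?thesis
    using integral_nonneg_eq_0_iff_AE[OF int nonneg] integral_nonneg_AE[OF nonneg] by linarith
qed

context spectral_limit
begin

interpretation neg: admissible_pair "- z" "- z'" by (rule uminus_pair)

lemma mixture_mean_damped_defect_le:
  obtains C where "0 \<le> C"
    "\<And>m L. 2 \<le> m \<Longrightarrow> 1 \<le> L \<Longrightarrow> mixture_mean m (damped_defect L m) \<le> C * (1 / real L + 1 / real m)"
proof -
  obtain B where B: "0 \<le> B" "\<And>m p. 2 \<le> m \<Longrightarrow> disc_kernel m p p \<le> B / (real p + 1)"
    using disc_kernel_diag_bound by blast
  obtain B' where B': "0 \<le> B'" "\<And>m p. 2 \<le> m \<Longrightarrow> neg.disc_kernel m p p \<le> B' / (real p + 1)"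
    using neg.disc_kernel_diag_bound by blast
  show ?thesis
  proof (rule that[of "B + B'"])
    fix m L :: nat assume m: "2 \<le> m" and L: "1 \<le> L"
    define R where "R = nat \<lceil>real m / real L\<rceil>"
    have "real m / real L \<le> real R" unfolding R_def by (rule real_nat_ceiling_ge)
    hence "real m \<le> real (L * R)" using L by (simp add: field_simps)
    hence mLR: "m \<le> L * R" by (simp only: of_nat_le_iff)
    have R: "real R \<le> real m / real L + 1"
      unfolding R_def using divide_nonneg_nonneg[of "real m" "real L"] by linarith
    have summable: "mixture_weight m summable_on frob_pairs"
      using mixture_weight_summable[of m] m by simp
    define f where "f x = (real (case x of Inl p \<Rightarrow> p | Inr q \<Rightarrow> q) + 1 / 2) / real m" for x :: "nat + nat"
    define Q where "Q x c = (case x of Inl p \<Rightarrow> p \<in> set (fst c) | Inr q \<Rightarrow> q \<in> set (snd c))"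
      for x :: "nat + nat" and c :: "frobenius"
    have "mixture_mean m (damped_defect L m)
        \<le> (\<Sum>x\<in>{..<R} <+> {..<R}. f x * mixture_mean m (\<lambda>c. of_bool (Q x c)))"
    proof (rule mixture_mean_le_sum[OF m summable])
      fix c assume c: "c \<in> frob_pairs"
      show "0 \<le> damped_defect L m c" using damped_defect_bounds(1)[OF c] m by simp
      show "damped_defect L m c \<le> (\<Sum>x\<in>{..<R} <+> {..<R}. f x * of_bool (Q x c))"
        using damped_defect_bounds(3)[OF c _ mLR] m by (simp add: sum.Plus f_def Q_def)
    qed (auto simp: f_def)
    also have "\<dots> = (\<Sum>p<R. f (Inl p) * disc_kernel m p p) + (\<Sum>p<R. f (Inr p) * neg.disc_kernel m p p)"
      using mixture_mean_contains_point[OF m summable]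
        neg.mixture_mean_contains_point[OF m mixture_weight_summable_uminus[OF summable], unfolded mixture_mean_uminus]
      by (simp add: sum.Plus Q_def)
    also have "\<dots> \<le> (\<Sum>p<R. B / real m) + (\<Sum>p<R. B' / real m)"
    proof -
      have "(real p + 1 / 2) / real m * K \<le> D / real m" if "K \<le> D / (real p + 1)" "0 \<le> D" for p K D
      proof -
        have "(real p + 1 / 2) * K \<le> (real p + 1 / 2) * (D / (real p + 1))" using that by (intro mult_left_mono) auto
        also have "\<dots> \<le> D" using that by (simp add: divide_le_eq mult_right_mono field_simps)
        finally show ?thesis by (simp add: divide_right_mono)
      qed
      thus ?thesis using B B' m by (intro add_mono sum_mono) (auto simp: f_def)
    qed
    also have "\<dots> = (B + B') * (real R / real m)" using m by (simp add: field_simps)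
    also have "\<dots> \<le> (B + B') * (1 / real L + 1 / real m)"
      using R m B(1) B'(1) by (intro mult_left_mono) (auto simp: field_simps)
    finally show "mixture_mean m (damped_defect L m) \<le> (B + B') * (1 / real L + 1 / real m)" .
  qed (use B B' in simp)
qed

lemma mixture_mean_damped_defect_tendsto:
  defines "D \<equiv> \<lambda>L. \<integral>w. indicator Thoma w * thoma_defect L w \<partial>P"
  shows "(\<lambda>m. mixture_mean m (damped_defect L m)) \<longlonglongrightarrow> (\<integral>s. s * max 0 (1 - s) * D L \<partial>gamma_meas t)"
    and "integrable (gamma_meas t) (\<lambda>s. s * max 0 (1 - s) * D L)"
proof -
  have "bounded (thoma_defect L ` Thoma)"
    unfolding bounded_iff using thoma_defect_bounds by (intro exI[of _ 1]) (auto simp: abs_le_iff intro: order_trans[of _ 0])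
  note level = level_expectation_tendsto[OF thoma_defect_continuous this]
  have conv: "(\<lambda>m. level_expectation (nat \<lfloor>real m * s\<rfloor>) (damped_defect L m)) \<longlonglongrightarrow> s * max 0 (1 - s) * D L"
    if s: "0 < s" for s
  proof -
    define k where "k m = nat \<lfloor>real m * s\<rfloor>" for m
    have k: "(\<lambda>m. real (k m) / real m) \<longlonglongrightarrow> s" unfolding k_def by (rule nat_floor_tendsto[OF s])
    have "filterlim k at_top sequentially" unfolding k_def using s by real_asymp
    from filterlim_compose[OF level this]
    have "(\<lambda>m. real (k m) / real m * max 0 (1 - real (k m) / real m) * level_expectation (k m) (\<lambda>c. thoma_defect L (config_point (k m) c)))
        \<longlonglongrightarrow> s * max 0 (1 - s) * D L"
      unfolding D_def by (intro tendsto_intros k)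
    moreover have "real (k m) / real m * max 0 (1 - real (k m) / real m) * level_expectation (k m) (\<lambda>c. thoma_defect L (config_point (k m) c))
        = level_expectation (k m) (damped_defect L m)" for m
      unfolding level_expectation_def sum_distrib_left
      by (intro sum.cong refl) (simp add: damped_defect_def frob_pairs_of_size_def)
    ultimately show ?thesis unfolding k_def by simp
  qed
  have bounds: "0 \<le> damped_defect L m c \<and> damped_defect L m c \<le> 1 * (1 + real k / real m) ^ 0"
    if "1 \<le> m" "c \<in> frob_pairs_of_size k" for m k c
    using damped_defect_bounds(1,2)[of c m L] that by (simp add: frob_pairs_of_size_def)
  have "(\<lambda>s. s * max 0 (1 - s) * D L) \<in> borel_measurable borel" by measurable
  from mixture_mean_tendsto[OF bounds _ conv this] mixture_sum_tendsto(2)[OF bounds _ conv this]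
  show "(\<lambda>m. mixture_mean m (damped_defect L m)) \<longlonglongrightarrow> (\<integral>s. s * max 0 (1 - s) * D L \<partial>gamma_meas t)"
    and "integrable (gamma_meas t) (\<lambda>s. s * max 0 (1 - s) * D L)" by simp_all
qed

lemma thoma_defect_integral_le:
  obtains C where "\<And>L. 1 \<le> L \<Longrightarrow> (\<integral>w. indicator Thoma w * thoma_defect L w \<partial>P) \<le> C / real L"
proof -
  let ?W = "\<integral>s. s * max 0 (1 - s) \<partial>gamma_meas t"
  obtain C where C: "0 \<le> C"
      "\<And>m L. 2 \<le> m \<Longrightarrow> 1 \<le> L \<Longrightarrow> mixture_mean m (damped_defect L m) \<le> C * (1 / real L + 1 / real m)"
    using mixture_mean_damped_defect_le by blast
  have "integrable (gamma_meas t) (\<lambda>s. s * max 0 (1 - s))"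
    using mixture_mean_damped_defect_tendsto(2)[of 0] prob_Thoma by (simp add: thoma_defect_def)
  hence W: "0 < ?W" by (rule damping_integral_pos[OF zz_t_pos])
  show ?thesis
  proof (rule that[of "C / ?W"])
    fix L :: nat assume L: "1 \<le> L"
    let ?D = "\<integral>w. indicator Thoma w * thoma_defect L w \<partial>P"
    have "?W * ?D \<le> C * (1 / real L + 0)"
    proof (rule LIMSEQ_le)
      show "(\<lambda>m. mixture_mean m (damped_defect L m)) \<longlonglongrightarrow> ?W * ?D"
        using mixture_mean_damped_defect_tendsto(1)[of L] by simp
      show "(\<lambda>m. C * (1 / real L + 1 / real m)) \<longlonglongrightarrow> C * (1 / real L + 0)" by (intro tendsto_intros lim_1_over_n)
      show "\<exists>N. \<forall>m\<ge>N. mixture_mean m (damped_defect L m) \<le> C * (1 / real L + 1 / real m)"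
        using C(2)[OF _ L] by blast
    qed
    thus "?D \<le> C / ?W / real L" using W L by (simp add: field_simps)
  qed
qed

lemma AE_Thoma0: "AE w in P. w \<in> Thoma0"
proof -
  interpret prob_space P using P by (simp add: Pn_weak_limit_def)
  have [measurable_cong]: "sets P = sets borel" using P by (simp add: Pn_weak_limit_def)
  have [measurable]: "Thoma \<in> sets P" by (rule Thoma_in_sets[OF P])
  obtain C where C: "\<And>L. 1 \<le> L \<Longrightarrow> (\<integral>w. indicator Thoma w * thoma_defect L w \<partial>P) \<le> C / real L"
    using thoma_defect_integral_le by blast
  define f where "f L w = indicator Thoma w * thoma_defect L w" for L w
  define g where "g w = indicator Thoma w * (1 - (\<Sum>i. fst w i + snd w i))" for w :: thoma
  have [measurable]: "thoma_defect L \<in> borel_measurable borel" for L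
    by (intro borel_measurable_continuous_onI thoma_defect_continuous)
  have meas [measurable]: "f L \<in> borel_measurable P" for L unfolding f_def[abs_def] by measurable
  have bounds: "0 \<le> f L w" "f L w \<le> 1" for L w
    using thoma_defect_bounds[of w L] by (auto simp: f_def indicator_def)
  have lim: "(\<lambda>L. f L w) \<longlonglongrightarrow> g w" for w
  proof (cases "w \<in> Thoma")
    case True
    hence "summable (\<lambda>i. fst w i + snd w i)" by (auto simp: Thoma_def case_prod_unfold)
    from tendsto_diff[OF tendsto_const summable_LIMSEQ[OF this]] show ?thesis
      using True by (simp add: f_def g_def thoma_defect_def)
  qed (simp add: f_def g_def)
  have g0: "0 \<le> g w" for w by (rule LIMSEQ_le_const[OF lim]) (use bounds in auto)
  have gm: "g \<in> borel_measurable P" by (rule borel_measurable_LIMSEQ_real[OF lim meas])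
  note dc = gm meas integrable_const[of 1] AE_I2[OF lim]
  have bound: "AE w in P. norm (f L w) \<le> 1" for L using bounds[of L] by (intro AE_I2) simp
  have int: "integrable P g" by (rule integrable_dominated_convergence[OF dc bound])
  have "(\<lambda>L. \<integral>w. f L w \<partial>P) \<longlonglongrightarrow> (\<integral>w. g w \<partial>P)" by (rule integral_dominated_convergence[OF dc bound])
  moreover have "(\<lambda>L. C / real L) \<longlonglongrightarrow> 0" by real_asymp
  ultimately have "(\<integral>w. g w \<partial>P) \<le> 0" by (rule LIMSEQ_le) (use C in \<open>auto simp: f_def\<close>)
  moreover have "0 \<le> (\<integral>w. g w \<partial>P)" using g0 by (intro Bochner_Integration.integral_nonneg) auto
  ultimately have "AE w in P. g w = 0" using integral_nonneg_eq_0_iff_AE[OF int AE_I2[OF g0]] by linarith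
  moreover have "AE w in P. w \<in> Thoma" using P by (intro AE_prob_1) (simp add: Pn_weak_limit_def measure_def)
  ultimately show ?thesis
    by eventually_elim (auto simp: g_def Thoma_def Thoma0_def case_prod_unfold)
qed

end

section \<open>The lifted process\<close>

abbreviation lborel_tuples :: "nat \<Rightarrow> (nat \<Rightarrow> real) measure" where
  "lborel_tuples n \<equiv> \<Pi>\<^sub>M i\<in>{..<n}. lborel"

definition distinct_tuples :: "nat \<Rightarrow> 'a set \<Rightarrow> 'a list set" where
  "distinct_tuples n S = {J. length J = n \<and> distinct J \<and> set J \<subseteq> S}"

definition tuple_point :: "nat \<Rightarrow> real \<Rightarrow> (nat \<Rightarrow> real) \<Rightarrow> nat list \<Rightarrow> nat \<Rightarrow> real" where
  "tuple_point n s a J = restrict (\<lambda>k. s * a (J ! k)) {..<n}"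

definition tuple_meas :: "thoma measure \<Rightarrow> real \<Rightarrow> nat \<Rightarrow> (nat \<Rightarrow> real) measure" where
  "tuple_meas P t n = distr (count_space (distinct_tuples n UNIV) \<Otimes>\<^sub>M (P \<Otimes>\<^sub>M gamma_meas t)) (lborel_tuples n)
    (\<lambda>(J, w, s). tuple_point n s (fst w) J)"

lemma finite_distinct_tuples: "finite S \<Longrightarrow> finite (distinct_tuples n S)"
  unfolding distinct_tuples_def by (rule finite_subset[OF _ finite_lists_length_eq[of S n]]) auto

lemma card_distinct_tuples_le: "finite S \<Longrightarrow> card (distinct_tuples n S) \<le> card S ^ n"
  unfolding card_lists_length_eq[symmetric] distinct_tuples_def by (intro card_mono finite_lists_length_eq) auto

lemma bij_betw_map_distinct_tuples:
  assumes "bij_betw f S T"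
  shows "bij_betw (map f) (distinct_tuples n S) (distinct_tuples n T)"
proof (rule bij_betw_byWitness[where f'="map (inv_into S f)"])
  have inj: "inj_on f S" "inj_on (inv_into S f) T" and inv: "\<And>y. y \<in> T \<Longrightarrow> f (inv_into S f y) = y"
    using assms bij_betw_inv_into[OF assms] by (auto simp: bij_betw_def f_inv_into_f)
  note range = bij_betw_apply[OF assms] bij_betw_apply[OF bij_betw_inv_into[OF assms]]
  show "\<forall>J\<in>distinct_tuples n S. map (inv_into S f) (map f J) = J"
    using inj by (auto simp: distinct_tuples_def intro!: map_idI)
  show "\<forall>J\<in>distinct_tuples n T. map f (map (inv_into S f) J) = J"
    using inv by (auto simp: distinct_tuples_def intro!: map_idI)
  show "map f ` distinct_tuples n S \<subseteq> distinct_tuples n T" "map (inv_into S f) ` distinct_tuples n T \<subseteq> distinct_tuples n S"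
    using inj range by (auto simp: distinct_tuples_def distinct_map intro: inj_on_subset; blast)+
qed

lemma sets_gamma_meas [measurable_cong]: "sets (gamma_meas t) = sets borel"
  by (simp add: gamma_meas_def)

lemma sigma_finite_gamma_meas: "sigma_finite_measure (gamma_meas t)"
  unfolding gamma_meas_def
  by (subst sigma_finite_measure.sigma_finite_iff_density_finite[OF sigma_finite_lborel]) auto

lemma sigma_finite_count_tuples: "sigma_finite_measure (count_space (distinct_tuples n (UNIV :: nat set)))"
  by (rule sigma_finite_measure_count_space_countable[OF countable_subset[OF subset_UNIV]]) simp

lemma tuple_point_measurable:
  assumes P [measurable_cong]: "sets P = sets (borel :: thoma measure)"
  shows "(\<lambda>(J, w, s). tuple_point n s (fst w) J)
    \<in> count_space (distinct_tuples n UNIV) \<Otimes>\<^sub>M (P \<Otimes>\<^sub>M gamma_meas t) \<rightarrow>\<^sub>M lborel_tuples n"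
proof (rule measurable_pair_measure_countable1)
  show "countable (distinct_tuples n (UNIV :: nat set))" by (rule countable_subset[OF subset_UNIV]) simp
  fix J :: "nat list"
  have [measurable]: "(\<lambda>w::thoma. fst w i) \<in> borel_measurable borel" for i
    by (intro borel_measurable_continuous_onI Thoma_coordinates_continuous)
  have "(\<lambda>ws. snd ws * fst (fst ws) (J ! k)) \<in> borel_measurable (P \<Otimes>\<^sub>M gamma_meas t)" for k by measurable
  thus "(\<lambda>ws. case (J, ws) of (J, w, s) \<Rightarrow> tuple_point n s (fst w) J) \<in> P \<Otimes>\<^sub>M gamma_meas t \<rightarrow>\<^sub>M lborel_tuples n"
    unfolding tuple_point_def by (simp add: case_prod_unfold measurable_restrict)
qed

lemma
  assumes prob: "prob_space P" and P: "sets P = sets (borel :: thoma measure)"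
    and f: "f \<in> borel_measurable (lborel_tuples n)"
  defines "F \<equiv> \<lambda>ws. \<integral>\<^sup>+J. f (tuple_point n (snd ws) (fst (fst ws)) J) \<partial>count_space (distinct_tuples n UNIV)"
  shows nn_integral_tuple_meas: "(\<integral>\<^sup>+y. f y \<partial>tuple_meas P t n) = (\<integral>\<^sup>+ws. F ws \<partial>(P \<Otimes>\<^sub>M gamma_meas t))"
    and tuple_integral_measurable: "F \<in> borel_measurable (P \<Otimes>\<^sub>M gamma_meas t)"
proof -
  let ?C = "count_space (distinct_tuples n (UNIV :: nat set))" and ?Q = "P \<Otimes>\<^sub>M gamma_meas t"
  interpret P: prob_space P by (rule prob)
  interpret G: sigma_finite_measure "gamma_meas t" by (rule sigma_finite_gamma_meas)
  interpret PG: pair_sigma_finite P "gamma_meas t" ..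
  interpret C: sigma_finite_measure ?C by (rule sigma_finite_count_tuples)
  interpret CQ: pair_sigma_finite ?C ?Q ..
  have meas: "(\<lambda>(J, w, s). f (tuple_point n s (fst w) J)) \<in> borel_measurable (?C \<Otimes>\<^sub>M ?Q)"
    using measurable_compose[OF tuple_point_measurable[OF P] f] by (simp add: case_prod_unfold)
  show "(\<integral>\<^sup>+y. f y \<partial>tuple_meas P t n) = (\<integral>\<^sup>+ws. F ws \<partial>?Q)"
    unfolding tuple_meas_def F_def using CQ.nn_integral_snd[OF meas] f
    by (subst nn_integral_distr[OF tuple_point_measurable[OF P]]) (simp_all add: case_prod_unfold)
  show "F \<in> borel_measurable ?Q"
    using C.borel_measurable_nn_integral_fst[OF measurable_pair_swap[OF meas]] by (simp add: F_def case_prod_unfold)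
qed

lemma count_positive_tuples:
  assumes nonneg: "\<And>i. 0 \<le> snd w i" and s: "0 < s" and A: "A \<subseteq> {x. \<forall>i<n. 0 < x i}"
  shows "emeasure (count_space UNIV) {J :: (nat + nat) list. length J = n \<and> distinct J \<and> set J \<subseteq> conf_idx w
      \<and> restrict (\<lambda>k. conf_pos w s (J ! k)) {..<n} \<in> A}
    = (\<integral>\<^sup>+J. indicator A (tuple_point n s (fst w) J) \<partial>count_space (distinct_tuples n UNIV))" (is "emeasure _ ?S = _")
proof -
  define T where "T = {J \<in> distinct_tuples n (UNIV :: nat set). tuple_point n s (fst w) J \<in> A}"
  have pos: "restrict (\<lambda>k. conf_pos w s (map Inl J ! k)) {..<n} = tuple_point n s (fst w) J" if "length J = n" for J
    using that by (auto simp: tuple_point_def conf_pos_def)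
  have "?S = map Inl ` T"
  proof (intro equalityI subsetI)
    fix J assume J: "J \<in> ?S"
    have "\<exists>i. x = Inl i" if x: "x \<in> set J" for x
    proof (cases x)
      case (Inr i)
      obtain k where "k < n" "x = J ! k" using x J by (auto simp: in_set_conv_nth)
      hence "0 < conf_pos w s x" using J A by auto
      thus ?thesis using Inr nonneg[of i] s by (simp add: conf_pos_def mult_less_0_iff)
    qed simp
    hence eq: "J = map Inl (map projl J)" by (auto intro!: map_idI[symmetric] simp: comp_def) (metis sum.sel(1))
    define I where "I = map projl J"
    have JI: "J = map Inl I" using eq by (simp add: I_def)
    have "I \<in> T" using J pos[of I] unfolding JI by (auto simp: T_def distinct_tuples_def distinct_map)
    thus "J \<in> map Inl ` T" using JI by blast
  next
    fix J :: "(nat + nat) list" assume "J \<in> map Inl ` T"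
    then obtain I where J: "J = map Inl I" and I: "length I = n" "distinct I" "tuple_point n s (fst w) I \<in> A"
      by (auto simp: T_def distinct_tuples_def)
    have "fst w i \<noteq> 0" if "i \<in> set I" for i
    proof -
      obtain k where "k < n" "i = I ! k" using \<open>i \<in> set I\<close> I(1) by (auto simp: in_set_conv_nth)
      thus ?thesis using I(3) A by (force simp: tuple_point_def)
    qed
    thus "J \<in> ?S" using I pos[OF I(1)] by (auto simp: J conf_idx_def distinct_map)
  qed
  moreover have "inj_on (map Inl :: nat list \<Rightarrow> (nat + nat) list) T" by (simp add: inj_on_def)
  ultimately have "emeasure (count_space UNIV) ?S = emeasure (count_space (distinct_tuples n UNIV)) T"
    by (subst (1 2) emeasure_count_space) (auto simp: T_def card_image finite_image_iff)
  also have "\<dots> = (\<integral>\<^sup>+J. indicator T J \<partial>count_space (distinct_tuples n UNIV))"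
    by (subst nn_integral_indicator) (auto simp: T_def)
  also have "\<dots> = (\<integral>\<^sup>+J. indicator A (tuple_point n s (fst w) J) \<partial>count_space (distinct_tuples n UNIV))"
    by (intro nn_integral_cong) (auto simp: T_def indicator_def)
  finally show ?thesis .
qed

context spectral_limit
begin

lemma sets_limit_measure: "sets P = sets borel" and prob_limit_measure: "prob_space P"
  using P by (auto simp: Pn_weak_limit_def)

lemma prob_gamma_meas: "prob_space (gamma_meas t)"
proof (rule prob_spaceI)
  have "measure (gamma_meas t) (space (gamma_meas t)) = 1"
    using gamma_meas_total by simp
  thus "emeasure (gamma_meas t) (space (gamma_meas t)) = 1"
    by (metis emeasure_eq_ennreal_measure enn2real_top ennreal_1 measure_def zero_neq_one)
qed

lemma AE_lifted: "AE ws in P \<Otimes>\<^sub>M gamma_meas t. fst ws \<in> Thoma0 \<and> 0 < snd ws"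
proof -
  interpret P: prob_space P by (rule prob_limit_measure)
  interpret G: prob_space "gamma_meas t" by (rule prob_gamma_meas)
  interpret pair_sigma_finite P "gamma_meas t" ..
  have "AE s in gamma_meas t. 0 < s"
    unfolding gamma_meas_def by (subst AE_density) (auto simp: indicator_def)
  hence "AE ws in P \<Otimes>\<^sub>M gamma_meas t. 0 < snd ws"
    by (intro AE_pair_measure) (auto intro!: measurable_sets_Collect)
  moreover have "AE ws in P \<Otimes>\<^sub>M gamma_meas t. fst ws \<in> Thoma0"
    by (rule AE_distrD[OF measurable_fst]) (unfold G.distr_pair_fst, rule AE_Thoma0)
  ultimately show ?thesis by eventually_elim simp
qed

lemma lifted_corr_measure_eq:
  assumes A: "A \<in> sets (lborel_tuples n)" "A \<subseteq> {x. \<forall>i<n. 0 < x i}"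
  shows "lifted_corr_measure z z' P n A = emeasure (tuple_meas P t n) A"
proof -
  let ?I = "\<lambda>ws. \<integral>\<^sup>+J. indicator A (tuple_point n (snd ws) (fst (fst ws)) J) \<partial>count_space (distinct_tuples n UNIV)"
  have "emeasure (tuple_meas P t n) A = (\<integral>\<^sup>+y. indicator A y \<partial>tuple_meas P t n)"
    using A(1) by (simp add: tuple_meas_def)
  also have "\<dots> = (\<integral>\<^sup>+ws. ?I ws \<partial>(P \<Otimes>\<^sub>M gamma_meas t))"
    by (rule nn_integral_tuple_meas[OF prob_limit_measure sets_limit_measure]) (use A(1) in simp)
  also have "\<dots> = lifted_corr_measure z z' P n A"
    unfolding lifted_corr_measure_def
  proof (rule nn_integral_cong_AE, rule eventually_mono[OF AE_lifted])
    fix ws :: "thoma \<times> real" assume ws: "fst ws \<in> Thoma0 \<and> 0 < snd ws"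
    hence "0 \<le> snd (fst ws) i" for i by (auto simp: Thoma0_def)
    from count_positive_tuples[OF this _ A(2), of "snd ws"] ws
    show "?I ws = indicator (Thoma0 \<times> {0<..}) ws * emeasure (count_space UNIV)
      {J. length J = n \<and> distinct J \<and> set J \<subseteq> conf_idx (fst ws)
        \<and> restrict (\<lambda>k. conf_pos (fst ws) (snd ws) (J ! k)) {..<n} \<in> A}"
      by (cases ws) (auto simp: indicator_def)
  qed
  finally show ?thesis ..
qed

end

definition grid_midpoint :: "nat \<Rightarrow> nat list \<Rightarrow> nat \<Rightarrow> real" where
  "grid_midpoint m x j = (real (x ! j) + 1 / 2) / real m"

locale test_function =
  fixes n :: nat and \<Phi> :: "(nat \<Rightarrow> real) \<Rightarrow> real" and c B K :: real
  assumes c: "0 < c" and K: "0 \<le> K"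
    and measurable [measurable]: "\<Phi> \<in> borel_measurable (lborel_tuples n)"
    and range: "0 \<le> \<Phi> x" "\<Phi> x \<le> 1"
    and lipschitz: "\<bar>\<Phi> x - \<Phi> y\<bar> \<le> K * (\<Sum>j<n. \<bar>x j - y j\<bar>)"
    and support: "j < n \<Longrightarrow> x j < c \<or> B < x j \<Longrightarrow> \<Phi> x = 0"
begin

lemma cong: "(\<And>j. j < n \<Longrightarrow> x j = y j) \<Longrightarrow> \<Phi> x = \<Phi> y"
  using lipschitz[of x y] by simp

lemma continuous_compose:
  assumes "\<And>j. j < n \<Longrightarrow> continuous_on S (\<lambda>w. x w j)"
  shows "continuous_on S (\<lambda>w. \<Phi> (x w))"
  unfolding continuous_on_def
proof
  fix v assume v: "v \<in> S"
  have "((\<lambda>w. K * (\<Sum>j<n. \<bar>x w j - x v j\<bar>)) \<longlongrightarrow> K * (\<Sum>j<n. \<bar>x v j - x v j\<bar>)) (at v within S)"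
    using assms v by (intro tendsto_intros) (auto simp: continuous_on_def)
  hence "((\<lambda>w. K * (\<Sum>j<n. \<bar>x w j - x v j\<bar>)) \<longlongrightarrow> 0) (at v within S)" by simp
  hence "((\<lambda>w. \<Phi> (x w) - \<Phi> (x v)) \<longlongrightarrow> 0) (at v within S)"
    by (rule Lim_null_comparison[rotated]) (simp add: lipschitz)
  thus "((\<lambda>w. \<Phi> (x w)) \<longlongrightarrow> \<Phi> (x v)) (at v within S)" by (rule LIM_zero_cancel)
qed

definition tuple_sum :: "real \<Rightarrow> (nat \<Rightarrow> real) \<Rightarrow> ennreal" where
  "tuple_sum s a = (\<integral>\<^sup>+J. ennreal (\<Phi> (tuple_point n s a J)) \<partial>count_space (distinct_tuples n UNIV))"

definition tuple_sum_below :: "nat \<Rightarrow> real \<Rightarrow> (nat \<Rightarrow> real) \<Rightarrow> real" where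
  "tuple_sum_below L s a = (\<Sum>J\<in>distinct_tuples n {..<L}. \<Phi> (tuple_point n s a J))"

definition config_tuple_sum :: "nat \<Rightarrow> frobenius \<Rightarrow> real" where
  "config_tuple_sum m pq = (\<Sum>x\<in>distinct_tuples n (set (fst pq)). \<Phi> (grid_midpoint m x))"

lemma grid_midpoint_vanishes:
  assumes R: "B * real m \<le> real R" and x: "length x = n" "\<not> set x \<subseteq> {..<R}" and m: "0 < m"
  shows "\<Phi> (grid_midpoint m x) = 0"
proof -
  obtain j where j: "j < n" "R \<le> x ! j" using x by (auto simp: subset_iff in_set_conv_nth not_less)
  hence "B * real m < real (x ! j) + 1 / 2" using R by linarith
  hence "B < grid_midpoint m x j" using m by (simp add: grid_midpoint_def field_simps)
  thus ?thesis by (intro support[OF j(1)]) simp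
qed

lemma tuple_sum_eq_below:
  assumes "\<And>i. L \<le> i \<Longrightarrow> s * a i < c"
  shows "tuple_sum s a = ennreal (tuple_sum_below L s a)"
proof -
  have "tuple_sum s a = (\<Sum>J\<in>distinct_tuples n {..<L}. ennreal (\<Phi> (tuple_point n s a J)))"
    unfolding tuple_sum_def
  proof (rule nn_integral_count_space')
    fix J assume "J \<in> distinct_tuples n (UNIV :: nat set)" "J \<notin> distinct_tuples n {..<L}"
    then obtain j where "j < n" "L \<le> J ! j" by (auto simp: distinct_tuples_def subset_iff in_set_conv_nth not_less)
    thus "ennreal (\<Phi> (tuple_point n s a J)) = 0"
      using assms support[of j "tuple_point n s a J"] by (simp add: tuple_point_def)
  qed (auto simp: finite_distinct_tuples, auto simp: distinct_tuples_def)
  thus ?thesis by (simp add: tuple_sum_below_def range sum_ennreal)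
qed

lemma tuple_sum_below_bounds: "0 \<le> tuple_sum_below L s a" "tuple_sum_below L s a \<le> real (card (distinct_tuples n {..<L}))"
  unfolding tuple_sum_below_def using range sum_bounded_above[of "distinct_tuples n {..<L}" "\<lambda>J. \<Phi> (tuple_point n s a J)" 1]
  by (auto intro: sum_nonneg)

lemma tuple_sum_below_lipschitz:
  assumes w: "w \<in> Thoma"
  shows "\<bar>tuple_sum_below L s (fst w) - tuple_sum_below L s' (fst w)\<bar>
    \<le> real (card (distinct_tuples n {..<L})) * (K * (real n * \<bar>s - s'\<bar>))"
proof -
  have "\<bar>\<Phi> (tuple_point n s (fst w) J) - \<Phi> (tuple_point n s' (fst w) J)\<bar> \<le> K * (real n * \<bar>s - s'\<bar>)" for J
  proof -
    have "\<bar>tuple_point n s (fst w) J j - tuple_point n s' (fst w) J j\<bar> \<le> \<bar>s - s'\<bar>" if "j < n" for j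
    proof -
      have "1 * fst w (J ! j) \<le> real (Suc (J ! j)) * fst w (J ! j)"
        by (intro mult_right_mono Thoma_coordinate_bounds[OF w]) auto
      hence "\<bar>fst w (J ! j)\<bar> \<le> 1" using Thoma_coordinate_bounds(1,3)[OF w, of "J ! j"] by simp
      thus ?thesis using that by (simp add: tuple_point_def left_diff_distrib[symmetric] abs_mult mult_left_le)
    qed
    hence "(\<Sum>j<n. \<bar>tuple_point n s (fst w) J j - tuple_point n s' (fst w) J j\<bar>) \<le> (\<Sum>j<n. \<bar>s - s'\<bar>)"
      by (intro sum_mono) auto
    thus ?thesis using lipschitz[of "tuple_point n s (fst w) J" "tuple_point n s' (fst w) J"] mult_left_mono[OF _ K] by fastforce
  qed
  thus ?thesis
    unfolding tuple_sum_below_def sum_subtractf[symmetric] by (intro sum_abs[THEN order_trans] sum_bounded_above)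
qed

lemma tuple_sum_below_continuous: "continuous_on S (\<lambda>w::thoma. tuple_sum_below L s (fst w))"
  unfolding tuple_sum_below_def
  by (intro continuous_on_sum continuous_compose) (auto simp: tuple_point_def intro!: continuous_intros Thoma_coordinates_continuous)

lemma Thoma_coordinate_below:
  assumes w: "w \<in> Thoma" and s: "0 \<le> s" "s \<le> c * real L" and i: "L \<le> i"
  shows "s * fst w i < c"
proof -
  have "s * (real (Suc i) * fst w i) \<le> s * 1" by (intro mult_left_mono Thoma_coordinate_bounds[OF w] s)
  also have "\<dots> \<le> c * real L" using s by simp
  also have "\<dots> < c * real (Suc i)" using c i by (intro mult_strict_left_mono) auto
  finally show ?thesis by (simp add: mult.left_commute mult.commute[of c])
qed

lemma config_tuple_sum_eq:
  assumes pq: "pq \<in> frob_pairs_of_size k" and k: "1 \<le> k" "1 \<le> m" and L: "real k / real m \<le> c * real L"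
  shows "config_tuple_sum m pq = tuple_sum_below L (real k / real m) (fst (config_point k pq))"
proof -
  define d where "d = length (fst pq)"
  let ?s = "real k / real m" and ?a = "fst (config_point k pq)"
  have dist: "distinct (fst pq)"
    using pq by (auto simp: frob_pairs_of_size_def frob_pairs_def intro: distinct_decreasing_list)
  have "bij_betw (map ((!) (fst pq))) (distinct_tuples n {..<d}) (distinct_tuples n (set (fst pq)))"
    by (rule bij_betw_map_distinct_tuples) (use bij_betw_nth[OF dist refl refl] in \<open>simp add: d_def\<close>)
  from sum.reindex_bij_betw[OF this, of "\<lambda>x. \<Phi> (grid_midpoint m x)"]
  have "config_tuple_sum m pq = (\<Sum>J\<in>distinct_tuples n {..<d}. \<Phi> (grid_midpoint m (map ((!) (fst pq)) J)))"
    by (simp add: config_tuple_sum_def)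
  also have "\<dots> = tuple_sum_below d ?s ?a"
    unfolding tuple_sum_below_def
  proof (intro sum.cong refl cong)
    fix J j assume "J \<in> distinct_tuples n {..<d}" "j < n"
    hence "length J = n" "J ! j < d" by (auto simp: distinct_tuples_def subset_iff)
    thus "grid_midpoint m (map ((!) (fst pq)) J) j = tuple_point n ?s ?a J j"
      using \<open>j < n\<close> k by (simp add: grid_midpoint_def tuple_point_def config_point_def d_def)
  qed
  also have "ennreal (tuple_sum_below d ?s ?a) = ennreal (tuple_sum_below L ?s ?a)"
  proof -
    have "?s * ?a i < c" if "d \<le> i" for i using that c by (simp add: config_point_def d_def)
    moreover have "?s * ?a i < c" if "L \<le> i" for i
      using Thoma_coordinate_below[OF config_point_in_Thoma[OF pq k(1)] _ L that] by simp
    ultimately show ?thesis using tuple_sum_eq_below by metis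
  qed
  hence "tuple_sum_below d ?s ?a = tuple_sum_below L ?s ?a" by (simp add: tuple_sum_below_bounds)
  finally show ?thesis .
qed

lemma config_tuple_sum_bound:
  assumes pq: "pq \<in> frob_pairs_of_size k" and m: "1 \<le> m"
  shows "0 \<le> config_tuple_sum m pq \<and> config_tuple_sum m pq \<le> (1 / c) ^ n * (1 + real k / real m) ^ n"
proof
  let ?\<Phi> = "\<lambda>x. \<Phi> (grid_midpoint m x)"
  show "0 \<le> config_tuple_sum m pq" unfolding config_tuple_sum_def by (intro sum_nonneg range)
  define S where "S = {p \<in> set (fst pq). c \<le> (real p + 1 / 2) / real m}"
  have dist: "distinct (fst pq)" and size: "frob_size pq = k"
    using pq by (auto simp: frob_pairs_of_size_def frob_pairs_def intro: distinct_decreasing_list)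
  have "config_tuple_sum m pq = (\<Sum>x\<in>distinct_tuples n S. ?\<Phi> x)"
    unfolding config_tuple_sum_def
  proof (rule sum.mono_neutral_right)
    show "\<forall>x\<in>distinct_tuples n (set (fst pq)) - distinct_tuples n S. ?\<Phi> x = 0"
    proof
      fix x assume "x \<in> distinct_tuples n (set (fst pq)) - distinct_tuples n S"
      then obtain j where j: "j < n" "(real (x ! j) + 1 / 2) / real m < c"
        by (auto simp: distinct_tuples_def S_def subset_iff in_set_conv_nth not_le)
      show "?\<Phi> x = 0" by (rule support[OF j(1)]) (use j(2) in \<open>simp add: grid_midpoint_def\<close>)
    qed
  qed (auto simp: finite_distinct_tuples, auto simp: distinct_tuples_def S_def)
  also have "\<dots> \<le> real (card (distinct_tuples n S)) * 1" by (rule sum_bounded_above) (rule range)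
  also have "\<dots> \<le> real (card S) ^ n"
    unfolding of_nat_power[symmetric] mult_1_right of_nat_le_iff by (rule card_distinct_tuples_le) (simp add: S_def)
  also have "\<dots> \<le> (1 / c * (1 + real k / real m)) ^ n"
  proof (rule power_mono)
    have "real (card S) * (c * real m) = (\<Sum>p\<in>S. c * real m)" by simp
    also have "\<dots> \<le> (\<Sum>p\<in>S. real p + 1 / 2)" using m by (intro sum_mono) (auto simp: S_def field_simps)
    also have "\<dots> \<le> (\<Sum>p\<in>set (fst pq). real p + 1 / 2)" by (intro sum_mono2) (auto simp: S_def)
    also have "\<dots> = real (sum_list (fst pq)) + real (length (fst pq)) / 2"
      using sum_list_distinct_conv_sum_set[OF dist, of "\<lambda>p. p"] distinct_card[OF dist] by (simp add: sum.distrib)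
    also have "\<dots> \<le> real k" using size by (auto simp: frob_size_def)
    finally have "real (card S) \<le> 1 / c * (real k / real m)" using c m by (simp add: field_simps)
    also have "\<dots> \<le> 1 / c * (1 + real k / real m)" using c by (intro mult_left_mono) auto
    finally show "real (card S) \<le> 1 / c * (1 + real k / real m)" .
  qed simp
  finally show "config_tuple_sum m pq \<le> (1 / c) ^ n * (1 + real k / real m) ^ n" by (simp only: power_mult_distrib)
qed

end

locale test_function_limit = spectral_limit + test_function
begin

definition mean_tuple_sum :: "real \<Rightarrow> real" where
  "mean_tuple_sum s = (if 0 < s then enn2real (\<integral>\<^sup>+w. indicator Thoma w * tuple_sum s (fst w) \<partial>P) else 0)"

lemma mean_tuple_sum_eq:
  assumes s: "0 < s" "s \<le> c * real L"
  shows "(\<integral>\<^sup>+w. indicator Thoma w * tuple_sum s (fst w) \<partial>P) = ennreal (mean_tuple_sum s)"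
    and "mean_tuple_sum s = (\<integral>w. indicator Thoma w * tuple_sum_below L s (fst w) \<partial>P)"
proof -
  interpret prob_space P by (rule prob_limit_measure)
  let ?f = "\<lambda>w. indicator Thoma w * tuple_sum_below L s (fst w)"
  note [measurable_cong] = sets_limit_measure and [measurable] = Thoma_in_sets[OF P]
  have [measurable]: "(\<lambda>w::thoma. tuple_sum_below L s (fst w)) \<in> borel_measurable borel"
    by (intro borel_measurable_continuous_onI tuple_sum_below_continuous)
  have "integrable P ?f"
    by (rule integrable_const_bound[of _ "real (card (distinct_tuples n {..<L}))"])
      (use tuple_sum_below_bounds in \<open>auto simp: indicator_def\<close>)
  hence "(\<integral>\<^sup>+w. ennreal (?f w) \<partial>P) = ennreal (\<integral>w. ?f w \<partial>P)"
    by (rule nn_integral_eq_integral) (use tuple_sum_below_bounds in auto)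
  moreover have "tuple_sum s (fst w) = ennreal (tuple_sum_below L s (fst w))" if "w \<in> Thoma" for w
    by (rule tuple_sum_eq_below, rule Thoma_coordinate_below[OF that]) (use s in auto)
  hence "ennreal (?f w) = indicator Thoma w * tuple_sum s (fst w)" for w by (auto simp: indicator_def)
  ultimately have eq: "(\<integral>\<^sup>+w. indicator Thoma w * tuple_sum s (fst w) \<partial>P) = ennreal (\<integral>w. ?f w \<partial>P)" by simp
  have "0 \<le> (\<integral>w. ?f w \<partial>P)" using tuple_sum_below_bounds by (intro Bochner_Integration.integral_nonneg) auto
  thus "mean_tuple_sum s = (\<integral>w. ?f w \<partial>P)" using s(1) by (simp add: mean_tuple_sum_def eq)
  thus "(\<integral>\<^sup>+w. indicator Thoma w * tuple_sum s (fst w) \<partial>P) = ennreal (mean_tuple_sum s)" using eq by simp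
qed

lemma le_mult_ceiling: "s \<le> c * real (nat \<lceil>s / c\<rceil>)"
  using real_nat_ceiling_ge[of "s / c"] c by (simp add: field_simps)

lemma tuple_sum_measurable [measurable]:
  "(\<lambda>ws. tuple_sum (snd ws) (fst (fst ws))) \<in> borel_measurable (P \<Otimes>\<^sub>M gamma_meas t)"
  unfolding tuple_sum_def
  by (rule tuple_integral_measurable[OF prob_limit_measure sets_limit_measure]) measurable

lemma mean_tuple_sum_measurable [measurable]: "mean_tuple_sum \<in> borel_measurable borel"
proof -
  interpret prob_space P by (rule prob_limit_measure)
  note [measurable] = Thoma_in_sets[OF P]
  have "(\<lambda>ws. indicator Thoma (fst ws) * tuple_sum (snd ws) (fst (fst ws))) \<in> borel_measurable (P \<Otimes>\<^sub>M gamma_meas 1)"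
    by measurable
  from borel_measurable_nn_integral_fst[OF measurable_pair_swap[OF this]]
  have "(\<lambda>s. \<integral>\<^sup>+w. indicator Thoma w * tuple_sum s (fst w) \<partial>P) \<in> borel_measurable borel"
    by (simp add: case_prod_unfold cong: measurable_cong_sets)
  thus ?thesis unfolding mean_tuple_sum_def[abs_def] by measurable
qed

lemma level_expectation_config_tuple_sum_tendsto:
  assumes s: "0 < s"
  shows "(\<lambda>m. level_expectation (nat \<lfloor>real m * s\<rfloor>) (config_tuple_sum m)) \<longlonglongrightarrow> mean_tuple_sum s"
proof -
  define k where "k m = nat \<lfloor>real m * s\<rfloor>" for m
  define L where "L = nat \<lceil>s / c\<rceil>"
  have sL: "s \<le> c * real L" unfolding L_def by (rule le_mult_ceiling)
  let ?T = "\<lambda>m r pq. tuple_sum_below L r (fst (config_point (k m) pq))"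
  have k: "(\<lambda>m. real (k m) / real m) \<longlonglongrightarrow> s" unfolding k_def by (rule nat_floor_tendsto[OF s])
  have k_top: "filterlim k at_top sequentially" unfolding k_def using s by real_asymp
  have "bounded ((\<lambda>w. tuple_sum_below L s (fst w)) ` Thoma)"
    unfolding bounded_iff using tuple_sum_below_bounds by (intro exI[of _ "real (card (distinct_tuples n {..<L}))"]) auto
  note limit = filterlim_compose[OF level_expectation_tendsto[OF tuple_sum_below_continuous this] k_top,
      folded mean_tuple_sum_eq(2)[OF s sL]]
  define A where "A = real (card (distinct_tuples n {..<L})) * (K * real n)"
  obtain D where D: "\<And>k g b. (\<And>pq. pq \<in> frob_pairs_of_size k \<Longrightarrow> \<bar>g pq\<bar> \<le> b) \<Longrightarrow> 0 \<le> b \<Longrightarrow> \<bar>level_expectation k g\<bar> \<le> D * b"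
    using level_expectation_bound by metis
  have "(\<lambda>m. level_expectation (k m) (config_tuple_sum m) - level_expectation (k m) (?T m s)) \<longlonglongrightarrow> 0"
  proof (rule Lim_null_comparison)
    have "(\<lambda>m. D * (A * \<bar>real (k m) / real m - s\<bar>)) \<longlonglongrightarrow> D * (A * \<bar>s - s\<bar>)" by (intro tendsto_intros k)
    thus "(\<lambda>m. D * (A * \<bar>real (k m) / real m - s\<bar>)) \<longlonglongrightarrow> 0" by simp
    have "\<forall>\<^sub>F m in sequentially. 1 \<le> k m" using k_top by (simp add: filterlim_at_top)
    thus "\<forall>\<^sub>F m in sequentially. norm (level_expectation (k m) (config_tuple_sum m) - level_expectation (k m) (?T m s))
        \<le> D * (A * \<bar>real (k m) / real m - s\<bar>)"
      using eventually_ge_at_top[of 1]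
    proof eventually_elim
      case (elim m)
      have kL: "real (k m) / real m \<le> c * real L"
        using nat_floor_bounds(1)[of m s] elim s sL unfolding k_def by linarith
      have "level_expectation (k m) (config_tuple_sum m) - level_expectation (k m) (?T m s)
          = level_expectation (k m) (\<lambda>pq. ?T m (real (k m) / real m) pq - ?T m s pq)"
        unfolding level_expectation_def sum_subtractf[symmetric] right_diff_distrib[symmetric]
        by (intro sum.cong refl) (simp add: config_tuple_sum_eq[OF _ elim kL])
      also have "\<bar>\<dots>\<bar> \<le> D * (A * \<bar>real (k m) / real m - s\<bar>)"
      proof (rule D)
        fix pq assume "pq \<in> frob_pairs_of_size (k m)"
        from tuple_sum_below_lipschitz[OF config_point_in_Thoma[OF this elim(1)]]
        show "\<bar>?T m (real (k m) / real m) pq - ?T m s pq\<bar> \<le> A * \<bar>real (k m) / real m - s\<bar>" by (simp add: A_def mult.assoc)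
      qed (use K in \<open>simp add: A_def\<close>)
      finally show ?case by simp
    qed
  qed
  from tendsto_add[OF this limit] show ?thesis by (simp add: k_def)
qed

lemma
  defines "V \<equiv> \<integral>s. mean_tuple_sum s \<partial>gamma_meas t"
  shows mixture_mean_config_tuple_sum_tendsto: "(\<lambda>m. mixture_mean m (config_tuple_sum m)) \<longlonglongrightarrow> V"
    and nn_integral_tuple_meas_test_function: "(\<integral>\<^sup>+y. ennreal (\<Phi> y) \<partial>tuple_meas P t n) = ennreal V"
proof -
  let ?G = "gamma_meas t"
  have "0 \<le> (1 / c) ^ n" using c by simp
  note limit = config_tuple_sum_bound this level_expectation_config_tuple_sum_tendsto mean_tuple_sum_measurable
  show "(\<lambda>m. mixture_mean m (config_tuple_sum m)) \<longlonglongrightarrow> V"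
    unfolding V_def by (rule mixture_mean_tendsto[OF limit(1)[rotated] limit(2-4)])
  have int: "integrable ?G mean_tuple_sum" by (rule mixture_sum_tendsto(2)[OF limit(1)[rotated] limit(2-4)])
  interpret P: prob_space P by (rule prob_limit_measure)
  interpret G: sigma_finite_measure ?G by (rule sigma_finite_gamma_meas)
  interpret PG: pair_sigma_finite P ?G ..
  note [measurable] = Thoma_in_sets[OF P]
  have "Thoma0 \<subseteq> Thoma" by (auto simp: Thoma0_def Thoma_def)
  hence lifted: "AE ws in P \<Otimes>\<^sub>M ?G. fst ws \<in> Thoma \<and> 0 < snd ws"
    using AE_lifted by (auto elim: eventually_mono)
  have "(\<integral>\<^sup>+y. ennreal (\<Phi> y) \<partial>tuple_meas P t n) = (\<integral>\<^sup>+ws. tuple_sum (snd ws) (fst (fst ws)) \<partial>(P \<Otimes>\<^sub>M ?G))"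
    unfolding tuple_sum_def by (rule nn_integral_tuple_meas[OF P.prob_space_axioms sets_limit_measure]) measurable
  also have "\<dots> = (\<integral>\<^sup>+ws. indicator {0<..} (snd ws) * (indicator Thoma (fst ws) * tuple_sum (snd ws) (fst (fst ws))) \<partial>(P \<Otimes>\<^sub>M ?G))"
    by (rule nn_integral_cong_AE, rule eventually_mono[OF lifted]) auto
  also have "\<dots> = (\<integral>\<^sup>+s. \<integral>\<^sup>+w. indicator {0<..} s * (indicator Thoma w * tuple_sum s (fst w)) \<partial>P \<partial>?G)"
    by (subst PG.nn_integral_snd[symmetric]) auto
  also have "\<dots> = (\<integral>\<^sup>+s. ennreal (mean_tuple_sum s) \<partial>?G)"
  proof (rule nn_integral_cong)
    fix s
    show "(\<integral>\<^sup>+w. indicator {0<..} s * (indicator Thoma w * tuple_sum s (fst w)) \<partial>P) = ennreal (mean_tuple_sum s)"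
      using mean_tuple_sum_eq(1)[OF _ le_mult_ceiling] by (cases "0 < s") (auto simp: mean_tuple_sum_def)
  qed
  also have "\<dots> = ennreal V" unfolding V_def by (rule nn_integral_eq_integral[OF int]) (simp add: mean_tuple_sum_def)
  finally show "(\<integral>\<^sup>+y. ennreal (\<Phi> y) \<partial>tuple_meas P t n) = ennreal V" .
qed

lemma mixture_mean_config_tuple_sum:
  assumes m: "2 \<le> m" and R: "B * real m \<le> real R"
  shows "mixture_mean m (config_tuple_sum m) = (\<Sum>x | set x \<subseteq> {..<R} \<and> length x = n.
    \<Phi> (grid_midpoint m x) * detN n (\<lambda>i j. disc_kernel m (x ! i) (x ! j)))"
proof -
  let ?\<Phi> = "\<lambda>x. \<Phi> (grid_midpoint m x)"
  let ?X = "distinct_tuples n {..<R}" and ?det = "\<lambda>x. detN n (\<lambda>i j. disc_kernel m (x ! i) (x ! j))"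
  have summable: "mixture_weight m summable_on frob_pairs" using mixture_weight_summable m by simp
  have "config_tuple_sum m = (\<lambda>pq. \<Sum>x\<in>?X. ?\<Phi> x * of_bool (set x \<subseteq> set (fst pq)))"
  proof
    fix pq
    have "config_tuple_sum m pq = (\<Sum>x\<in>{x \<in> ?X. set x \<subseteq> set (fst pq)}. ?\<Phi> x)"
      unfolding config_tuple_sum_def
    proof (rule sum.mono_neutral_right)
      show "\<forall>x\<in>distinct_tuples n (set (fst pq)) - {x \<in> ?X. set x \<subseteq> set (fst pq)}. ?\<Phi> x = 0"
      proof
        fix x assume "x \<in> distinct_tuples n (set (fst pq)) - {x \<in> ?X. set x \<subseteq> set (fst pq)}"
        hence "length x = n" "\<not> set x \<subseteq> {..<R}" by (auto simp: distinct_tuples_def)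
        thus "?\<Phi> x = 0" by (rule grid_midpoint_vanishes[OF R]) (use m in simp)
      qed
    qed (auto simp: finite_distinct_tuples, auto simp: distinct_tuples_def)
    also have "\<dots> = (\<Sum>x\<in>?X. if set x \<subseteq> set (fst pq) then ?\<Phi> x else 0)"
      by (rule sum.inter_filter) (simp add: finite_distinct_tuples)
    finally show "config_tuple_sum m pq = (\<Sum>x\<in>?X. ?\<Phi> x * of_bool (set x \<subseteq> set (fst pq)))"
      by (simp add: of_bool_def if_distrib cong: if_cong)
  qed
  hence "mixture_mean m (config_tuple_sum m) = (\<Sum>x\<in>?X. ?\<Phi> x * mixture_mean m (\<lambda>pq. of_bool (set x \<subseteq> set (fst pq))))"
    by (simp only: mixture_mean_sum[OF m summable finite_distinct_tuples[OF finite_lessThan]])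
  also have "\<dots> = (\<Sum>x\<in>?X. ?\<Phi> x * ?det x)"
  proof (intro sum.cong refl arg_cong2[where f="(*)"])
    fix x assume "x \<in> ?X"
    hence "inj_on ((!) x) {..<n}" "(!) x ` {..<n} = set x" by (auto simp: distinct_tuples_def inj_on_nth set_conv_nth)
    with mixture_mean_contains[OF m summable, of "(!) x" n]
    show "mixture_mean m (\<lambda>pq. of_bool (set x \<subseteq> set (fst pq))) = ?det x" by simp
  qed
  also have "\<dots> = (\<Sum>x | set x \<subseteq> {..<R} \<and> length x = n. ?\<Phi> x * ?det x)"
  proof (rule sum.mono_neutral_left)
    show "\<forall>x\<in>{x. set x \<subseteq> {..<R} \<and> length x = n} - ?X. ?\<Phi> x * ?det x = 0"
    proof
      fix x assume "x \<in> {x. set x \<subseteq> {..<R} \<and> length x = n} - ?X"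
      hence "\<not> inj_on ((!) x) {..<n}" by (auto simp: distinct_tuples_def distinct_conv_nth inj_on_def)
      from det_on_noninj_cols[OF finite_lessThan this, of "\<lambda>i q. disc_kernel m (x ! i) q"]
      show "?\<Phi> x * ?det x = 0" unfolding detN_eq_det_on by simp
    qed
  qed (auto simp: finite_lists_length_eq distinct_tuples_def)
  finally show ?thesis .
qed

end

lemma abs_detN_le:
  fixes M :: "nat \<Rightarrow> nat \<Rightarrow> real"
  assumes "\<And>i j. i < n \<Longrightarrow> j < n \<Longrightarrow> \<bar>M i j\<bar> \<le> C"
  shows "\<bar>detN n M\<bar> \<le> fact n * C ^ n"
proof -
  have "\<bar>of_int (sign p) * (\<Prod>i<n. M i (p i))\<bar> \<le> C ^ n" if "p permutes {..<n}" for p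
  proof -
    have "\<bar>of_int (sign p) * (\<Prod>i<n. M i (p i))\<bar> = (\<Prod>i<n. \<bar>M i (p i)\<bar>)" by (simp add: abs_mult sign_def abs_prod)
    also have "\<dots> \<le> (\<Prod>i<n. C)" using permutes_in_image[OF that] by (intro prod_mono) (auto intro!: assms)
    finally show ?thesis by simp
  qed
  hence "\<bar>detN n M\<bar> \<le> (\<Sum>p | p permutes {..<n}. C ^ n)"
    unfolding detN_def by (intro sum_abs[THEN order_trans] sum_mono) auto
  thus ?thesis by (simp add: card_permutations)
qed

definition grid_list :: "nat \<Rightarrow> nat \<Rightarrow> (nat \<Rightarrow> real) \<Rightarrow> nat list" where
  "grid_list n m y = map (\<lambda>j. nat \<lfloor>real m * y j\<rfloor>) [0..<n]"

lemma grid_list_eq_iff: "grid_list n m y = x \<longleftrightarrow> length x = n \<and> (\<forall>j<n. nat \<lfloor>real m * y j\<rfloor> = x ! j)"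
  unfolding grid_list_def list_eq_iff_nth_eq by auto

lemma grid_list_measurable [measurable]: "grid_list n m \<in> lborel_tuples n \<rightarrow>\<^sub>M count_space UNIV"
  unfolding measurable_count_space_eq_countable[OF countableI_type]
proof safe
  fix x
  have "grid_list n m -` {x} \<inter> space (lborel_tuples n)
      = {y \<in> space (lborel_tuples n). length x = n \<and> (\<forall>j\<in>{..<n}. nat \<lfloor>real m * y j\<rfloor> = x ! j)}"
    by (intro set_eqI) (simp add: grid_list_eq_iff Ball_def conj_commute)
  also have "\<dots> \<in> sets (lborel_tuples n)" by measurable
  finally show "grid_list n m -` {x} \<inter> space (lborel_tuples n) \<in> sets (lborel_tuples n)" .
qed auto

lemma grid_list_nth_tendsto: "0 < y j \<Longrightarrow> j < n \<Longrightarrow> (\<lambda>m. real (grid_list n m y ! j) / real m) \<longlonglongrightarrow> y j"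
  using nat_floor_tendsto[of "y j"] by (simp add: grid_list_def)

lemma orthant_indicator_measurable [measurable]:
  "(\<lambda>y. indicat_real {y. \<forall>i<n. 0 < y i} y) \<in> borel_measurable (lborel_tuples n)"
  "(\<lambda>y. indicat_real {y. \<forall>i<n. 0 \<le> y i} y) \<in> borel_measurable (lborel_tuples n)"
proof -
  have [measurable]: "Measurable.pred (lborel_tuples n) (\<lambda>y. \<forall>i\<in>{..<n}. 0 < y i)"
    "Measurable.pred (lborel_tuples n) (\<lambda>y. \<forall>i\<in>{..<n}. 0 \<le> y i)" by measurable
  have "(\<lambda>y. if \<forall>i\<in>{..<n}. 0 < y i then 1 else 0 :: real) \<in> borel_measurable (lborel_tuples n)"
    "(\<lambda>y. if \<forall>i\<in>{..<n}. 0 \<le> y i then 1 else 0 :: real) \<in> borel_measurable (lborel_tuples n)" by measurable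
  thus "(\<lambda>y. indicat_real {y. \<forall>i<n. 0 < y i} y) \<in> borel_measurable (lborel_tuples n)"
    "(\<lambda>y. indicat_real {y. \<forall>i<n. 0 \<le> y i} y) \<in> borel_measurable (lborel_tuples n)"
    by (simp_all add: indicator_def of_bool_def Ball_def)
qed

lemma integral_grid_list:
  assumes m: "0 < m" and g: "\<And>x. \<not> set x \<subseteq> {..<R} \<Longrightarrow> length x = n \<Longrightarrow> g x = 0"
  shows "(LINT y | lborel_tuples n. indicator {y. \<forall>j<n. 0 \<le> y j} y * g (grid_list n m y))
    = (\<Sum>x | set x \<subseteq> {..<R} \<and> length x = n. g x / real m ^ n)"
proof -
  interpret product_sigma_finite "\<lambda>_::nat. lborel :: real measure" by standard
  let ?X = "{x. set x \<subseteq> {..<R} \<and> length x = n}"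
  define cell where "cell x = Pi\<^sub>E {..<n} (\<lambda>j. {real (x ! j) / real m..<(real (x ! j) + 1) / real m})" for x
  have fin: "finite ?X" by (simp add: finite_lists_length_eq)
  have cell: "indicat_real (cell x) y = indicator {y. \<forall>j<n. 0 \<le> y j} y * (if grid_list n m y = x then 1 else 0)"
    if "y \<in> extensional {..<n}" "x \<in> ?X" for x y
  proof -
    have "real (x ! j) / real m \<le> y j \<and> y j < (real (x ! j) + 1) / real m \<longleftrightarrow> 0 \<le> y j \<and> nat \<lfloor>real m * y j\<rfloor> = x ! j" for j
      using m by (intro nat_floor_eq_iff) simp
    hence "y \<in> cell x \<longleftrightarrow> (\<forall>j<n. 0 \<le> y j) \<and> grid_list n m y = x"
      using that by (auto simp: cell_def PiE_iff grid_list_eq_iff)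
    thus ?thesis by (auto simp: indicator_def)
  qed
  have sets: "cell x \<in> sets (lborel_tuples n)" for x unfolding cell_def by (intro sets_PiM_I_finite) auto
  have "emeasure (lborel_tuples n) (cell x) = (\<Prod>j<n. ennreal (1 / real m))" for x
    unfolding cell_def by (subst emeasure_PiM) (auto simp: divide_right_mono add_divide_distrib)
  hence em: "emeasure (lborel_tuples n) (cell x) = ennreal (1 / real m ^ n)" for x
    by (simp add: ennreal_power power_one_over)
  have "(LINT y | lborel_tuples n. indicator {y. \<forall>j<n. 0 \<le> y j} y * g (grid_list n m y))
      = (LINT y | lborel_tuples n. (\<Sum>x\<in>?X. g x * indicator (cell x) y))"
  proof (rule Bochner_Integration.integral_cong[OF refl])
    fix y assume "y \<in> space (lborel_tuples n)"
    hence "y \<in> extensional {..<n}" by (simp add: space_PiM PiE_iff)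
    hence "(\<Sum>x\<in>?X. g x * indicator (cell x) y)
        = indicator {y. \<forall>j<n. 0 \<le> y j} y * (\<Sum>x\<in>?X. if grid_list n m y = x then g x else 0)"
      unfolding sum_distrib_left by (intro sum.cong refl) (simp add: cell)
    thus "indicator {y. \<forall>j<n. 0 \<le> y j} y * g (grid_list n m y) = (\<Sum>x\<in>?X. g x * indicator (cell x) y)"
      using fin g[of "grid_list n m y"] by (auto simp: grid_list_def)
  qed
  also have "\<dots> = (\<Sum>x\<in>?X. (LINT y | lborel_tuples n. g x * indicator (cell x) y))"
    by (rule Bochner_Integration.integral_sum) (use sets em in \<open>auto intro!: integrable_mult_right integrable_real_indicator\<close>)
  also have "\<dots> = (\<Sum>x\<in>?X. g x / real m ^ n)"
    using em sets.sets_into_space[OF sets] by (intro sum.cong refl) (simp add: Int_absorb2 measure_def)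
  finally show ?thesis .
qed

definition lower_box :: "nat \<Rightarrow> (nat \<Rightarrow> real) \<Rightarrow> (nat \<Rightarrow> real) set" where
  "lower_box n b = Pi\<^sub>E {..<n} (\<lambda>i. {..<b i})"

definition open_box :: "nat \<Rightarrow> (nat \<Rightarrow> real) \<Rightarrow> (nat \<Rightarrow> real) \<Rightarrow> (nat \<Rightarrow> real) set" where
  "open_box n a b = Pi\<^sub>E {..<n} (\<lambda>i. {a i<..<b i})"

lemma box_sets [measurable]: "lower_box n b \<in> sets (lborel_tuples n)" "open_box n a b \<in> sets (lborel_tuples n)"
  unfolding lower_box_def open_box_def by (intro sets_PiM_I_finite; simp)+

lemma sets_lborel_tuples:
  "sets (lborel_tuples n) = sigma_sets ({..<n} \<rightarrow>\<^sub>E UNIV) (range (lower_box n))"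
proof -
  let ?L = "range (lessThan :: real \<Rightarrow> real set)"
  let ?E = "{{f \<in> {..<n} \<rightarrow>\<^sub>E UNIV. \<forall>i\<in>j. f i \<in> X i} | X j. j \<in> {{..<n}} \<and> X \<in> Pi j (\<lambda>_. ?L)}"
  have "sets (lborel_tuples n) = sets (\<Pi>\<^sub>M i\<in>{..<n}. sigma UNIV ?L)"
    by (intro sets_PiM_cong refl) (simp add: borel_Iio[symmetric])
  also have "\<dots> = sets (sigma ({..<n} \<rightarrow>\<^sub>E UNIV) ?E)"
  proof (rule sets_PiM_sigma)
    show "\<exists>S\<subseteq>?L. countable S \<and> UNIV = \<Union>S"
      by (rule exI[of _ "range (\<lambda>k::nat. {..<real k})"]) (use reals_Archimedean2 in auto)
  qed auto
  also have "\<dots> = sigma_sets ({..<n} \<rightarrow>\<^sub>E UNIV) ?E" by (rule sets_measure_of) auto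
  also have "?E = range (lower_box n)"
  proof (intro equalityI subsetI)
    have box: "Pi\<^sub>E {..<n} Y = {f \<in> {..<n} \<rightarrow>\<^sub>E UNIV. \<forall>i\<in>{..<n}. f i \<in> Y i}" for Y :: "nat \<Rightarrow> real set"
      by (intro set_eqI) (simp add: PiE_iff conj_commute)
    fix S assume "S \<in> ?E"
    then obtain Y where Y: "S = {f \<in> {..<n} \<rightarrow>\<^sub>E UNIV. \<forall>i\<in>{..<n}. f i \<in> Y i}" "Y \<in> Pi {..<n} (\<lambda>_. ?L)" by blast
    hence "\<forall>i\<in>{..<n}. \<exists>b. Y i = {..<b}" by (auto simp: Pi_iff)
    from bchoice[OF this] obtain b where "\<forall>i\<in>{..<n}. Y i = {..<b i}" ..
    thus "S \<in> range (lower_box n)" unfolding Y(1) box[symmetric] lower_box_def by (intro range_eqI[of _ _ b] PiE_cong) auto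
  next
    fix S assume "S \<in> range (lower_box n)"
    then obtain b where "S = lower_box n b" by blast
    also have "\<dots> = {f \<in> {..<n} \<rightarrow>\<^sub>E UNIV. \<forall>i\<in>{..<n}. f i \<in> {..<b i}}"
      by (intro set_eqI) (simp add: lower_box_def PiE_iff conj_commute)
    finally show "S \<in> ?E" by (intro CollectI exI[of _ "\<lambda>i. {..<b i}"] exI[of _ "{..<n}"] conjI) auto
  qed
  finally show ?thesis .
qed

lemma finite_measure_eqI_lower_boxes:
  assumes sets: "sets M = sets (lborel_tuples n)" "sets N = sets (lborel_tuples n)"
    and finite: "emeasure M (space M) \<noteq> \<infinity>"
    and eq: "\<And>b. emeasure M (lower_box n b) = emeasure N (lower_box n b)"
  shows "M = N"
proof (rule measure_eqI_generator_eq[of "range (lower_box n)" "{..<n} \<rightarrow>\<^sub>E UNIV" _ _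
      "\<lambda>k. lower_box n (\<lambda>_. real k)"])
  show "Int_stable (range (lower_box n))"
  proof (rule Int_stableI, safe)
    fix b b' :: "nat \<Rightarrow> real"
    show "lower_box n b \<inter> lower_box n b' \<in> range (lower_box n)"
      unfolding lower_box_def PiE_Int by (rule range_eqI[of _ _ "\<lambda>i. min (b i) (b' i)"], rule PiE_cong) auto
  qed
  show "range (lower_box n) \<subseteq> Pow ({..<n} \<rightarrow>\<^sub>E UNIV)" by (force simp: lower_box_def PiE_iff)
  show "(\<Union>k. lower_box n (\<lambda>_. real k)) = {..<n} \<rightarrow>\<^sub>E UNIV"
  proof (intro equalityI subsetI)
    fix y :: "nat \<Rightarrow> real" assume y: "y \<in> {..<n} \<rightarrow>\<^sub>E UNIV"
    obtain k where "(\<Sum>j<n. \<bar>y j\<bar>) < real k" using reals_Archimedean2 by blast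
    hence "y j < real k" if "j < n" for j using member_le_sum[of j "{..<n}" "\<lambda>j. \<bar>y j\<bar>"] that by auto
    thus "y \<in> (\<Union>k. lower_box n (\<lambda>_. real k))" using y by (auto simp: lower_box_def PiE_iff)
  qed (auto simp: lower_box_def PiE_iff)
  show "emeasure M (lower_box n (\<lambda>_. real k)) \<noteq> \<infinity>" for k
    using emeasure_space[of M "lower_box n (\<lambda>_. real k)"] finite by (auto simp: top_unique)
qed (use sets eq in \<open>auto simp: sets_lborel_tuples\<close>)

text \<open>The boxes below exhaust the positive orthant, and restricted to each of them the measures are finite.\<close>

lemma measure_eqI_positive_boxes:
  assumes sets: "sets M = sets (lborel_tuples n)" "sets N = sets (lborel_tuples n)"
    and finite: "\<And>k. emeasure M (open_box n (\<lambda>_. 1 / real (Suc k)) (\<lambda>_. real (Suc k))) \<noteq> \<infinity>"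
    and eq: "\<And>c a b. 0 < c \<Longrightarrow> (\<And>j. c \<le> a j) \<Longrightarrow>
      emeasure M (open_box n a b) = emeasure N (open_box n a b)"
    and A: "A \<in> sets (lborel_tuples n)" "A \<subseteq> {x. \<forall>i<n. 0 < x i}"
  shows "emeasure M A = emeasure N A"
proof -
  define U where "U k = open_box n (\<lambda>_. 1 / real (Suc k)) (\<lambda>_. real (Suc k))" for k
  have U: "U k \<in> sets (lborel_tuples n)" for k unfolding U_def by (rule box_sets)
  have res: "emeasure (density L (indicator (U k))) X = emeasure L (U k \<inter> X)"
    if "sets L = sets (lborel_tuples n)" "X \<in> sets (lborel_tuples n)" for L X k
    by (rule emeasure_restricted) (use that U in auto)
  have "density M (indicator (U k)) = density N (indicator (U k))" for k
  proof (rule finite_measure_eqI_lower_boxes)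
    fix b
    have "U k \<inter> lower_box n b = open_box n (\<lambda>_. 1 / real (Suc k)) (\<lambda>i. min (real (Suc k)) (b i))"
      unfolding U_def open_box_def lower_box_def PiE_Int by (intro PiE_cong) auto
    thus "emeasure (density M (indicator (U k))) (lower_box n b)
        = emeasure (density N (indicator (U k))) (lower_box n b)"
      using eq[of "1 / real (Suc k)" "\<lambda>_. 1 / real (Suc k)"] by (simp add: res sets box_sets)
  next
    show "emeasure (density M (indicator (U k))) (space (density M (indicator (U k)))) \<noteq> \<infinity>"
      using finite[of k, folded U_def] U[of k] sets(1) sets.sets_into_space[OF U[of k]]
      by (simp add: emeasure_restricted Int_absorb2 sets_eq_imp_space_eq[OF sets(1)])
  qed (simp_all add: sets)
  from arg_cong[OF this, of "\<lambda>L. emeasure L A"]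
  have eqU: "emeasure M (A \<inter> U k) = emeasure N (A \<inter> U k)" for k by (simp add: res sets A(1) Int_commute)
  have "incseq (\<lambda>k. A \<inter> U k)"
  proof (rule incseq_SucI)
    fix k
    have "1 / real (Suc (Suc k)) \<le> 1 / real (Suc k)" by (intro divide_left_mono) auto
    thus "A \<inter> U k \<subseteq> A \<inter> U (Suc k)" unfolding U_def open_box_def by (force simp: PiE_iff)
  qed
  moreover have "(\<Union>k. A \<inter> U k) = A"
  proof (intro equalityI subsetI)
    fix y assume y: "y \<in> A"
    obtain k where k: "(\<Sum>j<n. y j + 1 / y j) < real k" using reals_Archimedean2 by blast
    have "1 / real (Suc k) < y j \<and> y j < real (Suc k)" if j: "j < n" for j
    proof -
      have pos: "0 < y i" if "i < n" for i using A(2) y that by auto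
      hence "y j + 1 / y j \<le> (\<Sum>j<n. y j + 1 / y j)"
        by (intro member_le_sum[of j "{..<n}" "\<lambda>j. y j + 1 / y j"]) (use j pos in \<open>auto simp: less_imp_le intro!: add_nonneg_nonneg\<close>)
      moreover have "0 < 1 / y j" using pos[OF j] by simp
      ultimately have "y j < real (Suc k)" "1 / y j < real (Suc k)" using k pos[OF j] by linarith+
      thus ?thesis using pos[OF j] by (simp add: divide_less_eq mult.commute del: of_nat_Suc)
    qed
    moreover have "y \<in> extensional {..<n}" using sets.sets_into_space[OF A(1)] y by (auto simp: space_PiM PiE_iff)
    ultimately have "y \<in> U k" unfolding U_def open_box_def PiE_iff by (simp del: of_nat_Suc)
    thus "y \<in> (\<Union>k. A \<inter> U k)" using y by blast
  qed auto
  ultimately have "(SUP k. emeasure L (A \<inter> U k)) = emeasure L A" if "sets L = sets (lborel_tuples n)" for L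
    using SUP_emeasure_incseq[of "\<lambda>k. A \<inter> U k" L] A(1) U that by auto
  from this[OF sets(1)] this[OF sets(2)] show ?thesis unfolding eqU by simp
qed

definition tent :: "nat \<Rightarrow> real \<Rightarrow> real \<Rightarrow> real \<Rightarrow> real" where
  "tent k a b x = min 1 (real (Suc k) * infdist x (- {a<..<b}))"

lemma tent_range: "0 \<le> tent k a b x" "tent k a b x \<le> 1"
  by (auto simp: tent_def infdist_nonneg)

lemma tent_zero: "x \<le> a \<or> b \<le> x \<Longrightarrow> tent k a b x = 0"
  by (auto simp: tent_def)

lemma tent_eq_one:
  assumes "a + 1 / real (Suc k) \<le> x" "x \<le> b - 1 / real (Suc k)"
  shows "tent k a b x = 1"
proof -
  have "1 / real (Suc k) \<le> infdist x (- {a<..<b})"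
  proof (subst infdist_notempty)
    show "1 / real (Suc k) \<le> (INF u\<in>- {a<..<b}. dist x u)"
      by (rule cINF_greatest) (use assms in \<open>auto simp: dist_real_def intro: exI[of _ a]\<close>)
  qed (auto intro: exI[of _ a])
  thus ?thesis by (simp add: tent_def field_simps)
qed

lemma tent_measurable [measurable]: "tent k a b \<in> borel_measurable borel"
  unfolding tent_def[abs_def] by (intro borel_measurable_continuous_onI continuous_intros)

lemma tent_mono: "k \<le> k' \<Longrightarrow> tent k a b x \<le> tent k' a b x"
  unfolding tent_def by (intro min.mono mult_right_mono) (auto simp: infdist_nonneg)

lemma tent_lipschitz: "\<bar>tent k a b x - tent k a b y\<bar> \<le> real (Suc k) * \<bar>x - y\<bar>"
proof -
  have "\<bar>min 1 u - min 1 v\<bar> \<le> \<bar>u - v\<bar>" for u v :: real by linarith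
  hence "\<bar>tent k a b x - tent k a b y\<bar> \<le> real (Suc k) * \<bar>infdist x (- {a<..<b}) - infdist y (- {a<..<b})\<bar>"
    unfolding tent_def by (rule order_trans) (simp add: right_diff_distrib[symmetric] abs_mult del: of_nat_Suc)
  also have "\<dots> \<le> real (Suc k) * \<bar>x - y\<bar>"
    by (intro mult_left_mono) (use infdist_triangle_abs[of x _ y] in \<open>auto simp: dist_real_def\<close>)
  finally show ?thesis .
qed

lemma tent_tendsto: "(\<lambda>k. tent k a b x) \<longlonglongrightarrow> indicat_real {a<..<b} x"
proof (cases "x \<in> {a<..<b}")
  case True
  have "closed (- {a<..<b})" "- {a<..<b} \<noteq> {}" by (auto simp: closed_def intro: exI[of _ a])
  hence "0 < infdist x (- {a<..<b})" using infdist_pos_not_in_closed[of "- {a<..<b}" x] True by simp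
  hence "\<forall>\<^sub>F k in sequentially. 1 \<le> real (Suc k) * infdist x (- {a<..<b})" by real_asymp
  hence "\<forall>\<^sub>F k in sequentially. 1 = tent k a b x" by eventually_elim (simp add: tent_def)
  from Lim_transform_eventually[OF tendsto_const this] show ?thesis using True by simp
qed (simp add: tent_zero not_less)

lemma tent_test_function:
  assumes "0 < c" "\<And>j. c \<le> a j" "\<And>j. j < n \<Longrightarrow> b j \<le> B"
  shows "test_function n (\<lambda>y. \<Prod>j<n. tent k (a j) (b j) (y j)) c B (real (Suc k))"
proof
  fix x y :: "nat \<Rightarrow> real" and j
  show "\<bar>(\<Prod>j<n. tent k (a j) (b j) (x j)) - (\<Prod>j<n. tent k (a j) (b j) (y j))\<bar> \<le> real (Suc k) * (\<Sum>j<n. \<bar>x j - y j\<bar>)"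
    using norm_prod_diff[of "{..<n}" "\<lambda>j. tent k (a j) (b j) (x j)" "\<lambda>j. tent k (a j) (b j) (y j)"]
      sum_mono[of "{..<n}" "\<lambda>j. \<bar>tent k (a j) (b j) (x j) - tent k (a j) (b j) (y j)\<bar>" _, OF tent_lipschitz]
    by (simp add: tent_range sum_distrib_left del: of_nat_Suc)
  show "(\<Prod>j<n. tent k (a j) (b j) (x j)) = 0" if "j < n" "x j < c \<or> B < x j"
    using that assms(2)[of j] assms(3)[of j] tent_zero[of "x j" "a j" "b j" k] by (intro prod_zero bexI[of _ j]) auto
  show "(\<lambda>y. \<Prod>j<n. tent k (a j) (b j) (y j)) \<in> borel_measurable (lborel_tuples n)" by measurable
qed (use assms in \<open>auto intro: prod_nonneg prod_le_1 tent_range\<close>)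

lemma nn_integral_tent_tendsto:
  assumes [measurable_cong]: "sets M = sets (lborel_tuples n)"
  shows "(\<lambda>k. \<integral>\<^sup>+y. ennreal (\<Prod>j<n. tent k (a j) (b j) (y j)) \<partial>M) \<longlonglongrightarrow> emeasure M (open_box n a b)"
proof -
  let ?U = "open_box n a b"
  let ?T = "\<lambda>y. ennreal (\<Prod>j<n. indicat_real {a j<..<b j} (y j))"
  have "(\<lambda>k. \<integral>\<^sup>+y. ennreal (\<Prod>j<n. tent k (a j) (b j) (y j)) \<partial>M) \<longlonglongrightarrow> (\<integral>\<^sup>+y. ?T y \<partial>M)"
  proof (rule nn_integral_LIMSEQ)
    show "incseq (\<lambda>k y. ennreal (\<Prod>j<n. tent k (a j) (b j) (y j)))"
      unfolding incseq_def le_fun_def by (intro allI impI ennreal_leI prod_mono conjI tent_mono tent_range)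
    show "(\<lambda>k. ennreal (\<Prod>j<n. tent k (a j) (b j) (y j))) \<longlonglongrightarrow> ?T y" for y
      by (intro tendsto_ennrealI tendsto_prod tent_tendsto)
    show "(\<lambda>y. ennreal (\<Prod>j<n. tent k (a j) (b j) (y j))) \<in> borel_measurable M" for k by measurable
  qed
  also have "(\<integral>\<^sup>+y. ?T y \<partial>M) = (\<integral>\<^sup>+y. indicator ?U y \<partial>M)"
  proof (rule nn_integral_cong)
    fix y assume "y \<in> space M"
    hence "y \<in> extensional {..<n}" using sets_eq_imp_space_eq[OF assms] by (simp add: space_PiM PiE_iff)
    hence "indicat_real ?U y = (\<Prod>j<n. indicat_real {a j<..<b j} (y j))" by (auto simp: indicator_def open_box_def PiE_iff)
    thus "?T y = indicator ?U y" by (metis ennreal_indicator)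
  qed
  also have "\<dots> = emeasure M ?U" using assms by (subst nn_integral_indicator) (auto intro: box_sets)
  finally show ?thesis .
qed

context spectral_limit
begin

definition whit_corr :: "nat \<Rightarrow> (nat \<Rightarrow> real) \<Rightarrow> real" where
  "whit_corr n y = Re (detN n (\<lambda>i j. Kwh z z' (y i) (y j)))"

definition scaled_minor :: "nat \<Rightarrow> nat \<Rightarrow> nat list \<Rightarrow> real" where
  "scaled_minor n m x = detN n (\<lambda>i j. real m * disc_kernel m (x ! i) (x ! j))"

definition whit_density :: "nat \<Rightarrow> (nat \<Rightarrow> real) \<Rightarrow> ennreal" where
  "whit_density n y = ennreal (indicator {y. \<forall>i<n. 0 < y i} y * whit_corr n y)"

lemma scaled_minor_eq: "scaled_minor n m x = real m ^ n * detN n (\<lambda>i j. disc_kernel m (x ! i) (x ! j))"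
  using detN_scale[of n "\<lambda>_. real m" "\<lambda>_. 1"] by (simp add: scaled_minor_def)

lemma scaled_minor_tendsto:
  assumes y: "\<forall>i<n. 0 < y i"
  shows "(\<lambda>m. of_real (scaled_minor n m (grid_list n m y))) \<longlonglongrightarrow> detN n (\<lambda>i j. Kwh z z' (y i) (y j))"
proof -
  have entry: "(\<lambda>m. of_real (real m * disc_kernel m (grid_list n m y ! i) (grid_list n m y ! j))) \<longlonglongrightarrow> Kwh z z' (y i) (y j)"
    if "i < n" "j < n" for i j
    using y that by (intro disc_kernel_tendsto_Kwh grid_list_nth_tendsto) (auto simp: grid_list_def)
  thus ?thesis
    unfolding scaled_minor_def detN_def of_real_sum of_real_mult[of "of_int _"] of_real_prod of_real_of_int_eq
  proof (intro tendsto_sum tendsto_mult[OF tendsto_const] tendsto_prod)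
    fix p i assume "p \<in> {p. p permutes {..<n}}" "i \<in> {..<n}"
    thus "(\<lambda>m. of_real (real m * disc_kernel m (grid_list n m y ! i) (grid_list n m y ! p i))) \<longlonglongrightarrow> Kwh z z' (y i) (y (p i))"
      using permutes_in_image[of p "{..<n}" i] by (intro entry) auto
  qed
qed

lemma scaled_minor_tendsto_Re:
  "\<forall>i<n. 0 < y i \<Longrightarrow> (\<lambda>m. scaled_minor n m (grid_list n m y)) \<longlonglongrightarrow> whit_corr n y"
  using tendsto_Re[OF scaled_minor_tendsto] by (simp add: whit_corr_def)

lemma whit_corr_real: "\<forall>i<n. 0 < y i \<Longrightarrow> Im (detN n (\<lambda>i j. Kwh z z' (y i) (y j))) = 0"
  using tendsto_Im[OF scaled_minor_tendsto[of n y]] by (simp add: LIMSEQ_const_iff)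

lemma whit_corr_nonneg:
  assumes "\<forall>i<n. 0 < y i"
  shows "0 \<le> whit_corr n y"
proof (rule tendsto_lowerbound[OF scaled_minor_tendsto_Re[OF assms]])
  show "\<forall>\<^sub>F m in sequentially. 0 \<le> scaled_minor n m (grid_list n m y)"
    using eventually_ge_at_top[of 2]
  proof eventually_elim
    case (elim m)
    hence "mixture_weight m summable_on frob_pairs" by (intro mixture_weight_summable) simp
    from disc_kernel_det_nonneg[OF elim this] show ?case by (simp add: scaled_minor_eq)
  qed
qed simp

lemma abs_scaled_minor_le:
  assumes c: "0 < c"
  obtains C where "0 \<le> C" "\<And>m x. 2 \<le> m \<Longrightarrow> \<forall>j<n. c * real m \<le> real (x ! j) + 1 \<Longrightarrow> \<bar>scaled_minor n m x\<bar> \<le> C"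
proof -
  obtain D where D: "0 \<le> D" "\<And>m p. 2 \<le> m \<Longrightarrow> disc_kernel m p p \<le> D / (real p + 1)"
    using disc_kernel_diag_bound by blast
  show ?thesis
  proof (rule that[of "fact n * (D / c) ^ n"])
    fix m x assume m: "2 \<le> m" and x: "\<forall>j<n. c * real m \<le> real (x ! j) + 1"
    show "\<bar>scaled_minor n m x\<bar> \<le> fact n * (D / c) ^ n"
      unfolding scaled_minor_def
    proof (rule abs_detN_le)
      fix i j assume ij: "i < n" "j < n"
      have diag: "disc_kernel m (x ! j) (x ! j) \<le> D / (c * real m)" if "j < n" for j
        by (rule order_trans[OF D(2)[OF m]]) (use x that D(1) c m in \<open>auto intro!: divide_left_mono\<close>)
      have "mixture_weight m summable_on frob_pairs" using mixture_weight_summable m by simp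
      from abs_disc_kernel_le[OF m this diag[OF ij(1)] diag[OF ij(2)]]
      show "\<bar>real m * disc_kernel m (x ! i) (x ! j)\<bar> \<le> D / c" using m c by (simp add: abs_mult field_simps)
    qed
  qed (use D(1) c in simp)
qed

lemma whit_density_measurable [measurable]: "whit_density n \<in> borel_measurable (lborel_tuples n)"
proof -
  have "(\<lambda>y. indicator {y. \<forall>i<n. 0 < y i} y * whit_corr n y) \<in> borel_measurable (lborel_tuples n)"
  proof (rule borel_measurable_LIMSEQ_real)
    show "(\<lambda>m. indicator {y. \<forall>i<n. 0 < y i} y * scaled_minor n m (grid_list n m y))
        \<longlonglongrightarrow> indicator {y. \<forall>i<n. 0 < y i} y * whit_corr n y" for y
      using scaled_minor_tendsto_Re[of n y] by (auto simp: indicator_def)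
    have [measurable]: "(\<lambda>y. scaled_minor n m (grid_list n m y)) \<in> borel_measurable (lborel_tuples n)" for m
      by (rule measurable_compose[OF grid_list_measurable]) simp
    show "(\<lambda>y. indicator {y. \<forall>i<n. 0 < y i} y * scaled_minor n m (grid_list n m y)) \<in> borel_measurable (lborel_tuples n)" for m
      by measurable
  qed
  thus ?thesis unfolding whit_density_def[abs_def] by measurable
qed

end

context test_function_limit
begin

definition grid_integrand :: "nat \<Rightarrow> (nat \<Rightarrow> real) \<Rightarrow> real" where
  "grid_integrand m y = indicator {y. \<forall>j<n. 0 \<le> y j} y
    * (\<Phi> (grid_midpoint m (grid_list n m y)) * scaled_minor n m (grid_list n m y))"

lemma grid_integrand_measurable [measurable]: "grid_integrand m \<in> borel_measurable (lborel_tuples n)"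
proof -
  have [measurable]: "(\<lambda>y. h (grid_list n m y)) \<in> borel_measurable (lborel_tuples n)" for h :: "nat list \<Rightarrow> real"
    by (rule measurable_compose[OF grid_list_measurable]) simp
  show ?thesis unfolding grid_integrand_def[abs_def] by measurable
qed

lemma grid_integrand_support:
  assumes m: "1 \<le> c * real m" and nz: "grid_integrand m y \<noteq> 0" and j: "j < n"
  shows "c * real m \<le> real (grid_list n m y ! j) + 1" "c / 2 \<le> y j" "y j \<le> B + 1"
proof -
  have m0: "1 \<le> real m" using m by (cases m) auto
  have "0 \<le> y j" using nz j by (auto simp: grid_integrand_def indicator_def split: if_splits)
  hence x: "real (grid_list n m y ! j) \<le> real m * y j" "real m * y j \<le> real (grid_list n m y ! j) + 1"
    using j by (auto simp: grid_list_def)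
  have "\<Phi> (grid_midpoint m (grid_list n m y)) \<noteq> 0" using nz by (auto simp: grid_integrand_def)
  hence "c \<le> grid_midpoint m (grid_list n m y) j" "grid_midpoint m (grid_list n m y) j \<le> B"
    using support[OF j] not_le by blast+
  hence mid: "c * real m \<le> real (grid_list n m y ! j) + 1 / 2" "real (grid_list n m y ! j) + 1 / 2 \<le> B * real m"
    using m0 by (simp_all add: grid_midpoint_def field_simps)
  thus "c * real m \<le> real (grid_list n m y ! j) + 1" by simp
  have "c * real m / 2 \<le> real m * y j" "real m * y j \<le> B * real m + real m" using mid x m m0 by linarith+
  hence "real m * (c / 2) \<le> real m * y j" "real m * y j \<le> real m * (B + 1)" by (simp_all add: algebra_simps)
  thus "c / 2 \<le> y j" "y j \<le> B + 1" using m0 by (auto dest!: mult_left_le_imp_le)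
qed

lemma integral_grid_integrand:
  assumes m: "2 \<le> m"
  shows "(LINT y | lborel_tuples n. grid_integrand m y) = mixture_mean m (config_tuple_sum m)"
proof -
  define R where "R = nat \<lceil>B * real m\<rceil>"
  have R: "B * real m \<le> real R" unfolding R_def by (rule real_nat_ceiling_ge)
  show ?thesis
    unfolding grid_integrand_def mixture_mean_config_tuple_sum[OF m R]
    using integral_grid_list[of m R n "\<lambda>x. \<Phi> (grid_midpoint m x) * scaled_minor n m x"] m
      grid_midpoint_vanishes[OF R] by (simp add: scaled_minor_eq)
qed

lemma grid_integrand_tendsto:
  assumes y: "\<forall>j<n. 0 < y j"
  shows "(\<lambda>m. grid_integrand m y) \<longlonglongrightarrow> \<Phi> y * whit_corr n y"
proof -
  have "(\<lambda>m. \<Phi> (grid_midpoint m (grid_list n m y))) \<longlonglongrightarrow> \<Phi> y"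
  proof (rule LIM_zero_cancel, rule Lim_null_comparison[OF always_eventually[OF allI]])
    let ?x = "\<lambda>m. grid_midpoint m (grid_list n m y)"
    show "norm (\<Phi> (?x m) - \<Phi> y) \<le> K * (\<Sum>j<n. \<bar>?x m j - y j\<bar>)" for m using lipschitz by simp
    have "(\<lambda>m. ?x m j) \<longlonglongrightarrow> y j" if "j < n" for j
    proof -
      have "(\<lambda>m. real (grid_list n m y ! j) / real m + 1 / 2 * (1 / real m)) \<longlonglongrightarrow> y j + 1 / 2 * 0"
        using y that by (intro tendsto_add tendsto_mult tendsto_const grid_list_nth_tendsto lim_1_over_n) auto
      thus ?thesis by (simp add: grid_midpoint_def add_divide_distrib)
    qed
    hence "(\<lambda>m. K * (\<Sum>j<n. \<bar>?x m j - y j\<bar>)) \<longlonglongrightarrow> K * (\<Sum>j<n. \<bar>y j - y j\<bar>)" by (intro tendsto_intros) auto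
    thus "(\<lambda>m. K * (\<Sum>j<n. \<bar>?x m j - y j\<bar>)) \<longlonglongrightarrow> 0" by simp
  qed
  moreover have "\<forall>j<n. 0 \<le> y j" using y by (auto intro: less_imp_le)
  ultimately show ?thesis
    unfolding grid_integrand_def using tendsto_mult[OF _ scaled_minor_tendsto_Re[OF y]] by simp
qed

lemma
  shows integrable_test_function: "integrable (lborel_tuples n) (\<lambda>y. \<Phi> y * whit_corr n y)" (is "integrable ?L ?F")
    and integral_test_function:
      "(LINT y | lborel_tuples n. \<Phi> y * whit_corr n y) = (\<integral>s. mean_tuple_sum s \<partial>gamma_meas t)"
proof -
  interpret product_sigma_finite "\<lambda>_::nat. lborel :: real measure" by standard
  define m0 where "m0 = nat \<lceil>1 / c\<rceil> + 2"
  have m0: "1 \<le> c * real (m + m0)" "2 \<le> m + m0" for m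
  proof -
    have "1 / c \<le> real (m + m0)" using real_nat_ceiling_ge[of "1 / c"] unfolding m0_def by linarith
    thus "1 \<le> c * real (m + m0)" using c by (simp add: divide_le_eq mult.commute)
  qed (simp add: m0_def)
  define U where "U = Pi\<^sub>E {..<n} (\<lambda>_. {c / 2..B + 1})"
  obtain C where C: "0 \<le> C" "\<And>m x. 2 \<le> m \<Longrightarrow> \<forall>j<n. c * real m \<le> real (x ! j) + 1 \<Longrightarrow> \<bar>scaled_minor n m x\<bar> \<le> C"
    using abs_scaled_minor_le[OF c, of n] by metis
  have support_U: "y \<in> U" if "grid_integrand (m + m0) y \<noteq> 0" "y \<in> space ?L" for m y
    using grid_integrand_support[OF m0(1) that(1)] that(2) by (auto simp: U_def space_PiM PiE_iff)
  have bound: "norm (grid_integrand (m + m0) y) \<le> C * indicator U y" if y: "y \<in> space ?L" for m y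
  proof (cases "grid_integrand (m + m0) y = 0")
    case False
    have "norm (grid_integrand (m + m0) y) \<le> 1 * (1 * \<bar>scaled_minor n (m + m0) (grid_list n (m + m0) y)\<bar>)"
      unfolding grid_integrand_def real_norm_def abs_mult using range by (intro mult_mono) (auto simp: indicator_def)
    also have "\<dots> \<le> C" using C(2)[OF m0(2)] grid_integrand_support(1)[OF m0(1) False] by simp
    finally show ?thesis using support_U[OF False y] by simp
  qed (use C in \<open>auto simp: indicator_def\<close>)
  have lim: "(\<lambda>m. grid_integrand (m + m0) y) \<longlonglongrightarrow> ?F y" if y: "y \<in> space ?L" for y
  proof (cases "y \<in> U")
    case True
    hence "\<forall>j<n. 0 < y j" using c by (force simp: U_def PiE_iff)
    from LIMSEQ_ignore_initial_segment[OF grid_integrand_tendsto[OF this]] show ?thesis .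
  next
    case False
    hence "grid_integrand (m + m0) y = 0" for m using support_U y by blast
    moreover obtain j where "j < n" "y j < c / 2 \<or> B + 1 < y j"
      using False y by (auto simp: U_def space_PiM PiE_iff not_le)
    hence "\<Phi> y = 0" using support[of j y] c by auto
    ultimately show ?thesis by simp
  qed
  have "U \<in> sets ?L" unfolding U_def by (intro sets_PiM_I_finite) auto
  moreover have "emeasure ?L U < \<infinity>"
    unfolding U_def using emeasure_compact_finite[of "{c / 2..B + 1}"] by (subst emeasure_PiM) (auto simp: power_less_top_ennreal)
  ultimately have intU: "integrable ?L (\<lambda>y. C * indicator U y)" by (intro integrable_mult_right integrable_real_indicator)
  have "(\<lambda>m. indicator (space ?L) y * grid_integrand (m + m0) y) \<longlonglongrightarrow> indicator (space ?L) y * ?F y" for y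
    using lim[of y] by (cases "y \<in> space ?L") auto
  hence "(\<lambda>y. indicator (space ?L) y * ?F y) \<in> borel_measurable ?L" by (rule borel_measurable_LIMSEQ_real) simp
  hence meas: "?F \<in> borel_measurable ?L" by (rule measurable_cong[THEN iffD1, rotated]) simp
  note dc = meas grid_integrand_measurable intU AE_I2[OF lim] AE_I2[OF bound]
  show "integrable ?L ?F" by (rule integrable_dominated_convergence[OF dc])
  have "(\<lambda>m. LINT y | ?L. grid_integrand (m + m0) y) \<longlonglongrightarrow> (\<integral>s. mean_tuple_sum s \<partial>gamma_meas t)"
    unfolding integral_grid_integrand[OF m0(2)]
    by (rule LIMSEQ_ignore_initial_segment[OF mixture_mean_config_tuple_sum_tendsto])
  with integral_dominated_convergence[OF dc]
  show "(LINT y | ?L. ?F y) = (\<integral>s. mean_tuple_sum s \<partial>gamma_meas t)" by (rule LIMSEQ_unique)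
qed

lemma nn_integral_test_function:
  "(\<integral>\<^sup>+y. ennreal (\<Phi> y) \<partial>density (lborel_tuples n) (whit_density n)) = (\<integral>\<^sup>+y. ennreal (\<Phi> y) \<partial>tuple_meas P t n)"
proof -
  have eq: "whit_density n y * ennreal (\<Phi> y) = ennreal (\<Phi> y * whit_corr n y)"
    and nonneg: "0 \<le> \<Phi> y * whit_corr n y" for y
  proof -
    have "0 \<le> whit_corr n y \<or> \<Phi> y = 0" "(\<forall>j<n. 0 < y j) \<or> \<Phi> y = 0"
      using whit_corr_nonneg[of n y] support[of _ y] c by (metis le_less_trans not_le)+
    thus "whit_density n y * ennreal (\<Phi> y) = ennreal (\<Phi> y * whit_corr n y)" "0 \<le> \<Phi> y * whit_corr n y"
      using range[of y] by (auto simp: whit_density_def ennreal_mult' mult.commute)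
  qed
  have "(\<integral>\<^sup>+y. ennreal (\<Phi> y) \<partial>density (lborel_tuples n) (whit_density n))
      = (\<integral>\<^sup>+y. whit_density n y * ennreal (\<Phi> y) \<partial>lborel_tuples n)"
    by (rule nn_integral_density[OF whit_density_measurable]) measurable
  also have "\<dots> = (\<integral>\<^sup>+y. ennreal (\<Phi> y) \<partial>tuple_meas P t n)"
    unfolding eq nn_integral_eq_integral[OF integrable_test_function AE_I2[OF nonneg]]
      nn_integral_tuple_meas_test_function integral_test_function ..
  finally show ?thesis .
qed

end

context spectral_limit
begin

lemma test_function_limitI: "test_function n \<Phi> c B K \<Longrightarrow> test_function_limit z z' P n \<Phi> c B K"
  by (intro test_function_limit.intro spectral_limit_axioms)

lemma tuple_meas_eq_whit_density:
  assumes A: "A \<in> sets (lborel_tuples n)" "A \<subseteq> {x. \<forall>i<n. 0 < x i}"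
  shows "emeasure (tuple_meas P t n) A = emeasure (density (lborel_tuples n) (whit_density n)) A"
proof (rule measure_eqI_positive_boxes[symmetric, OF _ _ _ _ A])
  let ?N = "density (lborel_tuples n) (whit_density n)" and ?M = "tuple_meas P t n"
  show sets: "sets ?N = sets (lborel_tuples n)" "sets ?M = sets (lborel_tuples n)" by (simp_all add: tuple_meas_def)
  show "emeasure ?N (open_box n a b) = emeasure ?M (open_box n a b)"
    if "0 < c" "\<And>j. c \<le> a j" for c a b
  proof (rule LIMSEQ_unique[OF nn_integral_tent_tendsto[OF sets(1)]])
    have "b j \<le> (\<Sum>j<n. \<bar>b j\<bar>)" if "j < n" for j using member_le_sum[of j "{..<n}" "\<lambda>j. \<bar>b j\<bar>"] that by auto
    from test_function_limit.nn_integral_test_function[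
      OF test_function_limitI[OF tent_test_function[of c a n b, OF \<open>0 < c\<close> \<open>\<And>j. c \<le> a j\<close> this]]]
    show "(\<lambda>k. \<integral>\<^sup>+y. ennreal (\<Prod>j<n. tent k (a j) (b j) (y j)) \<partial>?N) \<longlonglongrightarrow> emeasure ?M (open_box n a b)"
      using nn_integral_tent_tendsto[OF sets(2), of a b] by simp
  qed
  fix k
  let ?U = "open_box n (\<lambda>_. 1 / real (Suc k)) (\<lambda>_. real (Suc k))"
  define e where "e = 1 / real (Suc (2 * k + 1))"
  have e: "0 < e" "e \<le> 1" "1 / real (Suc k) = e + e" by (simp_all add: e_def field_simps)
  let ?\<Phi> = "\<lambda>y. \<Prod>j<n. tent (2 * k + 1) e (real (k + 2)) (y j)"
  interpret test_function_limit z z' P n ?\<Phi> e "real (k + 2)" "real (Suc (2 * k + 1))"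
    by (rule test_function_limitI, rule tent_test_function) (use e in auto)
  have "?U \<in> sets ?N" unfolding sets(1) by (rule box_sets)
  hence "emeasure ?N ?U = (\<integral>\<^sup>+y. indicator ?U y \<partial>?N)" by simp
  also have "\<dots> \<le> (\<integral>\<^sup>+y. ennreal (?\<Phi> y) \<partial>?N)"
  proof (rule nn_integral_mono)
    fix y
    have "tent (2 * k + 1) e (real (k + 2)) x = 1" if "1 / real (Suc k) < x" "x < real (Suc k)" for x
      by (rule tent_eq_one; unfold e_def[symmetric]) (use that e in simp_all)
    thus "indicator ?U y \<le> ennreal (?\<Phi> y)" by (auto simp: indicator_def open_box_def PiE_iff)
  qed
  also have "\<dots> < \<infinity>"
    unfolding nn_integral_test_function nn_integral_tuple_meas_test_function by simp
  finally show "emeasure ?N ?U \<noteq> \<infinity>" by simp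
qed

end

theorem theorem3p3p4:
  fixes z z' :: complex and P :: "thoma measure" and n :: nat
  assumes "admissible z z'"
    and "Pn_weak_limit z z' P"
    and "1 \<le> n"
  shows "(\<forall>x \<in> {x \<in> extensional {..<n}. \<forall>i<n. 0 < x i}.
            Im (detN n (\<lambda>i j. Kwh z z' (x i) (x j))) = 0 \<and>
            0 \<le> Re (detN n (\<lambda>i j. Kwh z z' (x i) (x j)))) \<and>
         (\<forall>A \<in> sets (\<Pi>\<^sub>M i\<in>{..<n}. lborel). A \<subseteq> {x. \<forall>i<n. 0 < x i} \<longrightarrow>
            lifted_corr_measure z z' P n A =
              (\<integral>\<^sup>+ x\<in>A. ennreal (Re (detN n (\<lambda>i j. Kwh z z' (x i) (x j)))) \<partial>(\<Pi>\<^sub>M i\<in>{..<n}. lborel)))"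
proof -
  interpret spectral_limit z z' P using assms(1,2) by unfold_locales
  show ?thesis
  proof (intro conjI ballI impI)
    fix x :: "nat \<Rightarrow> real" assume "x \<in> {x \<in> extensional {..<n}. \<forall>i<n. 0 < x i}"
    hence x: "\<forall>i<n. 0 < x i" by simp
    show "Im (detN n (\<lambda>i j. Kwh z z' (x i) (x j))) = 0" by (rule whit_corr_real[OF x])
    show "0 \<le> Re (detN n (\<lambda>i j. Kwh z z' (x i) (x j)))"
      using whit_corr_nonneg[OF x] by (simp add: whit_corr_def)
  next
    fix A assume A: "A \<in> sets (lborel_tuples n)" "A \<subseteq> {x. \<forall>i<n. 0 < x i}"
    have "lifted_corr_measure z z' P n A = emeasure (tuple_meas P t n) A"
      by (rule lifted_corr_measure_eq[OF A])
    also have "\<dots> = emeasure (density (lborel_tuples n) (whit_density n)) A"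
      by (rule tuple_meas_eq_whit_density[OF A])
    also have "\<dots> = (\<integral>\<^sup>+x. whit_density n x * indicator A x \<partial>lborel_tuples n)"
      by (rule emeasure_density[OF whit_density_measurable A(1)])
    also have "\<dots> = (\<integral>\<^sup>+x\<in>A. ennreal (Re (detN n (\<lambda>i j. Kwh z z' (x i) (x j)))) \<partial>lborel_tuples n)"
      using A(2) by (intro nn_integral_cong) (auto simp: whit_density_def whit_corr_def indicator_def)
    finally show "lifted_corr_measure z z' P n A = (\<integral>\<^sup>+x\<in>A. ennreal (Re (detN n (\<lambda>i j. Kwh z z' (x i) (x j)))) \<partial>lborel_tuples n)" .
  qed
qed

end
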